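(* Suppose that $(u,h)$ is a weak solution (in the sense defined in the context) of the linearized free surface problem on $\Sigma=\mathbb{T}^{N-1}$ with initial data $(u_0,h_0)$, and that $\mu(\xi)=g+\sigma(2\pi|\xi|)^{2r}$ with $g,\sigma>0$ and $r\ge\frac12$. If $u_0\in L^2(\Omega)$ and $h_0\in H^r(\Sigma)$, then there are constants $c,K>0$, depending on $g,\sigma,r$, such that for all $t\ge 0$ $$\mathcal{E}(t)\le K\,\mathcal{E}(0)\,e^{-ct}.$$
   Context: Fix an integer $N\ge 2$ and $\ell>0$. Let $\Sigma=\mathbb{T}^{N-1}=\mathbb{R}^{N-1}/\mathbb{Z}^{N-1}$, with dual group $\hat\Sigma=\mathbb{Z}^{N-1}$. Set $\Omega=\Sigma\times(0,\ell)$, with points $(x,y)$, $x\in\Sigma$, $y\in(0,\ell)$. The Fourier transform is always in the horizontal variable $x$ only: $\hat f(\xi)=\mathcal{F}f(\xi)=\int_\Sigma f(x)e^{-2\pi i\xi\cdot x}\,dx$, $\xi\in\hat\Sigma$. $H^s(\Sigma)$ has norm $\|f\|_{H^s}^2=\sum_{\xi\in\hat\Sigma}(1+|\xi|^2)^s|\hat f(\xi)|^2$. Boundary operator: $\mu:\hat\Sigma\to\mathbb{R}$ satisfies, for some $\theta>0$, $\theta\le\mu(\xi)\le\frac1\theta(1+|\xi|)^3$ for all $\xi\in\hat\Sigma$ (standing assumption), and $M$ is defined by $\mathcal{F}M(h)(\xi)=\mu(\xi)\mathcal{F}h(\xi)$. Let $(\mathbb{D}u)_{ij}=\partial_iu_j+\partial_ju_i$,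 let $(\cdot,\cdot)$ be the $L^2(\Omega)$ inner product, and let ${}_0H^1_{\mathrm{sol}}=\{u\in H^1(\Omega;\mathbb{R}^N): u=0\text{ on }\{y=0\},\ \operatorname{div}u=0\}$ with inner product $(\nabla u,\nabla v)$; it is embedded in its dual $({}_0H^1_{\mathrm{sol}})^*$ via the $L^2$ inner product, and $[\cdot,\cdot]$ denotes the duality pairing (dual element first). Weak solution: $(u,h)$ is a weak solution with initial data $(u_0,h_0)$ if $u\in L^2_{\mathrm{loc}}([0,\infty);{}_0H^1_{\mathrm{sol}})$, $\partial_tu\in L^2_{\mathrm{loc}}([0,\infty);({}_0H^1_{\mathrm{sol}})^* )$, $h\in L^2_{\mathrm{loc}}([0,\infty);L^2(\Sigma))$, $M(h)\in L^2_{\mathrm{loc}}([0,\infty);L^2(\Sigma))$, $\partial_th\in L^2_{\mathrm{loc}}([0,\infty);H^{1/2}(\Sigma))$, and (i) $[\partial_tu,v]+\frac12(\mathbb{D}u,\mathbb{D}v)+\int_{\{y=\ell\}}M(h)v_N=0$ for all $v\in L^2([0,T];{}_0H^1_{\mathrm{sol}})$ (all $T>0$), for a.e. $t$; (ii) $\operatorname{div}u=0$; (iii) $\partial_th=u_N$ on $\{y=\ell\}$; (iv) $u=u_0$ and $h=h_0$ at $t=0$; (v) $\int_{\mathbb{T}^{N-1}}h(x,t)\,dx=0$ for all $t\ge0$. Full energy: $$\mathcal{E}(t)=\frac12\int_\Omega|u|^2+\frac12\int_\Sigma M(h)h .$$ *)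

theory Defs
  imports "HOL-Analysis.Analysis"
begin

text \<open>
  With \<open>'n\<close> a finite index type and \<open>N = CARD('n) + 1\<close>, points \<open>(x, y)\<close> and velocities in
  \<open>\<real>\<^sup>N\<close> have type \<open>(real^'n) \<times> real\<close>, and \<open>\<partial>\<^sub>i\<close>, \<open>u\<^sub>j\<close> are indexed by the elements of \<open>Basis\<close>;
  the last (vertical) component is \<open>snd\<close>.  Since \<open>CARD('n) \<ge> 1\<close>, this is exactly \<open>N \<ge> 2\<close>.

  As a measure space the torus \<open>\<real>\<^bsup>N-1\<^esup>/\<int>\<^bsup>N-1\<^esup>\<close> is its unit cell, so the values of a function
  outside the cell play no role.  The torus structure enters through the characters and through
  the smooth functions used for weak derivatives and traces, which are periodic in \<open>x\<close> on all of
  \<open>\<real>\<^bsup>N-1\<^esup>\<close>.  Elements of function spaces are (Borel) functions rather than classes, and norms are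
  accordingly seminorms.
\<close>

type_synonym 'n pt = "(real^'n) \<times> real"

definition torus :: "(real^'n) measure" where
  "torus = restrict_space lborel {x. \<forall>i. 0 \<le> x $ i \<and> x $ i < 1}"

definition slab :: "real \<Rightarrow> 'n::finite pt measure" where
  "slab ell = restrict_space lborel ({x. \<forall>i. 0 \<le> x $ i \<and> x $ i < 1} \<times> {0<..<ell})"


section \<open>Lebesgue and Sobolev spaces\<close>

definition L2 :: "'a measure \<Rightarrow> ('a \<Rightarrow> 'b::euclidean_space) set" where
  "L2 M = {f \<in> borel_measurable M. integrable M (\<lambda>x. (norm (f x))\<^sup>2)}"

definition L2_inner :: "'a measure \<Rightarrow> ('a \<Rightarrow> 'b::euclidean_space) \<Rightarrow> ('a \<Rightarrow> 'b) \<Rightarrow> real" where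
  "L2_inner M f g = (\<integral>x. f x \<bullet> g x \<partial>M)"

definition L2_norm :: "'a measure \<Rightarrow> ('a \<Rightarrow> 'b::euclidean_space) \<Rightarrow> real" where
  "L2_norm M f = sqrt (L2_inner M f f)"

primrec C_k :: "nat \<Rightarrow> ('a::euclidean_space \<Rightarrow> real) \<Rightarrow> bool" where
  "C_k 0 f \<longleftrightarrow> continuous_on UNIV f"
| "C_k (Suc k) f \<longleftrightarrow>
     (\<exists>g. (\<forall>x. (f has_derivative (\<lambda>v. \<Sum>b\<in>Basis. (v \<bullet> b) * g b x)) (at x)) \<and>
          (\<forall>b\<in>Basis. C_k k (g b)))"

definition C_infinity :: "('a::euclidean_space \<Rightarrow> real) \<Rightarrow> bool" where
  "C_infinity f \<longleftrightarrow> (\<forall>k. C_k k f)"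

text \<open>The restrictions to \<open>0 \<le> y \<le> \<ell>\<close> of these functions are the functions on the slab that are
  smooth up to the boundary.\<close>

definition smooth_periodic :: "('n::finite pt \<Rightarrow> real) \<Rightarrow> bool" where
  "smooth_periodic \<phi> \<longleftrightarrow> C_infinity \<phi> \<and> (\<forall>x y i. \<phi> (x + axis i 1, y) = \<phi> (x, y))"

definition test_functions :: "real \<Rightarrow> ('n::finite pt \<Rightarrow> real) set" where
  "test_functions ell = {\<phi>. smooth_periodic \<phi> \<and>
     (\<exists>a b. 0 < a \<and> b < ell \<and> (\<forall>x y. y \<notin> {a..b} \<longrightarrow> \<phi> (x, y) = 0))}"

definition has_weak_partial ::
    "real \<Rightarrow> 'n::finite pt \<Rightarrow> ('n pt \<Rightarrow> real) \<Rightarrow> ('n pt \<Rightarrow> real) \<Rightarrow> bool" where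
  "has_weak_partial ell i f g \<longleftrightarrow>
     (\<forall>\<phi>\<in>test_functions ell.
        (\<integral>z. f z * frechet_derivative \<phi> (at z) i \<partial>slab ell) = - (\<integral>z. g z * \<phi> z \<partial>slab ell))"

text \<open>Unique up to null sets whenever it exists.\<close>

definition weak_partial :: "real \<Rightarrow> 'n::finite pt \<Rightarrow> ('n pt \<Rightarrow> real) \<Rightarrow> 'n pt \<Rightarrow> real" where
  "weak_partial ell i f = (SOME g. g \<in> L2 (slab ell) \<and> has_weak_partial ell i f g)"

definition H1 :: "real \<Rightarrow> ('n::finite pt \<Rightarrow> real) set" where
  "H1 ell = {f \<in> L2 (slab ell). \<forall>i\<in>Basis. \<exists>g\<in>L2 (slab ell). has_weak_partial ell i f g}"

definition H1_norm :: "real \<Rightarrow> ('n::finite pt \<Rightarrow> real) \<Rightarrow> real" where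
  "H1_norm ell f = sqrt ((L2_norm (slab ell) f)\<^sup>2 +
     (\<Sum>i\<in>Basis. (L2_norm (slab ell) (weak_partial ell i f))\<^sup>2))"

text \<open>\<open>q\<close> is the trace of \<open>f \<in> H\<^sup>1\<close> on \<open>{y = a}\<close>, \<open>a \<in> {0, \<ell>}\<close>: the trace operator is the
  continuous extension of restriction from functions smooth up to the boundary.\<close>

definition has_trace :: "real \<Rightarrow> real \<Rightarrow> ('n::finite pt \<Rightarrow> real) \<Rightarrow> (real^'n \<Rightarrow> real) \<Rightarrow> bool" where
  "has_trace ell a f q \<longleftrightarrow> f \<in> H1 ell \<and> q \<in> L2 torus \<and>
     (\<exists>\<phi>. (\<forall>k::nat. smooth_periodic (\<phi> k)) \<and>
          (\<lambda>k. H1_norm ell (\<lambda>z. \<phi> k z - f z)) \<longlonglongrightarrow> 0 \<and>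
          (\<lambda>k. L2_norm torus (\<lambda>x. \<phi> k (x, a) - q x)) \<longlonglongrightarrow> 0)"


section \<open>Fourier series on the torus\<close>

definition freq :: "int^'n \<Rightarrow> real^'n" where
  "freq \<xi> = (\<chi> i. real_of_int (\<xi> $ i))"

definition fourier :: "(real^'n \<Rightarrow> real) \<Rightarrow> int^'n \<Rightarrow> complex" where
  "fourier f \<xi> = (\<integral>x. complex_of_real (f x) * exp (- 2 * pi * \<i> * (freq \<xi> \<bullet> x)) \<partial>torus)"

text \<open>For \<open>s \<ge> 0\<close> only, when \<open>H\<^sup>s\<close> is contained in \<open>L\<^sup>2\<close>.\<close>

definition Hs :: "real \<Rightarrow> (real^'n \<Rightarrow> real) set" where
  "Hs s = {f \<in> L2 torus.
     (\<lambda>\<xi>. (1 + (norm (freq \<xi>))\<^sup>2) powr s * (cmod (fourier f \<xi>))\<^sup>2) summable_on UNIV}"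

definition Hs_norm :: "real \<Rightarrow> (real^'n \<Rightarrow> real) \<Rightarrow> real" where
  "Hs_norm s f =
     sqrt (\<Sum>\<^sub>\<infinity>\<xi>. (1 + (norm (freq \<xi>))\<^sup>2) powr s * (cmod (fourier f \<xi>))\<^sup>2)"

definition boundary_symbol :: "(int^'n \<Rightarrow> real) \<Rightarrow> bool" where
  "boundary_symbol \<mu> \<longleftrightarrow>
     (\<exists>\<theta>>0. \<forall>\<xi>. \<theta> \<le> \<mu> \<xi> \<and> \<mu> \<xi> \<le> (1 / \<theta>) * (1 + norm (freq \<xi>)) ^ 3)"

text \<open>For \<open>h \<in> L\<^sup>2\<close>, \<open>M(h)\<close> is in general only a distribution; it is given by its Fourier
  coefficients.\<close>

definition M_hat :: "(int^'n \<Rightarrow> real) \<Rightarrow> (real^'n \<Rightarrow> real) \<Rightarrow> int^'n \<Rightarrow> complex" where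
  "M_hat \<mu> h \<xi> = complex_of_real (\<mu> \<xi>) * fourier h \<xi>"


section \<open>The solenoidal space and its dual\<close>

definition vec_comp :: "('a \<Rightarrow> 'b::euclidean_space) \<Rightarrow> 'b \<Rightarrow> 'a \<Rightarrow> real" where
  "vec_comp u j = (\<lambda>z. u z \<bullet> j)"

definition div_free :: "real \<Rightarrow> ('n::finite pt \<Rightarrow> 'n pt) \<Rightarrow> bool" where
  "div_free ell u \<longleftrightarrow> (AE z in slab ell. (\<Sum>i\<in>Basis. weak_partial ell i (vec_comp u i) z) = 0)"

definition H1_sol :: "real \<Rightarrow> ('n::finite pt \<Rightarrow> 'n pt) set" where
  "H1_sol ell = {u. (\<forall>j\<in>Basis. vec_comp u j \<in> H1 ell \<and> has_trace ell 0 (vec_comp u j) (\<lambda>_. 0)) \<and> div_free ell u}"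

definition H1_sol_inner :: "real \<Rightarrow> ('n::finite pt \<Rightarrow> 'n pt) \<Rightarrow> ('n pt \<Rightarrow> 'n pt) \<Rightarrow> real" where
  "H1_sol_inner ell u v = (\<Sum>i\<in>Basis. \<Sum>j\<in>Basis.
     L2_inner (slab ell) (weak_partial ell i (vec_comp u j)) (weak_partial ell i (vec_comp v j)))"

definition H1_sol_norm :: "real \<Rightarrow> ('n::finite pt \<Rightarrow> 'n pt) \<Rightarrow> real" where
  "H1_sol_norm ell u = sqrt (H1_sol_inner ell u u)"

definition sym_grad ::
    "real \<Rightarrow> ('n::finite pt \<Rightarrow> 'n pt) \<Rightarrow> 'n pt \<Rightarrow> 'n pt \<Rightarrow> 'n pt \<Rightarrow> real" where
  "sym_grad ell u i j = (\<lambda>z. weak_partial ell i (vec_comp u j) z + weak_partial ell j (vec_comp u i) z)"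

definition sym_grad_inner :: "real \<Rightarrow> ('n::finite pt \<Rightarrow> 'n pt) \<Rightarrow> ('n pt \<Rightarrow> 'n pt) \<Rightarrow> real" where
  "sym_grad_inner ell u v = (\<Sum>i\<in>Basis. \<Sum>j\<in>Basis.
     L2_inner (slab ell) (sym_grad ell u i j) (sym_grad ell v i j))"

definition H1_sol_dual :: "real \<Rightarrow> (('n::finite pt \<Rightarrow> 'n pt) \<Rightarrow> real) set" where
  "H1_sol_dual ell = {F.
     (\<forall>v\<in>H1_sol ell. \<forall>w\<in>H1_sol ell. F (\<lambda>z. v z + w z) = F v + F w) \<and>
     (\<forall>a. \<forall>v\<in>H1_sol ell. F (\<lambda>z. a *\<^sub>R v z) = a * F v) \<and>
     (\<exists>C. \<forall>v\<in>H1_sol ell. \<bar>F v\<bar> \<le> C * H1_sol_norm ell v)}"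

definition H1_sol_dual_norm :: "real \<Rightarrow> (('n::finite pt \<Rightarrow> 'n pt) \<Rightarrow> real) \<Rightarrow> real" where
  "H1_sol_dual_norm ell F = (SUP v\<in>{v \<in> H1_sol ell. H1_sol_norm ell v \<le> 1}. \<bar>F v\<bar>)"


section \<open>Functions of time with values in a function space\<close>

text \<open>\<open>X\<close> is a vector space of functions with seminorm \<open>nrm\<close>; Bochner measurability is
  almost-everywhere approximability by simple functions.\<close>

definition bochner_measurable ::
    "real set \<Rightarrow> ('a \<Rightarrow> 'b::real_normed_vector) set \<Rightarrow> (('a \<Rightarrow> 'b) \<Rightarrow> real)
       \<Rightarrow> (real \<Rightarrow> 'a \<Rightarrow> 'b) \<Rightarrow> bool" where
  "bochner_measurable S X nrm f \<longleftrightarrow>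
     (\<exists>s::nat \<Rightarrow> real \<Rightarrow> 'a \<Rightarrow> 'b.
        (\<forall>k. finite (range (s k)) \<and> range (s k) \<subseteq> X \<and> (\<forall>p. s k -` {p} \<in> sets lebesgue)) \<and>
        (AE t in lebesgue. t \<in> S \<longrightarrow> (\<lambda>k. nrm (\<lambda>x. s k t x - f t x)) \<longlonglongrightarrow> 0))"

definition L2_time ::
    "real set \<Rightarrow> ('a \<Rightarrow> 'b::real_normed_vector) set \<Rightarrow> (('a \<Rightarrow> 'b) \<Rightarrow> real)
       \<Rightarrow> (real \<Rightarrow> 'a \<Rightarrow> 'b) set" where
  "L2_time S X nrm = {f. bochner_measurable S X nrm f \<and>
     (AE t in lebesgue. t \<in> S \<longrightarrow> f t \<in> X) \<and>
     (\<integral>\<^sup>+t\<in>S. ennreal ((nrm (f t))\<^sup>2) \<partial>lebesgue) < \<infinity>}"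

definition L2_loc ::
    "('a \<Rightarrow> 'b::real_normed_vector) set \<Rightarrow> (('a \<Rightarrow> 'b) \<Rightarrow> real) \<Rightarrow> (real \<Rightarrow> 'a \<Rightarrow> 'b) set" where
  "L2_loc X nrm = {f. \<forall>T>0. f \<in> L2_time {0..T} X nrm}"

definition time_test_functions :: "(real \<Rightarrow> real) set" where
  "time_test_functions =
     {\<phi>. C_infinity \<phi> \<and> (\<exists>a b. 0 < a \<and> (\<forall>t. t \<notin> {a..b} \<longrightarrow> \<phi> t = 0))}"

text \<open>The distributional identity \<open>\<partial>\<^sub>t f = f'\<close> on \<open>(0, \<infinity>)\<close> in the dual of \<open>X\<close>, where \<open>f t v\<close> and
  \<open>f' t v\<close> are the pairings of the two sides with \<open>v \<in> X\<close>.\<close>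

definition has_weak_time_derivative ::
    "'v set \<Rightarrow> (real \<Rightarrow> 'v \<Rightarrow> real) \<Rightarrow> (real \<Rightarrow> 'v \<Rightarrow> real) \<Rightarrow> bool" where
  "has_weak_time_derivative X f f' \<longleftrightarrow>
     (\<forall>\<phi>\<in>time_test_functions. \<forall>v\<in>X.
        (\<integral>t. deriv \<phi> t * f t v \<partial>lebesgue) = - (\<integral>t. \<phi> t * f' t v \<partial>lebesgue))"

definition continuous_L2 :: "'a measure \<Rightarrow> (real \<Rightarrow> 'a \<Rightarrow> 'b::euclidean_space) \<Rightarrow> bool" where
  "continuous_L2 M f \<longleftrightarrow> (\<forall>t\<ge>0. f t \<in> L2 M \<and>
     ((\<lambda>s. L2_norm M (\<lambda>x. f s x - f t x)) \<longlongrightarrow> 0) (at t within {0..}))"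


section \<open>Weak solutions and energy\<close>

text \<open>The regularity of \<open>u\<close>, \<open>\<partial>\<^sub>t u\<close>, \<open>h\<close>, \<open>\<partial>\<^sub>t h\<close> implies that \<open>u\<close> and \<open>h\<close> agree for almost every
  time with unique elements of \<open>C([0,\<infinity>); L\<^sup>2)\<close>.  Statements at individual times, such as the
  initial condition, the mean-zero condition and the value of the energy, refer to these
  representatives, and \<open>u\<close>, \<open>h\<close> are taken to be them.

  The witnesses \<open>ut\<close>, \<open>m\<close>, \<open>ht\<close> are \<open>\<partial>\<^sub>t u\<close>, \<open>M(h)\<close>, \<open>\<partial>\<^sub>t h\<close>.\<close>

definition weak_solution ::
    "real \<Rightarrow> (int^'n \<Rightarrow> real) \<Rightarrow> ('n::finite pt \<Rightarrow> 'n pt) \<Rightarrow> (real^'n \<Rightarrow> real)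
       \<Rightarrow> (real \<Rightarrow> 'n pt \<Rightarrow> 'n pt) \<Rightarrow> (real \<Rightarrow> real^'n \<Rightarrow> real) \<Rightarrow> bool" where
  "weak_solution ell \<mu> u0 h0 u h \<longleftrightarrow> (\<exists>ut m ht.
     u \<in> L2_loc (H1_sol ell) (H1_sol_norm ell) \<and>
     ut \<in> L2_loc (H1_sol_dual ell) (H1_sol_dual_norm ell) \<and>
     has_weak_time_derivative (H1_sol ell) (\<lambda>t. L2_inner (slab ell) (u t)) ut \<and>
     h \<in> L2_loc (L2 torus) (L2_norm torus) \<and>
     m \<in> L2_loc (L2 torus) (L2_norm torus) \<and>
     (AE t in lebesgue. t \<ge> 0 \<longrightarrow> fourier (m t) = M_hat \<mu> (h t)) \<and>
     ht \<in> L2_loc (Hs (1/2)) (Hs_norm (1/2)) \<and>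
     has_weak_time_derivative (L2 torus) (\<lambda>t. L2_inner torus (h t)) (\<lambda>t. L2_inner torus (ht t)) \<and>
     continuous_L2 (slab ell) u \<and> continuous_L2 torus h \<and>
     (\<forall>T>0. \<forall>v\<in>L2_time {0..T} (H1_sol ell) (H1_sol_norm ell).
        AE t in lebesgue. t \<in> {0..T} \<longrightarrow>
          (\<forall>q. has_trace ell ell (\<lambda>z. snd (v t z)) q \<longrightarrow>
             ut t (v t) + 1/2 * sym_grad_inner ell (u t) (v t) + L2_inner torus (m t) q = 0)) \<and>
     (AE t in lebesgue. t \<ge> 0 \<longrightarrow> div_free ell (u t)) \<and>
     (AE t in lebesgue. t \<ge> 0 \<longrightarrow> has_trace ell ell (\<lambda>z. snd (u t z)) (ht t)) \<and>
     (AE z in slab ell. u 0 z = u0 z) \<and> (AE x in torus. h 0 x = h0 x) \<and>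
     (\<forall>t\<ge>0. (\<integral>x. h t x \<partial>torus) = 0))"

text \<open>The integral of \<open>M(h) h\<close> is the pairing of \<open>M(h)\<close> with \<open>h\<close>, given by Parseval's formula.
  The values are extended reals, so that no finiteness is presupposed; for \<open>\<mu> \<ge> 0\<close> the terms of
  the series are nonnegative.\<close>

definition energy ::
    "real \<Rightarrow> (int^'n \<Rightarrow> real) \<Rightarrow> (real \<Rightarrow> 'n::finite pt \<Rightarrow> 'n pt)
       \<Rightarrow> (real \<Rightarrow> real^'n \<Rightarrow> real) \<Rightarrow> real \<Rightarrow> ennreal" where
  "energy ell \<mu> u h t =
     ennreal (1/2) * (\<integral>\<^sup>+z. ennreal ((norm (u t z))\<^sup>2) \<partial>slab ell) +
     ennreal (1/2) * (\<Sum>\<^sub>\<infinity>\<xi>. ennreal (Re (M_hat \<mu> (h t) \<xi> * cnj (fourier (h t) \<xi>))))"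

end

theory Submission
  imports Defs
begin

text \<open>
  The energy decreases at the rate \<open>(\<D>u, \<D>u) / 2\<close>, and the Korn-Poincare inequality bounds
  \<open>\<parallel>u\<parallel>\<close> and the trace of \<open>u\<close> by this dissipation, but the dissipation does not see \<open>h\<close>.  Since \<open>h\<close> has
  mean zero it is the normal trace of a divergence-free field \<open>v[h]\<close> vanishing at the bottom, linear
  in \<open>h\<close>, with \<open>\<parallel>v[h]\<parallel> \<lesssim> \<parallel>h\<parallel>\<close> and \<open>\<parallel>\<nabla>v[h]\<parallel>\<^sup>2 \<lesssim> \<Sum> |\<xi>| |h\<^sub>\<xi>|\<^sup>2\<close>.  The derivative of \<open>(u, v[h])\<close> in time is
  \<open>(u, v[\<partial>\<^sub>t h]) - (\<D>u, \<D>v[h]) / 2 - \<integral> M(h) h\<close>; here \<open>\<partial>\<^sub>t h\<close> is the trace of \<open>u\<close>, and the middle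
  term is absorbed because \<open>\<mu>(\<xi>) \<ge> \<sigma> |\<xi>|\<close> for \<open>\<xi> \<noteq> 0\<close>, which is where \<open>r \<ge> 1/2\<close> is used.  Hence the
  integral of the energy over \<open>[s, t]\<close> is at most a fixed multiple of its value at \<open>s\<close>, so that the
  energy is halved after a fixed time.
\<close>

section \<open>Square-integrable functions\<close>

text \<open>Low regularity in time is the obstacle. The time derivative of \<open>u\<close> exists
  only in a dual space, so an energy identity would need a chain rule there; decay needs only an
  inequality, and convexity of the square combined with Riemann sums tagged at right end points
  provides it. The potential energy is a Fourier series whose terms are absolutely continuous in
  time while the sum is not known to be, so every estimate is made for a finite set of frequencies.
  The truncated energy is dissipated up to a \<open>defect\<close>, the L1 distance in time between
  the truncated and the full work of \<open>M(h)\<close> against the surface velocity, and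
  Parseval's formula for traces with dominated convergence makes the defect vanish as the truncation
  is removed. Truncation also makes the test field finite-dimensional: \<open>(u, v[h])\<close>
  becomes a finite sum of products of absolutely continuous scalar functions. The constants do not
  depend on the truncation. With C = \<open>observability_const\<close> the halving time is 4 C,
  whence the rate ln 2 / (4 C).\<close>

lemma L2_measurable [measurable_dest]: "f \<in> L2 M \<Longrightarrow> f \<in> borel_measurable M"
  by (simp add: L2_def)

lemma L2_integrable_sq: "f \<in> L2 M \<Longrightarrow> integrable M (\<lambda>x. (norm (f x))\<^sup>2)"
  by (simp add: L2_def)

lemma integrable_L2_inner:
  assumes "f \<in> L2 M" "g \<in> L2 M"
  shows "integrable M (\<lambda>x. f x \<bullet> g x)"
proof (rule Bochner_Integration.integrable_bound)
  show "integrable M (\<lambda>x. (norm (f x))\<^sup>2 + (norm (g x))\<^sup>2)"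
    using assms by (auto simp: L2_def)
  show "(\<lambda>x. f x \<bullet> g x) \<in> borel_measurable M"
    using assms by (auto simp: L2_def)
  have "norm (f x \<bullet> g x) \<le> norm ((norm (f x))\<^sup>2 + (norm (g x))\<^sup>2)" for x
  proof -
    have "\<bar>f x \<bullet> g x\<bar> \<le> norm (f x) * norm (g x)" by (rule Cauchy_Schwarz_ineq2)
    also have "\<dots> \<le> (norm (f x))\<^sup>2 + (norm (g x))\<^sup>2"
      using sum_squares_bound[of "norm (f x)" "norm (g x)"] mult_nonneg_nonneg[of "norm (f x)" "norm (g x)"]
      by (auto simp del: mult_nonneg_nonneg)
    finally show ?thesis by simp
  qed
  then show "AE x in M. norm (f x \<bullet> g x) \<le> norm ((norm (f x))\<^sup>2 + (norm (g x))\<^sup>2)" by simp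
qed

lemma L2_zero [simp]: "(\<lambda>_. 0) \<in> L2 M"
  by (simp add: L2_def)

lemma L2_add:
  assumes "f \<in> L2 M" "g \<in> L2 M"
  shows "(\<lambda>x. f x + g x) \<in> L2 M"
proof -
  have "integrable M (\<lambda>x. (norm (f x))\<^sup>2 + (norm (g x))\<^sup>2 + 2 * (f x \<bullet> g x))"
    using assms integrable_L2_inner[OF assms] by (auto simp: L2_def)
  moreover have "(norm (f x + g x))\<^sup>2 = (norm (f x))\<^sup>2 + (norm (g x))\<^sup>2 + 2 * (f x \<bullet> g x)" for x
    by (simp add: power2_norm_eq_inner inner_simps inner_commute)
  ultimately show ?thesis using assms by (auto simp: L2_def)
qed

lemma L2_scaleR:
  assumes "f \<in> L2 M"
  shows "(\<lambda>x. c *\<^sub>R f x) \<in> L2 M"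
  using assms by (auto simp: L2_def power_mult_distrib)

lemma L2_cmult: "f \<in> L2 M \<Longrightarrow> (\<lambda>x. c * f x) \<in> L2 M" for f :: "_ \<Rightarrow> real"
  using L2_scaleR[of f M c] by simp

lemma L2_diff:
  assumes "f \<in> L2 M" "g \<in> L2 M"
  shows "(\<lambda>x. f x - g x) \<in> L2 M"
  using L2_add[OF assms(1) L2_scaleR[OF assms(2), of "-1"]] by simp

lemma L2_sum: "(\<And>i. i \<in> I \<Longrightarrow> f i \<in> L2 M) \<Longrightarrow> (\<lambda>x. \<Sum>i\<in>I. f i x) \<in> L2 M"
  by (induction I rule: infinite_finite_induct) (auto intro: L2_add)

lemma L2_bounded_mult:
  fixes f :: "'a \<Rightarrow> real"
  assumes "f \<in> L2 M" "w \<in> borel_measurable M" "\<And>x. x \<in> space M \<Longrightarrow> \<bar>w x\<bar> \<le> B"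
  shows "(\<lambda>x. w x * f x) \<in> L2 M"
proof -
  have "integrable M (\<lambda>x. (norm (w x * f x))\<^sup>2)"
  proof (rule Bochner_Integration.integrable_bound)
    show "integrable M (\<lambda>x. B\<^sup>2 * (norm (f x))\<^sup>2)" using assms by (auto simp: L2_def)
    show "(\<lambda>x. (norm (w x * f x))\<^sup>2) \<in> borel_measurable M" using assms by (auto simp: L2_def)
    show "AE x in M. norm ((norm (w x * f x))\<^sup>2) \<le> norm (B\<^sup>2 * (norm (f x))\<^sup>2)"
    proof (rule AE_I2)
      fix x assume "x \<in> space M"
      from assms(3)[OF this] have "(w x)\<^sup>2 \<le> B\<^sup>2" by (meson abs_ge_zero abs_le_square_iff dual_order.trans abs_ge_self)
      then show "norm ((norm (w x * f x))\<^sup>2) \<le> norm (B\<^sup>2 * (norm (f x))\<^sup>2)"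
        by (simp add: power_mult_distrib mult_right_mono)
    qed
  qed
  with assms show ?thesis by (auto simp: L2_def)
qed

lemma L2_inner_add_left: "f \<in> L2 M \<Longrightarrow> g \<in> L2 M \<Longrightarrow> k \<in> L2 M \<Longrightarrow>
    L2_inner M (\<lambda>x. f x + g x) k = L2_inner M f k + L2_inner M g k"
  by (simp add: L2_inner_def inner_simps integrable_L2_inner)

lemma L2_inner_commute: "L2_inner M f g = L2_inner M g f"
  by (simp add: L2_inner_def inner_commute)

lemma L2_inner_add_right: "f \<in> L2 M \<Longrightarrow> g \<in> L2 M \<Longrightarrow> k \<in> L2 M \<Longrightarrow>
    L2_inner M k (\<lambda>x. f x + g x) = L2_inner M k f + L2_inner M k g"
  using L2_inner_add_left[of f M g k] by (simp add: L2_inner_commute)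

lemma L2_inner_diff_left: "f \<in> L2 M \<Longrightarrow> g \<in> L2 M \<Longrightarrow> k \<in> L2 M \<Longrightarrow>
    L2_inner M (\<lambda>x. f x - g x) k = L2_inner M f k - L2_inner M g k"
  by (simp add: L2_inner_def inner_simps integrable_L2_inner)

lemma L2_inner_diff_right: "f \<in> L2 M \<Longrightarrow> g \<in> L2 M \<Longrightarrow> k \<in> L2 M \<Longrightarrow>
    L2_inner M k (\<lambda>x. f x - g x) = L2_inner M k f - L2_inner M k g"
  using L2_inner_diff_left[of f M g k] by (simp add: L2_inner_commute)

lemma L2_inner_scaleR_left: "L2_inner M (\<lambda>x. c *\<^sub>R f x) k = c * L2_inner M f k"
  by (simp add: L2_inner_def)

lemma L2_inner_scaleR_right: "L2_inner M k (\<lambda>x. c *\<^sub>R f x) = c * L2_inner M k f"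
  by (simp add: L2_inner_def)

lemma L2_inner_cmult_right: "L2_inner M k (\<lambda>x. c * f x) = c * L2_inner M k f" for c :: real
  using L2_inner_scaleR_right[of M k c f] by simp

lemma L2_inner_cmult_left: "L2_inner M (\<lambda>x. c * f x) k = c * L2_inner M f k" for c :: real
  using L2_inner_scaleR_left[of M c f k] by simp

lemma L2_inner_cong_AE:
  assumes "AE x in M. f x = f' x" "AE x in M. g x = g' x"
    and "f \<in> borel_measurable M" "f' \<in> borel_measurable M" "g \<in> borel_measurable M" "g' \<in> borel_measurable M"
  shows "L2_inner M f g = L2_inner M f' g'"
  unfolding L2_inner_def using assms by (intro integral_cong_AE) auto

lemma L2_inner_self_nonneg [simp]: "0 \<le> L2_inner M f f"
  by (simp add: L2_inner_def)

lemma L2_norm_nonneg [simp]: "0 \<le> L2_norm M f"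
  by (simp add: L2_norm_def)

lemma L2_norm_sq: "(L2_norm M f)\<^sup>2 = L2_inner M f f"
  by (simp add: L2_norm_def)

lemma L2_norm_sq_integral: "(L2_norm M f)\<^sup>2 = (\<integral>x. (norm (f x))\<^sup>2 \<partial>M)"
  by (simp add: L2_norm_sq L2_inner_def power2_norm_eq_inner)

text \<open>Discriminant argument for the quadratic t -> |f + t g|^2. The form is only semidefinite,
  since functions are not identified up to null sets, so a vanishing leading coefficient
  \<open>?c\<close> is possible and is treated apart.\<close>

lemma L2_Cauchy_Schwarz:
  assumes f: "f \<in> L2 M" and g: "g \<in> L2 M"
  shows "\<bar>L2_inner M f g\<bar> \<le> L2_norm M f * L2_norm M g"
proof -
  let ?a = "L2_inner M f f" and ?b = "L2_inner M f g" and ?c = "L2_inner M g g"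
  have q: "0 \<le> ?a + 2 * t * ?b + t\<^sup>2 * ?c" for t
  proof -
    have "0 \<le> L2_inner M (\<lambda>x. f x + t *\<^sub>R g x) (\<lambda>x. f x + t *\<^sub>R g x)" by simp
    also have "\<dots> = ?a + 2 * t * ?b + t\<^sup>2 * ?c"
      using f g L2_scaleR[OF g, of t]
      by (simp add: L2_inner_add_left L2_inner_add_right L2_add L2_inner_scaleR_left L2_inner_scaleR_right
          L2_inner_commute[of M g f] power2_eq_square algebra_simps)
    finally show ?thesis .
  qed
  have "?b\<^sup>2 \<le> ?a * ?c"
  proof (cases "?c = 0")
    case True
    have "?b = 0"
    proof (rule ccontr)
      assume b: "?b \<noteq> 0"
      \<comment> \<open>With \<open>?c\<close> = 0 the quadratic is affine in t, and this value of t
        makes it equal to -1.\<close>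
      have "0 \<le> ?a + 2 * (- (?a + 1) / (2 * ?b)) * ?b" using q[of "- (?a + 1) / (2 * ?b)"] True by simp
      then show False using b by (simp add: field_simps)
    qed
    then show ?thesis using True by simp
  next
    case False
    then have c: "?c > 0" using L2_inner_self_nonneg[of M g] by linarith
    have "0 \<le> ?a + 2 * (- ?b / ?c) * ?b + (- ?b / ?c)\<^sup>2 * ?c" by (rule q)
    also have "\<dots> = ?a - ?b\<^sup>2 / ?c" using c by (simp add: power2_eq_square field_simps)
    finally show ?thesis using c by (simp add: field_simps)
  qed
  then have "sqrt (?b\<^sup>2) \<le> sqrt (?a * ?c)" by (rule real_sqrt_le_mono)
  then show ?thesis by (simp add: L2_norm_def real_sqrt_mult)
qed

lemma L2_norm_triangle:
  assumes f: "f \<in> L2 M" and g: "g \<in> L2 M"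
  shows "L2_norm M (\<lambda>x. f x + g x) \<le> L2_norm M f + L2_norm M g"
proof (rule power2_le_imp_le)
  have "(L2_norm M (\<lambda>x. f x + g x))\<^sup>2 = L2_inner M f f + L2_inner M g g + 2 * L2_inner M f g"
    using f g by (simp add: L2_norm_sq L2_inner_add_left L2_inner_add_right L2_add L2_inner_commute[of M g f])
  also have "\<dots> \<le> (L2_norm M f + L2_norm M g)\<^sup>2"
    using L2_Cauchy_Schwarz[OF f g] by (auto simp: power2_sum L2_norm_sq)
  finally show "(L2_norm M (\<lambda>x. f x + g x))\<^sup>2 \<le> (L2_norm M f + L2_norm M g)\<^sup>2" .
qed simp

lemma L2_norm_scaleR: "L2_norm M (\<lambda>x. c *\<^sub>R f x) = \<bar>c\<bar> * L2_norm M f"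
  by (simp add: L2_norm_def L2_inner_scaleR_left L2_inner_scaleR_right real_sqrt_mult flip: mult.assoc)

lemma L2_norm_cmult: "L2_norm M (\<lambda>x. c * f x) = \<bar>c\<bar> * L2_norm M f" for c :: real
  using L2_norm_scaleR[of M c f] by simp

lemma L2_norm_minus_commute: "L2_norm M (\<lambda>x. f x - g x) = L2_norm M (\<lambda>x. g x - f x)"
  using L2_norm_scaleR[of M "-1" "\<lambda>x. f x - g x"] by simp

lemma L2_norm_triangle_diff:
  assumes f: "f \<in> L2 M" and g: "g \<in> L2 M"
  shows "\<bar>L2_norm M f - L2_norm M g\<bar> \<le> L2_norm M (\<lambda>x. f x - g x)"
  using L2_norm_triangle[OF L2_diff[OF f g] g] L2_norm_triangle[OF L2_diff[OF g f] f]
  by (simp add: L2_norm_minus_commute[of M f g] abs_le_iff)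

lemma L2_norm_zero [simp]: "L2_norm M (\<lambda>_. 0) = 0"
  by (simp add: L2_norm_def L2_inner_def)

lemma L2_norm_cong_AE:
  assumes "AE x in M. f x = f' x" and "f \<in> borel_measurable M" "f' \<in> borel_measurable M"
  shows "L2_norm M f = L2_norm M f'"
  unfolding L2_norm_def using L2_inner_cong_AE[OF assms(1,1,2,3,2,3)] by simp

text \<open>Joint continuity of the inner product: the increment splits into a product of two
  differences and two mixed terms. Convergence is expressed by seminorms of differences because the
  elements are functions and not classes.\<close>

lemma L2_inner_tendsto:
  assumes "\<And>k. f k \<in> L2 M" "f' \<in> L2 M" "\<And>k. g k \<in> L2 M" "g' \<in> L2 M"
    and "((\<lambda>k. L2_norm M (\<lambda>x. f k x - f' x)) \<longlongrightarrow> 0) F" "((\<lambda>k. L2_norm M (\<lambda>x. g k x - g' x)) \<longlongrightarrow> 0) F"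
  shows "((\<lambda>k. L2_inner M (f k) (g k)) \<longlongrightarrow> L2_inner M f' g') F"
proof (rule Lim_null[THEN iffD2], rule Lim_null_comparison)
  let ?a = "\<lambda>k. L2_norm M (\<lambda>x. f k x - f' x)" and ?b = "\<lambda>k. L2_norm M (\<lambda>x. g k x - g' x)"
  show "((\<lambda>k. ?a k * ?b k + ?a k * L2_norm M g' + L2_norm M f' * ?b k) \<longlongrightarrow> 0) F"
    by (intro tendsto_add_zero tendsto_mult_zero tendsto_mult_left_zero tendsto_mult_right_zero assms(5,6))
  have "\<bar>L2_inner M (f k) (g k) - L2_inner M f' g'\<bar> \<le> ?a k * ?b k + ?a k * L2_norm M g' + L2_norm M f' * ?b k" for k
  proof -
    have "L2_inner M (f k) (g k) - L2_inner M f' g' =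
       L2_inner M (\<lambda>x. f k x - f' x) (\<lambda>x. g k x - g' x) + L2_inner M (\<lambda>x. f k x - f' x) g' + L2_inner M f' (\<lambda>x. g k x - g' x)"
      using assms(1-4) by (simp add: L2_inner_diff_left L2_inner_diff_right L2_diff)
    then show ?thesis
      using L2_Cauchy_Schwarz[OF L2_diff[OF assms(1,2)] L2_diff[OF assms(3,4)], of k k]
        L2_Cauchy_Schwarz[OF L2_diff[OF assms(1,2)] assms(4), of k]
        L2_Cauchy_Schwarz[OF assms(2) L2_diff[OF assms(3,4)], of k] by linarith
  qed
  then show "\<forall>\<^sub>F k in F. norm (L2_inner M (f k) (g k) - L2_inner M f' g')
      \<le> ?a k * ?b k + ?a k * L2_norm M g' + L2_norm M f' * ?b k" by simp
qed

lemma L2_of_bounded: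
  assumes "finite_measure M" "f \<in> borel_measurable M" "\<And>x. x \<in> space M \<Longrightarrow> norm (f x) \<le> B"
  shows "f \<in> L2 M"
proof -
  interpret finite_measure M by fact
  have "integrable M (\<lambda>x. (norm (f x))\<^sup>2)"
  proof (rule Bochner_Integration.integrable_bound[OF integrable_const[of "B\<^sup>2"]])
    show "(\<lambda>x. (norm (f x))\<^sup>2) \<in> borel_measurable M" using assms by auto
    show "AE x in M. norm ((norm (f x))\<^sup>2) \<le> norm (B\<^sup>2)"
      using assms(3) by (auto intro!: AE_I2 power_mono)
  qed
  with assms show ?thesis by (simp add: L2_def)
qed

lemma L2_integrable:
  fixes f :: "'a \<Rightarrow> real"
  assumes "finite_measure M" "f \<in> L2 M"
  shows "integrable M f"
proof -
  have "(\<lambda>_. 1::real) \<in> L2 M" by (rule L2_of_bounded[OF assms(1), of _ 1]) auto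
  from integrable_L2_inner[OF assms(2) this] show ?thesis by simp
qed

section \<open>Smooth functions\<close>

declare C_k.simps(2) [simp del]


lemma C_k_SucD:
  assumes "C_k (Suc k) f"
  shows "\<exists>f'. (\<forall>x. (f has_derivative (\<lambda>v. \<Sum>b\<in>Basis. (v \<bullet> b) * f' b x)) (at x)) \<and> (\<forall>b\<in>Basis. C_k k (f' b))"
  using assms by (rule C_k.simps(2)[THEN iffD1])

lemma C_k_SucI:
  assumes "\<And>x. (f has_derivative (\<lambda>v. \<Sum>b\<in>Basis. (v \<bullet> b) * f' b x)) (at x)"
    "\<And>b. b \<in> Basis \<Longrightarrow> C_k k (f' b)"
  shows "C_k (Suc k) f"
  unfolding C_k.simps(2) by (rule exI[of _ f']) (simp add: assms)

lemma C_k_Suc_realD: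
  fixes F :: "real \<Rightarrow> real"
  assumes "C_k (Suc k) F"
  shows "\<exists>F'. (\<forall>x. (F has_real_derivative F' x) (at x)) \<and> C_k k F'"
proof -
  from C_k_SucD[OF assms] obtain f' where
    "\<forall>x. (F has_derivative (\<lambda>v. \<Sum>b\<in>Basis. (v \<bullet> b) * f' b x)) (at x)" "\<forall>b\<in>Basis. C_k k (f' b)"
    by (elim exE conjE)
  then show ?thesis
    by (intro exI[of _ "f' 1"]) (simp add: has_field_derivative_def mult_commute_abs)
qed

lemma C_k_Suc_realI:
  fixes F :: "real \<Rightarrow> real"
  assumes "\<And>x. (F has_real_derivative F' x) (at x)" "C_k k F'"
  shows "C_k (Suc k) F"
proof (rule C_k_SucI[of F "\<lambda>_. F'"])
  show "(F has_derivative (\<lambda>v. \<Sum>b\<in>Basis. v \<bullet> b * F' x)) (at x)" for x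
    using assms(1)[of x] by (simp add: has_field_derivative_def mult_commute_abs)
qed (rule assms)

lemma C_k_Suc_imp: "C_k (Suc k) f \<Longrightarrow> C_k k f"
proof (induction k arbitrary: f)
  case 0
  from C_k_SucD[OF this] obtain f' where
    f': "\<forall>x. (f has_derivative (\<lambda>v. \<Sum>b\<in>Basis. (v \<bullet> b) * f' b x)) (at x)"
    by (elim exE conjE)
  have "isCont f x" for x by (rule has_derivative_continuous[OF f'[rule_format]])
  then show ?case by (simp add: continuous_on_eq_continuous_at)
next
  case (Suc k)
  from C_k_SucD[OF Suc.prems] obtain f' where
    f': "\<forall>x. (f has_derivative (\<lambda>v. \<Sum>b\<in>Basis. (v \<bullet> b) * f' b x)) (at x)"
    "\<forall>b\<in>Basis. C_k (Suc k) (f' b)" by (elim exE conjE)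
  show ?case by (rule C_k_SucI[OF f'(1)[rule_format] Suc.IH[OF f'(2)[rule_format]]])
qed

lemma C_k_const [simp]: "C_k k (\<lambda>_. c)"
proof (induction k arbitrary: c)
  case (Suc k)
  show ?case by (rule C_k_SucI[of _ "\<lambda>_ _. 0", OF _ Suc]) simp
qed simp

lemma C_k_add: "C_k k f \<Longrightarrow> C_k k g \<Longrightarrow> C_k k (\<lambda>x. f x + g x)"
proof (induction k arbitrary: f g)
  case 0
  then show ?case by (auto intro: continuous_intros)
next
  case (Suc k)
  from C_k_SucD[OF Suc.prems(1)] C_k_SucD[OF Suc.prems(2)] obtain f' g' where
    f': "\<forall>x. (f has_derivative (\<lambda>v. \<Sum>b\<in>Basis. (v \<bullet> b) * f' b x)) (at x)" "\<forall>b\<in>Basis. C_k k (f' b)" and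
    g': "\<forall>x. (g has_derivative (\<lambda>v. \<Sum>b\<in>Basis. (v \<bullet> b) * g' b x)) (at x)" "\<forall>b\<in>Basis. C_k k (g' b)"
    by (elim exE conjE)
  show ?case
  proof (rule C_k_SucI)
    show "((\<lambda>x. f x + g x) has_derivative (\<lambda>v. \<Sum>b\<in>Basis. (v \<bullet> b) * (f' b x + g' b x))) (at x)" for x
      using has_derivative_add[OF f'(1)[rule_format] g'(1)[rule_format], of x]
      by (simp add: algebra_simps sum.distrib)
    show "C_k k (\<lambda>x. f' b x + g' b x)" if "b \<in> Basis" for b
      using that f' g' by (intro Suc.IH) simp_all
  qed
qed

lemma C_k_mult: "C_k k f \<Longrightarrow> C_k k g \<Longrightarrow> C_k k (\<lambda>x. f x * g x)"
proof (induction k arbitrary: f g)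
  case 0
  then show ?case by (auto intro: continuous_intros)
next
  case (Suc k)
  from C_k_SucD[OF Suc.prems(1)] C_k_SucD[OF Suc.prems(2)] obtain f' g' where
    f': "\<forall>x. (f has_derivative (\<lambda>v. \<Sum>b\<in>Basis. (v \<bullet> b) * f' b x)) (at x)" "\<forall>b\<in>Basis. C_k k (f' b)" and
    g': "\<forall>x. (g has_derivative (\<lambda>v. \<Sum>b\<in>Basis. (v \<bullet> b) * g' b x)) (at x)" "\<forall>b\<in>Basis. C_k k (g' b)"
    by (elim exE conjE)
  show ?case
  proof (rule C_k_SucI)
    show "((\<lambda>x. f x * g x) has_derivative (\<lambda>v. \<Sum>b\<in>Basis. (v \<bullet> b) * (f x * g' b x + f' b x * g x))) (at x)" for x
      using has_derivative_mult[OF f'(1)[rule_format] g'(1)[rule_format], of x]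
      by (simp add: algebra_simps sum.distrib sum_distrib_left sum_distrib_right)
    show "C_k k (\<lambda>x. f x * g' b x + f' b x * g x)" if "b \<in> Basis" for b
      by (rule C_k_add[OF Suc.IH[OF C_k_Suc_imp[OF Suc.prems(1)] g'(2)[rule_format, OF that]]
            Suc.IH[OF f'(2)[rule_format, OF that] C_k_Suc_imp[OF Suc.prems(2)]]])
  qed
qed

lemma C_k_compose:
  fixes F :: "real \<Rightarrow> real"
  shows "C_k k F \<Longrightarrow> C_k k f \<Longrightarrow> C_k k (\<lambda>x. F (f x))"
proof (induction k arbitrary: F f)
  case 0
  then show ?case using continuous_on_compose2[of UNIV F UNIV f] by auto
next
  case (Suc k)
  from C_k_Suc_realD[OF Suc.prems(1)] C_k_SucD[OF Suc.prems(2)] obtain F' f' where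
    F': "\<forall>x. (F has_real_derivative F' x) (at x)" "C_k k F'" and
    f': "\<forall>x. (f has_derivative (\<lambda>v. \<Sum>b\<in>Basis. (v \<bullet> b) * f' b x)) (at x)" "\<forall>b\<in>Basis. C_k k (f' b)"
    by (elim exE conjE)
  show ?case
  proof (rule C_k_SucI)
    show "((\<lambda>x. F (f x)) has_derivative (\<lambda>v. \<Sum>b\<in>Basis. (v \<bullet> b) * (F' (f x) * f' b x))) (at x)" for x
      using has_derivative_compose[OF f'(1)[rule_format] F'(1)[rule_format, unfolded has_field_derivative_def], of x]
      by (simp add: sum_distrib_left algebra_simps)
    show "C_k k (\<lambda>x. F' (f x) * f' b x)" if "b \<in> Basis" for b
      by (rule C_k_mult[OF Suc.IH[OF F'(2) C_k_Suc_imp[OF Suc.prems(2)]] f'(2)[rule_format, OF that]])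
  qed
qed

lemma C_infinity_const [simp]: "C_infinity (\<lambda>_. c)"
  by (simp add: C_infinity_def)

lemma C_infinity_add: "C_infinity f \<Longrightarrow> C_infinity g \<Longrightarrow> C_infinity (\<lambda>x. f x + g x)"
  by (simp add: C_infinity_def C_k_add)

lemma C_infinity_mult: "C_infinity f \<Longrightarrow> C_infinity g \<Longrightarrow> C_infinity (\<lambda>x. f x * g x)"
  by (simp add: C_infinity_def C_k_mult)

lemma C_infinity_diff: "C_infinity f \<Longrightarrow> C_infinity g \<Longrightarrow> C_infinity (\<lambda>x. f x - g x)"
  using C_infinity_add[OF _ C_infinity_mult[OF C_infinity_const[of "-1"]], of f g] by simp

lemma C_infinity_compose: "C_infinity F \<Longrightarrow> C_infinity f \<Longrightarrow> C_infinity (\<lambda>x. F (f x))" for F :: "real \<Rightarrow> real"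
  by (simp add: C_infinity_def C_k_compose)

lemma C_infinity_sum: "(\<And>i. i \<in> I \<Longrightarrow> C_infinity (f i)) \<Longrightarrow> C_infinity (\<lambda>x. \<Sum>i\<in>I. f i x)"
  by (induction I rule: infinite_finite_induct) (auto intro: C_infinity_add)

lemma C_infinity_prod: "(\<And>i. i \<in> I \<Longrightarrow> C_infinity (f i)) \<Longrightarrow> C_infinity (\<lambda>x. \<Prod>i\<in>I. f i x)"
  by (induction I rule: infinite_finite_induct) (auto intro: C_infinity_mult)

lemma C_infinity_inner: "C_infinity (\<lambda>x. x \<bullet> a)"
proof -
  have "C_k (Suc k) (\<lambda>x. x \<bullet> a)" for k
  proof -
    have "((\<lambda>x. x \<bullet> a) has_derivative (\<lambda>v. \<Sum>b\<in>Basis. (v \<bullet> b) * (b \<bullet> a))) (at x)" for x :: 'a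
    proof -
      have "(\<Sum>b\<in>Basis. (v \<bullet> b) * (b \<bullet> a)) = v \<bullet> a" for v
        by (subst euclidean_inner[of v a]) (simp add: inner_commute[of a])
      then show ?thesis
        by (simp add: bounded_linear.has_derivative[OF bounded_linear_inner_left has_derivative_ident])
    qed
    then show ?thesis by (intro C_k_SucI[of _ "\<lambda>b _. b \<bullet> a"]) simp_all
  qed
  then show ?thesis by (auto simp: C_infinity_def intro: C_k_Suc_imp)
qed

text \<open>Membership in a set closed under differentiation yields derivatives of every order, by
  induction on the order with the function generalised. For sine the set is the span of sine and
  cosine.\<close>

lemma C_infinity_real_coinduct:
  fixes f :: "real \<Rightarrow> real"
  assumes "f \<in> S" and S: "\<And>f. f \<in> S \<Longrightarrow> \<exists>g\<in>S. \<forall>x. (f has_real_derivative g x) (at x)"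
  shows "C_infinity f"
proof -
  have "f \<in> S \<Longrightarrow> C_k k f" for k f
  proof (induction k arbitrary: f)
    case 0
    then obtain g where "\<And>x. (f has_real_derivative g x) (at x)" using S by blast
    then have "isCont f x" for x by (rule DERIV_isCont)
    then show ?case by (simp add: continuous_on_eq_continuous_at)
  next
    case (Suc k)
    then obtain g where "g \<in> S" "\<And>x. (f has_real_derivative g x) (at x)" using S by blast
    then show ?case using Suc.IH by (intro C_k_Suc_realI)
  qed
  then show ?thesis using assms(1) by (auto simp: C_infinity_def)
qed

lemma C_infinity_antiderivative:
  fixes f :: "real \<Rightarrow> real"
  assumes "C_infinity g" and "\<And>x. (f has_real_derivative g x) (at x)"
  shows "C_infinity f"
proof -
  have "C_k (Suc k) f" for k
    using assms unfolding C_infinity_def by (intro C_k_Suc_realI) auto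
  then show ?thesis by (auto simp: C_infinity_def intro: C_k_Suc_imp)
qed

lemma C_infinity_sin [simp]: "C_infinity (sin :: real \<Rightarrow> real)"
proof (rule C_infinity_real_coinduct)
  let ?S = "range (\<lambda>(c, d) x. c * sin x + d * cos x :: real)"
  show "sin \<in> ?S" by (rule image_eqI[of _ _ "(1, 0)"]) auto
  fix f :: "real \<Rightarrow> real" assume "f \<in> ?S"
  then obtain c d where f: "f = (\<lambda>x. c * sin x + d * cos x)" by auto
  show "\<exists>g\<in>?S. \<forall>x. (f has_real_derivative g x) (at x)"
  proof
    show "(\<lambda>x. - d * sin x + c * cos x) \<in> ?S" by (rule image_eqI[of _ _ "(- d, c)"]) auto
    show "\<forall>x. (f has_real_derivative (- d * sin x + c * cos x)) (at x)"
      unfolding f by (auto intro!: derivative_eq_intros)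
  qed
qed

lemma C_infinity_cos [simp]: "C_infinity (cos :: real \<Rightarrow> real)"
proof (rule C_infinity_antiderivative)
  show "C_infinity (\<lambda>x::real. -1 * sin x)" by (intro C_infinity_mult C_infinity_const C_infinity_sin)
  show "(cos has_real_derivative -1 * sin x) (at x)" for x :: real by (auto intro!: derivative_eq_intros)
qed

lemma C_infinity_power: "C_infinity f \<Longrightarrow> C_infinity (\<lambda>x. f x ^ n)"
  by (induction n) (auto intro: C_infinity_mult)

lemma C_infinity_continuous: "C_infinity f \<Longrightarrow> continuous_on UNIV f"
  using C_k.simps(1) unfolding C_infinity_def by blast

lemma C_infinity_has_derivative:
  assumes "C_infinity f"
  shows "(f has_derivative frechet_derivative f (at x)) (at x)"
    and "b \<in> Basis \<Longrightarrow> continuous_on UNIV (\<lambda>x. frechet_derivative f (at x) b)"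
proof -
  from assms have "C_k (Suc 0) f" unfolding C_infinity_def by blast
  from C_k_SucD[OF this] obtain g where
    gg: "\<forall>x. (f has_derivative (\<lambda>v. \<Sum>b\<in>Basis. (v \<bullet> b) * g b x)) (at x)" "\<forall>b\<in>Basis. C_k 0 (g b)"
    by (elim exE conjE)
  note g = gg(1)[rule_format] gg(2)[rule_format]
  have eq: "frechet_derivative f (at x) = (\<lambda>v. \<Sum>b\<in>Basis. (v \<bullet> b) * g b x)" for x
    using frechet_derivative_at[OF g(1)] by simp
  then show "(f has_derivative frechet_derivative f (at x)) (at x)" using g(1) by simp
  show "continuous_on UNIV (\<lambda>x. frechet_derivative f (at x) b)" if "b \<in> Basis"
  proof -
    have "(\<Sum>a\<in>Basis. (b \<bullet> a) * g a x) = (\<Sum>a\<in>Basis. if a = b then g b x else 0)" for x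
      using that by (intro sum.cong) (auto simp: inner_Basis)
    then show ?thesis using g(2)[OF that] that by (simp add: eq)
  qed
qed

lemma C_infinity_real_deriv:
  fixes f :: "real \<Rightarrow> real"
  assumes "C_infinity f"
  shows "(f has_real_derivative deriv f x) (at x)" and "continuous_on UNIV (deriv f)"
proof -
  have d: "(f has_real_derivative frechet_derivative f (at x) 1) (at x)" for x
  proof -
    have "bounded_linear (frechet_derivative f (at x))"
      using C_infinity_has_derivative(1)[OF assms] has_derivative_bounded_linear by blast
    then have "frechet_derivative f (at x) = (\<lambda>v. frechet_derivative f (at x) 1 * v)"
      by (metis (no_types) mult.commute linear_scale bounded_linear.linear mult.right_neutral real_scaleR_def)
    then show ?thesis using C_infinity_has_derivative(1)[OF assms, of x]
      unfolding has_field_derivative_def by metis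
  qed
  then have "deriv f = (\<lambda>x. frechet_derivative f (at x) 1)" using DERIV_imp_deriv by blast
  with d C_infinity_has_derivative(2)[OF assms, of 1]
  show "(f has_real_derivative deriv f x) (at x)" and "continuous_on UNIV (deriv f)" by auto
qed

section \<open>A smooth step function\<close>

definition flat_exp :: "nat \<Rightarrow> real \<Rightarrow> real" where
  "flat_exp n x = (if x > 0 then exp (- 1 / x) * (1 / x) ^ n else 0)"

text \<open>The powers 1 / x^n are carried along so that the derivatives of the flat function exp
  (-1/x) stay in the span of the family; smoothness then follows by one induction for all n at
  once.\<close>

lemma flat_exp_deriv:
  "(flat_exp n has_real_derivative (flat_exp (n + 2) x - real n * flat_exp (n + 1) x)) (at x)"
proof -
  consider "x > 0" | "x < 0" | "x = 0" by linarith
  then show ?thesis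
  proof cases
    case 1
    have "((\<lambda>x. 1 / x) has_real_derivative - ((1 / x) ^ 2)) (at x)"
      using 1 by (auto intro!: derivative_eq_intros simp: power2_eq_square)
    then have "((\<lambda>x. exp (- (1 / x)) * (1 / x) ^ n) has_real_derivative
        exp (- (1 / x)) * - (- ((1 / x) ^ 2)) * (1 / x) ^ n
        + real n * (- ((1 / x) ^ 2) * (1 / x) ^ (n - Suc 0)) * exp (- (1 / x))) (at x)"
      by (intro DERIV_mult DERIV_fun_exp DERIV_minus DERIV_power)
    also have "exp (- (1 / x)) * - (- ((1 / x) ^ 2)) * (1 / x) ^ n
        + real n * (- ((1 / x) ^ 2) * (1 / x) ^ (n - Suc 0)) * exp (- (1 / x))
      = flat_exp (n + 2) x - real n * flat_exp (n + 1) x"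
      using 1 by (cases n) (auto simp: flat_exp_def power2_eq_square algebra_simps)
    finally have "((\<lambda>x. exp (- 1 / x) * (1 / x) ^ n) has_real_derivative
        (flat_exp (n + 2) x - real n * flat_exp (n + 1) x)) (at x)" by simp
    moreover have "\<forall>\<^sub>F y in nhds x. flat_exp n y = exp (- 1 / y) * (1 / y) ^ n"
      using eventually_nhds_in_open[of "{0<..}" x] 1 by (auto simp: flat_exp_def elim: eventually_mono)
    ultimately show ?thesis using 1 by (subst DERIV_cong_ev) auto
  next
    case 2
    have "\<forall>\<^sub>F y in nhds x. flat_exp n y = 0"
      using eventually_nhds_in_open[of "{..<0}" x] 2 by (auto simp: flat_exp_def elim: eventually_mono)
    then show ?thesis using 2 by (subst DERIV_cong_ev[OF refl, of _ "\<lambda>_. 0"]) (auto simp: flat_exp_def)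
  next
    case 3
    \<comment> \<open>The right difference quotient at 0. With z = 1 / h it is z^(n+1) / exp z,
      which tends to 0 as z grows.\<close>
    have "((\<lambda>h. exp (- 1 / h) * (1 / h) ^ (n + 1)) \<longlongrightarrow> 0) (at_right (0::real))"
    proof -
      have "((\<lambda>z. z ^ (n + 1) / exp z) \<longlongrightarrow> (0::real)) at_top" by (rule tendsto_power_div_exp_0)
      then have "((\<lambda>h. inverse h ^ (n + 1) / exp (inverse h)) \<longlongrightarrow> (0::real)) (at_right 0)"
        by (rule filterlim_compose[OF _ filterlim_inverse_at_top_right])
      then show ?thesis by (simp add: exp_minus field_simps inverse_eq_divide)
    qed
    then have "((\<lambda>h. flat_exp n h / h) \<longlongrightarrow> 0) (at_right (0::real))"
    proof (rule Lim_transform_eventually)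
      show "\<forall>\<^sub>F h in at_right 0. exp (- 1 / h) * (1 / h) ^ (n + 1) = flat_exp n h / h"
        by (rule eventually_mono[OF eventually_at_right_less[of 0]]) (auto simp: flat_exp_def)
    qed
    moreover have "((\<lambda>h. flat_exp n h / h) \<longlongrightarrow> 0) (at_left (0::real))"
      by (rule tendsto_eventually) (auto simp: flat_exp_def eventually_at_filter)
    ultimately have "((\<lambda>h. flat_exp n h / h) \<longlongrightarrow> 0) (at (0::real))"
      using filterlim_split_at by blast
    then show ?thesis using 3 by (simp add: DERIV_def flat_exp_def)
  qed
qed

lemma C_infinity_flat_exp: "C_infinity (flat_exp n)"
proof -
  have "C_k k (flat_exp n)" for k n
  proof (induction k arbitrary: n)
    case 0
    show ?case using DERIV_isCont[OF flat_exp_deriv] by (simp add: continuous_on_eq_continuous_at)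
  next
    case (Suc k)
    have "C_k k (\<lambda>x. flat_exp (n + 2) x + (- real n) * flat_exp (n + 1) x)"
      by (intro C_k_add C_k_mult Suc C_k_const)
    then show ?case using flat_exp_deriv[of n]
      by (intro C_k_Suc_realI[of _ "\<lambda>x. flat_exp (n + 2) x - real n * flat_exp (n + 1) x"]) simp_all
  qed
  then show ?thesis by (simp add: C_infinity_def)
qed

text \<open>A normalised antiderivative of the bump \<open>b\<close>, which is positive exactly on
  (0, 1). The same function serves later as cut-off in space and, rescaled, as a mollified jump in
  time.\<close>

lemma smooth_step_exists:
  "\<exists>R :: real \<Rightarrow> real. C_infinity R \<and> (\<forall>x\<le>0. R x = 0) \<and> (\<forall>x\<ge>1. R x = 1) \<and> (\<forall>x. 0 \<le> R x \<and> R x \<le> 1)"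
proof -
  define b where "b = (\<lambda>x. flat_exp 0 x * flat_exp 0 (1 + (-1) * x))"
  have "C_infinity (\<lambda>x::real. 1 + (-1) * (x \<bullet> 1))"
    by (intro C_infinity_mult C_infinity_add C_infinity_const C_infinity_inner)
  then have "C_infinity (\<lambda>x::real. 1 + (-1) * x)" by simp
  from C_infinity_mult[OF C_infinity_flat_exp[of 0] C_infinity_compose[OF C_infinity_flat_exp[of 0] this]]
  have bC: "C_infinity b" unfolding b_def .
  have bpos: "b x > 0" if "0 < x" "x < 1" for x using that by (simp add: b_def flat_exp_def)
  have bz: "b x = 0" if "x \<le> 0 \<or> 1 \<le> x" for x using that by (auto simp: b_def flat_exp_def)
  have bnn: "b x \<ge> 0" for x by (simp add: b_def flat_exp_def)
  have cb: "isCont b x" for x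
    using C_infinity_continuous[OF bC] by (simp add: continuous_on_eq_continuous_at)
  have "\<exists>B. \<forall>x::real. -\<infinity> < ereal x \<longrightarrow> ereal x < \<infinity> \<longrightarrow> (B has_vector_derivative b x) (at x)"
    by (rule einterval_antiderivative) (simp, rule cb)
  then obtain B where "\<forall>x::real. -\<infinity> < ereal x \<longrightarrow> ereal x < \<infinity> \<longrightarrow> (B has_vector_derivative b x) (at x)"
    by (elim exE)
  then have B: "(B has_real_derivative b x) (at x)" for x
    by (simp add: has_real_derivative_iff_has_vector_derivative)
  have cB: "continuous_on A B" for A
    by (rule continuous_at_imp_continuous_on, rule ballI, rule DERIV_isCont[OF B])
  have Bnn: "\<exists>y. (B has_real_derivative y) (at x) \<and> 0 \<le> y" for x using B[of x] bnn[of x] by (intro exI[of _ "b x"]) simp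
  have mono: "B x \<le> B y" if "x \<le> y" for x y
    using that Bnn by (intro DERIV_nonneg_imp_nondecreasing[of x y B])
  have "\<exists>y. (B has_real_derivative y) (at x) \<and> 0 < y" if "0 < x" "x < 1" for x
    using B[of x] bpos[OF that] by (intro exI[of _ "b x"]) simp
  then have "B 0 < B 1" using DERIV_pos_imp_increasing_open[of 0 1 B] cB by simp
  have B0: "(B has_real_derivative 0) (at x)" if "x \<le> 0 \<or> 1 \<le> x" for x
    using B[of x] bz[OF that] by simp
  have lo: "B x = B 0" if "x \<le> 0" for x
  proof (cases "x = 0")
    case False
    then have "x < 0" using that by simp
    from DERIV_isconst_end[OF this cB, OF B0] show ?thesis by simp
  qed simp
  have hi: "B x = B 1" if "x \<ge> 1" for x
  proof (cases "x = 1")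
    case False
    then have "1 < x" using that by simp
    from DERIV_isconst_end[OF this cB, OF B0] show ?thesis by simp
  qed simp
  define R where "R = (\<lambda>x. (B x + (- B 0)) * (1 / (B 1 - B 0)))"
  have "C_infinity B" by (rule C_infinity_antiderivative[OF bC B])
  then have "C_infinity R" unfolding R_def
    by (rule C_infinity_mult[OF C_infinity_add[OF _ C_infinity_const] C_infinity_const])
  moreover have "\<forall>x\<le>0. R x = 0" "\<forall>x\<ge>1. R x = 1" 
  proof (safe)
    show "R x = 0" if "x \<le> 0" for x using lo[OF that] by (simp add: R_def)
    show "R x = 1" if "x \<ge> 1" for x unfolding R_def hi[OF that] using \<open>B 0 < B 1\<close> by simp
  qed
  moreover have "B 0 \<le> B x \<and> B x \<le> B 1" for x
  proof
    show "B 0 \<le> B x" using mono[of 0 x] lo[of x] by (cases "0 \<le> x") simp_all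
    show "B x \<le> B 1" using mono[of x 1] hi[of x] by (cases "x \<le> 1") simp_all
  qed
  then have "0 \<le> (B x - B 0) / (B 1 - B 0) \<and> (B x - B 0) / (B 1 - B 0) \<le> 1" for x
    using \<open>B 0 < B 1\<close> by (simp add: divide_nonneg_pos)
  then have "\<forall>x. 0 \<le> R x \<and> R x \<le> 1" by (simp add: R_def)
  ultimately show ?thesis by (intro exI[of _ R] conjI)
qed

section \<open>Integration over the periodic cell\<close>

lemma lborel_integral_shift:
  fixes f :: "'a::euclidean_space \<Rightarrow> 'b::{banach, second_countable_topology}"
  assumes "f \<in> borel_measurable borel"
  shows "(\<integral>z. f (z + c) \<partial>lborel) = (\<integral>z. f z \<partial>lborel)"
proof -
  have "(\<integral>z. f z \<partial>lborel) = (\<integral>z. f z \<partial>distr lborel borel ((+) c))"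
    by (simp add: lborel_distr_plus)
  also have "\<dots> = (\<integral>z. f (c + z) \<partial>lborel)" using assms by (intro integral_distr) auto
  finally show ?thesis by (simp add: add.commute)
qed

lemma lborel_integrable_shift:
  fixes f :: "'a::euclidean_space \<Rightarrow> 'b::{banach, second_countable_topology}"
  assumes "f \<in> borel_measurable borel" "integrable lborel f"
  shows "integrable lborel (\<lambda>z. f (z + c))"
proof -
  have "integrable (distr lborel borel ((+) c)) f"
    using assms by (simp add: lborel_distr_plus)
  then have "integrable lborel (\<lambda>z. f (c + z))" using assms by (subst (asm) integrable_distr_eq) auto
  then show ?thesis by (simp add: add.commute)
qed

text \<open>A fundamental domain for translation by b: a set invariant in direction b, cut to length
  one. The torus cell and the slab both have this form for each horizontal axis, so periodic
  integration is proved once for both.\<close>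

definition periodic_cell :: "'a::euclidean_space set \<Rightarrow> 'a \<Rightarrow> bool" where
  "periodic_cell S b \<longleftrightarrow> b \<in> Basis \<and> (\<exists>S'\<in>sets borel. (\<forall>z t. z + t *\<^sub>R b \<in> S' \<longleftrightarrow> z \<in> S') \<and>
     S = {z\<in>S'. 0 \<le> z \<bullet> b \<and> z \<bullet> b < 1})"

lemma periodic_cell_sets: "periodic_cell S b \<Longrightarrow> S \<in> sets borel"
proof -
  assume "periodic_cell S b"
  then obtain S' where "S' \<in> sets borel" "S = S' \<inter> {z. 0 \<le> z \<bullet> b} \<inter> {z. z \<bullet> b < 1}"
    by (auto simp: periodic_cell_def)
  then show ?thesis by simp
qed

text \<open>Shifting the argument by s b moves the domain to \<open>A\<close> together with
  \<open>B\<close>. The overhang \<open>B\<close> beyond the face at 1 is translated back by one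
  period onto \<open>B'\<close>, which is exactly the gap left below \<open>A\<close>.\<close>

lemma integral_periodic_shift:
  fixes f :: "'a::euclidean_space \<Rightarrow> 'b::{banach, second_countable_topology}"
  assumes cell: "periodic_cell S b"
    and f: "f \<in> borel_measurable borel" "integrable (restrict_space lborel S) f"
    and per: "\<And>z. f (z + b) = f z" and s: "0 \<le> s" "s \<le> 1"
  shows "(\<integral>z. f (z + s *\<^sub>R b) \<partial>restrict_space lborel S) = (\<integral>z. f z \<partial>restrict_space lborel S)"
proof -
  from cell obtain S' where b: "b \<in> Basis" and S': "S' \<in> sets borel" "\<And>z t. z + t *\<^sub>R b \<in> S' \<longleftrightarrow> z \<in> S'"
    and S: "S = {z\<in>S'. 0 \<le> z \<bullet> b \<and> z \<bullet> b < 1}"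
    unfolding periodic_cell_def by blast
  have bb: "b \<bullet> b = 1" using b by simp
  define A where "A = {z\<in>S'. s \<le> z \<bullet> b \<and> z \<bullet> b < 1}"
  define B where "B = {z\<in>S'. 1 \<le> z \<bullet> b \<and> z \<bullet> b < 1 + s}"
  define B' where "B' = {z\<in>S'. 0 \<le> z \<bullet> b \<and> z \<bullet> b < s}"
  have eqs: "A = S' \<inter> {z. s \<le> z \<bullet> b} \<inter> {z. z \<bullet> b < 1}" "B = S' \<inter> {z. 1 \<le> z \<bullet> b} \<inter> {z. z \<bullet> b < 1 + s}"
     "B' = S' \<inter> {z. 0 \<le> z \<bullet> b} \<inter> {z. z \<bullet> b < s}"
    by (auto simp: A_def B_def B'_def)
  have m [measurable]: "A \<in> sets borel" "B \<in> sets borel" "B' \<in> sets borel" "S \<in> sets borel" "S' \<in> sets borel"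
    using S'(1) periodic_cell_sets[OF cell] by (simp_all add: eqs)
  note f(1)[measurable]
  have iS: "integrable lborel (\<lambda>z. indicator S z *\<^sub>R f z)"
    using f(2) m(4) by (subst (asm) integrable_restrict_space) auto
  have ii: "integrable lborel (\<lambda>z. indicator X z *\<^sub>R f z)" if "X \<in> sets borel" "X \<subseteq> S" for X
  proof (rule Bochner_Integration.integrable_bound[OF iS])
    show "(\<lambda>z. indicator X z *\<^sub>R f z) \<in> borel_measurable lborel" using that by measurable
    show "AE z in lborel. norm (indicator X z *\<^sub>R f z) \<le> norm (indicator S z *\<^sub>R f z)"
      using that by (auto simp: indicator_def)
  qed
  have "A \<subseteq> S" "B' \<subseteq> S" using s by (auto simp: A_def B'_def S)
  with ii m have iA: "integrable lborel (\<lambda>z. indicator A z *\<^sub>R f z)" and iB': "integrable lborel (\<lambda>z. indicator B' z *\<^sub>R f z)"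
    by auto
  have Bsh: "indicator B (z + b) *\<^sub>R f (z + b) = indicator B' z *\<^sub>R f z" for z
    using S'(2)[of z 1] by (auto simp: B_def B'_def indicator_def inner_add_left bb per)
  have perm: "f (z + (- b)) = f z" for z using per[of "z + (- b)"] by simp
  have iB: "integrable lborel (\<lambda>z. indicator B z *\<^sub>R f z)"
  proof -
    have "integrable lborel (\<lambda>z. indicator B' (z + (- b)) *\<^sub>R f (z + (- b)))"
      by (rule lborel_integrable_shift[OF _ iB']) measurable
    moreover have "indicator B' (z + (- b)) *\<^sub>R f (z + (- b)) = indicator B z *\<^sub>R f z" for z
      using Bsh[of "z + (-b)"] by simp
    ultimately show ?thesis by simp
  qed
  have "(\<integral>z. f (z + s *\<^sub>R b) \<partial>restrict_space lborel S) = (\<integral>z. indicator S z *\<^sub>R f (z + s *\<^sub>R b) \<partial>lborel)"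
    using m(4) by (subst integral_restrict_space) auto
  also have "\<dots> = (\<integral>z. indicator S (z + s *\<^sub>R b + - (s *\<^sub>R b)) *\<^sub>R f (z + s *\<^sub>R b) \<partial>lborel)" by simp
  also have "\<dots> = (\<integral>z. indicator S (z + - (s *\<^sub>R b)) *\<^sub>R f z \<partial>lborel)"
    by (rule lborel_integral_shift) measurable
  also have "\<dots> = (\<integral>z. indicator A z *\<^sub>R f z + indicator B z *\<^sub>R f z \<partial>lborel)"
  proof (intro Bochner_Integration.integral_cong refl)
    fix z
    show "indicator S (z + - (s *\<^sub>R b)) *\<^sub>R f z = indicator A z *\<^sub>R f z + indicator B z *\<^sub>R f z"
      using S'(2)[of z "- s"] s by (auto simp: indicator_def S A_def B_def inner_diff_left bb)
  qed
  also have "\<dots> = (\<integral>z. indicator A z *\<^sub>R f z \<partial>lborel) + (\<integral>z. indicator B z *\<^sub>R f z \<partial>lborel)"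
    by (rule Bochner_Integration.integral_add[OF iA iB])
  also have "(\<integral>z. indicator B z *\<^sub>R f z \<partial>lborel) = (\<integral>z. indicator B (z + b) *\<^sub>R f (z + b) \<partial>lborel)"
    by (rule lborel_integral_shift[symmetric]) measurable
  also have "\<dots> = (\<integral>z. indicator B' z *\<^sub>R f z \<partial>lborel)" by (simp only: Bsh)
  also have "(\<integral>z. indicator A z *\<^sub>R f z \<partial>lborel) + \<dots> = (\<integral>z. indicator A z *\<^sub>R f z + indicator B' z *\<^sub>R f z \<partial>lborel)"
    by (rule Bochner_Integration.integral_add[OF iA iB', symmetric])
  also have "\<dots> = (\<integral>z. indicator S z *\<^sub>R f z \<partial>lborel)"
    using s by (intro Bochner_Integration.integral_cong refl) (auto simp: indicator_def S A_def B'_def)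
  also have "\<dots> = (\<integral>z. f z \<partial>restrict_space lborel S)"
    using m(4) by (subst integral_restrict_space) auto
  finally show ?thesis .
qed

lemma continuous_bounded_on_bounded:
  fixes f :: "'a::euclidean_space \<Rightarrow> 'b::real_normed_vector"
  assumes "continuous_on UNIV f" "bounded S"
  obtains C where "C \<ge> 0" "\<And>z. z \<in> S \<Longrightarrow> norm (f z) \<le> C"
proof -
  have "compact (f ` closure S)"
    using assms by (intro compact_continuous_image) (auto intro: continuous_on_subset)
  then have "bounded (f ` closure S)" by (rule compact_imp_bounded)
  then obtain C where "\<forall>w\<in>f ` closure S. norm w \<le> C" unfolding bounded_iff by blast
  then show thesis using that[of "max C 0"] closure_subset[of S] by fastforce
qed

lemma finite_measure_restrict_bounded:
  fixes S :: "'a::euclidean_space set"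
  assumes "bounded S" "S \<in> sets borel"
  shows "finite_measure (restrict_space lborel S)"
proof
  have "emeasure (restrict_space lborel S) (space (restrict_space lborel S)) = emeasure lborel S"
    using assms by (simp add: emeasure_restrict_space space_restrict_space)
  also have "\<dots> < \<infinity>" by (rule emeasure_bounded_finite[OF assms(1)])
  finally show "emeasure (restrict_space lborel S) (space (restrict_space lborel S)) \<noteq> \<infinity>" by simp
qed

lemma integrable_continuous_restrict:
  fixes f :: "'a::euclidean_space \<Rightarrow> 'b::{banach, second_countable_topology}"
  assumes "bounded S" "S \<in> sets borel" "continuous_on UNIV f"
  shows "integrable (restrict_space lborel S) f"
proof -
  obtain C where C: "\<And>z. z \<in> S \<Longrightarrow> norm (f z) \<le> C"
    using continuous_bounded_on_bounded[OF assms(3,1)] by metis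
  show ?thesis
  proof (rule finite_measure.integrable_const_bound[OF finite_measure_restrict_bounded[OF assms(1,2)]])
    show "AE z in restrict_space lborel S. norm (f z) \<le> C"
      using C by (intro AE_I2) (auto simp: space_restrict_space)
    show "f \<in> borel_measurable (restrict_space lborel S)"
      using borel_measurable_continuous_onI[OF assms(3)] by (simp add: measurable_restrict_space1)
  qed
qed

lemma has_derivative_continuous_UNIV:
  assumes "\<And>z. (F has_derivative F' z) (at z)"
  shows "continuous_on UNIV F"
proof -
  have "isCont F z" for z by (rule has_derivative_continuous[OF assms])
  then show ?thesis by (simp add: continuous_on_eq_continuous_at)
qed

text \<open>Difference quotients in the periodic direction have integral 0 by translation
  invariance, and they converge boundedly to the derivative.\<close>

lemma integral_partial_periodic:
  fixes F :: "'a::euclidean_space \<Rightarrow> real"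
  assumes cell: "periodic_cell S b" and bd: "bounded S"
    and F: "\<And>z. (F has_derivative F' z) (at z)" and cont: "continuous_on UNIV (\<lambda>z. F' z b)"
    and per: "\<And>z. F (z + b) = F z"
  shows "(\<integral>z. F' z b \<partial>restrict_space lborel S) = 0"
proof -
  note S = periodic_cell_sets[OF cell]
  have cF: "continuous_on UNIV F" by (rule has_derivative_continuous_UNIV[OF F])
  have ray: "((\<lambda>t. F (z + t *\<^sub>R b)) has_real_derivative F' (z + t *\<^sub>R b) b) (at t)" for z t
  proof -
    have "((\<lambda>t. F (z + t *\<^sub>R b)) has_derivative (\<lambda>h. F' (z + t *\<^sub>R b) (h *\<^sub>R b))) (at t)"
      by (rule has_derivative_compose[OF _ F]) (auto intro!: derivative_eq_intros)
    moreover have "F' (z + t *\<^sub>R b) (h *\<^sub>R b) = F' (z + t *\<^sub>R b) b * h" for h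
      using linear_scale[OF has_derivative_linear[OF F], of "z + t *\<^sub>R b" h b] by simp
    ultimately show ?thesis by (simp add: has_field_derivative_def mult_commute_abs)
  qed
  \<comment> \<open>The mean value theorem evaluates the derivative at points z + t b that may leave
    S. They stay in this compact set, which provides the common bound \<open>C\<close>.\<close>
  define T where "T = (\<lambda>(z, t). z + t *\<^sub>R b) ` (closure S \<times> {0..1::real})"
  have "compact T" unfolding T_def using bd
    by (intro compact_continuous_image compact_Times) (auto intro!: continuous_intros simp: split_beta)
  then obtain C where C: "\<And>z. z \<in> T \<Longrightarrow> norm (F' z b) \<le> C"
    using continuous_bounded_on_bounded[OF cont compact_imp_bounded] by metis
  define q where "q n z = real (Suc n) * (F (z + (1 / real (Suc n)) *\<^sub>R b) - F z)" for n z
  have mF: "F \<in> borel_measurable borel" by (rule borel_measurable_continuous_onI[OF cF])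
  have q0: "(\<integral>z. q n z \<partial>restrict_space lborel S) = 0" for n
  proof -
    have "integrable (restrict_space lborel S) F" "integrable (restrict_space lborel S) (\<lambda>z. F (z + (1 / real (Suc n)) *\<^sub>R b))"
      by (rule integrable_continuous_restrict[OF bd S]; (rule cF)?;
          rule continuous_on_compose2[OF cF]; auto intro!: continuous_intros)+
    then show ?thesis unfolding q_def
      using integral_periodic_shift[OF cell mF _ per, of "1 / real (Suc n)"] by simp
  qed
  have qlim: "(\<lambda>n. q n z) \<longlonglongrightarrow> F' z b" for z
  proof -
    have "((\<lambda>h. (F (z + h *\<^sub>R b) - F z) / h) \<longlongrightarrow> F' z b) (at 0)"
      using ray[of z 0] by (simp add: DERIV_def)
    moreover have "filterlim (\<lambda>n. 1 / real (Suc n)) (at 0) sequentially"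
      unfolding filterlim_at using LIMSEQ_inverse_real_of_nat by (auto simp: inverse_eq_divide)
    ultimately have "(\<lambda>n. (F (z + (1 / real (Suc n)) *\<^sub>R b) - F z) / (1 / real (Suc n))) \<longlonglongrightarrow> F' z b"
      by (rule filterlim_compose)
    then show ?thesis by (simp add: q_def mult.commute)
  qed
  have qb: "norm (q n z) \<le> C" if "z \<in> S" for n z
  proof -
    let ?h = "1 / real (Suc n)"
    obtain t where t: "0 < t" "t < ?h" "F (z + ?h *\<^sub>R b) - F (z + 0 *\<^sub>R b) = (?h - 0) * F' (z + t *\<^sub>R b) b"
      using MVT2[of 0 ?h "\<lambda>t. F (z + t *\<^sub>R b)" "\<lambda>t. F' (z + t *\<^sub>R b) b"] ray by auto
    then have "q n z = F' (z + t *\<^sub>R b) b" by (simp add: q_def)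
    moreover have "z + t *\<^sub>R b \<in> T" unfolding T_def
      using that closure_subset t(1,2) order_trans[of t ?h 1] by (intro image_eqI[of _ _ "(z, t)"]) auto
    ultimately show ?thesis using C by simp
  qed
  have "(\<lambda>n. \<integral>z. q n z \<partial>restrict_space lborel S) \<longlonglongrightarrow> (\<integral>z. F' z b \<partial>restrict_space lborel S)"
  proof (rule integral_dominated_convergence[where w = "\<lambda>_. C"])
    show "integrable (restrict_space lborel S) (\<lambda>_. C)"
      using finite_measure.integrable_const[OF finite_measure_restrict_bounded[OF bd S]] by blast
    show "(\<lambda>z. F' z b) \<in> borel_measurable (restrict_space lborel S)"
      using borel_measurable_continuous_onI[OF cont] by (simp add: measurable_restrict_space1)
    show "q n \<in> borel_measurable (restrict_space lborel S)" for n
    proof -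
      note mF [measurable]
      have "(\<lambda>z. real (Suc n) * (F (z + (1 / real (Suc n)) *\<^sub>R b) - F z)) \<in> borel_measurable borel"
        by measurable
      then show ?thesis unfolding q_def by (intro measurable_restrict_space1) simp
    qed
    show "AE z in restrict_space lborel S. norm (q n z) \<le> C" for n
      using qb by (intro AE_I2) (auto simp: space_restrict_space)
  qed (use qlim in auto)
  then show ?thesis unfolding q0 using LIMSEQ_unique tendsto_const by blast
qed

section \<open>The torus cell and the slab as domains of integration\<close>

definition cell :: "(real^'n) set" where
  "cell = {x. \<forall>i. 0 \<le> x $ i \<and> x $ i < 1}"

lemma torus_eq: "torus = restrict_space lborel cell"
  by (simp add: torus_def cell_def)

lemma slab_eq: "slab ell = restrict_space lborel (cell \<times> {0<..<ell})"
  by (simp add: slab_def cell_def)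

lemma cell_sets [measurable, simp]: "cell \<in> sets borel"
proof -
  have "cell = (\<Inter>i. {x :: real^'n. 0 \<le> x $ i} \<inter> {x. x $ i < 1})" by (auto simp: cell_def)
  also have "\<dots> \<in> sets borel" by (intro sets.finite_INT) auto
  finally show ?thesis .
qed

lemma slab_sets [measurable, simp]: "cell \<times> {0<..<ell::real} \<in> sets (borel :: ((real^'n) \<times> real) measure)"
  unfolding borel_prod[symmetric] by (rule pair_measureI) auto

lemma cell_subset_cbox: "cell \<subseteq> cbox 0 (\<chi> i. 1)"
  by (auto simp: cell_def mem_box_cart less_imp_le)

lemma bounded_cell [simp]: "bounded cell"
  using bounded_cbox bounded_subset cell_subset_cbox by blast

lemma bounded_slab [simp]: "bounded (cell \<times> {0<..<ell::real})"
  by (intro bounded_Times) auto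

lemma finite_measure_torus: "finite_measure torus"
  unfolding torus_eq by (rule finite_measure_restrict_bounded) auto

lemma finite_measure_slab: "finite_measure (slab ell)"
  unfolding slab_eq by (rule finite_measure_restrict_bounded) auto

text \<open>The half-open cell lies between the open and the closed unit cube. Total mass 1 is what
  normalises the characters.\<close>

lemma measure_torus: "measure (torus :: (real^'n) measure) (space torus) = 1"
proof -
  have c: "emeasure lborel (cbox 0 (\<chi> i. 1) :: (real^'n) set) = 1"
    by (subst emeasure_lborel_cbox) (auto simp: Basis_vec_def inner_axis prod.neutral)
  have b: "emeasure lborel (box 0 (\<chi> i. 1) :: (real^'n) set) = 1"
    by (subst emeasure_lborel_box) (auto simp: Basis_vec_def inner_axis prod.neutral)
  have "emeasure lborel (cell :: (real^'n) set) \<le> 1"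
    using emeasure_mono[of "cell :: (real^'n) set" "cbox 0 (\<chi> i. 1)" lborel] cell_subset_cbox c by simp
  moreover have "box 0 (\<chi> i. 1) \<subseteq> (cell :: (real^'n) set)"
    by (auto simp: cell_def mem_box_cart less_imp_le)
  then have "1 \<le> emeasure lborel (cell :: (real^'n) set)"
    using emeasure_mono[of "box 0 (\<chi> i. 1) :: (real^'n) set" cell lborel] b by simp
  ultimately have "emeasure lborel (cell :: (real^'n) set) = 1" by simp
  then show ?thesis
    by (simp add: torus_eq measure_def emeasure_restrict_space space_restrict_space)
qed

lemma periodic_cell_torus: "periodic_cell (cell :: (real^'n) set) (axis i 1)"
  unfolding periodic_cell_def
proof (intro conjI bexI allI)
  let ?S' = "{x :: real^'n. \<forall>j. j \<noteq> i \<longrightarrow> 0 \<le> x $ j \<and> x $ j < 1}"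
  show "axis i 1 \<in> (Basis :: (real^'n) set)" by (simp add: axis_in_Basis_iff)
  show "z + t *\<^sub>R axis i 1 \<in> ?S' \<longleftrightarrow> z \<in> ?S'" for z t by (auto simp: axis_def)
  show "cell = {z \<in> ?S'. 0 \<le> z \<bullet> axis i 1 \<and> z \<bullet> axis i 1 < 1}"
    by (auto simp: cell_def inner_axis)
  have "?S' = (\<Inter>j. if j = i then UNIV else {x :: real^'n. 0 \<le> x $ j} \<inter> {x. x $ j < 1})" by auto
  also have "\<dots> \<in> sets borel"
    by (intro sets.finite_INT) auto
  finally show "?S' \<in> sets borel" .
qed

lemma periodic_cell_slab: "periodic_cell ((cell :: (real^'n) set) \<times> {0<..<ell::real}) (axis i 1, 0)"
proof -
  from periodic_cell_torus[of i] obtain S' where S': "S' \<in> sets borel" "\<And>z t. z + t *\<^sub>R axis i 1 \<in> S' \<longleftrightarrow> z \<in> S'"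
    "cell = {z\<in>S'. 0 \<le> z \<bullet> axis i 1 \<and> z \<bullet> axis i 1 < 1}" unfolding periodic_cell_def by blast
  show ?thesis unfolding periodic_cell_def
  proof (intro conjI bexI allI)
    show "(axis i 1, 0) \<in> (Basis :: ((real^'n) \<times> real) set)"
      by (simp add: Basis_prod_def axis_in_Basis_iff)
    show "S' \<times> {0<..<ell} \<in> sets borel" unfolding borel_prod[symmetric] using S'(1) by (intro pair_measureI) auto
    show "z + t *\<^sub>R (axis i 1, 0) \<in> S' \<times> {0<..<ell} \<longleftrightarrow> z \<in> S' \<times> {0<..<ell}" for z t
      by (cases z) (auto simp: S'(2))
    show "cell \<times> {0<..<ell} = {z \<in> S' \<times> {0<..<ell}. 0 \<le> z \<bullet> (axis i 1, 0) \<and> z \<bullet> (axis i 1, 0) < 1}"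
      unfolding S'(3) by (auto simp: inner_prod_def)
  qed
qed

lemma borel_measurable_slab_continuous: "continuous_on UNIV f \<Longrightarrow> f \<in> borel_measurable (slab ell)"
  unfolding slab_eq using borel_measurable_continuous_onI by (intro measurable_restrict_space1) simp

lemma borel_measurable_torus_continuous: "continuous_on UNIV f \<Longrightarrow> f \<in> borel_measurable torus"
  unfolding torus_eq using borel_measurable_continuous_onI by (intro measurable_restrict_space1) simp

lemma continuous_L2_slab:
  fixes f :: "'n::finite pt \<Rightarrow> 'b::euclidean_space"
  assumes "continuous_on UNIV f" shows "f \<in> L2 (slab ell)"
proof -
  obtain C where "\<And>z. z \<in> cell \<times> {0<..<ell} \<Longrightarrow> norm (f z) \<le> C"
    using continuous_bounded_on_bounded[OF assms bounded_slab] by metis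
  then show ?thesis
    by (intro L2_of_bounded[OF finite_measure_slab borel_measurable_slab_continuous[OF assms]])
       (auto simp: slab_eq space_restrict_space)
qed

lemma continuous_L2_torus:
  fixes f :: "real^'n \<Rightarrow> 'b::euclidean_space"
  assumes "continuous_on UNIV f" shows "f \<in> L2 torus"
proof -
  obtain C where "\<And>z. z \<in> cell \<Longrightarrow> norm (f z) \<le> C"
    using continuous_bounded_on_bounded[OF assms bounded_cell] by metis
  then show ?thesis
    by (intro L2_of_bounded[OF finite_measure_torus borel_measurable_torus_continuous[OF assms]])
       (auto simp: torus_eq space_restrict_space)
qed

lemma integrable_slab_continuous:
  fixes f :: "'n::finite pt \<Rightarrow> real"
  assumes "continuous_on UNIV f" shows "integrable (slab ell) f"
  unfolding slab_eq by (rule integrable_continuous_restrict[OF bounded_slab slab_sets assms])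

lemma integrable_torus_continuous:
  fixes f :: "real^'n \<Rightarrow> real"
  assumes "continuous_on UNIV f" shows "integrable torus f"
  unfolding torus_eq by (rule integrable_continuous_restrict[OF bounded_cell cell_sets assms])

lemma slab_integral_horizontal:
  fixes F :: "'n::finite pt \<Rightarrow> real"
  assumes "\<And>z. (F has_derivative F' z) (at z)" "continuous_on UNIV (\<lambda>z. F' z (axis i 1, 0))"
    and "\<And>x y. F (x + axis i 1, y) = F (x, y)"
  shows "(\<integral>z. F' z (axis i 1, 0) \<partial>slab ell) = 0"
  unfolding slab_eq
proof (rule integral_partial_periodic[OF periodic_cell_slab bounded_slab, of F F'])
  show "F (z + (axis i 1, 0)) = F z" for z using assms(3) by (cases z) simp
qed (rule assms)+

text \<open>Fubini's theorem reduces the claim to the fundamental theorem of calculus on each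
  vertical segment. Together with \<open>slab_integral_horizontal\<close> this is the divergence
  theorem on the slab.\<close>

lemma slab_integral_vertical:
  fixes F :: "'n::finite pt \<Rightarrow> real"
  assumes F: "\<And>z. (F has_derivative F' z) (at z)" and cont: "continuous_on UNIV (\<lambda>z. F' z (0, 1))"
    and ell: "ell > 0"
  shows "(\<integral>z. F' z (0, 1) \<partial>slab ell) = (\<integral>x. F (x, ell) \<partial>torus) - (\<integral>x. F (x, 0) \<partial>torus)"
proof -
  let ?S = "(cell :: (real^'n) set) \<times> {0<..<ell}"
  let ?g = "\<lambda>z. indicator ?S z *\<^sub>R F' z (0, 1)"
  have cF: "continuous_on UNIV F" by (rule has_derivative_continuous_UNIV[OF F])
  have col: "((\<lambda>y. F (x, y)) has_real_derivative F' (x, y) (0, 1)) (at y)" for x y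
  proof -
    have "((\<lambda>y. F (x, y)) has_derivative (\<lambda>h. F' (x, y) (0, h))) (at y)"
      by (rule has_derivative_compose[OF has_derivative_Pair[OF has_derivative_const has_derivative_ident] F])
    moreover have "(\<lambda>h. F' (x, y) (0, h)) = (*) (F' (x, y) (0, 1))"
    proof
      fix h show "F' (x, y) (0, h) = F' (x, y) (0, 1) * h"
        using linear_scale[OF has_derivative_linear[OF F], of "(x, y)" h "(0, 1)"] by simp
    qed
    ultimately show ?thesis by (simp only: has_field_derivative_def)
  qed
  have int: "integrable (lborel \<Otimes>\<^sub>M lborel) ?g"
    using integrable_slab_continuous[OF cont, of ell]
    unfolding slab_eq lborel_prod by (subst (asm) integrable_restrict_space) auto
  have "(\<integral>z. F' z (0, 1) \<partial>slab ell) = integral\<^sup>L (lborel \<Otimes>\<^sub>M lborel) ?g"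
    unfolding slab_eq lborel_prod by (subst integral_restrict_space) auto
  also have "\<dots> = (\<integral>x. (\<integral>y. ?g (x, y) \<partial>lborel) \<partial>lborel)"
    by (rule lborel_pair.integral_fst'[OF int, symmetric])
  also have "\<dots> = (\<integral>x. indicator cell x *\<^sub>R (F (x, ell) - F (x, 0)) \<partial>lborel)"
  proof (intro Bochner_Integration.integral_cong refl)
    fix x :: "real^'n"
    have "(\<integral>y. ?g (x, y) \<partial>lborel) = indicator cell x * (\<integral>y. F' (x, y) (0, 1) * indicator {0..ell} y \<partial>lborel)"
    proof -
      have "(\<integral>y. ?g (x, y) \<partial>lborel) = (\<integral>y. indicator cell x * (F' (x, y) (0, 1) * indicator {0..ell} y) \<partial>lborel)"
      proof (rule integral_cong_AE)
        have c1: "continuous_on UNIV (\<lambda>y. F' (x, y) (0, 1))"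
          by (rule continuous_on_compose2[OF cont]) (auto intro!: continuous_intros)
        then have [measurable]: "(\<lambda>y. F' (x, y) (0, 1)) \<in> borel_measurable borel" by (rule borel_measurable_continuous_onI)
        have eq: "indicator ?S (x, y) = indicator cell x * (indicator {0<..<ell} y :: real)" for y
          by (auto simp: indicator_def)
        show "(\<lambda>y. ?g (x, y)) \<in> borel_measurable lborel" unfolding eq by measurable
        show "(\<lambda>y. indicator cell x * (F' (x, y) (0, 1) * indicator {0..ell} y)) \<in> borel_measurable lborel" by measurable
        \<comment> \<open>The slab is open in y while the fundamental theorem integrates over the
          closed interval; the two end points form a null set.\<close>
        show "AE y in lborel. ?g (x, y) = indicator cell x * (F' (x, y) (0, 1) * indicator {0..ell} y)"
          using AE_lborel_singleton[of 0] AE_lborel_singleton[of ell]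
          by eventually_elim (auto simp: indicator_def)
      qed
      then show ?thesis by simp
    qed
    also have "(\<integral>y. F' (x, y) (0, 1) * indicator {0..ell} y \<partial>lborel) = F (x, ell) - F (x, 0)"
    proof (rule integral_FTC_Icc_real)
      show "isCont (\<lambda>y. F' (x, y) (0, 1)) y" for y
      proof -
        have "continuous_on UNIV (\<lambda>y. F' (x, y) (0, 1))"
          by (rule continuous_on_compose2[OF cont]) (auto intro!: continuous_intros)
        then show ?thesis by (simp add: continuous_on_eq_continuous_at)
      qed
      show "((\<lambda>y. F (x, y)) has_real_derivative F' (x, y) (0, 1)) (at y)" for y by (rule col)
    qed (use ell in simp)
    finally show "(\<integral>y. ?g (x, y) \<partial>lborel) = indicator cell x *\<^sub>R (F (x, ell) - F (x, 0))" by simp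
  qed
  also have "\<dots> = (\<integral>x. F (x, ell) - F (x, 0) \<partial>torus)"
    unfolding torus_eq by (subst integral_restrict_space) auto
  also have "\<dots> = (\<integral>x. F (x, ell) \<partial>torus) - (\<integral>x. F (x, 0) \<partial>torus)"
    by (intro Bochner_Integration.integral_diff integrable_torus_continuous continuous_on_compose2[OF cF])
       (auto intro!: continuous_intros)
  finally show ?thesis .
qed

section \<open>Weak derivatives and traces\<close>

text \<open>The positive and the negative part of g define measures that agree on the open boxes, an
  intersection-stable generator of the Borel sets, hence on all of them; uniqueness of densities
  then makes the two parts coincide.\<close>

lemma integral_zero_on_boxes_imp_AE_zero:
  fixes g :: "'a::euclidean_space \<Rightarrow> real"
  assumes int: "integrable lborel g" and z: "\<And>l u. (\<integral>z. indicator (box l u) z * g z \<partial>lborel) = 0"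
  shows "AE z in lborel. g z = 0"
proof -
  have [measurable]: "g \<in> borel_measurable borel" using int by auto
  define P where "P = density lborel (\<lambda>z. ennreal (g z))"
  define N where "N = density lborel (\<lambda>z. ennreal (- g z))"
  have eqbox: "emeasure P X = emeasure N X" if "X \<in> range (\<lambda>(a, b). box a b :: 'a set)" for X
  proof -
    from that obtain a b where X: "X = box a b" by auto
    have pos: "integrable lborel (\<lambda>z. indicator X z * max 0 (g z))" and neg: "integrable lborel (\<lambda>z. indicator X z * max 0 (- g z))"
      by (rule Bochner_Integration.integrable_bound[OF int]; auto simp: X indicator_def)+
    have "(\<integral>z. indicator X z * max 0 (g z) \<partial>lborel) - (\<integral>z. indicator X z * max 0 (- g z) \<partial>lborel)
      = (\<integral>z. indicator X z * max 0 (g z) - indicator X z * max 0 (- g z) \<partial>lborel)"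
      using pos neg by simp
    also have "\<dots> = (\<integral>z. indicator X z * g z \<partial>lborel)"
      by (intro Bochner_Integration.integral_cong) (auto simp: indicator_def max_def)
    also have "\<dots> = 0" unfolding X by (rule z)
    finally have eq: "(\<integral>z. indicator X z * max 0 (g z) \<partial>lborel) = (\<integral>z. indicator X z * max 0 (- g z) \<partial>lborel)" by simp
    have "emeasure P X = (\<integral>\<^sup>+z. ennreal (indicator X z * max 0 (g z)) \<partial>lborel)"
      unfolding P_def X by (subst emeasure_density) (auto intro!: nn_integral_cong simp: indicator_def max_def ennreal_neg)
    also have "\<dots> = ennreal (\<integral>z. indicator X z * max 0 (g z) \<partial>lborel)"
      by (rule nn_integral_eq_integral[OF pos]) auto
    also have "\<dots> = (\<integral>\<^sup>+z. ennreal (indicator X z * max 0 (- g z)) \<partial>lborel)"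
      unfolding eq by (rule nn_integral_eq_integral[OF neg, symmetric]) auto
    also have "\<dots> = emeasure N X"
      unfolding N_def X by (subst emeasure_density) (auto intro!: nn_integral_cong simp: indicator_def max_def ennreal_neg)
    finally show ?thesis .
  qed
  have "P = N"
  proof (rule measure_eqI_generator_eq)
    let ?E = "range (\<lambda>(a, b). box a b :: 'a set)"
    show "Int_stable ?E"
      by (auto simp: Int_stable_def box_Int_box)
    show "?E \<subseteq> Pow UNIV" by simp
    show "emeasure P X = emeasure N X" if "X \<in> ?E" for X by (rule eqbox[OF that])
    show "sets P = sigma_sets UNIV ?E" "sets N = sigma_sets UNIV ?E"
      by (simp_all add: P_def N_def borel_eq_box)
    let ?A = "\<lambda>n::nat. box (- (real n *\<^sub>R One)) (real n *\<^sub>R One) :: 'a set"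
    show "range ?A \<subseteq> ?E" "(\<Union>i. ?A i) = UNIV"
      unfolding UN_box_eq_UNIV by auto
    show "emeasure P (?A i) \<noteq> \<infinity>" for i
    proof -
      have "emeasure P (?A i) \<le> (\<integral>\<^sup>+z. ennreal (norm (g z)) \<partial>lborel)"
        unfolding P_def by (subst emeasure_density) (auto intro!: nn_integral_mono simp: indicator_def ennreal_leI)
      also have "\<dots> < \<infinity>" using int by (simp add: integrable_iff_bounded)
      finally show ?thesis by simp
    qed
  qed
  then have "AE z in lborel. ennreal (g z) = ennreal (- g z)"
    unfolding P_def N_def by (subst (asm) sigma_finite_measure.density_unique_iff[OF sigma_finite_lborel]) auto
  then show ?thesis
  proof eventually_elim
    case (elim z)
    show ?case
    proof (cases "g z \<ge> 0")
      case True
      then have "ennreal (g z) = 0" using elim by (simp add: ennreal_neg)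
      then show ?thesis using True by simp
    next
      case False
      then have "ennreal (- g z) = 0" using elim[symmetric] by (simp add: ennreal_neg)
      then show ?thesis using False by simp
    qed
  qed
qed

section \<open>Periodic test functions and the fundamental lemma of the calculus of
  variations\<close>

lemma smooth_periodic_const [simp]: "smooth_periodic (\<lambda>_. c)"
  by (simp add: smooth_periodic_def)

lemma smooth_periodic_add: "smooth_periodic f \<Longrightarrow> smooth_periodic g \<Longrightarrow> smooth_periodic (\<lambda>z. f z + g z)"
  by (simp add: smooth_periodic_def C_infinity_add)

lemma smooth_periodic_mult: "smooth_periodic f \<Longrightarrow> smooth_periodic g \<Longrightarrow> smooth_periodic (\<lambda>z. f z * g z)"
  by (simp add: smooth_periodic_def C_infinity_mult)

lemma smooth_periodic_sum: "(\<And>i. i \<in> I \<Longrightarrow> smooth_periodic (f i)) \<Longrightarrow> smooth_periodic (\<lambda>z. \<Sum>i\<in>I. f i z)"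
  by (simp add: smooth_periodic_def C_infinity_sum)

lemma smooth_periodic_prod: "(\<And>i. i \<in> I \<Longrightarrow> smooth_periodic (f i)) \<Longrightarrow> smooth_periodic (\<lambda>z. \<Prod>i\<in>I. f i z)"
  by (simp add: smooth_periodic_def C_infinity_prod)

lemma C_infinity_real_ident: "C_infinity (\<lambda>t::real. t)"
  using C_infinity_inner[of "1::real"] by simp

lemma C_infinity_affine: "C_infinity (\<lambda>t::real. c * t + d)"
  by (intro C_infinity_add C_infinity_mult C_infinity_const C_infinity_real_ident)

lemma C_infinity_coord: "C_infinity (\<lambda>z::'n::finite pt. fst z $ i)"
proof -
  have "(\<lambda>z::'n pt. fst z $ i) = (\<lambda>z. z \<bullet> (axis i 1, 0))" by (simp add: inner_prod_def inner_axis)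
  then show ?thesis using C_infinity_inner by metis
qed

lemma C_infinity_snd: "C_infinity (\<lambda>z::'n::finite pt. snd z)"
proof -
  have "(\<lambda>z::'n pt. snd z) = (\<lambda>z. z \<bullet> (0, 1))" by (simp add: inner_prod_def)
  then show ?thesis using C_infinity_inner by metis
qed

lemma smooth_periodic_snd: "C_infinity F \<Longrightarrow> smooth_periodic (\<lambda>z. F (snd z))"
  by (simp add: smooth_periodic_def C_infinity_compose[OF _ C_infinity_snd])

lemma smooth_periodic_coord:
  assumes "C_infinity F" "\<And>t. F (t + 1) = F t"
  shows "smooth_periodic (\<lambda>z. F (fst z $ i))"
  using assms(2) by (auto simp: smooth_periodic_def axis_def C_infinity_compose[OF assms(1) C_infinity_coord])

text \<open>This is sin (pi (t - a)) sin (pi (b - t)). Each factor changes sign under t -> t + 1, so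
  the product is smooth and 1-periodic; for 0 \<le> a < b \<le> 1 it is positive within [0, 1)
  exactly on (a, b).\<close>

definition arc_weight :: "real \<Rightarrow> real \<Rightarrow> real \<Rightarrow> real" where
  "arc_weight a b t = sin (pi * t + - pi * a) * sin (- pi * t + pi * b)"

lemma C_infinity_arc_weight: "C_infinity (arc_weight a b)"
  unfolding arc_weight_def
  by (intro C_infinity_mult C_infinity_compose[OF C_infinity_sin C_infinity_affine])

lemma arc_weight_periodic: "arc_weight a b (t + 1) = arc_weight a b t"
proof -
  have "sin (pi * (t + 1) + - pi * a) = - sin (pi * t + - pi * a)"
    using sin_periodic_pi[of "pi * t + - pi * a"] by (simp add: algebra_simps)
  moreover have "sin (- pi * (t + 1) + pi * b) = - sin (- pi * t + pi * b)"
    using sin_periodic_pi[of "- pi * (t + 1) + pi * b"] by (simp add: algebra_simps)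
  ultimately show ?thesis by (simp add: arc_weight_def)
qed

lemma arc_weight_sign:
  assumes "0 \<le> a" "a < b" "b \<le> 1" "0 \<le> t" "t < 1"
  shows "0 < arc_weight a b t \<longleftrightarrow> a < t \<and> t < b"
proof -
  have p: "0 < sin (pi * s)" if "0 < s" "s < 1" for s using that by (intro sin_gt_zero) auto
  have n: "sin (pi * s) \<le> 0" if "- 1 \<le> s" "s \<le> 0" for s
    using sin_ge_zero[of "- (pi * s)"] that mult_left_mono[of "- s" 1 pi] by (auto simp: mult_nonneg_nonpos)
  have nn: "0 \<le> sin (pi * s)" if "0 \<le> s" "s \<le> 1" for s using that by (intro sin_ge_zero) auto
  have eq: "arc_weight a b t = sin (pi * (t - a)) * sin (pi * (b - t))" by (simp add: arc_weight_def algebra_simps)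
  consider "a < t" "t < b" | "t \<le> a" | "b \<le> t" by linarith
  then show ?thesis
  proof cases
    case 1
    then have "arc_weight a b t > 0" unfolding eq using assms by (intro mult_pos_pos p) auto
    with 1 show ?thesis by simp
  next
    case 2
    then have "arc_weight a b t \<le> 0" unfolding eq using assms by (intro mult_nonpos_nonneg n nn) auto
    with 2 show ?thesis by simp
  next
    case 3
    then have "arc_weight a b t \<le> 0" unfolding eq using assms by (intro mult_nonneg_nonpos n nn) auto
    with 3 show ?thesis by simp
  qed
qed

lemma ball_pt_Basis: "(\<forall>b\<in>(Basis :: 'n::finite pt set). P b) \<longleftrightarrow> (\<forall>i. P (axis i 1, 0)) \<and> P (0, 1)"
  by (auto simp: Basis_prod_def Basis_vec_def)

text \<open>Inside the slab the indicators of boxes are almost everywhere bounded limits of test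
  functions, so the integrals of g over boxes vanish. Cut-offs in x have to be periodic, which is
  why a step function is composed with a large multiple of \<open>arc_weight\<close>.\<close>

lemma test_functions_fundamental:
  fixes g :: "'n::finite pt \<Rightarrow> real"
  assumes int: "integrable (slab ell) g" and z: "\<And>\<phi>. \<phi> \<in> test_functions ell \<Longrightarrow> (\<integral>z. g z * \<phi> z \<partial>slab ell) = 0"
  shows "AE z in slab ell. g z = 0"
proof -
  let ?S = "(cell :: (real^'n) set) \<times> {0<..<ell}"
  obtain R :: "real \<Rightarrow> real" where R: "C_infinity R" "\<And>x. x \<le> 0 \<Longrightarrow> R x = 0" "\<And>x. 1 \<le> x \<Longrightarrow> R x = 1"
    "\<And>x. 0 \<le> R x \<and> R x \<le> 1" using smooth_step_exists by blast
  have intS: "integrable lborel (\<lambda>z. indicator ?S z * g z)"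
    using int unfolding slab_eq by (subst (asm) integrable_restrict_space) auto
  have box0: "(\<integral>z. indicator (box l u) z * (indicator ?S z * g z) \<partial>lborel) = 0" for l u :: "'n pt"
  proof -
    \<comment> \<open>The box is clamped to the closure of the slab. Inside the slab this changes it
      only on the faces where a coordinate of x is 0, which belong to the half-open cell.\<close>
    define a where "a i = max (fst l $ i) 0" for i
    define b where "b i = min (fst u $ i) 1" for i
    define c where "c = max (snd l) 0"
    define d where "d = min (snd u) ell"
    define I where "I z \<longleftrightarrow> (\<forall>i. a i < fst z $ i \<and> fst z $ i < b i) \<and> c < snd z \<and> snd z < d" for z
    have AE0: "AE z in lborel. \<forall>i. fst (z :: 'n pt) $ i \<noteq> 0"
    proof -
      have "AE z in lborel. (z :: 'n pt) \<bullet> (axis i 1, 0) \<noteq> 0" for i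
        by (rule AE_lborel_inner_neq) (simp add: Basis_prod_def axis_in_Basis_iff)
      then have "AE z in lborel. fst (z :: 'n pt) $ i \<noteq> 0" for i by (simp add: inner_prod_def inner_axis)
      then show ?thesis unfolding AE_all_countable by blast
    qed
    have box_iff: "z \<in> box l u \<longleftrightarrow> (\<forall>i. fst l $ i < fst z $ i \<and> fst z $ i < fst u $ i) \<and> snd l < snd z \<and> snd z < snd u" for z
      by (auto simp: mem_box ball_pt_Basis inner_prod_def inner_axis)
    have Ibox: "AE z in lborel. indicator (box l u) z * (indicator ?S z * g z) = indicator {z. I z} z * (indicator ?S z * g z)"
      using AE0
    proof eventually_elim
      case (elim z)
      show ?case
      proof (cases "z \<in> ?S")
        case True
        then have "0 < fst z $ i" "fst z $ i < 1" for i
          using elim by (auto simp: cell_def mem_Times_iff less_le)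
        then have "z \<in> box l u \<longleftrightarrow> I z"
          using True by (auto simp: box_iff I_def a_def b_def c_def d_def mem_Times_iff)
        then show ?thesis by (simp add: indicator_def)
      qed simp
    qed
    have mI: "{z. I z} \<in> sets borel"
    proof -
      have "{z. I z} = (\<Inter>i. {z. a i < fst z $ i} \<inter> {z. fst z $ i < b i}) \<inter> ({z. c < snd z} \<inter> {z. snd z < d})"
        by (auto simp: I_def)
      also have "open \<dots>"
        by (intro open_Int open_INT ballI open_Collect_less continuous_intros finite_class.finite_UNIV
            continuous_on_component continuous_on_fst continuous_on_id)
      finally show ?thesis by (rule borel_open)
    qed
    have m: "(\<lambda>z. indicator ?S z * g z) \<in> borel_measurable lborel" using intS by auto
    have mb: "box l u \<in> sets borel" by simp
    have "(\<integral>z. indicator (box l u) z * (indicator ?S z * g z) \<partial>lborel) = (\<integral>z. indicator {z. I z} z * (indicator ?S z * g z) \<partial>lborel)"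
      by (intro integral_cong_AE borel_measurable_times[OF _ m] borel_measurable_indicator Ibox)
        (use mI mb in auto)
    also have "\<dots> = 0"
    proof (cases "\<forall>i. a i < b i")
      case False
      then obtain i where "b i \<le> a i" by (auto simp: not_less)
      then have "\<not> I z" for z unfolding I_def by (meson less_trans not_le)
      then show ?thesis by simp
    next
      case ab: True
      \<comment> \<open>As k grows, R (k w) tends to 1 where w > 0 and is 0 elsewhere. The
        additional margin 1 / (k + 1) in the vertical factors keeps the support in a compact part of
        (0, ell), as a test function requires.\<close>
      define \<phi> where "\<phi> k z = (\<Prod>i\<in>UNIV. R (real k * arc_weight (a i) (b i) (fst z $ i))) *
         (R (real k * snd z + (- real k * (c + 1 / real (Suc k)))) * R (- real k * snd z + (real k * (d - 1 / real (Suc k)))))" for k z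
      have \<phi>sm: "smooth_periodic (\<phi> k)" for k unfolding \<phi>_def
        by (intro smooth_periodic_mult smooth_periodic_prod smooth_periodic_coord smooth_periodic_snd
            C_infinity_compose[OF R(1)] C_infinity_affine C_infinity_mult C_infinity_const C_infinity_arc_weight)
           (simp add: arc_weight_periodic)
      have \<phi>0: "\<phi> k (x, y) = 0" if "y \<notin> {c + 1 / real (Suc k)..d - 1 / real (Suc k)}" for k x y
      proof -
        have "y \<le> c + 1 / real (Suc k) \<or> d - 1 / real (Suc k) \<le> y" using that by auto
        then have "real k * y + (- real k * (c + 1 / real (Suc k))) \<le> 0 \<or> - real k * y + (real k * (d - 1 / real (Suc k))) \<le> 0"
          using mult_left_mono[of y "c + 1 / real (Suc k)" "real k"] mult_left_mono[of "d - 1 / real (Suc k)" y "real k"] by auto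
        then show ?thesis using R(2) by (auto simp: \<phi>_def)
      qed
      have "\<phi> k \<in> test_functions ell" for k
      proof -
        have "0 < 1 / real (Suc k)" "0 \<le> c" "d \<le> ell" by (simp_all add: c_def d_def)
        then have "0 < c + 1 / real (Suc k)" "d - 1 / real (Suc k) < ell" by linarith+
        with \<phi>sm \<phi>0 show ?thesis unfolding test_functions_def by blast
      qed
      then have \<phi>z: "(\<integral>z. g z * \<phi> k z \<partial>slab ell) = 0" for k by (rule z)
      have \<phi>b: "\<bar>\<phi> k z\<bar> \<le> 1" for k z
      proof -
        have "0 \<le> (\<Prod>i\<in>UNIV. R (real k * arc_weight (a i) (b i) (fst z $ i)))" "(\<Prod>i\<in>UNIV. R (real k * arc_weight (a i) (b i) (fst z $ i))) \<le> 1"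
          using R(4) by (auto intro!: prod_nonneg prod_le_1)
        then show ?thesis unfolding \<phi>_def abs_mult using R(4) by (intro mult_le_one) (auto intro!: mult_le_one)
      qed
      have step: "(\<lambda>k. R (real k * t)) \<longlonglongrightarrow> (if t > 0 then 1 else 0)" for t
      proof (cases "t > 0")
        case True
        have "\<forall>\<^sub>F k in sequentially. 1 \<le> real k * t"
          using eventually_ge_at_top[of "nat \<lceil>1 / t\<rceil>"]
        proof eventually_elim
          case (elim k)
          then have "1 / t \<le> real k" by linarith
          then show ?case using True by (simp add: field_simps)
        qed
        then have "\<forall>\<^sub>F k in sequentially. R (real k * t) = 1" by eventually_elim (rule R(3))
        then show ?thesis using True by (simp add: tendsto_eventually)
      next
        case False
        then have "R (real k * t) = 0" for k by (intro R(2)) (simp add: mult_nonneg_nonpos)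
        then show ?thesis using False by simp
      qed
      have step2: "(\<lambda>k. R (real k * (t - 1 / real (Suc k)))) \<longlonglongrightarrow> (if t > 0 then 1 else 0)" for t
      proof (cases "t > 0")
        case True
        have "\<forall>\<^sub>F k in sequentially. 1 \<le> real k * (t - 1 / real (Suc k))"
          using eventually_ge_at_top[of "nat \<lceil>2 / t\<rceil>"]
        proof eventually_elim
          case (elim k)
          then have "2 / t \<le> real k" by linarith
          then have "2 \<le> real k * t" using True by (simp add: field_simps)
          moreover have "real k * (1 / real (Suc k)) \<le> 1" by simp
          ultimately show ?case unfolding right_diff_distrib by linarith
        qed
        then have "\<forall>\<^sub>F k in sequentially. R (real k * (t - 1 / real (Suc k))) = 1" by eventually_elim (rule R(3))
        then show ?thesis using True by (simp add: tendsto_eventually)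
      next
        case False
        have "R (real k * (t - 1 / real (Suc k))) = 0" for k
        proof (intro R(2) mult_nonneg_nonpos)
          have "0 < 1 / real (Suc k)" by simp
          then show "t - 1 / real (Suc k) \<le> 0" using False by linarith
        qed simp
        then show ?thesis using False by simp
      qed
      have lim: "(\<lambda>k. \<phi> k z) \<longlonglongrightarrow> indicator {z. I z} z" if "z \<in> ?S" for z
      proof -
        have 1: "real k * snd z + (- real k * (c + 1 / real (Suc k))) = real k * ((snd z - c) - 1 / real (Suc k))"
          "- real k * snd z + (real k * (d - 1 / real (Suc k))) = real k * ((d - snd z) - 1 / real (Suc k))" for k
          by (simp_all add: algebra_simps)
        have "(\<lambda>k. \<phi> k z) \<longlonglongrightarrow> (\<Prod>i\<in>UNIV. if arc_weight (a i) (b i) (fst z $ i) > 0 then 1 else 0) *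
          ((if snd z - c > 0 then 1 else 0) * (if d - snd z > 0 then 1 else 0))"
          unfolding \<phi>_def 1 by (intro tendsto_mult tendsto_prod step step2)
        also have "(\<Prod>i\<in>UNIV. if arc_weight (a i) (b i) (fst z $ i) > 0 then 1 else (0::real)) =
           (if \<forall>i. a i < fst z $ i \<and> fst z $ i < b i then 1 else 0)"
        proof -
          have "0 < arc_weight (a i) (b i) (fst z $ i) \<longleftrightarrow> a i < fst z $ i \<and> fst z $ i < b i" for i
            using that ab by (intro arc_weight_sign) (auto simp: a_def b_def cell_def mem_Times_iff)
          then show ?thesis by (auto simp: prod_zero_iff intro!: prod.neutral)
        qed
        also have "(if \<forall>i. a i < fst z $ i \<and> fst z $ i < b i then 1 else 0) *
          ((if snd z - c > 0 then 1 else 0) * (if d - snd z > 0 then 1 else (0::real))) = indicator {z. I z} z"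
          by (simp add: indicator_def I_def)
        finally show ?thesis .
      qed
      have "(\<lambda>k. \<integral>z. g z * \<phi> k z \<partial>slab ell) \<longlonglongrightarrow> (\<integral>z. g z * indicator {z. I z} z \<partial>slab ell)"
      proof (rule integral_dominated_convergence[where w = "\<lambda>z. norm (g z)"])
        have [measurable]: "{z. I z} \<in> sets borel" by (rule mI)
        have "indicator {z. I z} \<in> borel_measurable (slab ell)"
          unfolding slab_eq by (intro measurable_restrict_space1) simp
        then show "(\<lambda>z. g z * indicator {z. I z} z) \<in> borel_measurable (slab ell)"
          using int by (intro borel_measurable_times) auto
        show "(\<lambda>z. g z * \<phi> k z) \<in> borel_measurable (slab ell)" for k
        proof (rule borel_measurable_times)
          show "g \<in> borel_measurable (slab ell)" using int by auto
          show "\<phi> k \<in> borel_measurable (slab ell)"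
            using \<phi>sm[of k] unfolding smooth_periodic_def
            by (intro borel_measurable_slab_continuous C_infinity_continuous) simp
        qed
        show "integrable (slab ell) (\<lambda>z. norm (g z))" using int by simp
        show "AE z in slab ell. (\<lambda>k. g z * \<phi> k z) \<longlonglongrightarrow> g z * indicator {z. I z} z"
          using lim by (intro AE_I2 tendsto_mult_left) (auto simp: slab_eq space_restrict_space)
        show "AE z in slab ell. norm (g z * \<phi> k z) \<le> norm (g z)" for k
          using \<phi>b[of k] by (intro AE_I2) (simp add: abs_mult mult_left_le)
      qed
      then have "(\<integral>z. g z * indicator {z. I z} z \<partial>slab ell) = 0"
        unfolding \<phi>z using LIMSEQ_unique tendsto_const by blast
      moreover have "(\<integral>z. g z * indicator {z. I z} z \<partial>slab ell) = (\<integral>z. indicator {z. I z} z * (indicator ?S z * g z) \<partial>lborel)"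
        unfolding slab_eq by (subst integral_restrict_space) (auto simp: mult_ac)
      ultimately show ?thesis by simp
    qed
    finally show ?thesis .
  qed
  have "AE z in lborel. indicator ?S z * g z = 0"
    by (rule integral_zero_on_boxes_imp_AE_zero[OF intS box0])
  then have "AE z in lborel. z \<in> ?S \<longrightarrow> g z = 0" by eventually_elim (auto simp: indicator_def)
  then show ?thesis unfolding slab_eq by (subst AE_restrict_space_iff) auto
qed

section \<open>Classical and weak partial derivatives\<close>

definition pd :: "'n::finite pt \<Rightarrow> ('n pt \<Rightarrow> real) \<Rightarrow> 'n pt \<Rightarrow> real" where
  "pd b \<phi> = (\<lambda>z. frechet_derivative \<phi> (at z) b)"

lemma smooth_periodic_C_infinity: "smooth_periodic \<phi> \<Longrightarrow> C_infinity \<phi>"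
  by (simp add: smooth_periodic_def)

lemma smooth_periodic_has_derivative: "smooth_periodic \<phi> \<Longrightarrow> (\<phi> has_derivative frechet_derivative \<phi> (at z)) (at z)"
  by (rule C_infinity_has_derivative(1)[OF smooth_periodic_C_infinity])

lemma continuous_pd: "smooth_periodic \<phi> \<Longrightarrow> b \<in> Basis \<Longrightarrow> continuous_on UNIV (pd b \<phi>)"
  unfolding pd_def by (rule C_infinity_has_derivative(2)[OF smooth_periodic_C_infinity])

lemma continuous_smooth_periodic: "smooth_periodic \<phi> \<Longrightarrow> continuous_on UNIV \<phi>"
  by (rule C_infinity_continuous[OF smooth_periodic_C_infinity])

lemma pd_eqI: "(\<phi> has_derivative D) (at z) \<Longrightarrow> pd b \<phi> z = D b"
  unfolding pd_def by (simp add: frechet_derivative_at[symmetric])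

lemma pd_mult:
  assumes "smooth_periodic f" "smooth_periodic g"
  shows "pd b (\<lambda>z. f z * g z) z = f z * pd b g z + pd b f z * g z"
  using pd_eqI[OF has_derivative_mult[OF smooth_periodic_has_derivative[OF assms(1)] smooth_periodic_has_derivative[OF assms(2)]], of b z]
  by (simp add: pd_def)

lemma pd_add:
  assumes "smooth_periodic f" "smooth_periodic g"
  shows "pd b (\<lambda>z. f z + g z) z = pd b f z + pd b g z"
  using pd_eqI[OF has_derivative_add[OF smooth_periodic_has_derivative[OF assms(1)] smooth_periodic_has_derivative[OF assms(2)]], of b z]
  by (simp add: pd_def)

lemma pd_const: "pd b (\<lambda>_. c) z = 0"
  using pd_eqI[OF has_derivative_const, of b c z] by simp

lemma pd_snd: "pd b snd z = snd b"
  using pd_eqI[OF has_derivative_snd[OF has_derivative_ident], of b z] by simp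

lemma smooth_periodic_snd_id: "smooth_periodic snd"
  using smooth_periodic_snd[OF C_infinity_real_ident] by simp

lemma L2_smooth_periodic: "smooth_periodic \<phi> \<Longrightarrow> \<phi> \<in> L2 (slab ell)"
  by (intro continuous_L2_slab continuous_smooth_periodic)

lemma L2_pd: "smooth_periodic \<phi> \<Longrightarrow> b \<in> Basis \<Longrightarrow> pd b \<phi> \<in> L2 (slab ell)"
  by (intro continuous_L2_slab continuous_pd)

lemma test_function_smooth: "\<phi> \<in> test_functions ell \<Longrightarrow> smooth_periodic \<phi>"
  by (simp add: test_functions_def)

lemma slab_pd_horizontal:
  fixes F :: "'n::finite pt \<Rightarrow> real"
  assumes "smooth_periodic F"
  shows "(\<integral>z. pd (axis i 1, 0) F z \<partial>slab ell) = 0"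
  unfolding pd_def
proof (rule slab_integral_horizontal[OF smooth_periodic_has_derivative[OF assms]])
  have "(axis i 1, 0) \<in> (Basis :: 'n pt set)" using ball_pt_Basis[of "\<lambda>b. b \<in> Basis"] by blast
  from continuous_pd[OF assms this]
  show "continuous_on UNIV (\<lambda>z. frechet_derivative F (at z) (axis i 1, 0))" by (simp add: pd_def)
  show "F (x + axis i 1, y) = F (x, y)" for x y using assms by (simp add: smooth_periodic_def)
qed

lemma slab_pd_vertical:
  fixes F :: "'n::finite pt \<Rightarrow> real"
  assumes "smooth_periodic F" "ell > 0"
  shows "(\<integral>z. pd (0, 1) F z \<partial>slab ell) = (\<integral>x. F (x, ell) \<partial>torus) - (\<integral>x. F (x, 0) \<partial>torus)"
  unfolding pd_def
proof (rule slab_integral_vertical[OF smooth_periodic_has_derivative[OF assms(1)] _ assms(2)])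
  have "(0, 1) \<in> (Basis :: 'n pt set)" using ball_pt_Basis[of "\<lambda>b. b \<in> Basis"] by blast
  from continuous_pd[OF assms(1) this]
  show "continuous_on UNIV (\<lambda>z. frechet_derivative F (at z) (0, 1))" by (simp add: pd_def)
qed

text \<open>Here integration by parts loses its boundary terms: periodicity removes the lateral ones
  and the vanishing of \<phi> at 0 and \<open>ell\<close> the vertical ones, so F may be arbitrary
  at the top and the bottom.\<close>

lemma slab_pd_compact_support:
  fixes \<phi> :: "'n::finite pt \<Rightarrow> real"
  assumes "smooth_periodic F" "\<phi> \<in> test_functions ell" "b \<in> Basis"
  shows "(\<integral>z. pd b (\<lambda>z. F z * \<phi> z) z \<partial>slab ell) = 0"
proof (cases "ell > 0")
  case False
  then have "space (slab ell :: 'n pt measure) = {}" by (auto simp: slab_eq space_restrict_space)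
  then show ?thesis by (simp add: Bochner_Integration.integral_empty)
next
  case True
  have sm: "smooth_periodic (\<lambda>z. F z * \<phi> z)"
    using assms test_function_smooth by (intro smooth_periodic_mult) auto
  have "\<forall>b\<in>Basis. (\<integral>z. pd b (\<lambda>z. F z * \<phi> z) z \<partial>slab ell) = 0"
    unfolding ball_pt_Basis
  proof (intro conjI allI)
    show "(\<integral>z. pd (axis i 1, 0) (\<lambda>z. F z * \<phi> z) z \<partial>slab ell) = 0" for i by (rule slab_pd_horizontal[OF sm])
    obtain a b where "0 < a" "b < ell" "\<And>x y. y \<notin> {a..b} \<Longrightarrow> \<phi> (x, y) = 0"
      using assms(2) unfolding test_functions_def by blast
    then have "\<phi> (x, 0) = 0" "\<phi> (x, ell) = 0" for x by auto
    then show "(\<integral>z. pd (0, 1) (\<lambda>z. F z * \<phi> z) z \<partial>slab ell) = 0"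
      by (simp add: slab_pd_vertical[OF sm True])
  qed
  then show ?thesis using assms(3) by blast
qed

lemma has_weak_partial_smooth:
  assumes "smooth_periodic F" "b \<in> Basis"
  shows "has_weak_partial ell b F (pd b F)"
  unfolding has_weak_partial_def
proof
  fix \<phi> :: "'a pt \<Rightarrow> real" assume \<phi>: "\<phi> \<in> test_functions ell"
  note s = test_function_smooth[OF \<phi>]
  have i: "integrable (slab ell) (\<lambda>z. F z * pd b \<phi> z)" "integrable (slab ell) (\<lambda>z. pd b F z * \<phi> z)"
    using integrable_L2_inner[OF L2_smooth_periodic[OF assms(1)] L2_pd[OF s assms(2)]]
      integrable_L2_inner[OF L2_pd[OF assms] L2_smooth_periodic[OF s]] by simp_all
  have "(\<integral>z. F z * pd b \<phi> z \<partial>slab ell) + (\<integral>z. pd b F z * \<phi> z \<partial>slab ell) = (\<integral>z. pd b (\<lambda>z. F z * \<phi> z) z \<partial>slab ell)"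
    using i by (simp add: pd_mult[OF assms(1) s])
  also have "\<dots> = 0" by (rule slab_pd_compact_support[OF assms(1) \<phi> assms(2)])
  finally show "(\<integral>z. F z * frechet_derivative \<phi> (at z) b \<partial>slab ell) = - (\<integral>z. pd b F z * \<phi> z \<partial>slab ell)"
    by (simp add: pd_def)
qed

lemma has_weak_partial_unique:
  assumes "has_weak_partial ell b f g" "has_weak_partial ell b f g'" "g \<in> L2 (slab ell)" "g' \<in> L2 (slab ell)"
  shows "AE z in slab ell. g z = g' z"
proof -
  have "AE z in slab ell. g z - g' z = 0"
  proof (rule test_functions_fundamental)
    show "integrable (slab ell) (\<lambda>z. g z - g' z)"
      using assms(3,4) by (intro L2_integrable[OF finite_measure_slab] L2_diff)
    fix \<phi> :: "'a pt \<Rightarrow> real" assume \<phi>: "\<phi> \<in> test_functions ell"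
    have "integrable (slab ell) (\<lambda>z. g z * \<phi> z)" "integrable (slab ell) (\<lambda>z. g' z * \<phi> z)"
      using integrable_L2_inner[OF assms(3) L2_smooth_periodic[OF test_function_smooth[OF \<phi>]]]
        integrable_L2_inner[OF assms(4) L2_smooth_periodic[OF test_function_smooth[OF \<phi>]]] by simp_all
    moreover have "(\<integral>z. g z * \<phi> z \<partial>slab ell) = (\<integral>z. g' z * \<phi> z \<partial>slab ell)"
      using assms(1,2) \<phi> unfolding has_weak_partial_def by fastforce
    ultimately show "(\<integral>z. (g z - g' z) * \<phi> z \<partial>slab ell) = 0" by (simp add: left_diff_distrib)
  qed
  then show ?thesis by simp
qed

lemma weak_partial:
  assumes "f \<in> H1 ell" "b \<in> Basis"
  shows "weak_partial ell b f \<in> L2 (slab ell)" "has_weak_partial ell b f (weak_partial ell b f)"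
proof -
  have "\<exists>g. g \<in> L2 (slab ell) \<and> has_weak_partial ell b f g" using assms by (auto simp: H1_def)
  from someI_ex[OF this] show "weak_partial ell b f \<in> L2 (slab ell)" "has_weak_partial ell b f (weak_partial ell b f)"
    by (auto simp: weak_partial_def)
qed

lemma weak_partial_eq:
  assumes "f \<in> H1 ell" "b \<in> Basis" "g \<in> L2 (slab ell)" "has_weak_partial ell b f g"
  shows "AE z in slab ell. weak_partial ell b f z = g z"
  by (rule has_weak_partial_unique[OF weak_partial(2)[OF assms(1,2)] assms(4) weak_partial(1)[OF assms(1,2)] assms(3)])

lemma H1_L2: "f \<in> H1 ell \<Longrightarrow> f \<in> L2 (slab ell)"
  by (simp add: H1_def)

lemma has_weak_partial_add:
  assumes "has_weak_partial ell b f f'" "has_weak_partial ell b g g'" "b \<in> Basis"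
    and "f \<in> L2 (slab ell)" "g \<in> L2 (slab ell)" "f' \<in> L2 (slab ell)" "g' \<in> L2 (slab ell)"
  shows "has_weak_partial ell b (\<lambda>z. f z + g z) (\<lambda>z. f' z + g' z)"
  unfolding has_weak_partial_def
proof
  fix \<phi> :: "'a pt \<Rightarrow> real" assume \<phi>: "\<phi> \<in> test_functions ell"
  note s = L2_smooth_periodic[OF test_function_smooth[OF \<phi>], of ell] L2_pd[OF test_function_smooth[OF \<phi>] assms(3), of ell, unfolded pd_def]
  note i = integrable_L2_inner[OF assms(4) s(2)] integrable_L2_inner[OF assms(5) s(2)]
    integrable_L2_inner[OF assms(6) s(1)] integrable_L2_inner[OF assms(7) s(1)]
  show "(\<integral>z. (f z + g z) * frechet_derivative \<phi> (at z) b \<partial>slab ell) = - (\<integral>z. (f' z + g' z) * \<phi> z \<partial>slab ell)"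
    using assms(1,2) \<phi> i unfolding has_weak_partial_def by (simp add: distrib_right)
qed

lemma has_weak_partial_cmult:
  assumes "has_weak_partial ell b f f'"
  shows "has_weak_partial ell b (\<lambda>z. c * f z) (\<lambda>z. c * f' z)"
  using assms unfolding has_weak_partial_def by (simp add: mult.assoc)

lemma H1_add:
  assumes "f \<in> H1 ell" "g \<in> H1 ell"
  shows "(\<lambda>z. f z + g z) \<in> H1 ell"
  unfolding H1_def
proof (intro CollectI conjI ballI)
  show "(\<lambda>z. f z + g z) \<in> L2 (slab ell)" by (intro L2_add H1_L2 assms)
  fix b :: "'a pt" assume b: "b \<in> Basis"
  show "\<exists>k\<in>L2 (slab ell). has_weak_partial ell b (\<lambda>z. f z + g z) k"
    by (rule bexI[where x = "\<lambda>z. weak_partial ell b f z + weak_partial ell b g z"])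
      (intro has_weak_partial_add L2_add H1_L2 assms weak_partial b)+
qed

lemma H1_cmult:
  assumes "f \<in> H1 ell"
  shows "(\<lambda>z. c * f z) \<in> H1 ell"
  unfolding H1_def
proof (intro CollectI conjI ballI)
  show "(\<lambda>z. c * f z) \<in> L2 (slab ell)" by (intro L2_cmult H1_L2 assms)
  fix b :: "'a pt" assume b: "b \<in> Basis"
  show "\<exists>k\<in>L2 (slab ell). has_weak_partial ell b (\<lambda>z. c * f z) k"
    by (rule bexI[where x = "\<lambda>z. c * weak_partial ell b f z"])
      (intro has_weak_partial_cmult L2_cmult weak_partial assms b)+
qed

lemma H1_diff: "f \<in> H1 ell \<Longrightarrow> g \<in> H1 ell \<Longrightarrow> (\<lambda>z. f z - g z) \<in> H1 ell"
  using H1_add[OF _ H1_cmult[of g ell "-1"], of f] by simp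

lemma H1_smooth: "smooth_periodic \<phi> \<Longrightarrow> \<phi> \<in> H1 ell"
  unfolding H1_def
proof (intro CollectI conjI ballI)
  assume s: "smooth_periodic \<phi>"
  then show "\<phi> \<in> L2 (slab ell)" by (rule L2_smooth_periodic)
  fix b :: "'a pt" assume b: "b \<in> Basis"
  show "\<exists>g\<in>L2 (slab ell). has_weak_partial ell b \<phi> g"
    by (rule bexI[where x = "pd b \<phi>"]) (rule has_weak_partial_smooth[OF s b], rule L2_pd[OF s b])
qed

lemma weak_partial_add:
  assumes "f \<in> H1 ell" "g \<in> H1 ell" "b \<in> Basis"
  shows "AE z in slab ell. weak_partial ell b (\<lambda>z. f z + g z) z = weak_partial ell b f z + weak_partial ell b g z"
  by (intro weak_partial_eq H1_add L2_add has_weak_partial_add weak_partial H1_L2 assms)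

lemma weak_partial_cmult:
  assumes "f \<in> H1 ell" "b \<in> Basis"
  shows "AE z in slab ell. weak_partial ell b (\<lambda>z. c * f z) z = c * weak_partial ell b f z"
  by (intro weak_partial_eq H1_cmult L2_cmult has_weak_partial_cmult weak_partial assms)

lemma weak_partial_diff:
  assumes "f \<in> H1 ell" "g \<in> H1 ell" "b \<in> Basis"
  shows "AE z in slab ell. weak_partial ell b (\<lambda>z. f z - g z) z = weak_partial ell b f z - weak_partial ell b g z"
  using weak_partial_add[OF assms(1) H1_cmult[OF assms(2), of "-1"] assms(3)] weak_partial_cmult[OF assms(2,3), of "-1"]
  by eventually_elim simp

lemma weak_partial_smooth:
  assumes "smooth_periodic \<phi>" "b \<in> Basis"
  shows "AE z in slab ell. weak_partial ell b \<phi> z = pd b \<phi> z"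
  using assms by (intro weak_partial_eq H1_smooth L2_pd has_weak_partial_smooth)

section \<open>Traces through smooth approximation\<close>

lemma H1_norm_tendsto_iff:
  assumes "\<And>k. f k \<in> H1 ell" "f' \<in> H1 ell"
  shows "((\<lambda>k. H1_norm ell (\<lambda>z. f k z - f' z)) \<longlonglongrightarrow> 0) \<longleftrightarrow>
    (\<lambda>k. L2_norm (slab ell) (\<lambda>z. f k z - f' z)) \<longlonglongrightarrow> 0 \<and>
    (\<forall>b\<in>Basis. (\<lambda>k. L2_norm (slab ell) (\<lambda>z. weak_partial ell b (f k) z - weak_partial ell b f' z)) \<longlonglongrightarrow> 0)"
    (is "?L \<longleftrightarrow> ?R1 \<and> ?R2")
proof -
  have eq: "L2_norm (slab ell) (weak_partial ell b (\<lambda>z. f k z - f' z)) =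
      L2_norm (slab ell) (\<lambda>z. weak_partial ell b (f k) z - weak_partial ell b f' z)" if "b \<in> Basis" for b k
    by (intro L2_norm_cong_AE weak_partial_diff L2_measurable L2_diff H1_diff weak_partial(1) assms that)
  have H: "H1_norm ell (\<lambda>z. f k z - f' z) = sqrt ((L2_norm (slab ell) (\<lambda>z. f k z - f' z))\<^sup>2 +
     (\<Sum>b\<in>Basis. (L2_norm (slab ell) (\<lambda>z. weak_partial ell b (f k) z - weak_partial ell b f' z))\<^sup>2))" for k
    unfolding H1_norm_def by (simp add: eq)
  show ?thesis
  proof (intro iffI conjI ballI)
    assume L: ?L
    show ?R1
    proof (rule Lim_null_comparison[OF _ L], intro always_eventually allI)
      show "norm (L2_norm (slab ell) (\<lambda>z. f k z - f' z)) \<le> H1_norm ell (\<lambda>z. f k z - f' z)" for k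
        unfolding H by (auto intro!: real_le_rsqrt sum_nonneg)
    qed
    fix b :: "'a pt" assume b: "b \<in> Basis"
    show "(\<lambda>k. L2_norm (slab ell) (\<lambda>z. weak_partial ell b (f k) z - weak_partial ell b f' z)) \<longlonglongrightarrow> 0"
    proof (rule Lim_null_comparison[OF _ L], intro always_eventually allI)
      fix k
      let ?g = "\<lambda>b. (L2_norm (slab ell) (\<lambda>z. weak_partial ell b (f k) z - weak_partial ell b f' z))\<^sup>2"
      have "?g b \<le> sum ?g Basis" using b by (intro member_le_sum) auto
      also have "\<dots> \<le> (L2_norm (slab ell) (\<lambda>z. f k z - f' z))\<^sup>2 + sum ?g Basis" by simp
      finally show "norm (L2_norm (slab ell) (\<lambda>z. weak_partial ell b (f k) z - weak_partial ell b f' z)) \<le> H1_norm ell (\<lambda>z. f k z - f' z)"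
        unfolding H by (simp add: real_le_rsqrt)
    qed
  next
    assume R: "?R1 \<and> ?R2"
    have "(\<lambda>k. sqrt ((L2_norm (slab ell) (\<lambda>z. f k z - f' z))\<^sup>2 +
     (\<Sum>b\<in>Basis. (L2_norm (slab ell) (\<lambda>z. weak_partial ell b (f k) z - weak_partial ell b f' z))\<^sup>2)))
       \<longlonglongrightarrow> sqrt (0\<^sup>2 + (\<Sum>b\<in>(Basis :: 'a pt set). 0\<^sup>2))"
      using R by (intro tendsto_intros) auto
    then show ?L unfolding H by simp
  qed
qed

text \<open>The working form of the trace. The weak derivatives of the approximants are choices
  fixed only up to null sets and are replaced here by classical ones, so that identities proved by
  calculus can be carried to the limit term by term.\<close>

lemma has_trace_approx:
  assumes "has_trace ell a f q"
  obtains \<phi> where "\<And>k::nat. smooth_periodic (\<phi> k)"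
    "(\<lambda>k. L2_norm (slab ell) (\<lambda>z. \<phi> k z - f z)) \<longlonglongrightarrow> 0"
    "\<And>b. b \<in> Basis \<Longrightarrow> (\<lambda>k. L2_norm (slab ell) (\<lambda>z. pd b (\<phi> k) z - weak_partial ell b f z)) \<longlonglongrightarrow> 0"
    "(\<lambda>k. L2_norm torus (\<lambda>x. \<phi> k (x, a) - q x)) \<longlonglongrightarrow> 0"
proof -
  from assms obtain \<phi> where \<phi>: "\<And>k::nat. smooth_periodic (\<phi> k)"
    "(\<lambda>k. H1_norm ell (\<lambda>z. \<phi> k z - f z)) \<longlonglongrightarrow> 0" "(\<lambda>k. L2_norm torus (\<lambda>x. \<phi> k (x, a) - q x)) \<longlonglongrightarrow> 0"
    and f: "f \<in> H1 ell"
    unfolding has_trace_def by blast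
  have *: "(\<lambda>k. L2_norm (slab ell) (\<lambda>z. \<phi> k z - f z)) \<longlonglongrightarrow> 0"
    "\<forall>b\<in>Basis. (\<lambda>k. L2_norm (slab ell) (\<lambda>z. weak_partial ell b (\<phi> k) z - weak_partial ell b f z)) \<longlonglongrightarrow> 0"
    using \<phi>(2) H1_norm_tendsto_iff[OF H1_smooth[OF \<phi>(1)] f] by auto
  have eq: "L2_norm (slab ell) (\<lambda>z. weak_partial ell b (\<phi> k) z - weak_partial ell b f z) =
    L2_norm (slab ell) (\<lambda>z. pd b (\<phi> k) z - weak_partial ell b f z)" if "b \<in> Basis" for b k
  proof (rule L2_norm_cong_AE)
    show "AE z in slab ell. weak_partial ell b (\<phi> k) z - weak_partial ell b f z = pd b (\<phi> k) z - weak_partial ell b f z"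
      using weak_partial_smooth[OF \<phi>(1)[of k] that, of ell] by eventually_elim simp
    note w = weak_partial(1)[OF f that] weak_partial(1)[OF H1_smooth[OF \<phi>(1)[of k]] that, of ell] L2_pd[OF \<phi>(1)[of k] that, of ell]
    show "(\<lambda>z. weak_partial ell b (\<phi> k) z - weak_partial ell b f z) \<in> borel_measurable (slab ell)"
      "(\<lambda>z. pd b (\<phi> k) z - weak_partial ell b f z) \<in> borel_measurable (slab ell)"
      by (intro L2_measurable L2_diff w)+
  qed
  show thesis
    by (rule that[OF \<phi>(1) *(1) _ \<phi>(3)]) (use *(2) eq in auto)
qed

lemma has_traceI:
  assumes f: "f \<in> H1 ell" and q: "q \<in> L2 torus" and \<phi>: "\<And>k::nat. smooth_periodic (\<phi> k)"
    "(\<lambda>k. L2_norm (slab ell) (\<lambda>z. \<phi> k z - f z)) \<longlonglongrightarrow> 0"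
    "\<And>b. b \<in> Basis \<Longrightarrow> (\<lambda>k. L2_norm (slab ell) (\<lambda>z. pd b (\<phi> k) z - weak_partial ell b f z)) \<longlonglongrightarrow> 0"
    "(\<lambda>k. L2_norm torus (\<lambda>x. \<phi> k (x, a) - q x)) \<longlonglongrightarrow> 0"
  shows "has_trace ell a f q"
proof -
  have eq: "L2_norm (slab ell) (\<lambda>z. weak_partial ell b (\<phi> k) z - weak_partial ell b f z) =
    L2_norm (slab ell) (\<lambda>z. pd b (\<phi> k) z - weak_partial ell b f z)" if "b \<in> Basis" for b k
  proof (rule L2_norm_cong_AE)
    show "AE z in slab ell. weak_partial ell b (\<phi> k) z - weak_partial ell b f z = pd b (\<phi> k) z - weak_partial ell b f z"
      using weak_partial_smooth[OF \<phi>(1)[of k] that, of ell] by eventually_elim simp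
    note w = weak_partial(1)[OF f that] weak_partial(1)[OF H1_smooth[OF \<phi>(1)[of k]] that, of ell] L2_pd[OF \<phi>(1)[of k] that, of ell]
    show "(\<lambda>z. weak_partial ell b (\<phi> k) z - weak_partial ell b f z) \<in> borel_measurable (slab ell)"
      "(\<lambda>z. pd b (\<phi> k) z - weak_partial ell b f z) \<in> borel_measurable (slab ell)"
      by (intro L2_measurable L2_diff w)+
  qed
  have "(\<lambda>k. H1_norm ell (\<lambda>z. \<phi> k z - f z)) \<longlonglongrightarrow> 0"
    using \<phi>(2,3) H1_norm_tendsto_iff[OF H1_smooth[OF \<phi>(1)] f] by (simp add: eq)
  then show ?thesis unfolding has_trace_def using f q \<phi>(1,4) by blast
qed

lemma continuous_slice: "continuous_on UNIV f \<Longrightarrow> continuous_on UNIV (\<lambda>x. f (x, a))"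
  by (rule continuous_on_compose2[of UNIV f]) (auto intro!: continuous_intros)

lemma L2_slice: "smooth_periodic \<phi> \<Longrightarrow> (\<lambda>x. \<phi> (x, a)) \<in> L2 torus"
  by (intro continuous_L2_torus continuous_slice continuous_smooth_periodic)

lemma has_trace_smooth:
  fixes \<phi> :: "'n::finite pt \<Rightarrow> real"
  assumes "smooth_periodic \<phi>"
  shows "has_trace ell a \<phi> (\<lambda>x. \<phi> (x, a))"
proof (rule has_traceI[where \<phi> = "\<lambda>_. \<phi>"])
  fix b :: "'n pt" assume b: "b \<in> Basis"
  have "L2_norm (slab ell) (\<lambda>z. pd b \<phi> z - weak_partial ell b \<phi> z) = L2_norm (slab ell) (\<lambda>_ :: 'n pt. 0 :: real)"
  proof (rule L2_norm_cong_AE)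
    show "AE z in slab ell. pd b \<phi> z - weak_partial ell b \<phi> z = 0"
      using weak_partial_smooth[OF assms b, of ell] by eventually_elim simp
    show "(\<lambda>z. pd b \<phi> z - weak_partial ell b \<phi> z) \<in> borel_measurable (slab ell)"
      by (intro L2_measurable L2_diff L2_pd weak_partial(1) H1_smooth assms b)
  qed simp
  then show "(\<lambda>k. L2_norm (slab ell) (\<lambda>z. pd b \<phi> z - weak_partial ell b \<phi> z)) \<longlonglongrightarrow> 0" by simp
qed (simp_all add: assms H1_smooth L2_slice)

lemma L2_norm_add_tendsto_zero:
  assumes "\<And>k. f k \<in> L2 M" "f' \<in> L2 M" "\<And>k. g k \<in> L2 M" "g' \<in> L2 M"
    and "(\<lambda>k. L2_norm M (\<lambda>x. f k x - f' x)) \<longlonglongrightarrow> 0" "(\<lambda>k. L2_norm M (\<lambda>x. g k x - g' x)) \<longlonglongrightarrow> 0"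
    and "\<And>k x. x \<in> space M \<Longrightarrow> s k x - s' x = (f k x - f' x) + (g k x - g' x)"
  shows "(\<lambda>k. L2_norm M (\<lambda>x. s k x - s' x)) \<longlonglongrightarrow> 0"
proof (rule Lim_null_comparison)
  show "(\<lambda>k. L2_norm M (\<lambda>x. f k x - f' x) + L2_norm M (\<lambda>x. g k x - g' x)) \<longlonglongrightarrow> 0"
    by (rule tendsto_add_zero) (rule assms)+
  have "L2_norm M (\<lambda>x. s k x - s' x) = L2_norm M (\<lambda>x. (f k x - f' x) + (g k x - g' x))" for k
    unfolding L2_norm_def L2_inner_def using assms(7)
    by (intro arg_cong[where f = sqrt] Bochner_Integration.integral_cong) auto
  then show "\<forall>\<^sub>F k in sequentially. norm (L2_norm M (\<lambda>x. s k x - s' x))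
      \<le> L2_norm M (\<lambda>x. f k x - f' x) + L2_norm M (\<lambda>x. g k x - g' x)"
    using L2_norm_triangle[OF L2_diff[OF assms(1,2)] L2_diff[OF assms(3,4)]] by simp
qed

lemma has_trace_add:
  assumes "has_trace ell a f p" "has_trace ell a g q"
  shows "has_trace ell a (\<lambda>z. f z + g z) (\<lambda>x. p x + q x)"
proof -
  from assms have m: "f \<in> H1 ell" "g \<in> H1 ell" "p \<in> L2 torus" "q \<in> L2 torus" by (auto simp: has_trace_def)
  from assms(1) obtain \<phi> where \<phi>: "\<And>k::nat. smooth_periodic (\<phi> k)"
    "(\<lambda>k. L2_norm (slab ell) (\<lambda>z. \<phi> k z - f z)) \<longlonglongrightarrow> 0"
    "\<And>b. b \<in> Basis \<Longrightarrow> (\<lambda>k. L2_norm (slab ell) (\<lambda>z. pd b (\<phi> k) z - weak_partial ell b f z)) \<longlonglongrightarrow> 0"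
    "(\<lambda>k. L2_norm torus (\<lambda>x. \<phi> k (x, a) - p x)) \<longlonglongrightarrow> 0" by (rule has_trace_approx) blast
  from assms(2) obtain \<psi> where \<psi>: "\<And>k::nat. smooth_periodic (\<psi> k)"
    "(\<lambda>k. L2_norm (slab ell) (\<lambda>z. \<psi> k z - g z)) \<longlonglongrightarrow> 0"
    "\<And>b. b \<in> Basis \<Longrightarrow> (\<lambda>k. L2_norm (slab ell) (\<lambda>z. pd b (\<psi> k) z - weak_partial ell b g z)) \<longlonglongrightarrow> 0"
    "(\<lambda>k. L2_norm torus (\<lambda>x. \<psi> k (x, a) - q x)) \<longlonglongrightarrow> 0" by (rule has_trace_approx) blast
  show ?thesis
  proof (rule has_traceI[where \<phi> = "\<lambda>k z. \<phi> k z + \<psi> k z"])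
    show "(\<lambda>k. L2_norm (slab ell) (\<lambda>z. \<phi> k z + \<psi> k z - (f z + g z))) \<longlonglongrightarrow> 0"
      by (rule L2_norm_add_tendsto_zero[OF L2_smooth_periodic[OF \<phi>(1)] H1_L2[OF m(1)] L2_smooth_periodic[OF \<psi>(1)] H1_L2[OF m(2)] \<phi>(2) \<psi>(2)]) simp
    show "(\<lambda>k. L2_norm torus (\<lambda>x. \<phi> k (x, a) + \<psi> k (x, a) - (p x + q x))) \<longlonglongrightarrow> 0"
      by (rule L2_norm_add_tendsto_zero[OF L2_slice[OF \<phi>(1)] m(3) L2_slice[OF \<psi>(1)] m(4) \<phi>(4) \<psi>(4)]) simp
    fix b :: "'a pt" assume b: "b \<in> Basis"
    have "(\<lambda>k. L2_norm (slab ell) (\<lambda>z. (pd b (\<phi> k) z + pd b (\<psi> k) z) - (weak_partial ell b f z + weak_partial ell b g z))) \<longlonglongrightarrow> 0"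
      by (rule L2_norm_add_tendsto_zero[OF L2_pd[OF \<phi>(1) b] weak_partial(1)[OF m(1) b] L2_pd[OF \<psi>(1) b] weak_partial(1)[OF m(2) b] \<phi>(3)[OF b] \<psi>(3)[OF b]]) simp
    moreover have "L2_norm (slab ell) (\<lambda>z. (pd b (\<phi> k) z + pd b (\<psi> k) z) - (weak_partial ell b f z + weak_partial ell b g z)) =
        L2_norm (slab ell) (\<lambda>z. pd b (\<lambda>z. \<phi> k z + \<psi> k z) z - weak_partial ell b (\<lambda>z. f z + g z) z)" for k
    proof (rule L2_norm_cong_AE)
      show "AE z in slab ell. (pd b (\<phi> k) z + pd b (\<psi> k) z) - (weak_partial ell b f z + weak_partial ell b g z)
          = pd b (\<lambda>z. \<phi> k z + \<psi> k z) z - weak_partial ell b (\<lambda>z. f z + g z) z"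
        using weak_partial_add[OF m(1,2) b] by eventually_elim (simp add: pd_add[OF \<phi>(1) \<psi>(1)])
      show "(\<lambda>z. (pd b (\<phi> k) z + pd b (\<psi> k) z) - (weak_partial ell b f z + weak_partial ell b g z)) \<in> borel_measurable (slab ell)"
        by (intro L2_measurable L2_diff L2_add L2_pd weak_partial(1) \<phi>(1) \<psi>(1) b m)
      show "(\<lambda>z. pd b (\<lambda>z. \<phi> k z + \<psi> k z) z - weak_partial ell b (\<lambda>z. f z + g z) z) \<in> borel_measurable (slab ell)"
        by (intro L2_measurable L2_diff L2_pd weak_partial(1) H1_add smooth_periodic_add \<phi>(1) \<psi>(1) b m)
    qed
    ultimately show "(\<lambda>k. L2_norm (slab ell) (\<lambda>z. pd b (\<lambda>z. \<phi> k z + \<psi> k z) z - weak_partial ell b (\<lambda>z. f z + g z) z)) \<longlonglongrightarrow> 0"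
      by simp
  qed (use m \<phi>(1) \<psi>(1) in \<open>auto intro: H1_add L2_add smooth_periodic_add\<close>)
qed

lemma pd_cmult:
  assumes "smooth_periodic f"
  shows "pd b (\<lambda>z. c * f z) z = c * pd b f z"
  using pd_mult[OF smooth_periodic_const assms, of b c z] by (simp add: pd_const)

lemma has_trace_cmult:
  assumes "has_trace ell a f p"
  shows "has_trace ell a (\<lambda>z. c * f z) (\<lambda>x. c * p x)"
proof -
  from assms have m: "f \<in> H1 ell" "p \<in> L2 torus" by (auto simp: has_trace_def)
  from assms(1) obtain \<phi> where \<phi>: "\<And>k::nat. smooth_periodic (\<phi> k)"
    "(\<lambda>k. L2_norm (slab ell) (\<lambda>z. \<phi> k z - f z)) \<longlonglongrightarrow> 0"
    "\<And>b. b \<in> Basis \<Longrightarrow> (\<lambda>k. L2_norm (slab ell) (\<lambda>z. pd b (\<phi> k) z - weak_partial ell b f z)) \<longlonglongrightarrow> 0"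
    "(\<lambda>k. L2_norm torus (\<lambda>x. \<phi> k (x, a) - p x)) \<longlonglongrightarrow> 0" by (rule has_trace_approx) blast
  have sc: "L2_norm M (\<lambda>x. c * u x - c * v x) = \<bar>c\<bar> * L2_norm M (\<lambda>x. u x - v x)" for M :: "'x measure" and u v :: "'x \<Rightarrow> real"
    using L2_norm_cmult[of M c "\<lambda>x. u x - v x"] by (simp add: right_diff_distrib)
  show ?thesis
  proof (rule has_traceI[where \<phi> = "\<lambda>k z. c * \<phi> k z"])
    show "(\<lambda>k. L2_norm (slab ell) (\<lambda>z. c * \<phi> k z - c * f z)) \<longlonglongrightarrow> 0"
      unfolding sc by (intro tendsto_mult_right_zero \<phi>)
    show "(\<lambda>k. L2_norm torus (\<lambda>x. c * \<phi> k (x, a) - c * p x)) \<longlonglongrightarrow> 0"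
      unfolding sc by (intro tendsto_mult_right_zero \<phi>)
    fix b :: "'a pt" assume b: "b \<in> Basis"
    have "(\<lambda>k. L2_norm (slab ell) (\<lambda>z. c * pd b (\<phi> k) z - c * weak_partial ell b f z)) \<longlonglongrightarrow> 0"
      unfolding sc by (intro tendsto_mult_right_zero \<phi> b)
    moreover have "L2_norm (slab ell) (\<lambda>z. c * pd b (\<phi> k) z - c * weak_partial ell b f z) =
        L2_norm (slab ell) (\<lambda>z. pd b (\<lambda>z. c * \<phi> k z) z - weak_partial ell b (\<lambda>z. c * f z) z)" for k
    proof (rule L2_norm_cong_AE)
      show "AE z in slab ell. c * pd b (\<phi> k) z - c * weak_partial ell b f z
          = pd b (\<lambda>z. c * \<phi> k z) z - weak_partial ell b (\<lambda>z. c * f z) z"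
        using weak_partial_cmult[OF m(1) b, of c] by eventually_elim (simp add: pd_cmult[OF \<phi>(1)])
      show "(\<lambda>z. c * pd b (\<phi> k) z - c * weak_partial ell b f z) \<in> borel_measurable (slab ell)"
        by (intro L2_measurable L2_diff L2_cmult L2_pd weak_partial(1) \<phi>(1) b m)
      show "(\<lambda>z. pd b (\<lambda>z. c * \<phi> k z) z - weak_partial ell b (\<lambda>z. c * f z) z) \<in> borel_measurable (slab ell)"
        by (intro L2_measurable L2_diff L2_pd weak_partial(1) H1_cmult smooth_periodic_mult smooth_periodic_const \<phi>(1) b m)
    qed
    ultimately show "(\<lambda>k. L2_norm (slab ell) (\<lambda>z. pd b (\<lambda>z. c * \<phi> k z) z - weak_partial ell b (\<lambda>z. c * f z) z)) \<longlonglongrightarrow> 0"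
      by simp
  qed (use m \<phi>(1) in \<open>auto intro: H1_cmult L2_cmult smooth_periodic_mult\<close>)
qed

lemma has_trace_diff:
  assumes "has_trace ell a f p" "has_trace ell a g q"
  shows "has_trace ell a (\<lambda>z. f z - g z) (\<lambda>x. p x - q x)"
  using has_trace_add[OF assms(1) has_trace_cmult[OF assms(2), of "-1"]] by simp

section \<open>Poincare and trace identities\<close>

lemma L2_norm_bounded_mult:
  fixes f w :: "'a \<Rightarrow> real"
  assumes "f \<in> L2 M" "w \<in> borel_measurable M" "\<And>x. x \<in> space M \<Longrightarrow> \<bar>w x\<bar> \<le> B"
  shows "L2_norm M (\<lambda>x. w x * f x) \<le> B * L2_norm M f"
proof (cases "space M = {}")
  \<comment> \<open>On the empty space B may be negative, but both norms vanish.\<close>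
  case True
  then show ?thesis by (simp add: L2_norm_def L2_inner_def Bochner_Integration.integral_empty)
next
  case False
  then have B: "0 \<le> B" using assms(3) by (metis abs_ge_zero all_not_in_conv order_trans)
  show ?thesis
  proof (rule power2_le_imp_le)
    have "(L2_norm M (\<lambda>x. w x * f x))\<^sup>2 = (\<integral>x. (norm (w x * f x))\<^sup>2 \<partial>M)" by (rule L2_norm_sq_integral)
    also have "\<dots> \<le> (\<integral>x. B\<^sup>2 * (norm (f x))\<^sup>2 \<partial>M)"
    proof (rule integral_mono)
      show "integrable M (\<lambda>x. (norm (w x * f x))\<^sup>2)"
        using L2_bounded_mult[OF assms] by (rule L2_integrable_sq)
      show "integrable M (\<lambda>x. B\<^sup>2 * (norm (f x))\<^sup>2)" using L2_integrable_sq[OF assms(1)] by simp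
      show "(norm (w x * f x))\<^sup>2 \<le> B\<^sup>2 * (norm (f x))\<^sup>2" if "x \<in> space M" for x
        using power_mono[OF assms(3)[OF that], of 2] by (simp add: power_mult_distrib mult_right_mono)
    qed
    also have "\<dots> = (B * L2_norm M f)\<^sup>2" by (simp add: power_mult_distrib L2_norm_sq_integral)
    finally show "(L2_norm M (\<lambda>x. w x * f x))\<^sup>2 \<le> (B * L2_norm M f)\<^sup>2" .
  qed (simp add: B)
qed

text \<open>Affine weights select boundary terms: \<open>yweight ell (-1)\<close> is ell - y and
  vanishes at the top, \<open>yweight 0 1\<close> is y and vanishes at the bottom. Being independent
  of x, they commute with horizontal derivatives.\<close>

definition yweight :: "real \<Rightarrow> real \<Rightarrow> 'n::finite pt \<Rightarrow> real" where
  "yweight \<alpha> \<beta> z = \<alpha> + \<beta> * snd z"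

lemma smooth_yweight: "smooth_periodic (yweight \<alpha> \<beta>)"
  unfolding yweight_def by (intro smooth_periodic_add smooth_periodic_mult smooth_periodic_const smooth_periodic_snd_id)

lemma pd_yweight: "pd b (yweight \<alpha> \<beta>) z = \<beta> * snd b"
  unfolding yweight_def
  by (simp add: pd_add[OF smooth_periodic_const smooth_periodic_mult[OF smooth_periodic_const smooth_periodic_snd_id]]
      pd_mult[OF smooth_periodic_const smooth_periodic_snd_id] pd_const pd_snd)

lemma yweight_measurable: "yweight \<alpha> \<beta> \<in> borel_measurable (slab ell)"
  by (intro borel_measurable_slab_continuous continuous_smooth_periodic smooth_yweight)

lemma yweight_bound: "z \<in> space (slab ell) \<Longrightarrow> \<bar>yweight \<alpha> \<beta> z\<bar> \<le> \<bar>\<alpha>\<bar> + \<bar>\<beta>\<bar> * ell"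
proof -
  assume "z \<in> space (slab ell)"
  then have "\<bar>snd z\<bar> \<le> ell" by (auto simp: slab_eq space_restrict_space)
  then have "\<bar>\<beta> * snd z\<bar> \<le> \<bar>\<beta>\<bar> * ell" by (simp add: abs_mult mult_left_mono)
  then show ?thesis unfolding yweight_def by linarith
qed

lemma L2_yweight: "f \<in> L2 (slab ell) \<Longrightarrow> (\<lambda>z. yweight \<alpha> \<beta> z * f z) \<in> L2 (slab ell)"
  by (rule L2_bounded_mult[OF _ yweight_measurable yweight_bound])

lemma pt_Basis: "(axis i 1, 0) \<in> (Basis :: 'n::finite pt set)" "(0, 1) \<in> (Basis :: 'n::finite pt set)"
  using ball_pt_Basis[of "\<lambda>b. b \<in> Basis"] by blast+

lemma pd_weighted_square:
  assumes "smooth_periodic \<phi>" "b \<in> Basis"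
  shows "(\<integral>z. pd b (\<lambda>z. yweight \<alpha> \<beta> z * (\<phi> z * \<phi> z)) z \<partial>slab ell)
    = \<beta> * snd b * L2_inner (slab ell) \<phi> \<phi> + 2 * L2_inner (slab ell) (\<lambda>z. yweight \<alpha> \<beta> z * \<phi> z) (pd b \<phi>)"
proof -
  note s2 = smooth_periodic_mult[OF assms(1) assms(1)]
  have "pd b (\<lambda>z. yweight \<alpha> \<beta> z * (\<phi> z * \<phi> z)) z = \<beta> * snd b * (\<phi> z \<bullet> \<phi> z) + 2 * ((yweight \<alpha> \<beta> z * \<phi> z) \<bullet> pd b \<phi> z)" for z
    unfolding pd_mult[OF smooth_yweight s2] pd_mult[OF assms(1) assms(1)] pd_yweight by (simp add: algebra_simps)
  moreover have "integrable (slab ell) (\<lambda>z. \<phi> z \<bullet> \<phi> z)" "integrable (slab ell) (\<lambda>z. (yweight \<alpha> \<beta> z * \<phi> z) \<bullet> pd b \<phi> z)"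
    by (intro integrable_L2_inner L2_smooth_periodic L2_yweight L2_pd assms)+
  ultimately show ?thesis unfolding L2_inner_def by simp
qed

lemma smooth_vertical_identity:
  assumes "smooth_periodic \<phi>" "ell > 0"
  shows "\<beta> * L2_inner (slab ell) \<phi> \<phi> + 2 * L2_inner (slab ell) (\<lambda>z. yweight \<alpha> \<beta> z * \<phi> z) (pd (0, 1) \<phi>)
    = (\<alpha> + \<beta> * ell) * L2_inner torus (\<lambda>x. \<phi> (x, ell)) (\<lambda>x. \<phi> (x, ell)) - \<alpha> * L2_inner torus (\<lambda>x. \<phi> (x, 0)) (\<lambda>x. \<phi> (x, 0))"
proof -
  have "smooth_periodic (\<lambda>z. yweight \<alpha> \<beta> z * (\<phi> z * \<phi> z))"
    by (intro smooth_periodic_mult smooth_yweight assms)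
  from slab_pd_vertical[OF this assms(2)] show ?thesis
    using pd_weighted_square[OF assms(1) pt_Basis(2), where \<alpha> = \<alpha> and \<beta> = \<beta> and ell = ell]
    by (simp add: L2_inner_def yweight_def)
qed

lemma smooth_horizontal_identity:
  assumes "smooth_periodic \<phi>"
  shows "L2_inner (slab ell) (\<lambda>z. yweight \<alpha> \<beta> z * \<phi> z) (pd (axis i 1, 0) \<phi>) = 0"
proof -
  have "smooth_periodic (\<lambda>z. yweight \<alpha> \<beta> z * (\<phi> z * \<phi> z))"
    by (intro smooth_periodic_mult smooth_yweight assms)
  from slab_pd_horizontal[OF this, where i = i and ell = ell] show ?thesis
    using pd_weighted_square[OF assms(1) pt_Basis(1)[of i], where \<alpha> = \<alpha> and \<beta> = \<beta> and ell = ell] by simp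
qed

lemma L2_norm_yweight_tendsto:
  assumes "\<And>k. \<phi> k \<in> L2 (slab ell)" "f \<in> L2 (slab ell)" "(\<lambda>k. L2_norm (slab ell) (\<lambda>z. \<phi> k z - f z)) \<longlonglongrightarrow> 0"
  shows "(\<lambda>k. L2_norm (slab ell) (\<lambda>z. yweight \<alpha> \<beta> z * \<phi> k z - yweight \<alpha> \<beta> z * f z)) \<longlonglongrightarrow> 0"
proof (rule Lim_null_comparison)
  show "(\<lambda>k. (\<bar>\<alpha>\<bar> + \<bar>\<beta>\<bar> * ell) * L2_norm (slab ell) (\<lambda>z. \<phi> k z - f z)) \<longlonglongrightarrow> 0"
    by (intro tendsto_mult_right_zero assms)
  show "\<forall>\<^sub>F k in sequentially. norm (L2_norm (slab ell) (\<lambda>z. yweight \<alpha> \<beta> z * \<phi> k z - yweight \<alpha> \<beta> z * f z))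
      \<le> (\<bar>\<alpha>\<bar> + \<bar>\<beta>\<bar> * ell) * L2_norm (slab ell) (\<lambda>z. \<phi> k z - f z)"
    using L2_norm_bounded_mult[OF L2_diff[OF assms(1,2)] yweight_measurable yweight_bound]
    by (simp add: right_diff_distrib)
qed

text \<open>Divergence theorem for w f^2 with w affine in y, first for the smooth approximants and
  then in the limit, since every term is continuous under convergence of the function, its gradient
  and its trace. In the first two identities the weight leaves only the boundary value at the face
  where the trace is given.\<close>

lemma trace_identity:
  assumes tr: "has_trace ell a f q" and ell: "ell > 0"
  shows "a = 0 \<Longrightarrow> L2_inner (slab ell) f f = ell * L2_inner torus q q
      + 2 * L2_inner (slab ell) (\<lambda>z. yweight ell (-1) z * f z) (weak_partial ell (0, 1) f)"
    and "a = ell \<Longrightarrow> ell * L2_inner torus q q = L2_inner (slab ell) f f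
      + 2 * L2_inner (slab ell) (\<lambda>z. yweight 0 1 z * f z) (weak_partial ell (0, 1) f)"
    and "L2_inner (slab ell) (\<lambda>z. yweight \<alpha> \<beta> z * f z) (weak_partial ell (axis i 1, 0) f) = 0"
proof -
  from tr have f: "f \<in> H1 ell" and q: "q \<in> L2 torus" by (auto simp: has_trace_def)
  from tr obtain \<phi> where \<phi>: "\<And>k::nat. smooth_periodic (\<phi> k)"
    "(\<lambda>k. L2_norm (slab ell) (\<lambda>z. \<phi> k z - f z)) \<longlonglongrightarrow> 0"
    "\<And>b. b \<in> Basis \<Longrightarrow> (\<lambda>k. L2_norm (slab ell) (\<lambda>z. pd b (\<phi> k) z - weak_partial ell b f z)) \<longlonglongrightarrow> 0"
    "(\<lambda>k. L2_norm torus (\<lambda>x. \<phi> k (x, a) - q x)) \<longlonglongrightarrow> 0" by (rule has_trace_approx) blast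
  note L = L2_smooth_periodic[OF \<phi>(1)] H1_L2[OF f]
  have sq: "(\<lambda>k. L2_inner (slab ell) (\<phi> k) (\<phi> k)) \<longlonglongrightarrow> L2_inner (slab ell) f f"
    by (rule L2_inner_tendsto[OF L L \<phi>(2) \<phi>(2)])
  have tq: "(\<lambda>k. L2_inner torus (\<lambda>x. \<phi> k (x, a)) (\<lambda>x. \<phi> k (x, a))) \<longlonglongrightarrow> L2_inner torus q q"
    by (rule L2_inner_tendsto[OF L2_slice[OF \<phi>(1)] q L2_slice[OF \<phi>(1)] q \<phi>(4) \<phi>(4)])
  have w: "(\<lambda>k. L2_inner (slab ell) (\<lambda>z. yweight \<alpha> \<beta> z * \<phi> k z) (pd b (\<phi> k)))
      \<longlonglongrightarrow> L2_inner (slab ell) (\<lambda>z. yweight \<alpha> \<beta> z * f z) (weak_partial ell b f)" if "b \<in> Basis" for \<alpha> \<beta> b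
    by (rule L2_inner_tendsto[OF L2_yweight[OF L(1)] L2_yweight[OF L(2)] L2_pd[OF \<phi>(1) that]
        weak_partial(1)[OF f that] L2_norm_yweight_tendsto[OF L \<phi>(2)] \<phi>(3)[OF that]])
  show "L2_inner (slab ell) f f = ell * L2_inner torus q q
      + 2 * L2_inner (slab ell) (\<lambda>z. yweight ell (-1) z * f z) (weak_partial ell (0, 1) f)" if a: "a = 0"
  proof (rule LIMSEQ_unique[OF sq])
    have "L2_inner (slab ell) (\<phi> k) (\<phi> k) = ell * L2_inner torus (\<lambda>x. \<phi> k (x, a)) (\<lambda>x. \<phi> k (x, a))
      + 2 * L2_inner (slab ell) (\<lambda>z. yweight ell (-1) z * \<phi> k z) (pd (0, 1) (\<phi> k))" for k
      using smooth_vertical_identity[OF \<phi>(1) ell, of "-1" k ell] a by simp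
    then show "(\<lambda>k. L2_inner (slab ell) (\<phi> k) (\<phi> k)) \<longlonglongrightarrow> ell * L2_inner torus q q
      + 2 * L2_inner (slab ell) (\<lambda>z. yweight ell (-1) z * f z) (weak_partial ell (0, 1) f)"
      by (simp only:) (intro tendsto_intros tq w pt_Basis)
  qed
  show "ell * L2_inner torus q q = L2_inner (slab ell) f f
      + 2 * L2_inner (slab ell) (\<lambda>z. yweight 0 1 z * f z) (weak_partial ell (0, 1) f)" if a: "a = ell"
  proof (rule LIMSEQ_unique[OF tendsto_mult_left[OF tq]])
    have "ell * L2_inner torus (\<lambda>x. \<phi> k (x, a)) (\<lambda>x. \<phi> k (x, a)) = L2_inner (slab ell) (\<phi> k) (\<phi> k)
      + 2 * L2_inner (slab ell) (\<lambda>z. yweight 0 1 z * \<phi> k z) (pd (0, 1) (\<phi> k))" for k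
      using smooth_vertical_identity[OF \<phi>(1) ell, of 1 k 0] a by simp
    then show "(\<lambda>k. ell * L2_inner torus (\<lambda>x. \<phi> k (x, a)) (\<lambda>x. \<phi> k (x, a))) \<longlonglongrightarrow> L2_inner (slab ell) f f
      + 2 * L2_inner (slab ell) (\<lambda>z. yweight 0 1 z * f z) (weak_partial ell (0, 1) f)"
      by (simp only:) (intro tendsto_intros sq w pt_Basis)
  qed
  show "L2_inner (slab ell) (\<lambda>z. yweight \<alpha> \<beta> z * f z) (weak_partial ell (axis i 1, 0) f) = 0"
    using w[OF pt_Basis(1), of \<alpha> \<beta> i] LIMSEQ_unique[OF _ tendsto_const]
    unfolding smooth_horizontal_identity[OF \<phi>(1)] by blast
qed

text \<open>The weighted horizontal term ((ell - y) f, f_i) vanishes by periodicity, so any multiple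
  of it can be added to the vertical derivative for free. The Poincare inequality thus holds with
  the same constant along every oblique direction e_N + c e_i.\<close>

lemma poincare_directional:
  fixes f :: "'n::finite pt \<Rightarrow> real"
  assumes tr: "has_trace ell 0 f (\<lambda>_. 0)" and ell: "ell > 0"
  shows "L2_norm (slab ell) f \<le> 2 * ell *
    L2_norm (slab ell) (\<lambda>z. weak_partial ell (0, 1) f z + c * weak_partial ell (axis i 1, 0) f z)"
proof -
  from tr have f: "f \<in> H1 ell" by (auto simp: has_trace_def)
  let ?D = "\<lambda>z. weak_partial ell (0, 1) f z + c * weak_partial ell (axis i 1, 0) f z"
  let ?w = "\<lambda>z. yweight ell (-1) z * f z"
  note L = L2_yweight[OF H1_L2[OF f], of ell "-1"] weak_partial(1)[OF f pt_Basis(2)] weak_partial(1)[OF f pt_Basis(1)]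
  have D: "?D \<in> L2 (slab ell)" by (intro L2_add L2_cmult L)
  have "(L2_norm (slab ell) f)\<^sup>2 = 2 * L2_inner (slab ell) ?w ?D"
    unfolding L2_norm_sq L2_inner_add_right[OF L(2) L2_cmult[OF L(3)] L(1)] L2_inner_cmult_right
    using trace_identity(1)[OF tr ell refl] trace_identity(3)[OF tr ell, of ell "-1" i] by (simp add: L2_inner_def[of torus])
  also have "\<dots> \<le> 2 * (L2_norm (slab ell) ?w * L2_norm (slab ell) ?D)"
    using L2_Cauchy_Schwarz[OF L(1) D] by simp
  also have "\<dots> \<le> 2 * (ell * L2_norm (slab ell) f * L2_norm (slab ell) ?D)"
  proof -
    have "\<bar>yweight ell (-1) z\<bar> \<le> ell" if "z \<in> space (slab ell :: 'n pt measure)" for z :: "'n pt"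
      using that by (auto simp: slab_eq space_restrict_space yweight_def)
    from L2_norm_bounded_mult[OF H1_L2[OF f] yweight_measurable this]
    show ?thesis by (intro mult_left_mono mult_right_mono) auto
  qed
  finally have "L2_norm (slab ell) f * L2_norm (slab ell) f \<le> 2 * ell * L2_norm (slab ell) ?D * L2_norm (slab ell) f"
    by (simp add: power2_eq_square mult_ac)
  then show ?thesis
    by (cases "L2_norm (slab ell) f = 0") (use ell in \<open>auto simp: mult_le_cancel_right\<close>, auto simp: less_le L2_norm_nonneg)
qed

text \<open>The identities at the bottom and at the top are added. Their weights ell - y and y sum
  to the constant \<open>ell\<close>, leaving |q|^2 = 2 (f, f_y), to which the Poincare inequality
  is applied.\<close>

lemma trace_top_bound:
  fixes f :: "'n::finite pt \<Rightarrow> real"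
  assumes tr: "has_trace ell 0 f (\<lambda>_. 0)" and tq: "has_trace ell ell f q" and ell: "ell > 0"
  shows "L2_norm torus q \<le> 2 * sqrt ell * L2_norm (slab ell) (weak_partial ell (0, 1) f)"
proof -
  from tr have f: "f \<in> H1 ell" by (auto simp: has_trace_def)
  note L = H1_L2[OF f] weak_partial(1)[OF f pt_Basis(2)]
  let ?fy = "weak_partial ell (0, 1) f"
  have "ell * L2_inner torus q q = 2 * (L2_inner (slab ell) (\<lambda>z. yweight ell (-1) z * f z) ?fy
      + L2_inner (slab ell) (\<lambda>z. yweight 0 1 z * f z) ?fy)"
    using trace_identity(1)[OF tr ell refl] trace_identity(2)[OF tq ell refl] by (simp add: L2_inner_def[of torus "\<lambda>_. 0"])
  also have "\<dots> = 2 * L2_inner (slab ell) (\<lambda>z. yweight ell (-1) z * f z + yweight 0 1 z * f z) ?fy"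
    by (simp add: L2_inner_add_left[OF L2_yweight[OF L(1)] L2_yweight[OF L(1)] L(2)])
  also have "(\<lambda>z. yweight ell (-1) z * f z + yweight 0 1 z * f z) = (\<lambda>z. ell * f z)"
    by (simp add: yweight_def algebra_simps)
  finally have "(L2_norm torus q)\<^sup>2 = 2 * L2_inner (slab ell) f ?fy"
    using ell by (simp add: L2_inner_cmult_left L2_norm_sq)
  also have "\<dots> \<le> 2 * (L2_norm (slab ell) f * L2_norm (slab ell) ?fy)"
    using L2_Cauchy_Schwarz[OF L] by simp
  also have "\<dots> \<le> 2 * ((2 * ell * L2_norm (slab ell) ?fy) * L2_norm (slab ell) ?fy)"
    using poincare_directional[OF tr ell, of 0] by (intro mult_left_mono mult_right_mono) auto
  also have "\<dots> = (2 * sqrt ell * L2_norm (slab ell) ?fy)\<^sup>2"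
    using ell by (simp add: power_mult_distrib power2_eq_square)
  finally show ?thesis by (rule power2_le_imp_le) (use ell in simp)
qed

section \<open>Solenoidal fields and the symmetric gradient\<close>

lemma vec_comp_add: "vec_comp (\<lambda>z. u z + v z) b = (\<lambda>z. vec_comp u b z + vec_comp v b z)"
  by (simp add: vec_comp_def inner_add_left)

lemma vec_comp_scaleR: "vec_comp (\<lambda>z. c *\<^sub>R u z) b = (\<lambda>z. c * vec_comp u b z)"
  by (simp add: vec_comp_def)

lemma H1_solD:
  assumes "u \<in> H1_sol ell" "b \<in> Basis"
  shows "vec_comp u b \<in> H1 ell" "has_trace ell 0 (vec_comp u b) (\<lambda>_. 0)"
  using assms by (auto simp: H1_sol_def)

lemma H1_sol_wp: "u \<in> H1_sol ell \<Longrightarrow> a \<in> Basis \<Longrightarrow> b \<in> Basis \<Longrightarrow> weak_partial ell a (vec_comp u b) \<in> L2 (slab ell)"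
  by (intro weak_partial(1) H1_solD)

lemma H1_sol_L2: "u \<in> H1_sol ell \<Longrightarrow> u \<in> L2 (slab ell)"
proof -
  assume u: "u \<in> H1_sol ell"
  have "(\<lambda>z. \<Sum>b\<in>Basis. vec_comp u b z *\<^sub>R b) \<in> L2 (slab ell)"
  proof (rule L2_sum)
    fix b :: "'a pt" assume b: "b \<in> Basis"
    have "vec_comp u b \<in> L2 (slab ell)" by (rule H1_L2[OF H1_solD(1)[OF u b]])
    then show "(\<lambda>z. vec_comp u b z *\<^sub>R b) \<in> L2 (slab ell)"
      using b by (auto simp: L2_def intro!: borel_measurable_scaleR)
  qed
  then show ?thesis by (simp add: vec_comp_def euclidean_representation)
qed

lemma H1_sol_add:
  assumes u: "u \<in> H1_sol ell" and v: "v \<in> H1_sol ell"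
  shows "(\<lambda>z. u z + v z) \<in> H1_sol ell"
proof -
  have "AE z in slab ell. \<forall>b\<in>Basis. weak_partial ell b (vec_comp (\<lambda>z. u z + v z) b) z
      = weak_partial ell b (vec_comp u b) z + weak_partial ell b (vec_comp v b) z"
    unfolding vec_comp_add using u v by (intro AE_finite_allI weak_partial_add H1_solD) auto
  moreover have "AE z in slab ell. (\<Sum>b\<in>Basis. weak_partial ell b (vec_comp u b) z) = 0"
    "AE z in slab ell. (\<Sum>b\<in>Basis. weak_partial ell b (vec_comp v b) z) = 0"
    using u v by (auto simp: H1_sol_def div_free_def)
  ultimately have "div_free ell (\<lambda>z. u z + v z)" unfolding div_free_def
    by eventually_elim (simp add: sum.distrib)
  then show ?thesis
    unfolding H1_sol_def
    using H1_add[OF H1_solD(1)[OF u] H1_solD(1)[OF v]] has_trace_add[OF H1_solD(2)[OF u] H1_solD(2)[OF v]]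
    by (simp add: vec_comp_add)
qed

lemma H1_sol_scaleR:
  assumes u: "u \<in> H1_sol ell"
  shows "(\<lambda>z. c *\<^sub>R u z) \<in> H1_sol ell"
proof -
  have "AE z in slab ell. \<forall>b\<in>Basis. weak_partial ell b (vec_comp (\<lambda>z. c *\<^sub>R u z) b) z
      = c * weak_partial ell b (vec_comp u b) z"
    unfolding vec_comp_scaleR using u by (intro AE_finite_allI weak_partial_cmult H1_solD) auto
  moreover have "AE z in slab ell. (\<Sum>b\<in>Basis. weak_partial ell b (vec_comp u b) z) = 0"
    using u by (auto simp: H1_sol_def div_free_def)
  ultimately have "div_free ell (\<lambda>z. c *\<^sub>R u z)" unfolding div_free_def
    by eventually_elim (simp flip: sum_distrib_left)
  then show ?thesis
    unfolding H1_sol_def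
    using H1_cmult[OF H1_solD(1)[OF u]] has_trace_cmult[OF H1_solD(2)[OF u], of _ c]
    by (simp add: vec_comp_scaleR)
qed

lemma H1_sol_diff: "u \<in> H1_sol ell \<Longrightarrow> v \<in> H1_sol ell \<Longrightarrow> (\<lambda>z. u z - v z) \<in> H1_sol ell"
  using H1_sol_add[OF _ H1_sol_scaleR[of v ell "-1"], of u] by simp

lemma sym_grad_L2: "u \<in> H1_sol ell \<Longrightarrow> a \<in> Basis \<Longrightarrow> b \<in> Basis \<Longrightarrow> sym_grad ell u a b \<in> L2 (slab ell)"
  unfolding sym_grad_def by (intro L2_add H1_sol_wp)

lemma sym_grad_add_AE:
  assumes "u \<in> H1_sol ell" "v \<in> H1_sol ell" "a \<in> Basis" "b \<in> Basis"
  shows "AE z in slab ell. sym_grad ell (\<lambda>z. u z + v z) a b z = sym_grad ell u a b z + sym_grad ell v a b z"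
  using weak_partial_add[OF H1_solD(1)[OF assms(1,4)] H1_solD(1)[OF assms(2,4)] assms(3)]
    weak_partial_add[OF H1_solD(1)[OF assms(1,3)] H1_solD(1)[OF assms(2,3)] assms(4)]
  by eventually_elim (simp add: sym_grad_def vec_comp_add)

lemma sym_grad_scaleR_AE:
  assumes "u \<in> H1_sol ell" "a \<in> Basis" "b \<in> Basis"
  shows "AE z in slab ell. sym_grad ell (\<lambda>z. c *\<^sub>R u z) a b z = c * sym_grad ell u a b z"
  using weak_partial_cmult[OF H1_solD(1)[OF assms(1,3)] assms(2), where c = c]
    weak_partial_cmult[OF H1_solD(1)[OF assms(1,2)] assms(3), where c = c]
  by eventually_elim (simp add: sym_grad_def vec_comp_scaleR distrib_left)

lemma sym_grad_inner_commute: "sym_grad_inner ell u v = sym_grad_inner ell v u"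
  unfolding sym_grad_inner_def by (simp add: L2_inner_commute)

lemma sym_grad_inner_add_right:
  assumes "u \<in> H1_sol ell" "v \<in> H1_sol ell" "w \<in> H1_sol ell"
  shows "sym_grad_inner ell w (\<lambda>z. u z + v z) = sym_grad_inner ell w u + sym_grad_inner ell w v"
proof -
  have "L2_inner (slab ell) (sym_grad ell w a b) (sym_grad ell (\<lambda>z. u z + v z) a b)
    = L2_inner (slab ell) (sym_grad ell w a b) (sym_grad ell u a b) + L2_inner (slab ell) (sym_grad ell w a b) (sym_grad ell v a b)"
    if "a \<in> Basis" "b \<in> Basis" for a b
  proof -
    have "L2_inner (slab ell) (sym_grad ell w a b) (sym_grad ell (\<lambda>z. u z + v z) a b)
      = L2_inner (slab ell) (sym_grad ell w a b) (\<lambda>z. sym_grad ell u a b z + sym_grad ell v a b z)"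
      using assms that
      by (intro L2_inner_cong_AE sym_grad_add_AE L2_measurable sym_grad_L2 H1_sol_add L2_add) auto
    then show ?thesis using assms that by (simp add: L2_inner_add_right sym_grad_L2)
  qed
  then show ?thesis unfolding sym_grad_inner_def by (simp add: sum.distrib)
qed

lemma sym_grad_inner_scaleR_right:
  assumes "u \<in> H1_sol ell" "w \<in> H1_sol ell"
  shows "sym_grad_inner ell w (\<lambda>z. c *\<^sub>R u z) = c * sym_grad_inner ell w u"
proof -
  have "L2_inner (slab ell) (sym_grad ell w a b) (sym_grad ell (\<lambda>z. c *\<^sub>R u z) a b)
    = c * L2_inner (slab ell) (sym_grad ell w a b) (sym_grad ell u a b)"
    if "a \<in> Basis" "b \<in> Basis" for a b
  proof -
    have "L2_inner (slab ell) (sym_grad ell w a b) (sym_grad ell (\<lambda>z. c *\<^sub>R u z) a b)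
      = L2_inner (slab ell) (sym_grad ell w a b) (\<lambda>z. c * sym_grad ell u a b z)"
      using assms that
      by (intro L2_inner_cong_AE sym_grad_scaleR_AE L2_measurable sym_grad_L2 H1_sol_scaleR L2_cmult) auto
    then show ?thesis by (simp add: L2_inner_cmult_right)
  qed
  then show ?thesis unfolding sym_grad_inner_def by (simp add: sum_distrib_left)
qed

lemma sym_grad_inner_diff_right:
  assumes "u \<in> H1_sol ell" "v \<in> H1_sol ell" "w \<in> H1_sol ell"
  shows "sym_grad_inner ell w (\<lambda>z. u z - v z) = sym_grad_inner ell w u - sym_grad_inner ell w v"
  using sym_grad_inner_add_right[OF assms(1) H1_sol_scaleR[OF assms(2), of "-1"] assms(3)]
    sym_grad_inner_scaleR_right[OF assms(2,3), of "-1"] by simp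

definition sym_norm :: "real \<Rightarrow> ('n::finite pt \<Rightarrow> 'n pt) \<Rightarrow> real" where
  "sym_norm ell u = sqrt (sym_grad_inner ell u u)"

text \<open>As a Euclidean norm over the matrix of entry norms, \<open>sym_norm\<close> inherits the
  finite Cauchy-Schwarz and Minkowski inequalities of \<open>L2_set\<close>.\<close>

lemma sym_norm_eq: "sym_norm ell u = L2_set (\<lambda>(a, b). L2_norm (slab ell) (sym_grad ell u a b)) (Basis \<times> Basis)"
  by (simp add: sym_norm_def L2_set_def sym_grad_inner_def sum.cartesian_product L2_norm_sq split_beta)

lemma H1_sol_norm_eq: "H1_sol_norm ell u = L2_set (\<lambda>(a, b). L2_norm (slab ell) (weak_partial ell a (vec_comp u b))) (Basis \<times> Basis)"
  by (simp add: H1_sol_norm_def L2_set_def H1_sol_inner_def sum.cartesian_product L2_norm_sq split_beta)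

lemma H1_sol_norm_nonneg [simp]: "0 \<le> H1_sol_norm ell u"
  by (simp add: H1_sol_norm_eq)

lemma sym_norm_nonneg [simp]: "0 \<le> sym_norm ell u"
  by (simp add: sym_norm_eq)

lemma sym_norm_sq: "(sym_norm ell u)\<^sup>2 = sym_grad_inner ell u u"
  by (simp add: sym_norm_def sym_grad_inner_def sum_nonneg)

lemma sym_grad_le_sym_norm: "a \<in> Basis \<Longrightarrow> b \<in> Basis \<Longrightarrow> L2_norm (slab ell) (sym_grad ell u a b) \<le> sym_norm ell u"
  unfolding sym_norm_eq using member_le_L2_set[of "Basis \<times> Basis" "(a, b)" "\<lambda>(a, b). L2_norm (slab ell) (sym_grad ell u a b)"] by simp

lemma sym_grad_inner_bound:
  assumes "u \<in> H1_sol ell" "v \<in> H1_sol ell"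
  shows "\<bar>sym_grad_inner ell u v\<bar> \<le> sym_norm ell u * sym_norm ell v"
proof -
  let ?f = "\<lambda>w (a, b). L2_norm (slab ell) (sym_grad ell w a b)"
  have "\<bar>sym_grad_inner ell u v\<bar> \<le> (\<Sum>a\<in>Basis. \<Sum>b\<in>Basis. \<bar>L2_inner (slab ell) (sym_grad ell u a b) (sym_grad ell v a b)\<bar>)"
    unfolding sym_grad_inner_def by (intro order_trans[OF sum_abs] sum_mono order_refl)
  also have "\<dots> \<le> (\<Sum>a\<in>Basis. \<Sum>b\<in>Basis. ?f u (a, b) * ?f v (a, b))"
    using assms by (intro sum_mono) (auto intro!: L2_Cauchy_Schwarz sym_grad_L2)
  also have "\<dots> = (\<Sum>p\<in>Basis \<times> Basis. \<bar>?f u p\<bar> * \<bar>?f v p\<bar>)"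
    unfolding sum.cartesian_product by (intro sum.cong) auto
  also have "\<dots> \<le> L2_set (?f u) (Basis \<times> Basis) * L2_set (?f v) (Basis \<times> Basis)"
    by (rule L2_set_mult_ineq)
  finally show ?thesis by (simp add: sym_norm_eq)
qed

lemma H1_sol_norm_triangle:
  assumes "u \<in> H1_sol ell" "v \<in> H1_sol ell"
  shows "H1_sol_norm ell (\<lambda>z. u z + v z) \<le> H1_sol_norm ell u + H1_sol_norm ell v"
proof -
  let ?f = "\<lambda>w (a, b). L2_norm (slab ell) (weak_partial ell a (vec_comp w b))"
  have "?f (\<lambda>z. u z + v z) (a, b) \<le> ?f u (a, b) + ?f v (a, b)" if "a \<in> Basis" "b \<in> Basis" for a b
  proof -
    have "?f (\<lambda>z. u z + v z) (a, b) = L2_norm (slab ell) (\<lambda>z. weak_partial ell a (vec_comp u b) z + weak_partial ell a (vec_comp v b) z)"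
      unfolding vec_comp_add prod.case
      by (intro L2_norm_cong_AE weak_partial_add L2_measurable L2_add weak_partial(1) H1_add H1_solD(1) assms that)
    also have "\<dots> \<le> ?f u (a, b) + ?f v (a, b)"
      unfolding prod.case by (intro L2_norm_triangle H1_sol_wp assms that)
    finally show ?thesis .
  qed
  then have "L2_set (?f (\<lambda>z. u z + v z)) (Basis \<times> Basis) \<le> L2_set (\<lambda>p. ?f u p + ?f v p) (Basis \<times> Basis)"
    by (intro L2_set_mono) auto
  also have "\<dots> \<le> L2_set (?f u) (Basis \<times> Basis) + L2_set (?f v) (Basis \<times> Basis)"
    by (rule L2_set_triangle_ineq)
  finally show ?thesis by (simp add: H1_sol_norm_eq)
qed

lemma H1_sol_norm_scaleR:
  assumes "u \<in> H1_sol ell"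
  shows "H1_sol_norm ell (\<lambda>z. c *\<^sub>R u z) = \<bar>c\<bar> * H1_sol_norm ell u"
proof -
  have "L2_norm (slab ell) (weak_partial ell a (vec_comp (\<lambda>z. c *\<^sub>R u z) b)) = \<bar>c\<bar> * L2_norm (slab ell) (weak_partial ell a (vec_comp u b))"
    if "a \<in> Basis" "b \<in> Basis" for a b
  proof -
    have "L2_norm (slab ell) (weak_partial ell a (vec_comp (\<lambda>z. c *\<^sub>R u z) b)) = L2_norm (slab ell) (\<lambda>z. c * weak_partial ell a (vec_comp u b) z)"
      unfolding vec_comp_scaleR
      by (intro L2_norm_cong_AE weak_partial_cmult L2_measurable L2_cmult weak_partial(1) H1_cmult H1_solD(1) assms that)
    then show ?thesis by (simp add: L2_norm_cmult)
  qed
  then have "H1_sol_norm ell (\<lambda>z. c *\<^sub>R u z) = L2_set (\<lambda>p. \<bar>c\<bar> * (case p of (a, b) \<Rightarrow> L2_norm (slab ell) (weak_partial ell a (vec_comp u b)))) (Basis \<times> Basis)"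
    unfolding H1_sol_norm_eq by (intro L2_set_cong) auto
  then show ?thesis by (simp add: L2_set_right_distrib H1_sol_norm_eq)
qed

lemma H1_sol_norm_minus_commute:
  assumes "u \<in> H1_sol ell" "v \<in> H1_sol ell"
  shows "H1_sol_norm ell (\<lambda>z. u z - v z) = H1_sol_norm ell (\<lambda>z. v z - u z)"
  using H1_sol_norm_scaleR[OF H1_sol_diff[OF assms], of "-1"] by simp

lemma sym_norm_le:
  assumes "u \<in> H1_sol ell"
  shows "sym_norm ell u \<le> 2 * H1_sol_norm ell u"
proof -
  let ?f = "\<lambda>(a, b). L2_norm (slab ell) (weak_partial ell a (vec_comp u b))"
  let ?g = "\<lambda>(a, b). L2_norm (slab ell) (weak_partial ell b (vec_comp u a))"
  have "sym_norm ell u \<le> L2_set (\<lambda>p. ?f p + ?g p) (Basis \<times> Basis)"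
    unfolding sym_norm_eq
  proof (rule L2_set_mono, goal_cases)
    case (1 p)
    then show ?case unfolding sym_grad_def using assms
      by (auto simp: split_beta intro!: L2_norm_triangle H1_sol_wp)
  qed (auto simp: split_beta)
  also have "\<dots> \<le> L2_set ?f (Basis \<times> Basis) + L2_set ?g (Basis \<times> Basis)" by (rule L2_set_triangle_ineq)
  also have "L2_set ?g (Basis \<times> Basis) = L2_set ?f (Basis \<times> Basis)"
    unfolding L2_set_def
    by (intro arg_cong[where f = sqrt] sum.reindex_bij_witness[of _ prod.swap prod.swap]) auto
  finally show ?thesis by (simp add: H1_sol_norm_eq)
qed

text \<open>Along the directions \<open>e\<^sub>N\<close> and \<open>e\<^sub>N + e\<^sub>i\<close> the derivative of \<open>u \<bullet> e\<close> is \<open>(\<D>u e \<bullet> e) / 2\<close>, so the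
  Poincare inequality needs no control of the full gradient.\<close>

lemma korn_poincare_component:
  fixes u :: "'n::finite pt \<Rightarrow> 'n pt"
  assumes u: "u \<in> H1_sol ell" and ell: "ell > 0" and b: "b \<in> Basis"
  shows "L2_norm (slab ell) (vec_comp u b) \<le> 5 * ell * sym_norm ell u"
proof -
  let ?N = "(0, 1) :: 'n pt"
  let ?D = "sym_grad ell u" and ?wp = "\<lambda>a b. weak_partial ell a (vec_comp u b)"
  note B = pt_Basis[where 'n = 'n]
  have vN: "L2_norm (slab ell) (vec_comp u ?N) \<le> ell * sym_norm ell u"
  proof -
    have "L2_norm (slab ell) (vec_comp u ?N) \<le> 2 * ell * L2_norm (slab ell) (?wp ?N ?N)"
      using poincare_directional[OF H1_solD(2)[OF u B(2)] ell, of 0] by simp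
    also have "2 * L2_norm (slab ell) (?wp ?N ?N) = L2_norm (slab ell) (?D ?N ?N)"
      using L2_norm_cmult[of "slab ell" 2 "?wp ?N ?N"] by (simp add: sym_grad_def)
    then have "2 * ell * L2_norm (slab ell) (?wp ?N ?N) = ell * L2_norm (slab ell) (?D ?N ?N)" by simp
    also have "\<dots> \<le> ell * sym_norm ell u"
      using ell by (intro mult_left_mono sym_grad_le_sym_norm B) auto
    finally show ?thesis .
  qed
  \<comment> \<open>The constant 5 is 4 for u_N + u_i, whose directional derivative has norm at most
    2 \<open>sym_norm\<close>, plus 1 for subtracting u_N.\<close>
  have vi: "L2_norm (slab ell) (vec_comp u (axis i 1, 0)) \<le> 5 * ell * sym_norm ell u" for i
  proof -
    let ?I = "(axis i 1, 0) :: 'n pt"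
    let ?f = "\<lambda>z. vec_comp u ?N z + vec_comp u ?I z"
    note L = H1_L2[OF H1_solD(1)[OF u B(2)]] H1_L2[OF H1_solD(1)[OF u B(1)[of i]]]
    have tr: "has_trace ell 0 ?f (\<lambda>_. 0)"
      using has_trace_add[OF H1_solD(2)[OF u B(2)] H1_solD(2)[OF u B(1)[of i]]] by simp
    have fH: "?f \<in> H1 ell" by (intro H1_add H1_solD(1) u B)
    \<comment> \<open>The derivative of u_N + u_i along e_N + e_i through entries of the symmetric
      gradient alone: half of each diagonal entry plus the off-diagonal one.\<close>
    have "L2_norm (slab ell) (\<lambda>z. weak_partial ell ?N ?f z + 1 * weak_partial ell ?I ?f z)
       = L2_norm (slab ell) (\<lambda>z. (1/2 * ?D ?N ?N z + 1/2 * ?D ?I ?I z) + ?D ?I ?N z)"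
    proof (rule L2_norm_cong_AE)
      show "AE z in slab ell. weak_partial ell ?N ?f z + 1 * weak_partial ell ?I ?f z
         = (1/2 * ?D ?N ?N z + 1/2 * ?D ?I ?I z) + ?D ?I ?N z"
        using weak_partial_add[OF H1_solD(1)[OF u B(2)] H1_solD(1)[OF u B(1)[of i]] B(2)]
          weak_partial_add[OF H1_solD(1)[OF u B(2)] H1_solD(1)[OF u B(1)[of i]] B(1)[of i]]
        by eventually_elim (simp add: sym_grad_def)
    qed (intro L2_measurable L2_add L2_cmult weak_partial(1) sym_grad_L2 fH u B)+
    also have "\<dots> \<le> (1/2 * L2_norm (slab ell) (?D ?N ?N) + 1/2 * L2_norm (slab ell) (?D ?I ?I)) + L2_norm (slab ell) (?D ?I ?N)"
      using L2_norm_triangle[OF L2_add[OF L2_cmult[OF sym_grad_L2[OF u B(2) B(2)], of "1/2"] L2_cmult[OF sym_grad_L2[OF u B(1)[of i] B(1)[of i]], of "1/2"]] sym_grad_L2[OF u B(1)[of i] B(2)]]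
        L2_norm_triangle[OF L2_cmult[OF sym_grad_L2[OF u B(2) B(2)], of "1/2"] L2_cmult[OF sym_grad_L2[OF u B(1)[of i] B(1)[of i]], of "1/2"]]
      unfolding L2_norm_cmult by simp
    also have "\<dots> \<le> 2 * sym_norm ell u"
      using sym_grad_le_sym_norm[OF B(2) B(2), of ell u] sym_grad_le_sym_norm[OF B(1)[of i] B(1)[of i], of ell u]
        sym_grad_le_sym_norm[OF B(1)[of i] B(2), of ell u] by simp
    finally have "2 * ell * L2_norm (slab ell) (\<lambda>z. weak_partial ell ?N ?f z + 1 * weak_partial ell ?I ?f z) \<le> 2 * ell * (2 * sym_norm ell u)"
      using ell by (intro mult_left_mono) auto
    with poincare_directional[OF tr ell, of 1 i] have f4: "L2_norm (slab ell) ?f \<le> 4 * ell * sym_norm ell u" by simp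
    have "L2_norm (slab ell) (vec_comp u ?I) = L2_norm (slab ell) (\<lambda>z. ?f z - vec_comp u ?N z)" by simp
    also have "\<dots> \<le> L2_norm (slab ell) ?f + L2_norm (slab ell) (vec_comp u ?N)"
      using L2_norm_triangle[OF L2_add[OF L] L2_cmult[OF L(1), of "-1"]] L2_norm_cmult[of "slab ell" "-1" "vec_comp u ?N"] by simp
    finally show ?thesis using f4 vN by simp
  qed
  have "0 \<le> ell * sym_norm ell u" using ell by simp
  then have "\<forall>b\<in>Basis. L2_norm (slab ell) (vec_comp u b) \<le> 5 * ell * sym_norm ell u"
    unfolding ball_pt_Basis using vi vN by (simp add: mult.assoc)
  then show ?thesis using b by blast
qed

lemma L2_norm_sq_components:
  fixes u :: "'n::finite pt \<Rightarrow> 'n pt"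
  assumes "\<And>b. b \<in> Basis \<Longrightarrow> vec_comp u b \<in> L2 (slab ell)"
  shows "(L2_norm (slab ell) u)\<^sup>2 = (\<Sum>b\<in>Basis. (L2_norm (slab ell) (vec_comp u b))\<^sup>2)"
proof -
  have "(L2_norm (slab ell) u)\<^sup>2 = (\<integral>z. (\<Sum>b\<in>Basis. vec_comp u b z * vec_comp u b z) \<partial>slab ell)"
    unfolding L2_norm_sq L2_inner_def vec_comp_def by (simp add: euclidean_inner[symmetric])
  also have "\<dots> = (\<Sum>b\<in>Basis. \<integral>z. vec_comp u b z * vec_comp u b z \<partial>slab ell)"
    using integrable_L2_inner[OF assms assms] by (intro Bochner_Integration.integral_sum) simp
  finally show ?thesis by (simp add: L2_norm_sq L2_inner_def)
qed

lemma korn_poincare: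
  fixes u :: "'n::finite pt \<Rightarrow> 'n pt"
  assumes u: "u \<in> H1_sol ell" and ell: "ell > 0"
  shows "L2_norm (slab ell) u \<le> sqrt (real DIM('n pt)) * (5 * ell) * sym_norm ell u"
proof (rule power2_le_imp_le)
  have "(L2_norm (slab ell) u)\<^sup>2 = (\<Sum>b\<in>Basis. (L2_norm (slab ell) (vec_comp u b))\<^sup>2)"
    by (rule L2_norm_sq_components) (intro H1_L2 H1_solD(1) u)
  also have "\<dots> \<le> (\<Sum>b\<in>(Basis :: 'n pt set). (5 * ell * sym_norm ell u)\<^sup>2)"
    by (intro sum_mono power_mono korn_poincare_component u ell) auto
  also have "\<dots> = (sqrt (real DIM('n pt)) * (5 * ell) * sym_norm ell u)\<^sup>2"
    by (simp add: power_mult_distrib)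
  finally show "(L2_norm (slab ell) u)\<^sup>2 \<le> (sqrt (real DIM('n pt)) * (5 * ell) * sym_norm ell u)\<^sup>2" .
qed (use ell in simp)

text \<open>The trace of the vertical component is bounded by its vertical derivative, which is half
  a diagonal entry of the symmetric gradient. The surface velocity is therefore controlled by the
  dissipation.\<close>

lemma trace_top_sym_norm:
  fixes u :: "'n::finite pt \<Rightarrow> 'n pt"
  assumes u: "u \<in> H1_sol ell" and ell: "ell > 0" and q: "has_trace ell ell (\<lambda>z. snd (u z)) q"
  shows "L2_norm torus q \<le> sqrt ell * sym_norm ell u"
proof -
  let ?N = "(0, 1) :: 'n pt"
  note B = pt_Basis(2)[where 'n = 'n]
  have eq: "(\<lambda>z. snd (u z)) = vec_comp u ?N" by (simp add: vec_comp_def inner_prod_def)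
  have "L2_norm torus q \<le> 2 * sqrt ell * L2_norm (slab ell) (weak_partial ell ?N (vec_comp u ?N))"
    by (rule trace_top_bound[OF H1_solD(2)[OF u B] q[unfolded eq] ell])
  also have "2 * L2_norm (slab ell) (weak_partial ell ?N (vec_comp u ?N)) = L2_norm (slab ell) (sym_grad ell u ?N ?N)"
    using L2_norm_cmult[of "slab ell" 2 "weak_partial ell ?N (vec_comp u ?N)"] by (simp add: sym_grad_def)
  then have "2 * sqrt ell * L2_norm (slab ell) (weak_partial ell ?N (vec_comp u ?N)) = sqrt ell * L2_norm (slab ell) (sym_grad ell u ?N ?N)" by simp
  also have "\<dots> \<le> sqrt ell * sym_norm ell u"
    using ell by (intro mult_left_mono sym_grad_le_sym_norm B) auto
  finally show ?thesis .
qed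

text \<open>Lipschitz dependence of the trace on the field. It turns closeness of \<open>u\<close>
  at two times into closeness of the surface velocities.\<close>

lemma trace_top_diff:
  fixes u v :: "'n::finite pt \<Rightarrow> 'n pt"
  assumes "u \<in> H1_sol ell" "v \<in> H1_sol ell" "ell > 0"
    and "has_trace ell ell (\<lambda>z. snd (u z)) p" "has_trace ell ell (\<lambda>z. snd (v z)) q"
  shows "L2_norm torus (\<lambda>x. p x - q x) \<le> 2 * sqrt ell * H1_sol_norm ell (\<lambda>z. u z - v z)"
proof -
  have "has_trace ell ell (\<lambda>z. snd (u z - v z)) (\<lambda>x. p x - q x)"
    using has_trace_diff[OF assms(4,5)] by simp
  from trace_top_sym_norm[OF H1_sol_diff[OF assms(1,2)] assms(3) this]
  have "L2_norm torus (\<lambda>x. p x - q x) \<le> sqrt ell * sym_norm ell (\<lambda>z. u z - v z)" .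
  also have "\<dots> \<le> sqrt ell * (2 * H1_sol_norm ell (\<lambda>z. u z - v z))"
    using assms(3) by (intro mult_left_mono sym_norm_le H1_sol_diff assms) auto
  finally show ?thesis by (simp add: mult_ac)
qed

section \<open>Fourier series\<close>

definition chr :: "int^'n \<Rightarrow> real^'n \<Rightarrow> complex" where
  "chr \<xi> x = cis (2 * pi * (freq \<xi> \<bullet> x))"

lemma chr_cnj: "cnj (chr \<xi> x) = exp (- 2 * pi * \<i> * (freq \<xi> \<bullet> x))"
  unfolding chr_def cis_cnj by (simp add: cis_conv_exp mult_ac)

lemma fourier_chr: "fourier f \<xi> = (\<integral>x. of_real (f x) * cnj (chr \<xi> x) \<partial>torus)"
  by (simp add: fourier_def chr_cnj)

lemma continuous_chr: "continuous_on UNIV (chr \<xi>)"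
  unfolding chr_def by (intro continuous_intros continuous_on_cis)

lemma norm_chr [simp]: "cmod (chr \<xi> x) = 1"
  by (simp add: chr_def)

lemma freq_add: "freq (\<xi> + \<eta>) = freq \<xi> + freq \<eta>"
  by (simp add: freq_def vec_eq_iff)

lemma freq_minus: "freq (- \<xi>) = - freq \<xi>"
  by (simp add: freq_def vec_eq_iff)

lemma chr_mult: "chr \<xi> x * chr \<eta> x = chr (\<xi> + \<eta>) x"
  by (simp add: chr_def cis_mult freq_add inner_add_left distrib_left)

lemma chr_minus: "chr (- \<xi>) x = cnj (chr \<xi> x)"
  by (simp add: chr_def cis_cnj freq_minus)

lemma chr_0: "chr 0 x = 1"
  by (simp add: chr_def freq_def zero_vec_def[symmetric])

lemma chr_mult_cnj: "chr \<xi> x * cnj (chr \<eta> x) = chr (\<xi> - \<eta>) x"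
  using chr_mult[of \<xi> x "- \<eta>"] by (simp add: chr_minus)

lemma chr_self_cnj [simp]: "chr \<xi> x * cnj (chr \<xi> x) = 1"
  by (simp add: chr_mult_cnj chr_0)

lemma freq_inner_axis: "freq \<xi> \<bullet> axis i t = real_of_int (\<xi> $ i) * t"
  by (simp add: freq_def inner_axis)

lemma chr_shift: "chr \<xi> (x + s *\<^sub>R axis i 1) = chr \<xi> x * cis (2 * pi * (real_of_int (\<xi> $ i) * s))"
  by (simp add: chr_def inner_add_right freq_inner_axis cis_mult distrib_left mult_ac)

lemma chr_periodic: "chr \<xi> (x + axis i 1) = chr \<xi> x"
proof -
  have "cis (2 * pi * real_of_int (\<xi> $ i)) = 1"
    using cis_multiple_2pi[of "real_of_int (\<xi> $ i)"] by simp
  then show ?thesis using chr_shift[of \<xi> x 1 i] by simp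
qed

text \<open>A shift by half a wavelength, 1 / (2 |k|), reverses the sign of G and preserves the
  integral.\<close>

lemma integral_chr_cell_zero:
  fixes S :: "'a::euclidean_space set" and G :: "'a \<Rightarrow> complex" and p :: "'a \<Rightarrow> real^'n"
  assumes cell: "periodic_cell S b" and bd: "bounded S" and cont: "continuous_on UNIV G"
    and G: "\<And>z s. G (z + s *\<^sub>R b) = G z * cis (2 * pi * (real_of_int k * s))" and k: "k \<noteq> 0"
  shows "(\<integral>z. G z \<partial>restrict_space lborel S) = 0"
proof -
  let ?s = "1 / (2 * \<bar>real_of_int k\<bar>)"
  have s: "0 \<le> ?s" "?s \<le> 1" using k by (auto simp: field_simps)
  have "cis (2 * pi * real_of_int k) = 1" using cis_multiple_2pi[of "real_of_int k"] by simp
  then have per: "G (z + b) = G z" for z using G[of z 1] by simp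
  have half: "cis (2 * pi * (real_of_int k * ?s)) = -1"
  proof (cases "k > 0")
    case True
    then have "2 * pi * (real_of_int k * ?s) = pi" by simp
    then show ?thesis by simp
  next
    case False
    then have "2 * pi * (real_of_int k * ?s) = - pi" using k by (simp add: field_simps)
    then show ?thesis by (simp add: cis.ctr complex_eq_iff)
  qed
  have "(\<integral>z. G z \<partial>restrict_space lborel S) = (\<integral>z. G (z + ?s *\<^sub>R b) \<partial>restrict_space lborel S)"
    using integral_periodic_shift[OF cell borel_measurable_continuous_onI[OF cont]
        integrable_continuous_restrict[OF bd periodic_cell_sets[OF cell] cont] per s] by simp
  also have "\<dots> = - (\<integral>z. G z \<partial>restrict_space lborel S)" unfolding G half by simp
  finally show ?thesis by simp
qed

lemma integral_chr_torus: "(\<integral>x. chr \<xi> x \<partial>torus) = (if \<xi> = 0 then 1 else 0)"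
proof (cases "\<xi> = 0")
  case True
  then show ?thesis by (simp add: chr_0 measure_torus)
next
  case False
  then obtain i where i: "\<xi> $ i \<noteq> 0" by (auto simp: vec_eq_iff)
  show ?thesis unfolding torus_eq
    using integral_chr_cell_zero[OF periodic_cell_torus[of i] bounded_cell continuous_chr chr_shift i] False by simp
qed

lemma integral_chr_slab:
  assumes "continuous_on UNIV a" "\<xi> \<noteq> 0"
  shows "(\<integral>z. chr \<xi> (fst z) * of_real (a (snd z)) \<partial>slab ell) = 0"
proof -
  from assms(2) obtain i where i: "\<xi> $ i \<noteq> 0" by (auto simp: vec_eq_iff)
  have c: "continuous_on UNIV (\<lambda>z :: 'a pt. chr \<xi> (fst z) * of_real (a (snd z)))"
    by (intro continuous_on_mult continuous_on_of_real continuous_on_compose2[OF assms(1)]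
        continuous_on_compose2[OF continuous_chr] continuous_on_fst continuous_on_snd continuous_on_id) auto
  show ?thesis unfolding slab_eq
    by (rule integral_chr_cell_zero[OF periodic_cell_slab[of _ i] bounded_slab c _ i]) (simp add: chr_shift mult_ac)
qed

lemma integrable_slab_continuous_complex: "continuous_on UNIV f \<Longrightarrow> integrable (slab ell) f" for f :: "'n::finite pt \<Rightarrow> complex"
  unfolding slab_eq by (rule integrable_continuous_restrict[OF bounded_slab slab_sets])

lemma integrable_torus_continuous_complex: "continuous_on UNIV f \<Longrightarrow> integrable torus f" for f :: "real^'n \<Rightarrow> complex"
  unfolding torus_eq by (rule integrable_continuous_restrict[OF bounded_cell cell_sets])

text \<open>Pythagoras for an orthogonal system that need not be normalised, over a general measure:
  it serves the characters on the torus and the modes on the slab, whose squared norms depend on the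
  index.\<close>

lemma integral_norm_sq_orthogonal:
  fixes G :: "'i \<Rightarrow> 'a \<Rightarrow> complex"
  assumes F: "finite F" and int: "\<And>i j. i \<in> F \<Longrightarrow> j \<in> F \<Longrightarrow> integrable M (\<lambda>x. G i x * cnj (G j x))"
    and orth: "\<And>i j. i \<in> F \<Longrightarrow> j \<in> F \<Longrightarrow> i \<noteq> j \<Longrightarrow> (\<integral>x. G i x * cnj (G j x) \<partial>M) = 0"
    and diag: "\<And>i. i \<in> F \<Longrightarrow> (\<integral>x. G i x * cnj (G i x) \<partial>M) = of_real (n i)"
  shows "integrable M (\<lambda>x. (cmod (\<Sum>i\<in>F. c i * G i x))\<^sup>2)"
    and "(\<integral>x. (cmod (\<Sum>i\<in>F. c i * G i x))\<^sup>2 \<partial>M) = (\<Sum>i\<in>F. (cmod (c i))\<^sup>2 * n i)"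
proof -
  have eq: "complex_of_real ((cmod (\<Sum>i\<in>F. c i * G i x))\<^sup>2) = (\<Sum>i\<in>F. \<Sum>j\<in>F. (c i * cnj (c j)) * (G i x * cnj (G j x)))" for x
    unfolding complex_norm_square cnj_sum sum_product by (intro sum.cong refl) (simp add: mult_ac)
  have i1: "integrable M (\<lambda>x. complex_of_real ((cmod (\<Sum>i\<in>F. c i * G i x))\<^sup>2))"
    unfolding eq by (intro Bochner_Integration.integrable_sum integrable_mult_right int)
  then have "integrable M (\<lambda>x. Re (complex_of_real ((cmod (\<Sum>i\<in>F. c i * G i x))\<^sup>2)))" by (rule integrable_Re)
  then show "integrable M (\<lambda>x. (cmod (\<Sum>i\<in>F. c i * G i x))\<^sup>2)" by simp
  have "complex_of_real (\<integral>x. (cmod (\<Sum>i\<in>F. c i * G i x))\<^sup>2 \<partial>M) = (\<integral>x. complex_of_real ((cmod (\<Sum>i\<in>F. c i * G i x))\<^sup>2) \<partial>M)"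
    by (rule integral_complex_of_real[symmetric])
  also have "\<dots> = (\<Sum>i\<in>F. \<Sum>j\<in>F. \<integral>x. (c i * cnj (c j)) * (G i x * cnj (G j x)) \<partial>M)"
    unfolding eq
    by (subst Bochner_Integration.integral_sum; (intro Bochner_Integration.integrable_sum integrable_mult_right int sum.cong refl)?;
        (subst Bochner_Integration.integral_sum; (intro integrable_mult_right int)?)?) auto
  also have "\<dots> = (\<Sum>i\<in>F. \<Sum>j\<in>F. if j = i then of_real ((cmod (c i))\<^sup>2 * n i) else 0)"
  proof (intro sum.cong refl)
    fix i j assume "i \<in> F" "j \<in> F"
    then show "(\<integral>x. (c i * cnj (c j)) * (G i x * cnj (G j x)) \<partial>M) = (if j = i then of_real ((cmod (c i))\<^sup>2 * n i) else 0)"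
    proof (cases "j = i")
      case True
      have "(\<integral>x. (c i * cnj (c i)) * (G i x * cnj (G i x)) \<partial>M) = (c i * cnj (c i)) * of_real (n i)"
        by (simp only: integral_mult_right_zero diag[OF \<open>i \<in> F\<close>])
      then show ?thesis using True by (simp only: complex_norm_square[symmetric] of_real_mult if_True refl)
    next
      case False
      then show ?thesis using orth[OF \<open>i \<in> F\<close> \<open>j \<in> F\<close>] by simp
    qed
  qed
  also have "\<dots> = of_real (\<Sum>i\<in>F. (cmod (c i))\<^sup>2 * n i)" using F by simp
  finally show "(\<integral>x. (cmod (\<Sum>i\<in>F. c i * G i x))\<^sup>2 \<partial>M) = (\<Sum>i\<in>F. (cmod (c i))\<^sup>2 * n i)"
    by (simp only: of_real_eq_iff)
qed

lemma integrable_mult_chr: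
  assumes "f \<in> L2 torus"
  shows "integrable torus (\<lambda>x. complex_of_real (f x) * cnj (chr \<xi> x))"
proof (rule Bochner_Integration.integrable_bound[OF L2_integrable[OF finite_measure_torus assms]])
  have "(\<lambda>x. cnj (chr \<xi> x)) \<in> borel_measurable torus"
    by (intro borel_measurable_torus_continuous continuous_on_cnj continuous_chr)
  note [measurable] = this L2_measurable[OF assms]
  show "(\<lambda>x. complex_of_real (f x) * cnj (chr \<xi> x)) \<in> borel_measurable torus" by measurable
qed (simp add: norm_mult)

lemma fourier_diff: "f \<in> L2 torus \<Longrightarrow> g \<in> L2 torus \<Longrightarrow> fourier (\<lambda>x. f x - g x) \<xi> = fourier f \<xi> - fourier g \<xi>"
  by (simp add: fourier_chr left_diff_distrib integrable_mult_chr)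

lemma fourier_Re: "f \<in> L2 torus \<Longrightarrow> Re (fourier f \<xi>) = L2_inner torus f (\<lambda>x. Re (chr \<xi> x))"
  unfolding fourier_chr L2_inner_def by (subst integral_Re[symmetric]) (auto simp: integrable_mult_chr)

lemma fourier_Im: "f \<in> L2 torus \<Longrightarrow> Im (fourier f \<xi>) = L2_inner torus f (\<lambda>x. - Im (chr \<xi> x))"
  unfolding fourier_chr L2_inner_def by (subst integral_Im[symmetric]) (auto simp: integrable_mult_chr)

lemma chr_torus_orth:
  "(\<integral>x. chr \<xi> x * cnj (chr \<eta> x) \<partial>torus) = (if \<xi> = \<eta> then 1 else 0)"
  by (simp add: chr_mult_cnj integral_chr_torus)

lemma bessel:
  assumes q: "q \<in> L2 torus" and F: "finite F"
  shows "(\<Sum>\<xi>\<in>F. (cmod (fourier q \<xi>))\<^sup>2) \<le> (L2_norm torus q)\<^sup>2"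
proof -
  let ?S = "\<lambda>x. \<Sum>\<xi>\<in>F. fourier q \<xi> * chr \<xi> x"
  have int: "integrable torus (\<lambda>x. chr \<xi> x * cnj (chr \<eta> x))" for \<xi> \<eta> :: "int^'a"
    unfolding chr_mult_cnj by (rule integrable_torus_continuous_complex[OF continuous_chr])
  have S2: "integrable torus (\<lambda>x. (cmod (?S x))\<^sup>2)" "(\<integral>x. (cmod (?S x))\<^sup>2 \<partial>torus) = (\<Sum>\<xi>\<in>F. (cmod (fourier q \<xi>))\<^sup>2 * 1)"
    by (rule integral_norm_sq_orthogonal[where n = "\<lambda>_. 1", OF F]; simp add: int chr_torus_orth measure_torus)+
  have q2: "integrable torus (\<lambda>x. (q x)\<^sup>2)" using L2_integrable_sq[OF q] by simp
  have c: "integrable torus (\<lambda>x. \<Sum>\<xi>\<in>F. Re (cnj (fourier q \<xi>) * (of_real (q x) * cnj (chr \<xi> x))))"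
    by (intro Bochner_Integration.integrable_sum integrable_Re integrable_mult_right integrable_mult_chr q)
  have "(\<integral>x. (\<Sum>\<xi>\<in>F. Re (cnj (fourier q \<xi>) * (of_real (q x) * cnj (chr \<xi> x)))) \<partial>torus)
     = (\<Sum>\<xi>\<in>F. \<integral>x. Re (cnj (fourier q \<xi>) * (of_real (q x) * cnj (chr \<xi> x))) \<partial>torus)"
    by (rule Bochner_Integration.integral_sum) (intro integrable_Re integrable_mult_right integrable_mult_chr q)
  also have "\<dots> = (\<Sum>\<xi>\<in>F. Re (\<integral>x. cnj (fourier q \<xi>) * (of_real (q x) * cnj (chr \<xi> x)) \<partial>torus))"
    by (intro sum.cong refl integral_Re integrable_mult_right integrable_mult_chr q)
  also have "\<dots> = (\<Sum>\<xi>\<in>F. (cmod (fourier q \<xi>))\<^sup>2)"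
  proof (intro sum.cong refl)
    fix \<xi>
    have "(\<integral>x. cnj (fourier q \<xi>) * (of_real (q x) * cnj (chr \<xi> x)) \<partial>torus) = of_real ((cmod (fourier q \<xi>))\<^sup>2)"
      by (simp only: integral_mult_right_zero fourier_chr[symmetric] complex_norm_square) (rule mult.commute)
    then show "Re (\<integral>x. cnj (fourier q \<xi>) * (of_real (q x) * cnj (chr \<xi> x)) \<partial>torus) = (cmod (fourier q \<xi>))\<^sup>2"
      by (simp only: Re_complex_of_real)
  qed
  finally have cI: "(\<integral>x. (\<Sum>\<xi>\<in>F. Re (cnj (fourier q \<xi>) * (of_real (q x) * cnj (chr \<xi> x)))) \<partial>torus) = (\<Sum>\<xi>\<in>F. (cmod (fourier q \<xi>))\<^sup>2)" .
  \<comment> \<open>The integrand is |q - S|^2 with S the partial Fourier sum, written out so that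
    the integrals computed above apply.\<close>
  have "0 \<le> (\<integral>x. (q x)\<^sup>2 + (cmod (?S x))\<^sup>2 - 2 * (\<Sum>\<xi>\<in>F. Re (cnj (fourier q \<xi>) * (of_real (q x) * cnj (chr \<xi> x)))) \<partial>torus)"
  proof (rule Bochner_Integration.integral_nonneg_AE, rule AE_I2)
    fix x
    have "(\<Sum>\<xi>\<in>F. Re (cnj (fourier q \<xi>) * (of_real (q x) * cnj (chr \<xi> x)))) = Re (\<Sum>\<xi>\<in>F. of_real (q x) * cnj (fourier q \<xi> * chr \<xi> x))"
      by (simp add: mult_ac)
    also have "\<dots> = Re (of_real (q x) * cnj (?S x))" by (simp add: sum_distrib_left)
    also have "\<dots> = q x * Re (?S x)" by simp
    finally have "(q x)\<^sup>2 + (cmod (?S x))\<^sup>2 - 2 * (\<Sum>\<xi>\<in>F. Re (cnj (fourier q \<xi>) * (of_real (q x) * cnj (chr \<xi> x))))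
       = (q x - Re (?S x))\<^sup>2 + (Im (?S x))\<^sup>2"
      by (simp only: cmod_power2) (simp add: power2_eq_square algebra_simps)
    then show "0 \<le> (q x)\<^sup>2 + (cmod (?S x))\<^sup>2 - 2 * (\<Sum>\<xi>\<in>F. Re (cnj (fourier q \<xi>) * (of_real (q x) * cnj (chr \<xi> x))))"
      by simp
  qed
  also have "\<dots> = (L2_norm torus q)\<^sup>2 + (\<Sum>\<xi>\<in>F. (cmod (fourier q \<xi>))\<^sup>2) - 2 * (\<Sum>\<xi>\<in>F. (cmod (fourier q \<xi>))\<^sup>2)"
    using q2 S2 c cI by (simp add: L2_norm_sq_integral)
  finally show ?thesis by simp
qed

text \<open>The bound does not depend on F. This extends Parseval's formula from trigonometric
  polynomials by density, and later dominates the truncated work uniformly in the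
  truncation.\<close>

lemma fourier_pairing_bound:
  assumes m: "m \<in> L2 torus" and q: "q \<in> L2 torus" and F: "finite F"
  shows "cmod (\<Sum>\<xi>\<in>F. fourier m \<xi> * cnj (fourier q \<xi>)) \<le> L2_norm torus m * L2_norm torus q"
proof -
  have "cmod (\<Sum>\<xi>\<in>F. fourier m \<xi> * cnj (fourier q \<xi>)) \<le> (\<Sum>\<xi>\<in>F. \<bar>cmod (fourier m \<xi>)\<bar> * \<bar>cmod (fourier q \<xi>)\<bar>)"
    by (intro order_trans[OF norm_sum]) (simp add: norm_mult)
  also have "\<dots> \<le> L2_set (\<lambda>\<xi>. cmod (fourier m \<xi>)) F * L2_set (\<lambda>\<xi>. cmod (fourier q \<xi>)) F"
    by (rule L2_set_mult_ineq)
  also have "\<dots> \<le> L2_norm torus m * L2_norm torus q"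
    unfolding L2_set_def using bessel[OF m F] bessel[OF q F]
    by (intro mult_mono real_sqrt_ge_zero sum_nonneg) (auto intro!: real_le_lsqrt sum_nonneg)
  finally show ?thesis .
qed

section \<open>Trigonometric polynomials and Parseval's formula\<close>

inductive trig_poly :: "(real^'n \<Rightarrow> complex) \<Rightarrow> bool" where
  chr: "trig_poly (\<lambda>x. c * chr \<xi> x)"
| add: "trig_poly P \<Longrightarrow> trig_poly Q \<Longrightarrow> trig_poly (\<lambda>x. P x + Q x)"

text \<open>Frequencies add when characters are multiplied; the resulting algebra is what
  Stone-Weierstrass asks for.\<close>

lemma trig_poly_mult: "trig_poly P \<Longrightarrow> trig_poly Q \<Longrightarrow> trig_poly (\<lambda>x. P x * Q x)"
proof (induction rule: trig_poly.induct)
  case (chr c \<xi>)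
  then show ?case
  proof (induction rule: trig_poly.induct)
    case (chr d \<eta>)
    have "(\<lambda>x. (c * chr \<xi> x) * (d * chr \<eta> x)) = (\<lambda>x. (c * d) * chr (\<xi> + \<eta>) x)"
      by (simp add: chr_mult[symmetric] mult_ac)
    then show ?case using trig_poly.chr[of "c * d" "\<xi> + \<eta>"] by simp
  next
    case (add P Q)
    then show ?case using trig_poly.add by (simp add: distrib_left)
  qed
next
  case (add P1 P2)
  then show ?case using trig_poly.add by (simp add: distrib_right)
qed

lemma trig_poly_const: "trig_poly (\<lambda>_. c)"
  using trig_poly.chr[of c 0] by (simp add: chr_0)

lemma trig_poly_continuous: "trig_poly P \<Longrightarrow> continuous_on UNIV P"
  by (induction rule: trig_poly.induct) (intro continuous_intros continuous_chr; assumption?)+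

definition cfourier :: "(real^'n \<Rightarrow> complex) \<Rightarrow> int^'n \<Rightarrow> complex" where
  "cfourier P \<xi> = (\<integral>x. P x * cnj (chr \<xi> x) \<partial>torus)"

text \<open>Only finitely many coefficients of P are nonzero, so the partial sums are eventually
  constant along the filter of finite sets, and convergence can be stated as eventual
  equality.\<close>

lemma parseval_trig_poly:
  assumes m: "m \<in> L2 torus" and P: "trig_poly P"
  shows "integrable torus (\<lambda>x. of_real (m x) * cnj (P x)) \<and> (\<forall>\<^sub>F F in finite_subsets_at_top UNIV.
    (\<Sum>\<xi>\<in>F. fourier m \<xi> * cnj (cfourier P \<xi>)) = (\<integral>x. of_real (m x) * cnj (P x) \<partial>torus))"
  using P
proof (induction rule: trig_poly.induct)
  case (chr c \<eta>)
  have i: "integrable torus (\<lambda>x. cnj c * (of_real (m x) * cnj (chr \<eta> x)))"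
    by (intro integrable_mult_right integrable_mult_chr m)
  have eq: "of_real (m x) * cnj (c * chr \<eta> x) = cnj c * (of_real (m x) * cnj (chr \<eta> x))" for x by simp
  have cf: "cfourier (\<lambda>x. c * chr \<eta> x) \<xi> = (if \<xi> = \<eta> then c else 0)" for \<xi>
    unfolding cfourier_def mult.assoc by (simp add: chr_torus_orth)
  have "\<forall>\<^sub>F F in finite_subsets_at_top UNIV. finite F \<and> {\<eta>} \<subseteq> F \<and> F \<subseteq> UNIV"
    unfolding eventually_finite_subsets_at_top by (rule exI[of _ "{\<eta>}"]) auto
  then have "\<forall>\<^sub>F F in finite_subsets_at_top UNIV. (\<Sum>\<xi>\<in>F. fourier m \<xi> * cnj (cfourier (\<lambda>x. c * chr \<eta> x) \<xi>)) = (\<integral>x. of_real (m x) * cnj (c * chr \<eta> x) \<partial>torus)"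
  proof eventually_elim
    case (elim F)
    have "(\<Sum>\<xi>\<in>F. fourier m \<xi> * cnj (cfourier (\<lambda>x. c * chr \<eta> x) \<xi>)) = (\<Sum>\<xi>\<in>F. if \<xi> = \<eta> then fourier m \<eta> * cnj c else 0)"
      by (intro sum.cong) (auto simp: cf)
    also have "\<dots> = fourier m \<eta> * cnj c" using elim by simp
    also have "\<dots> = (\<integral>x. of_real (m x) * cnj (c * chr \<eta> x) \<partial>torus)"
      unfolding eq by (simp add: fourier_chr)
    finally show ?case .
  qed
  then show ?case using i unfolding eq by simp
next
  case (add P Q)
  have cf: "cfourier (\<lambda>x. P x + Q x) \<xi> = cfourier P \<xi> + cfourier Q \<xi>" for \<xi>
  proof -
    have "integrable torus (\<lambda>x. P x * cnj (chr \<xi> x))" "integrable torus (\<lambda>x. Q x * cnj (chr \<xi> x))"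
      by (intro integrable_torus_continuous_complex continuous_on_mult continuous_on_cnj trig_poly_continuous add.hyps continuous_chr)+
    then show ?thesis by (simp add: cfourier_def distrib_right)
  qed
  from add.IH(1) add.IH(2) have "\<forall>\<^sub>F F in finite_subsets_at_top UNIV.
     (\<Sum>\<xi>\<in>F. fourier m \<xi> * cnj (cfourier P \<xi>)) = (\<integral>x. of_real (m x) * cnj (P x) \<partial>torus) \<and>
     (\<Sum>\<xi>\<in>F. fourier m \<xi> * cnj (cfourier Q \<xi>)) = (\<integral>x. of_real (m x) * cnj (Q x) \<partial>torus)"
    by (simp add: eventually_conj_iff)
  then have "\<forall>\<^sub>F F in finite_subsets_at_top UNIV. (\<Sum>\<xi>\<in>F. fourier m \<xi> * cnj (cfourier (\<lambda>x. P x + Q x) \<xi>))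
     = (\<integral>x. of_real (m x) * cnj (P x + Q x) \<partial>torus)"
    by eventually_elim (use add.IH in \<open>simp add: cf distrib_left sum.distrib\<close>)
  then show ?case using add.IH by (simp add: distrib_left)
qed

lemma integer_translate_invariant:
  fixes p :: "real^'n \<Rightarrow> 'b"
  assumes per: "\<And>x i. p (x + axis i 1) = p x"
  shows "p (x + freq k) = p x"
proof -
  have nat: "p (x + real n *\<^sub>R axis i 1) = p x" for x i n
  proof (induction n)
    case (Suc n)
    have "x + real (Suc n) *\<^sub>R axis i 1 = (x + real n *\<^sub>R axis i 1) + axis i 1" by (simp add: algebra_simps)
    then show ?case by (simp only: per Suc)
  qed simp
  have int: "p (x + real_of_int n *\<^sub>R axis i 1) = p x" for x i n
  proof (cases "n \<ge> 0")
    case True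
    then show ?thesis using nat[of x "nat n" i] by simp
  next
    case False
    then show ?thesis using nat[of "x + real_of_int n *\<^sub>R axis i 1" "nat (- n)" i] by simp
  qed
  have sum: "p (x + (\<Sum>i\<in>I. real_of_int (k $ i) *\<^sub>R axis i 1)) = p x" if "finite I" for I x
    using that
  proof (induction I arbitrary: x)
    case (insert i I)
    have "x + (\<Sum>i\<in>insert i I. real_of_int (k $ i) *\<^sub>R axis i 1) = (x + real_of_int (k $ i) *\<^sub>R axis i 1) + (\<Sum>i\<in>I. real_of_int (k $ i) *\<^sub>R axis i 1)"
      using insert.hyps by (simp add: add.assoc)
    then show ?case by (simp only: insert.IH int)
  qed simp
  have "freq k = (\<Sum>i\<in>UNIV. real_of_int (k $ i) *\<^sub>R axis i 1)"
    using basis_expansion[of "freq k"] by (simp add: freq_def scalar_mult_eq_scaleR)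
  then show ?thesis using sum[of UNIV x] by simp
qed

text \<open>Stone-Weierstrass on the image \<open>K\<close> of the closed cube under
  \<open>E\<close>, the standard embedding of the torus into complex space. On the cube itself the
  characters do not separate opposite faces.\<close>

lemma trig_poly_dense:
  fixes p :: "real^'n \<Rightarrow> real"
  assumes cont: "continuous_on UNIV p" and per: "\<And>x i. p (x + axis i 1) = p x" and e: "e > 0"
  shows "\<exists>t. trig_poly (\<lambda>x. of_real (t x)) \<and> (\<forall>x\<in>cell. \<bar>p x - t x\<bar> < e)"
proof -
  define E :: "real^'n \<Rightarrow> complex^'n" where "E x = (\<chi> i. cis (2 * pi * (x $ i)))" for x
  let ?C = "cbox 0 (\<chi> i. 1) :: (real^'n) set"
  define K where "K = E ` ?C"
  have contE: "continuous_on A E" for A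
    unfolding E_def by (intro continuous_intros continuous_on_cis continuous_on_component)
  have cK: "compact K" unfolding K_def by (intro compact_continuous_image contE compact_cbox)
  \<comment> \<open>Points with the same image under \<open>E\<close> differ by an integer vector,
    so the periodic function p factors through \<open>K\<close>.\<close>
  have inv: "p x = p y" if "E x = E y" for x y
  proof -
    have "\<forall>i. \<exists>k::int. x $ i - y $ i = real_of_int k"
    proof
      fix i
      from that have "cis (2 * pi * (x $ i)) = cis (2 * pi * (y $ i))" by (simp add: E_def vec_eq_iff)
      then have "cis (2 * pi * (x $ i) - 2 * pi * (y $ i)) = 1"
        by (simp add: cis_divide[symmetric])
      then have "cos (2 * pi * (x $ i) - 2 * pi * (y $ i)) = 1" by (simp add: complex_eq_iff)
      then obtain k :: int where "2 * pi * (x $ i) - 2 * pi * (y $ i) = real_of_int k * 2 * pi"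
        unfolding cos_one_2pi_int by blast
      then have "2 * pi * (x $ i - y $ i) = 2 * pi * real_of_int k" by (simp add: algebra_simps)
      then have "x $ i - y $ i = real_of_int k" by simp
      then show "\<exists>k::int. x $ i - y $ i = real_of_int k" by blast
    qed
    then obtain k :: "'n \<Rightarrow> int" where "\<And>i. x $ i - y $ i = real_of_int (k i)" by metis
    then have "x = y + freq (\<chi> i. k i)" by (simp add: freq_def vec_eq_iff algebra_simps)
    then show ?thesis using integer_translate_invariant[of p, OF per] by simp
  qed
  define f where "f z = p (SOME x. x \<in> ?C \<and> E x = z)" for z
  have fE: "f (E x) = p x" if "x \<in> ?C" for x
  proof -
    have "\<exists>y. y \<in> ?C \<and> E y = E x" using that by blast
    from someI_ex[OF this] show ?thesis unfolding f_def using inv by metis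
  qed
  \<comment> \<open>The compact cube is mapped onto \<open>K\<close> by a closed map: preimages of
    closed sets under f are images under \<open>E\<close> of closed parts of the cube.\<close>
  have "continuous_on K f"
    unfolding continuous_on_closed_vimage[OF compact_imp_closed[OF cK]]
  proof (intro allI impI)
    fix B :: "real set" assume B: "closed B"
    have "f -` B \<inter> K = E ` (?C \<inter> p -` B)" using fE by (auto simp: K_def)
    moreover have "compact (?C \<inter> p -` B)"
      by (rule compact_Int_closed[OF compact_cbox]) (use B cont in \<open>simp add: continuous_on_closed_vimage\<close>)
    ultimately show "closed (f -` B \<inter> K)"
      using compact_continuous_image[OF contE] compact_imp_closed by metis
  qed
  moreover
  define R where "R = {f :: complex^'n \<Rightarrow> real. continuous_on K f \<and> trig_poly (\<lambda>x. of_real (f (E x)))}"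
  have trig_re: "trig_poly (\<lambda>x. of_real (Re (w * E x $ i)))" for w i
  proof -
    have "freq (axis i 1) = axis i 1" by (auto simp: freq_def axis_def vec_eq_iff)
    then have "chr (axis i 1) x = E x $ i" for x by (simp add: chr_def E_def inner_axis')
    then have "of_real (Re (w * E x $ i)) = (w / 2) * chr (axis i 1) x + (cnj w / 2) * chr (- axis i 1) x" for x
      unfolding chr_minus by (simp add: complex_eq_iff field_simps)
    then show ?thesis using trig_poly.add[OF trig_poly.chr[of "w / 2" "axis i 1"] trig_poly.chr[of "cnj w / 2" "- axis i 1"]]
      by simp
  qed
  have "function_ring_on R K"
  proof
    show "compact K" by (rule cK)
    show "continuous_on K f" if "f \<in> R" for f using that by (simp add: R_def)
    show "(\<lambda>x. f x + g x) \<in> R" if "f \<in> R" "g \<in> R" for f g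
      using that trig_poly.add by (auto simp: R_def intro: continuous_intros)
    show "(\<lambda>x. f x * g x) \<in> R" if "f \<in> R" "g \<in> R" for f g
      using that trig_poly_mult by (auto simp: R_def intro: continuous_intros)
    show "(\<lambda>_. c) \<in> R" for c by (simp add: R_def trig_poly_const)
    show "\<exists>f\<in>R. f z \<noteq> f w" if "z \<in> K" "w \<in> K" "z \<noteq> w" for z w
    proof -
      from that(3) obtain i where i: "z $ i \<noteq> w $ i" by (auto simp: vec_eq_iff)
      have "(\<lambda>z. Re (c * z $ i)) \<in> R" for c
        unfolding R_def using trig_re by (auto intro!: continuous_intros continuous_on_component)
      \<comment> \<open>The factor -\<i> turns the real part into the imaginary part, so the two
        functions together separate points.\<close>
      from this[of 1] this[of "- \<i>"] have R: "(\<lambda>z. Re (z $ i)) \<in> R" "(\<lambda>z. Im (z $ i)) \<in> R" by simp_all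
      from i have "Re (z $ i) \<noteq> Re (w $ i) \<or> Im (z $ i) \<noteq> Im (w $ i)" by (simp add: complex_eq_iff)
      then show ?thesis by (elim disjE) (rule bexI[OF _ R(1)], simp, rule bexI[OF _ R(2)], simp)
    qed
  qed
  ultimately obtain g where g: "g \<in> R" "\<And>z. z \<in> K \<Longrightarrow> \<bar>f z - g z\<bar> < e"
    using function_ring_on.Stone_Weierstrass_basic[of R K f e] e by metis
  show ?thesis
  proof (intro exI[of _ "\<lambda>x. g (E x)"] conjI ballI)
    show "trig_poly (\<lambda>x. of_real (g (E x)))" using g(1) by (simp add: R_def)
    fix x :: "real^'n" assume "x \<in> cell"
    then have "x \<in> ?C" using cell_subset_cbox by blast
    then show "\<bar>p x - g (E x)\<bar> < e" using g(2)[of "E x"] fE[of x] by (simp add: K_def)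
  qed
qed

text \<open>Approximation of q first by some p k and then by a trigonometric polynomial t, with
  \<open>fourier_pairing_bound\<close> controlling the error of the sums uniformly in F.
  Approximability of q by continuous periodic functions is a hypothesis because for a trace it is
  part of the definition.\<close>

lemma parseval_limit:
  fixes q m :: "real^'n \<Rightarrow> real"
  assumes m: "m \<in> L2 torus" and q: "q \<in> L2 torus"
    and p: "\<And>k::nat. continuous_on UNIV (p k)" "\<And>k x i. p k (x + axis i 1) = p k x"
      "(\<lambda>k. L2_norm torus (\<lambda>x. p k x - q x)) \<longlonglongrightarrow> 0"
  shows "((\<lambda>F. \<Sum>\<xi>\<in>F. Re (fourier m \<xi> * cnj (fourier q \<xi>))) \<longlongrightarrow> L2_inner torus m q) (finite_subsets_at_top UNIV)"
proof (rule tendstoI)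
  fix e :: real assume e: "e > 0"
  let ?n = "L2_norm torus m + 1"
  have n: "?n > 0" using L2_norm_nonneg[of torus m] by linarith
  \<comment> \<open>The error enters twice, through the inner product and through the Fourier sum,
    whence the 2; the 1 in \<open>?n\<close> protects against a zero norm of m.\<close>
  define d where "d = e / (2 * ?n)"
  have d: "d > 0" using e n by (simp add: d_def)
  have "\<forall>\<^sub>F k in sequentially. L2_norm torus (\<lambda>x. p k x - q x) < d / 2"
    using order_tendstoD(2)[OF p(3), of "d / 2"] d by simp
  then obtain k where k: "L2_norm torus (\<lambda>x. p k x - q x) < d / 2" by (auto simp: eventually_sequentially)
  obtain t where t: "trig_poly (\<lambda>x. of_real (t x))" "\<And>x. x \<in> cell \<Longrightarrow> \<bar>p k x - t x\<bar> < d / 2"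
    using trig_poly_dense[OF p(1)[of k] p(2)[of k], of "d / 2"] d half_gt_zero[OF d] by blast
  have tL: "t \<in> L2 torus"
    using continuous_on_Re[OF trig_poly_continuous[OF t(1)]] by (intro continuous_L2_torus) simp
  have pL: "p k \<in> L2 torus" by (rule continuous_L2_torus[OF p(1)])
  have "(L2_norm torus (\<lambda>x. t x - p k x))\<^sup>2 \<le> (d / 2)\<^sup>2"
  proof -
    have "(L2_norm torus (\<lambda>x. t x - p k x))\<^sup>2 \<le> (\<integral>x. (d / 2)\<^sup>2 \<partial>(torus :: (real^'n) measure))"
      unfolding L2_norm_sq_integral
    proof (rule integral_mono)
      show "integrable torus (\<lambda>x. (norm (t x - p k x))\<^sup>2)" by (rule L2_integrable_sq[OF L2_diff[OF tL pL]])
      show "integrable torus (\<lambda>x :: real^'n. (d / 2)\<^sup>2)" using finite_measure.integrable_const[OF finite_measure_torus] .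
      fix x :: "real^'n" assume "x \<in> space torus"
      then have "\<bar>p k x - t x\<bar> < d / 2" by (intro t(2)) (auto simp: torus_eq space_restrict_space)
      then have "norm (t x - p k x) \<le> d / 2" by (simp add: abs_minus_commute[of "t x"])
      then show "(norm (t x - p k x))\<^sup>2 \<le> (d / 2)\<^sup>2" by (intro power_mono) auto
    qed
    then show ?thesis by (simp add: measure_torus)
  qed
  then have "L2_norm torus (\<lambda>x. t x - p k x) \<le> d / 2" by (rule power2_le_imp_le) (use d in simp)
  then have tq: "L2_norm torus (\<lambda>x. t x - q x) < d"
    using L2_norm_triangle[OF L2_diff[OF tL pL] L2_diff[OF pL q]] k by simp
  have "\<forall>\<^sub>F F in finite_subsets_at_top UNIV. finite F \<and>
    (\<Sum>\<xi>\<in>F. fourier m \<xi> * cnj (cfourier (\<lambda>x. of_real (t x)) \<xi>)) = (\<integral>x. of_real (m x) * cnj (of_real (t x)) \<partial>torus)"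
    using parseval_trig_poly[OF m t(1)]
    by (intro eventually_conj[OF eventually_finite_subsets_at_top_weakI]) auto
  then show "\<forall>\<^sub>F F in finite_subsets_at_top UNIV. dist (\<Sum>\<xi>\<in>F. Re (fourier m \<xi> * cnj (fourier q \<xi>))) (L2_inner torus m q) < e"
  proof eventually_elim
    case (elim F)
    have "(\<integral>x. of_real (m x) * cnj (complex_of_real (t x)) \<partial>torus) = complex_of_real (L2_inner torus m t)"
      unfolding L2_inner_def by (subst integral_complex_of_real[symmetric]) simp
    then have "(\<Sum>\<xi>\<in>F. fourier m \<xi> * cnj (fourier t \<xi>)) = complex_of_real (L2_inner torus m t)"
      using elim by (simp add: cfourier_def fourier_chr)
    then have ft: "Re (\<Sum>\<xi>\<in>F. fourier m \<xi> * cnj (fourier t \<xi>)) = L2_inner torus m t" by simp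
    have "Re (\<Sum>\<xi>\<in>F. fourier m \<xi> * cnj (fourier (\<lambda>x. t x - q x) \<xi>)) = L2_inner torus m t - Re (\<Sum>\<xi>\<in>F. fourier m \<xi> * cnj (fourier q \<xi>))"
      unfolding ft[symmetric] by (simp add: fourier_diff[OF tL q] right_diff_distrib sum_subtractf)
    moreover have "L2_inner torus m (\<lambda>x. t x - q x) = L2_inner torus m t - L2_inner torus m q"
      by (rule L2_inner_diff_right[OF tL q m])
    ultimately have "\<bar>Re (\<Sum>\<xi>\<in>F. fourier m \<xi> * cnj (fourier q \<xi>)) - L2_inner torus m q\<bar>
       \<le> \<bar>L2_inner torus m (\<lambda>x. t x - q x)\<bar> + \<bar>Re (\<Sum>\<xi>\<in>F. fourier m \<xi> * cnj (fourier (\<lambda>x. t x - q x) \<xi>))\<bar>" by linarith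
    also have "\<dots> \<le> L2_norm torus m * L2_norm torus (\<lambda>x. t x - q x) + L2_norm torus m * L2_norm torus (\<lambda>x. t x - q x)"
      using elim order_trans[OF abs_Re_le_cmod fourier_pairing_bound[OF m L2_diff[OF tL q]]]
      by (intro add_mono L2_Cauchy_Schwarz m L2_diff tL q) auto
    also have "\<dots> \<le> 2 * L2_norm torus m * d"
      using tq mult_left_mono[of "L2_norm torus (\<lambda>x. t x - q x)" d "L2_norm torus m"] by simp
    also have "\<dots> < 2 * ?n * d" using d by simp
    also have "\<dots> = e" using n by (simp add: d_def field_simps)
    finally show ?case by (simp add: dist_real_def)
  qed
qed

lemma parseval_trace:
  assumes "m \<in> L2 torus" "has_trace ell a f q"
  shows "((\<lambda>F. \<Sum>\<xi>\<in>F. Re (fourier m \<xi> * cnj (fourier q \<xi>))) \<longlongrightarrow> L2_inner torus m q) (finite_subsets_at_top UNIV)"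
proof -
  from assms(2) obtain \<phi> where \<phi>: "\<And>k::nat. smooth_periodic (\<phi> k)" "q \<in> L2 torus"
    "(\<lambda>k. L2_norm torus (\<lambda>x. \<phi> k (x, a) - q x)) \<longlonglongrightarrow> 0" unfolding has_trace_def by blast
  show ?thesis
  proof (rule parseval_limit[OF assms(1) \<phi>(2) _ _ \<phi>(3)])
    show "continuous_on UNIV (\<lambda>x. \<phi> k (x, a))" for k by (rule continuous_slice[OF continuous_smooth_periodic[OF \<phi>(1)]])
    show "\<phi> k (x + axis i 1, a) = \<phi> k (x, a)" for k x i using \<phi>(1)[of k] by (simp add: smooth_periodic_def)
  qed
qed

section \<open>Divergence-free extension of boundary data\<close>

text \<open>Real modes with a power profile in y, each frequency having its own exponent. The class
  is closed under partial derivatives: a horizontal one multiplies the coefficient by 2 pi \<i>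
  times a component of \<xi>, the vertical one multiplies it by j / ell and lowers the
  exponent.\<close>

definition wave :: "real \<Rightarrow> (int^'n \<Rightarrow> complex) \<Rightarrow> (int^'n \<Rightarrow> nat) \<Rightarrow> (int^'n) set \<Rightarrow> 'n::finite pt \<Rightarrow> real" where
  "wave ell c j F z = (\<Sum>\<xi>\<in>F. Re (c \<xi> * chr \<xi> (fst z)) * (snd z / ell) ^ j \<xi>)"

lemma Re_chr: "Re (c * chr \<xi> x) = Re c * cos (2 * pi * (freq \<xi> \<bullet> x)) - Im c * sin (2 * pi * (freq \<xi> \<bullet> x))"
  by (simp add: chr_def)

lemma smooth_wave: "smooth_periodic (wave ell c j F)"
  unfolding wave_def
proof (intro smooth_periodic_sum smooth_periodic_mult)
  fix \<xi> assume "\<xi> \<in> F"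
  have ph: "C_infinity (\<lambda>z :: 'a pt. 2 * pi * (freq \<xi> \<bullet> fst z))"
    using C_infinity_inner[of "(2 * pi) *\<^sub>R (freq \<xi>, 0 :: real)"] by (simp add: inner_prod_def inner_commute)
  have "C_infinity (\<lambda>z :: 'a pt. Re (c \<xi> * chr \<xi> (fst z)))" unfolding Re_chr
    by (intro C_infinity_diff C_infinity_mult C_infinity_const C_infinity_compose[OF C_infinity_cos ph] C_infinity_compose[OF C_infinity_sin ph])
  then show "smooth_periodic (\<lambda>z. Re (c \<xi> * chr \<xi> (fst z)))"
    by (simp add: smooth_periodic_def chr_periodic)
  have "C_infinity (\<lambda>y::real. (1 / ell * y + 0) ^ j \<xi>)" by (intro C_infinity_power C_infinity_affine)
  then show "smooth_periodic (\<lambda>z. (snd z / ell) ^ j \<xi>)" using smooth_periodic_snd by fastforce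
qed

lemma snd_power_has_derivative:
  fixes z :: "'n::finite pt"
  shows "((\<lambda>z. (snd z / ell) ^ n) has_derivative (\<lambda>v. real n * (snd v / ell) * (snd z / ell) ^ (n - 1))) (at z)"
  by (rule has_derivative_eq_rhs[OF has_derivative_power[OF bounded_linear_imp_has_derivative[OF
      bounded_linear_compose[OF bounded_linear_divide bounded_linear_snd]]]]) auto

lemma wave_has_derivative:
  "(wave ell c j F has_derivative (\<lambda>v. \<Sum>\<xi>\<in>F.
      Re (of_real (2 * pi * (freq \<xi> \<bullet> fst v)) * \<i> * c \<xi> * chr \<xi> (fst z)) * (snd z / ell) ^ j \<xi>
      + Re (c \<xi> * chr \<xi> (fst z)) * (real (j \<xi>) * (snd v / ell) * (snd z / ell) ^ (j \<xi> - 1)))) (at z)"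
  unfolding wave_def
proof (rule has_derivative_sum)
  fix \<xi> assume "\<xi> \<in> F"
  let ?th = "\<lambda>z :: 'a pt. 2 * pi * (freq \<xi> \<bullet> fst z)"
  have th: "(?th has_derivative ?th) (at z)"
    by (intro bounded_linear_imp_has_derivative bounded_linear_mult_right[THEN bounded_linear_compose]
        bounded_linear_inner_right[THEN bounded_linear_compose] bounded_linear_fst)
  have 1: "((\<lambda>z. Re (c \<xi> * chr \<xi> (fst z))) has_derivative
      (\<lambda>v. Re (of_real (?th v) * \<i> * c \<xi> * chr \<xi> (fst z)))) (at z)"
    unfolding Re_chr
    by (rule has_derivative_eq_rhs[OF has_derivative_diff[OF has_derivative_mult_right[OF has_derivative_cos[OF th]]
            has_derivative_mult_right[OF has_derivative_sin[OF th]]]]) (auto simp: chr_def algebra_simps)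
  have 2: "((\<lambda>z :: 'a pt. (snd z / ell) ^ j \<xi>) has_derivative
      (\<lambda>v. real (j \<xi>) * (snd v / ell) * (snd z / ell) ^ (j \<xi> - 1))) (at z)"
    by (rule snd_power_has_derivative)
  show "((\<lambda>z. Re (c \<xi> * chr \<xi> (fst z)) * (snd z / ell) ^ j \<xi>) has_derivative
     (\<lambda>v. Re (of_real (2 * pi * (freq \<xi> \<bullet> fst v)) * \<i> * c \<xi> * chr \<xi> (fst z)) * (snd z / ell) ^ j \<xi>
      + Re (c \<xi> * chr \<xi> (fst z)) * (real (j \<xi>) * (snd v / ell) * (snd z / ell) ^ (j \<xi> - 1)))) (at z)"
    by (rule has_derivative_eq_rhs[OF has_derivative_mult[OF 1 2]]) (auto simp: algebra_simps)
qed

lemma pd_wave_horizontal: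
  "pd (axis i 1, 0) (wave ell c j F) = wave ell (\<lambda>\<xi>. of_real (2 * pi * real_of_int (\<xi> $ i)) * \<i> * c \<xi>) j F"
proof
  fix z
  show "pd (axis i 1, 0) (wave ell c j F) z = wave ell (\<lambda>\<xi>. of_real (2 * pi * real_of_int (\<xi> $ i)) * \<i> * c \<xi>) j F z"
    unfolding pd_eqI[OF wave_has_derivative] wave_def by (intro sum.cong refl) (simp add: freq_inner_axis)
qed

lemma pd_wave_vertical:
  "pd (0, 1) (wave ell c j F) = wave ell (\<lambda>\<xi>. of_real (real (j \<xi>) / ell) * c \<xi>) (\<lambda>\<xi>. j \<xi> - 1) F"
proof
  fix z
  show "pd (0, 1) (wave ell c j F) z = wave ell (\<lambda>\<xi>. of_real (real (j \<xi>) / ell) * c \<xi>) (\<lambda>\<xi>. j \<xi> - 1) F z"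
    unfolding pd_eqI[OF wave_has_derivative] wave_def by (intro sum.cong refl) (simp add: algebra_simps diff_divide_distrib add_divide_distrib)
qed

lemma integral_slab_power:
  assumes ell: "ell > 0"
  shows "(\<integral>z. (snd z / ell) ^ n \<partial>(slab ell :: 'n::finite pt measure)) = ell / real (n + 1)"
proof -
  let ?F = "\<lambda>z :: 'n pt. ell / real (n + 1) * (snd z / ell) ^ (n + 1)"
  have d: "(?F has_derivative (\<lambda>v. snd v * (snd z / ell) ^ n)) (at z)" for z
  proof (rule has_derivative_eq_rhs[OF has_derivative_mult_right[OF snd_power_has_derivative]], rule ext)
    fix v :: "'n pt"
    have c: "ell / m * (m * (a / ell) * b) = a * b" if "m > 0" for m a b :: real using that ell by (simp add: field_simps)
    show "ell / real (n + 1) * (real (n + 1) * (snd v / ell) * (snd z / ell) ^ (n + 1 - 1)) = snd v * (snd z / ell) ^ n"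
      by (subst c) auto
  qed
  have "(\<integral>z. snd (0 :: real^'n, 1::real) * (snd z / ell) ^ n \<partial>(slab ell :: 'n pt measure)) = (\<integral>x. ?F (x, ell) \<partial>torus) - (\<integral>x. ?F (x, 0) \<partial>torus)"
  proof (rule slab_integral_vertical[OF d _ ell])
    show "continuous_on UNIV (\<lambda>z :: 'n pt. snd (0 :: real^'n, 1::real) * (snd z / ell) ^ n)"
      using ell by (intro continuous_intros) auto
  qed
  then show ?thesis using ell by (simp add: measure_torus)
qed

text \<open>Distinct frequencies are orthogonal already in x, whatever their profiles, and each
  profile contributes the integral of (y / ell)^(2 j), that is ell / (2 j + 1). This denominator is
  the gain from the boundary layer. Passing to the real part costs only an inequality.\<close>

lemma wave_L2_bound:
  fixes F :: "(int^'n::finite) set"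
  assumes ell: "ell > 0" and F: "finite F"
  shows "(L2_norm (slab ell) (wave ell c j F))\<^sup>2 \<le> ell * (\<Sum>\<xi>\<in>F. (cmod (c \<xi>))\<^sup>2 / real (2 * j \<xi> + 1))"
proof -
  define G where "G \<xi> z = chr \<xi> (fst z) * of_real ((snd z / ell) ^ j \<xi>)" for \<xi> :: "int^'n" and z :: "'n pt"
  have GG: "G \<xi> z * cnj (G \<eta> z) = chr (\<xi> - \<eta>) (fst z) * of_real ((snd z / ell) ^ (j \<xi> + j \<eta>))" for \<xi> \<eta> z
    unfolding G_def chr_mult_cnj[symmetric] by (simp add: power_add mult_ac)
  have cc: "continuous_on UNIV (\<lambda>y. (y / ell) ^ n)" for n using ell by (intro continuous_intros) auto
  have int: "integrable (slab ell) (\<lambda>z. G \<xi> z * cnj (G \<eta> z))" for \<xi> \<eta>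
    unfolding GG
    by (intro integrable_slab_continuous_complex continuous_on_mult continuous_on_of_real continuous_on_compose2[OF cc]
        continuous_on_compose2[OF continuous_chr] continuous_on_fst continuous_on_snd continuous_on_id) auto
  have orth: "(\<integral>z. G \<xi> z * cnj (G \<eta> z) \<partial>slab ell) = 0" if "\<xi> \<noteq> \<eta>" for \<xi> \<eta>
    unfolding GG using that by (intro integral_chr_slab[OF cc]) simp
  have diag: "(\<integral>z. G \<xi> z * cnj (G \<xi> z) \<partial>slab ell) = of_real (ell / real (2 * j \<xi> + 1))" for \<xi>
  proof -
    have "(\<integral>z. G \<xi> z * cnj (G \<xi> z) \<partial>slab ell) = (\<integral>z. complex_of_real ((snd z / ell) ^ (2 * j \<xi>)) \<partial>(slab ell :: 'n pt measure))"
      unfolding GG by (simp add: chr_0 mult_2)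
    also have "\<dots> = of_real (ell / real (2 * j \<xi> + 1))"
      unfolding integral_complex_of_real integral_slab_power[OF ell] by simp
    finally show ?thesis .
  qed
  have O: "integrable (slab ell) (\<lambda>z. (cmod (\<Sum>\<xi>\<in>F. c \<xi> * G \<xi> z))\<^sup>2)"
    "(\<integral>z. (cmod (\<Sum>\<xi>\<in>F. c \<xi> * G \<xi> z))\<^sup>2 \<partial>slab ell) = (\<Sum>\<xi>\<in>F. (cmod (c \<xi>))\<^sup>2 * (ell / real (2 * j \<xi> + 1)))"
    by (rule integral_norm_sq_orthogonal[where n = "\<lambda>\<xi>. ell / real (2 * j \<xi> + 1)", OF F];
        (rule int | rule diag | (rule orth, assumption)))+
  have "(L2_norm (slab ell) (wave ell c j F))\<^sup>2 \<le> (\<integral>z. (cmod (\<Sum>\<xi>\<in>F. c \<xi> * G \<xi> z))\<^sup>2 \<partial>slab ell)"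
    unfolding L2_norm_sq_integral
  proof (rule integral_mono)
    show "integrable (slab ell) (\<lambda>z. (norm (wave ell c j F z))\<^sup>2)" by (rule L2_integrable_sq[OF L2_smooth_periodic[OF smooth_wave]])
    show "integrable (slab ell) (\<lambda>z. (cmod (\<Sum>\<xi>\<in>F. c \<xi> * G \<xi> z))\<^sup>2)" by (rule O(1))
    have "wave ell c j F z = Re (\<Sum>\<xi>\<in>F. c \<xi> * G \<xi> z)" for z
      unfolding wave_def G_def by (simp add: sum_distrib_right algebra_simps)
    then show "(norm (wave ell c j F z))\<^sup>2 \<le> (cmod (\<Sum>\<xi>\<in>F. c \<xi> * G \<xi> z))\<^sup>2" for z
      using abs_Re_le_cmod[of "\<Sum>\<xi>\<in>F. c \<xi> * G \<xi> z"] by (intro power_mono) auto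
  qed
  also have "\<dots> = ell * (\<Sum>\<xi>\<in>F. (cmod (c \<xi>))\<^sup>2 / real (2 * j \<xi> + 1))"
    unfolding O(2) by (simp add: sum_distrib_left mult_ac)
  finally show ?thesis .
qed

lemma wave_L2_bound_weight:
  fixes F :: "(int^'n::finite) set"
  assumes ell: "ell > 0" and F: "finite F"
    and b: "\<And>\<xi>. \<xi> \<in> F \<Longrightarrow> (cmod (d \<xi>))\<^sup>2 / real (2 * j \<xi> + 1) \<le> B * w \<xi>"
  shows "(L2_norm (slab ell) (wave ell d j F))\<^sup>2 \<le> ell * B * (\<Sum>\<xi>\<in>F. w \<xi>)"
proof -
  have "ell * (\<Sum>\<xi>\<in>F. (cmod (d \<xi>))\<^sup>2 / real (2 * j \<xi> + 1)) \<le> ell * (\<Sum>\<xi>\<in>F. B * w \<xi>)"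
    using ell b by (intro mult_left_mono sum_mono) auto
  then show ?thesis using wave_L2_bound[OF ell F, of d j] by (simp add: sum_distrib_left mult_ac)
qed

text \<open>The + 1 gives an exponent of at least 2 for \<xi> \<noteq> 0, so the horizontal
  components of the extension, whose exponent is one less, still vanish at y = 0.\<close>

definition decay_exp :: "int^'n \<Rightarrow> nat" where
  "decay_exp \<xi> = nat \<lceil>norm (freq \<xi>)\<rceil> + 1"

text \<open>The solution a parallel to \<xi> of 2 pi \<i> (\<xi> \<bullet> a) = - (k / ell) c with k
  = \<open>decay_exp \<xi>\<close>: the horizontal divergence has to cancel the vertical derivative
  of (y / ell)^k.\<close>

definition extension_coeff :: "real \<Rightarrow> (int^'n \<Rightarrow> complex) \<Rightarrow> 'n \<Rightarrow> int^'n \<Rightarrow> complex" where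
  "extension_coeff ell c i \<xi> =
     of_real (real_of_int (\<xi> $ i) * real (decay_exp \<xi>) / (2 * pi * (norm (freq \<xi>))\<^sup>2 * ell)) * \<i> * c \<xi>"

text \<open>Divergence-free field with vertical component \<open>\<Sum> Re (c \<xi> e\<^sub>\<xi>) (y/\<ell>)\<^sup>k\<close>; the exponent \<open>k \<approx> |\<xi>|\<close> puts it in a
  boundary layer of width \<open>1/|\<xi>|\<close>, which makes the \<open>H\<^sup>1\<close> norm comparable to the \<open>H\<^bsup>1/2\<^esup>\<close> norm of the boundary data.\<close>

definition extension :: "real \<Rightarrow> (int^'n) set \<Rightarrow> (int^'n \<Rightarrow> complex) \<Rightarrow> 'n::finite pt \<Rightarrow> 'n pt" where
  "extension ell F c z =
     ((\<chi> i. wave ell (extension_coeff ell c i) (\<lambda>\<xi>. decay_exp \<xi> - 1) F z), wave ell c decay_exp F z)"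

lemma vec_comp_extension:
  "vec_comp (extension ell F c) (0, 1) = wave ell c decay_exp F"
  "vec_comp (extension ell F c) (axis i 1, 0) = wave ell (extension_coeff ell c i) (\<lambda>\<xi>. decay_exp \<xi> - 1) F"
  by (auto simp: vec_comp_def extension_def inner_prod_def inner_axis)

lemma norm_freq_ge_1:
  fixes \<xi> :: "int^'n"
  assumes "\<xi> \<noteq> 0" shows "1 \<le> norm (freq \<xi>)"
proof -
  from assms obtain i where "\<xi> $ i \<noteq> 0" by (auto simp: vec_eq_iff)
  then have "1 \<le> \<bar>freq \<xi> $ i\<bar>" by (simp add: freq_def)
  then show ?thesis using component_le_norm_cart[of "freq \<xi>" i] by linarith
qed

lemma decay_exp_bounds:
  fixes \<xi> :: "int^'n"
  assumes "\<xi> \<noteq> 0"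
  shows "2 \<le> decay_exp \<xi>" "norm (freq \<xi>) \<le> real (decay_exp \<xi>)" "real (decay_exp \<xi>) \<le> 3 * norm (freq \<xi>)"
proof -
  have n: "1 \<le> norm (freq \<xi>)" by (rule norm_freq_ge_1[OF assms])
  then have k: "real (decay_exp \<xi>) = real_of_int \<lceil>norm (freq \<xi>)\<rceil> + 1" by (simp add: decay_exp_def)
  show "norm (freq \<xi>) \<le> real (decay_exp \<xi>)" "real (decay_exp \<xi>) \<le> 3 * norm (freq \<xi>)"
    unfolding k using n by linarith+
  have "2 \<le> real (decay_exp \<xi>)" unfolding k using n by linarith
  then show "2 \<le> decay_exp \<xi>" by simp
qed

lemma sum_pt_Basis:
  fixes f :: "'n::finite pt \<Rightarrow> real"
  shows "(\<Sum>b\<in>Basis. f b) = (\<Sum>i\<in>UNIV. f (axis i 1, 0)) + f (0, 1)"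
proof -
  have B: "(Basis :: 'n pt set) = range (\<lambda>i. (axis i 1, 0)) \<union> {(0, 1)}"
    by (auto simp: Basis_prod_def Basis_vec_def)
  have "inj (\<lambda>i. (axis i 1 :: real^'n, 0::real))" by (auto intro!: injI simp: axis_eq_axis)
  then show ?thesis unfolding B by (subst sum.union_disjoint) (auto simp: sum.reindex)
qed

text \<open>\<open>0 \<notin> F\<close> is the compatibility condition: a divergence-free field
  vanishing at the bottom has no net flux through the top. The divergence cancels frequency by
  frequency, because after differentiation all terms carry the same profile, of exponent
  \<open>decay_exp \<xi> - 1\<close>.\<close>

lemma extension_H1_sol:
  fixes F :: "(int^'n::finite) set"
  assumes F: "finite F" "0 \<notin> F" and ell: "ell > 0"
  shows "extension ell F c \<in> H1_sol ell"
    and "has_trace ell ell (\<lambda>z. snd (extension ell F c z)) (\<lambda>x. \<Sum>\<xi>\<in>F. Re (c \<xi> * chr \<xi> x))"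
proof -
  have sm: "\<forall>b\<in>Basis. smooth_periodic (vec_comp (extension ell F c) b)"
    unfolding ball_pt_Basis vec_comp_extension by (simp add: smooth_wave)
  have wz: "wave ell d j F (x, 0) = 0" if "\<And>\<xi>. \<xi> \<in> F \<Longrightarrow> j \<xi> \<noteq> 0" for d j and x :: "real^'n"
    unfolding wave_def
  proof (intro sum.neutral ballI)
    fix \<xi> assume "\<xi> \<in> F"
    from that[OF this] show "Re (d \<xi> * chr \<xi> (fst (x, 0))) * (snd (x, 0) / ell) ^ j \<xi> = 0" by (simp add: power_0_left)
  qed
  have k: "decay_exp \<xi> \<noteq> 0" "decay_exp \<xi> - 1 \<noteq> 0" if "\<xi> \<in> F" for \<xi>
    using decay_exp_bounds(1)[of \<xi>] that F(2) by (cases "\<xi> = 0"; auto)+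
  have z: "\<forall>b\<in>Basis. \<forall>x. vec_comp (extension ell F c) b (x, 0) = 0"
    unfolding ball_pt_Basis vec_comp_extension by (intro conjI allI wz k)
  have tr: "has_trace ell 0 (vec_comp (extension ell F c) b) (\<lambda>_. 0)" if "b \<in> Basis" for b
    using has_trace_smooth[of "vec_comp (extension ell F c) b" ell 0] sm z that by simp
  have "AE z in slab ell. \<forall>b\<in>Basis. weak_partial ell b (vec_comp (extension ell F c) b) z = pd b (vec_comp (extension ell F c) b) z"
    using sm by (intro AE_finite_allI weak_partial_smooth) auto
  then have "div_free ell (extension ell F c)" unfolding div_free_def
  proof eventually_elim
    case (elim z)
    have "(\<Sum>b\<in>Basis. weak_partial ell b (vec_comp (extension ell F c) b) z) = (\<Sum>b\<in>Basis. pd b (vec_comp (extension ell F c) b) z)"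
      using elim by (intro sum.cong) auto
    also have "\<dots> = (\<Sum>i\<in>UNIV. pd (axis i 1, 0) (vec_comp (extension ell F c) (axis i 1, 0)) z) + pd (0, 1) (vec_comp (extension ell F c) (0, 1)) z"
      by (rule sum_pt_Basis)
    also have "\<dots> = (\<Sum>\<xi>\<in>F. (\<Sum>i\<in>UNIV. Re (of_real (2 * pi * real_of_int (\<xi> $ i)) * \<i> * extension_coeff ell c i \<xi> * chr \<xi> (fst z)) * (snd z / ell) ^ (decay_exp \<xi> - 1))
       + Re (of_real (real (decay_exp \<xi>) / ell) * c \<xi> * chr \<xi> (fst z)) * (snd z / ell) ^ (decay_exp \<xi> - 1))"
      unfolding vec_comp_extension pd_wave_horizontal pd_wave_vertical wave_def sum.distrib by (subst sum.swap) simp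
    also have "\<dots> = (\<Sum>\<xi>\<in>F. 0)"
    proof (intro sum.cong refl)
      fix \<xi> assume "\<xi> \<in> F"
      then have n: "norm (freq \<xi>) \<noteq> 0" using norm_freq_ge_1[of \<xi>] F(2) by fastforce
      let ?k = "real (decay_exp \<xi>)" and ?n2 = "(norm (freq \<xi>))\<^sup>2"
      have "of_real (2 * pi * real_of_int (\<xi> $ i)) * \<i> * extension_coeff ell c i \<xi> = of_real (- ((real_of_int (\<xi> $ i))\<^sup>2) * (?k / (?n2 * ell))) * c \<xi>" for i
        unfolding extension_coeff_def by (simp add: field_simps power2_eq_square)
      then have "(\<Sum>i\<in>UNIV. Re (of_real (2 * pi * real_of_int (\<xi> $ i)) * \<i> * extension_coeff ell c i \<xi> * chr \<xi> (fst z)))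
         = (\<Sum>i\<in>UNIV. - ((real_of_int (\<xi> $ i))\<^sup>2)) * (?k / (?n2 * ell)) * Re (c \<xi> * chr \<xi> (fst z))"
        unfolding sum_distrib_right by (intro sum.cong refl) (simp add: algebra_simps)
      \<comment> \<open>Summing over the directions restores |\<xi>|^2, which cancels the
        denominator of \<open>extension_coeff\<close>.\<close>
      also have "(\<Sum>i\<in>UNIV. - ((real_of_int (\<xi> $ i))\<^sup>2)) = - ?n2"
        unfolding power2_norm_eq_inner by (simp add: inner_vec_def freq_def power2_eq_square sum_negf)
      also have "- ?n2 * (?k / (?n2 * ell)) = - (?k / ell)" using n by simp
      finally have s0: "(\<Sum>i\<in>UNIV. Re (of_real (2 * pi * real_of_int (\<xi> $ i)) * \<i> * extension_coeff ell c i \<xi> * chr \<xi> (fst z)))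
         = - (?k / ell) * Re (c \<xi> * chr \<xi> (fst z))" .
      have s1: "Re (of_real (?k / ell) * c \<xi> * chr \<xi> (fst z)) = (?k / ell) * Re (c \<xi> * chr \<xi> (fst z))"
      proof -
        have "Re (of_real a * w) = a * Re w" for a w by simp
        then show ?thesis unfolding mult.assoc .
      qed
      show "(\<Sum>i\<in>UNIV. Re (of_real (2 * pi * real_of_int (\<xi> $ i)) * \<i> * extension_coeff ell c i \<xi> * chr \<xi> (fst z)) * (snd z / ell) ^ (decay_exp \<xi> - 1))
       + Re (of_real (?k / ell) * c \<xi> * chr \<xi> (fst z)) * (snd z / ell) ^ (decay_exp \<xi> - 1) = 0"
        unfolding sum_distrib_right[symmetric] s0 s1 by (simp add: algebra_simps)
    qed
    finally show ?case by simp
  qed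
  then show "extension ell F c \<in> H1_sol ell"
    unfolding H1_sol_def using sm tr H1_smooth by blast
  have "has_trace ell ell (wave ell c decay_exp F) (\<lambda>x. wave ell c decay_exp F (x, ell))"
    by (rule has_trace_smooth[OF smooth_wave])
  moreover have "(\<lambda>z. snd (extension ell F c z)) = wave ell c decay_exp F" by (auto simp: extension_def)
  moreover have "(\<lambda>x. wave ell c decay_exp F (x, ell)) = (\<lambda>x. \<Sum>\<xi>\<in>F. Re (c \<xi> * chr \<xi> x))"
    using ell by (auto simp: wave_def)
  ultimately show "has_trace ell ell (\<lambda>z. snd (extension ell F c z)) (\<lambda>x. \<Sum>\<xi>\<in>F. Re (c \<xi> * chr \<xi> x))" by simp
qed

lemma extension_coeff_bound:
  fixes \<xi> :: "int^'n"
  assumes "\<xi> \<noteq> 0" "ell > 0"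
  shows "cmod (extension_coeff ell c i \<xi>) \<le> real (decay_exp \<xi>) / (norm (freq \<xi>) * (2 * pi * ell)) * cmod (c \<xi>)"
proof -
  have n: "norm (freq \<xi>) > 0" using norm_freq_ge_1[OF assms(1)] by linarith
  have "\<bar>real_of_int (\<xi> $ i)\<bar> \<le> norm (freq \<xi>)"
    using component_le_norm_cart[of "freq \<xi>" i] by (simp add: freq_def)
  then have "\<bar>real_of_int (\<xi> $ i)\<bar> * (real (decay_exp \<xi>) / (2 * pi * (norm (freq \<xi>))\<^sup>2 * ell))
     \<le> norm (freq \<xi>) * (real (decay_exp \<xi>) / (2 * pi * (norm (freq \<xi>))\<^sup>2 * ell))"
    using assms(2) by (intro mult_right_mono) auto
  also have "\<dots> = real (decay_exp \<xi>) / (norm (freq \<xi>) * (2 * pi * ell))"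
    using n by (simp add: power2_eq_square field_simps)
  finally show ?thesis unfolding extension_coeff_def norm_mult
    using assms(2) by (intro mult_right_mono) (auto simp: norm_mult norm_divide norm_power abs_mult power2_eq_square)
qed

lemma extension_L2_bound:
  fixes F :: "(int^'n::finite) set"
  assumes F: "finite F" "0 \<notin> F" and ell: "ell > 0"
  shows "(L2_norm (slab ell) (extension ell F c))\<^sup>2 \<le> real DIM('n pt) * (ell * (1 + 9 / ell\<^sup>2)) * (\<Sum>\<xi>\<in>F. (cmod (c \<xi>))\<^sup>2)"
proof -
  \<comment> \<open>The 1 covers the vertical component and 9 / ell^2 the horizontal ones, whose
    coefficients are at most 3 / ell times c because \<open>decay_exp \<xi>\<close> is at most 3
    |\<xi>|.\<close>
  let ?B = "1 + 9 / ell\<^sup>2" and ?w = "\<lambda>\<xi>. (cmod (c \<xi>))\<^sup>2"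
  have B1: "1 \<le> ?B" by simp
  have "(L2_norm (slab ell) (wave ell c decay_exp F))\<^sup>2 \<le> ell * ?B * sum ?w F"
  proof (rule wave_L2_bound_weight[OF ell F(1)])
    fix \<xi> assume "\<xi> \<in> F"
    have "?w \<xi> / real (2 * decay_exp \<xi> + 1) \<le> ?w \<xi> / 1" by (intro divide_left_mono) auto
    also have "\<dots> \<le> ?B * ?w \<xi>" using mult_right_mono[OF B1, of "?w \<xi>"] by simp
    finally show "?w \<xi> / real (2 * decay_exp \<xi> + 1) \<le> ?B * ?w \<xi>" .
  qed
  moreover have "(L2_norm (slab ell) (wave ell (extension_coeff ell c i) (\<lambda>\<xi>. decay_exp \<xi> - 1) F))\<^sup>2 \<le> ell * ?B * sum ?w F" for i
  proof (rule wave_L2_bound_weight[OF ell F(1)])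
    fix \<xi> assume "\<xi> \<in> F"
    then have x: "\<xi> \<noteq> 0" using F(2) by auto
    let ?n = "norm (freq \<xi>)"
    have n: "?n > 0" using norm_freq_ge_1[OF x] by linarith
    have "cmod (extension_coeff ell c i \<xi>) \<le> real (decay_exp \<xi>) / (?n * (2 * pi * ell)) * cmod (c \<xi>)"
      by (rule extension_coeff_bound[OF x ell])
    also have "\<dots> \<le> 3 / ell * cmod (c \<xi>)"
    proof (intro mult_right_mono)
      have "real (decay_exp \<xi>) / (?n * (2 * pi * ell)) \<le> (3 * ?n) / (?n * (2 * pi * ell))"
        using decay_exp_bounds(3)[OF x] n ell by (intro divide_right_mono) auto
      also have "\<dots> = 3 / ell * (1 / (2 * pi))" using n by simp
      also have "\<dots> \<le> 3 / ell * 1" using ell pi_ge_two by (intro mult_left_mono) (auto simp: field_simps)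
      finally show "real (decay_exp \<xi>) / (?n * (2 * pi * ell)) \<le> 3 / ell" by simp
    qed simp
    finally have "(cmod (extension_coeff ell c i \<xi>))\<^sup>2 \<le> (3 / ell * cmod (c \<xi>))\<^sup>2" by (intro power_mono) auto
    also have "\<dots> = 9 / ell\<^sup>2 * ?w \<xi>" by (simp add: power_mult_distrib power_divide)
    also have "\<dots> \<le> ?B * ?w \<xi>" by (intro mult_right_mono) auto
    finally have "(cmod (extension_coeff ell c i \<xi>))\<^sup>2 \<le> ?B * ?w \<xi>" .
    moreover have "(cmod (extension_coeff ell c i \<xi>))\<^sup>2 / real (2 * (decay_exp \<xi> - 1) + 1) \<le> (cmod (extension_coeff ell c i \<xi>))\<^sup>2 / 1"
      by (intro divide_left_mono) auto
    ultimately show "(cmod (extension_coeff ell c i \<xi>))\<^sup>2 / real (2 * (decay_exp \<xi> - 1) + 1) \<le> ?B * ?w \<xi>" by simp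
  qed
  ultimately have comp: "\<forall>b\<in>Basis. (L2_norm (slab ell) (vec_comp (extension ell F c) b))\<^sup>2 \<le> ell * ?B * sum ?w F"
    unfolding ball_pt_Basis vec_comp_extension by blast
  have sm: "\<forall>b\<in>Basis. vec_comp (extension ell F c) b \<in> L2 (slab ell)"
    unfolding ball_pt_Basis vec_comp_extension by (simp add: smooth_wave L2_smooth_periodic)
  then have "(L2_norm (slab ell) (extension ell F c))\<^sup>2 = (\<Sum>b\<in>Basis. (L2_norm (slab ell) (vec_comp (extension ell F c) b))\<^sup>2)"
    by (intro L2_norm_sq_components) blast
  also have "\<dots> \<le> (\<Sum>b\<in>(Basis :: 'n pt set). ell * ?B * sum ?w F)" using comp by (intro sum_mono) blast
  also have "\<dots> = real DIM('n pt) * (ell * ?B) * sum ?w F" by simp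
  finally show ?thesis .
qed

text \<open>A derivative costs |\<xi>|^2 in the squared norm, the boundary layer returns a factor
  comparable to 1 / |\<xi>|, and one power of |\<xi>| is left: the H^(1/2) scaling that a symbol of
  linear growth can absorb. The squared dimension counts the entries of the gradient.\<close>

lemma extension_H1_bound:
  fixes F :: "(int^'n::finite) set"
  assumes F: "finite F" "0 \<notin> F" and ell: "ell > 0"
  shows "(H1_sol_norm ell (extension ell F c))\<^sup>2 \<le> (real DIM('n pt))\<^sup>2 * (ell * (2 * pi\<^sup>2 + 3 / ell\<^sup>2 + 27 / ell ^ 4))
     * (\<Sum>\<xi>\<in>F. norm (freq \<xi>) * (cmod (c \<xi>))\<^sup>2)"
proof -
  \<comment> \<open>One summand for each kind of entry: horizontal derivatives of the vertical
    component; entries whose coefficients are at most k / ell, both derivatives being of the same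
    kind as the component; vertical derivatives of the horizontal components.\<close>
  let ?B = "2 * pi\<^sup>2 + 3 / ell\<^sup>2 + 27 / ell ^ 4" and ?w = "\<lambda>\<xi>. norm (freq \<xi>) * (cmod (c \<xi>))\<^sup>2"
  let ?X = "ell * ?B * sum ?w F"
  have B: "2 * pi\<^sup>2 \<le> ?B" "3 / ell\<^sup>2 \<le> ?B" "27 / ell ^ 4 \<le> ?B" using ell by simp_all
  have X: "\<xi> \<noteq> 0 \<and> 1 \<le> norm (freq \<xi>) \<and> 2 \<le> real (decay_exp \<xi>) \<and> norm (freq \<xi>) \<le> real (decay_exp \<xi>)
      \<and> real (decay_exp \<xi>) \<le> 3 * norm (freq \<xi>)" if "\<xi> \<in> F" for \<xi>
    using that F(2) decay_exp_bounds[of \<xi>] norm_freq_ge_1[of \<xi>] by auto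
  have comp: "\<bar>real_of_int (\<xi> $ i)\<bar> \<le> norm (freq \<xi>)" for \<xi> :: "int^'n" and i
    using component_le_norm_cart[of "freq \<xi>" i] by (simp add: freq_def)
  \<comment> \<open>Each entry is reduced to two scalar facts: a bound a for the ratio of
    coefficients, and a^2 at most |\<xi>| (2 j + 1) up to the constant.\<close>
  have entry: "(L2_norm (slab ell) (wave ell d j F))\<^sup>2 \<le> ?X"
    if "\<And>\<xi>. \<xi> \<in> F \<Longrightarrow> cmod (d \<xi>) \<le> a \<xi> * cmod (c \<xi>)" "\<And>\<xi>. \<xi> \<in> F \<Longrightarrow> (a \<xi>)\<^sup>2 \<le> ?B * norm (freq \<xi>) * real (2 * j \<xi> + 1)" for d j a
  proof (rule wave_L2_bound_weight[OF ell F(1)])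
    fix \<xi> assume \<xi>: "\<xi> \<in> F"
    have "(cmod (d \<xi>))\<^sup>2 \<le> (a \<xi> * cmod (c \<xi>))\<^sup>2" using that(1)[OF \<xi>] by (intro power_mono) auto
    also have "\<dots> = (a \<xi>)\<^sup>2 * (cmod (c \<xi>))\<^sup>2" by (rule power_mult_distrib)
    also have "\<dots> \<le> (?B * norm (freq \<xi>) * real (2 * j \<xi> + 1)) * (cmod (c \<xi>))\<^sup>2" using that(2)[OF \<xi>] by (intro mult_right_mono) auto
    finally show "(cmod (d \<xi>))\<^sup>2 / real (2 * j \<xi> + 1) \<le> ?B * ?w \<xi>"
      by (subst pos_divide_le_eq) (auto simp: mult_ac)
  qed
  have e1: "(L2_norm (slab ell) (wave ell (\<lambda>\<xi>. of_real (2 * pi * real_of_int (\<xi> $ i)) * \<i> * c \<xi>) decay_exp F))\<^sup>2 \<le> ?X" for i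
  proof (rule entry[where a = "\<lambda>\<xi>. 2 * pi * norm (freq \<xi>)"])
    fix \<xi> assume \<xi>: "\<xi> \<in> F"
    show "cmod (of_real (2 * pi * real_of_int (\<xi> $ i)) * \<i> * c \<xi>) \<le> 2 * pi * norm (freq \<xi>) * cmod (c \<xi>)"
      using comp[of \<xi> i] by (simp add: norm_mult mult_right_mono)
    have "(2 * pi * norm (freq \<xi>))\<^sup>2 = 2 * pi\<^sup>2 * norm (freq \<xi>) * (2 * norm (freq \<xi>))"
      by (simp add: power2_eq_square)
    also have "\<dots> \<le> ?B * norm (freq \<xi>) * real (2 * decay_exp \<xi> + 1)"
      using B(1) X[OF \<xi>] by (intro mult_mono) auto
    finally show "(2 * pi * norm (freq \<xi>))\<^sup>2 \<le> ?B * norm (freq \<xi>) * real (2 * decay_exp \<xi> + 1)" .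
  qed
  have k2: "(real (decay_exp \<xi>) / ell)\<^sup>2 \<le> ?B * norm (freq \<xi>) * real (2 * (decay_exp \<xi> - 1) + 1)" if \<xi>: "\<xi> \<in> F" for \<xi>
  proof -
    let ?k = "real (decay_exp \<xi>)"
    have "(?k / ell)\<^sup>2 = 1 / ell\<^sup>2 * (?k * ?k)" by (simp add: power_divide power2_eq_square)
    also have "\<dots> \<le> 1 / ell\<^sup>2 * ((3 * norm (freq \<xi>)) * real (2 * (decay_exp \<xi> - 1) + 1))"
      using X[OF \<xi>] by (intro mult_left_mono mult_mono) auto
    also have "\<dots> = 3 / ell\<^sup>2 * norm (freq \<xi>) * real (2 * (decay_exp \<xi> - 1) + 1)" by simp
    also have "\<dots> \<le> ?B * norm (freq \<xi>) * real (2 * (decay_exp \<xi> - 1) + 1)"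
      by (intro mult_right_mono B) auto
    finally show ?thesis .
  qed
  have e2: "(L2_norm (slab ell) (wave ell (\<lambda>\<xi>. of_real (real (decay_exp \<xi>) / ell) * c \<xi>) (\<lambda>\<xi>. decay_exp \<xi> - 1) F))\<^sup>2 \<le> ?X"
    by (rule entry[where a = "\<lambda>\<xi>. real (decay_exp \<xi>) / ell", OF _ k2]) (use ell in \<open>auto simp: norm_mult norm_divide\<close>)
  have e3: "(L2_norm (slab ell) (wave ell (\<lambda>\<xi>. of_real (2 * pi * real_of_int (\<xi> $ i)) * \<i> * extension_coeff ell c i' \<xi>) (\<lambda>\<xi>. decay_exp \<xi> - 1) F))\<^sup>2 \<le> ?X" for i i'
  proof (rule entry[where a = "\<lambda>\<xi>. real (decay_exp \<xi>) / ell", OF _ k2])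
    fix \<xi> assume \<xi>: "\<xi> \<in> F"
    have "cmod (of_real (2 * pi * real_of_int (\<xi> $ i)) * \<i> * extension_coeff ell c i' \<xi>) = 2 * pi * \<bar>real_of_int (\<xi> $ i)\<bar> * cmod (extension_coeff ell c i' \<xi>)"
      by (simp add: norm_mult)
    also have "\<dots> \<le> 2 * pi * norm (freq \<xi>) * (real (decay_exp \<xi>) / (norm (freq \<xi>) * (2 * pi * ell)) * cmod (c \<xi>))"
      using comp[of \<xi> i] X[OF \<xi>] ell by (intro mult_mono extension_coeff_bound) auto
    also have "\<dots> = real (decay_exp \<xi>) / ell * cmod (c \<xi>)" using X[OF \<xi>] by (auto simp: field_simps)
    finally show "cmod (of_real (2 * pi * real_of_int (\<xi> $ i)) * \<i> * extension_coeff ell c i' \<xi>) \<le> real (decay_exp \<xi>) / ell * cmod (c \<xi>)" .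
  qed
  have e4: "(L2_norm (slab ell) (wave ell (\<lambda>\<xi>. of_real (real (decay_exp \<xi> - 1) / ell) * extension_coeff ell c i \<xi>) (\<lambda>\<xi>. decay_exp \<xi> - 1 - 1) F))\<^sup>2 \<le> ?X" for i
  proof (rule entry[where a = "\<lambda>\<xi>. real (decay_exp \<xi> - 1) / ell * (3 / ell)"])
    fix \<xi> assume \<xi>: "\<xi> \<in> F"
    let ?k = "real (decay_exp \<xi>)" and ?n = "norm (freq \<xi>)"
    have "?k / (?n * (2 * pi * ell)) \<le> 3 / ell"
    proof -
      have "?k / (?n * (2 * pi * ell)) \<le> (3 * ?n) / (?n * (2 * pi * ell))"
        using X[OF \<xi>] ell by (intro divide_right_mono) auto
      also have "\<dots> = 3 / ell * (1 / (2 * pi))" using X[OF \<xi>] by auto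
      also have "\<dots> \<le> 3 / ell * 1" using ell pi_ge_two by (intro mult_left_mono) (auto simp: field_simps)
      finally show ?thesis by simp
    qed
    then have "cmod (extension_coeff ell c i \<xi>) \<le> 3 / ell * cmod (c \<xi>)"
      using order_trans[OF extension_coeff_bound[of \<xi> ell c i] mult_right_mono[OF _ norm_ge_zero]] X[OF \<xi>] ell by blast
    then have "real (decay_exp \<xi> - 1) / ell * cmod (extension_coeff ell c i \<xi>) \<le> real (decay_exp \<xi> - 1) / ell * (3 / ell * cmod (c \<xi>))"
      using ell by (intro mult_left_mono) auto
    then show "cmod (of_real (real (decay_exp \<xi> - 1) / ell) * extension_coeff ell c i \<xi>) \<le> real (decay_exp \<xi> - 1) / ell * (3 / ell) * cmod (c \<xi>)"
      using ell by (simp add: norm_mult norm_divide)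
    \<comment> \<open>A \<open>decay_exp\<close> of at least 2 makes the natural subtractions exact
      and gives k - 1 \<le> 2 k - 3, which absorbs one of the two factors k - 1 below; the other is
      at most 3 |\<xi>|.\<close>
    have km: "real (decay_exp \<xi> - 1) = ?k - 1" "real (2 * (decay_exp \<xi> - 1 - 1) + 1) = 2 * ?k - 3" using X[OF \<xi>] by auto
    have "(real (decay_exp \<xi> - 1) / ell * (3 / ell))\<^sup>2 = 9 / ell ^ 4 * ((?k - 1) * (?k - 1))"
      unfolding km using ell by (simp add: power2_eq_square power4_eq_xxxx field_simps)
    also have "\<dots> \<le> 9 / ell ^ 4 * ((3 * ?n) * (2 * ?k - 3))"
      using X[OF \<xi>] ell by (intro mult_left_mono mult_mono) auto
    also have "\<dots> = 27 / ell ^ 4 * ?n * (2 * ?k - 3)" by simp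
    also have "\<dots> \<le> ?B * ?n * (2 * ?k - 3)" using X[OF \<xi>] by (intro mult_right_mono B) auto
    finally show "(real (decay_exp \<xi> - 1) / ell * (3 / ell))\<^sup>2 \<le> ?B * ?n * real (2 * (decay_exp \<xi> - 1 - 1) + 1)" unfolding km .
  qed
  have all: "\<forall>a\<in>Basis. \<forall>b\<in>Basis. (L2_norm (slab ell) (pd a (vec_comp (extension ell F c) b)))\<^sup>2 \<le> ?X"
    unfolding ball_pt_Basis vec_comp_extension pd_wave_horizontal pd_wave_vertical using e1 e2 e3 e4 by blast
  have sm: "\<forall>b\<in>Basis. smooth_periodic (vec_comp (extension ell F c) b)"
    unfolding ball_pt_Basis vec_comp_extension by (simp add: smooth_wave)
  have wp: "L2_norm (slab ell) (weak_partial ell a (vec_comp (extension ell F c) b)) = L2_norm (slab ell) (pd a (vec_comp (extension ell F c) b))"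
    if "a \<in> Basis" "b \<in> Basis" for a b
    using sm that by (intro L2_norm_cong_AE weak_partial_smooth L2_measurable weak_partial(1) L2_pd H1_smooth) auto
  have "(H1_sol_norm ell (extension ell F c))\<^sup>2 = (\<Sum>p\<in>Basis \<times> Basis. (L2_norm (slab ell) (weak_partial ell (fst p) (vec_comp (extension ell F c) (snd p))))\<^sup>2)"
    unfolding H1_sol_norm_eq L2_set_def by (simp add: sum_nonneg split_beta)
  also have "\<dots> \<le> (\<Sum>p\<in>(Basis \<times> Basis :: ('n pt \<times> 'n pt) set). ?X)"
    using all wp by (intro sum_mono) auto
  also have "\<dots> = (real DIM('n pt))\<^sup>2 * ?X"
  proof -
    have "(\<Sum>p\<in>(Basis \<times> Basis :: ('n pt \<times> 'n pt) set). x) = (real DIM('n pt))\<^sup>2 * x" for x :: real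
      by (simp add: card_cartesian_product power2_eq_square algebra_simps)
    then show ?thesis .
  qed
  finally show ?thesis by (simp only: mult.assoc)
qed

text \<open>The extension depends real-linearly on the complex coefficients, so a linear functional
  of it is a finite combination of fixed numbers weighted by Re c and Im c. For coefficients that
  vary in time this separates the variation from stationary fields.\<close>

lemma extension_linear:
  fixes F :: "(int^'n::finite) set" and L :: "('n pt \<Rightarrow> 'n pt) \<Rightarrow> real"
  assumes F: "finite F" "0 \<notin> F" and ell: "ell > 0"
    and add: "\<And>v w. v \<in> H1_sol ell \<Longrightarrow> w \<in> H1_sol ell \<Longrightarrow> L (\<lambda>z. v z + w z) = L v + L w"
    and scale: "\<And>a v. v \<in> H1_sol ell \<Longrightarrow> L (\<lambda>z. a *\<^sub>R v z) = a * L v"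
  shows "L (extension ell F c) = (\<Sum>\<xi>\<in>F. Re (c \<xi>) * L (extension ell {\<xi>} (\<lambda>_. 1)) + Im (c \<xi>) * L (extension ell {\<xi>} (\<lambda>_. \<i>)))"
  using F
proof (induction F rule: finite_induct)
  case empty
  \<comment> \<open>Writing the zero field as 0 times itself obtains its value under L from
    homogeneity.\<close>
  have "extension ell {} c = (\<lambda>z. 0 *\<^sub>R extension ell {} c z)"
    by (auto simp: extension_def wave_def prod_eq_iff vec_eq_iff)
  then show ?case using scale[OF extension_H1_sol(1)[of "{}" ell c], of 0] ell by simp
next
  case (insert \<xi> F)
  have x: "\<xi> \<noteq> 0" "0 \<notin> F" using insert.prems by auto
  note E = extension_H1_sol(1)[OF _ _ ell]
  have "extension ell (insert \<xi> F) c = (\<lambda>z. extension ell {\<xi>} c z + extension ell F c z)"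
    using insert.hyps by (auto simp: extension_def wave_def prod_eq_iff vec_eq_iff)
  then have 1: "L (extension ell (insert \<xi> F) c) = L (extension ell {\<xi>} c) + L (extension ell F c)"
    using add[OF E[of "{\<xi>}" c] E[of F c]] x insert.hyps by simp
  have "extension ell {\<xi>} c = (\<lambda>z. Re (c \<xi>) *\<^sub>R extension ell {\<xi>} (\<lambda>_. 1) z + Im (c \<xi>) *\<^sub>R extension ell {\<xi>} (\<lambda>_. \<i>) z)"
    by (rule ext, rule prod_eqI)
      (auto simp: extension_def wave_def vec_eq_iff extension_coeff_def algebra_simps diff_divide_distrib add_divide_distrib)
  then have "L (extension ell {\<xi>} c) = Re (c \<xi>) * L (extension ell {\<xi>} (\<lambda>_. 1)) + Im (c \<xi>) * L (extension ell {\<xi>} (\<lambda>_. \<i>))"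
    using add[OF H1_sol_scaleR[OF E[of "{\<xi>}" "\<lambda>_. 1"], of "Re (c \<xi>)"] H1_sol_scaleR[OF E[of "{\<xi>}" "\<lambda>_. \<i>"], of "Im (c \<xi>)"]]
      scale[OF E[of "{\<xi>}" "\<lambda>_. 1"], of "Re (c \<xi>)"] scale[OF E[of "{\<xi>}" "\<lambda>_. \<i>"], of "Im (c \<xi>)"] x by simp
  then show ?case using 1 insert by simp
qed

section \<open>Differential inequalities and weak derivatives in time\<close>

lemma absolutely_integrable_bound_AE:
  fixes f g :: "real \<Rightarrow> real"
  assumes "f \<in> borel_measurable (lebesgue_on S)" "S \<in> sets lebesgue" "g absolutely_integrable_on S"
    and "AE t in lebesgue. t \<in> S \<longrightarrow> \<bar>f t\<bar> \<le> g t"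
  shows "f absolutely_integrable_on S"
  unfolding set_integrable_def
proof (rule Bochner_Integration.integrable_bound[OF assms(3)[unfolded set_integrable_def]])
  show "(\<lambda>x. indicat_real S x *\<^sub>R f x) \<in> borel_measurable lebesgue"
    using assms(1,2) by (simp add: borel_measurable_restrict_space_iff mult.commute)
  show "AE x in lebesgue. norm (indicat_real S x *\<^sub>R f x) \<le> norm (indicat_real S x *\<^sub>R g x)"
    using assms(4) by eventually_elim (auto simp: indicator_def)
qed

lemma integral_mono_AE_on:
  fixes f g :: "real \<Rightarrow> real"
  assumes "f absolutely_integrable_on S" "g absolutely_integrable_on S" "AE t in lebesgue. t \<in> S \<longrightarrow> f t \<le> g t"
  shows "integral S f \<le> integral S g"
  unfolding set_lebesgue_integral_eq_integral(2)[OF assms(1), symmetric] set_lebesgue_integral_eq_integral(2)[OF assms(2), symmetric]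
    set_lebesgue_integral_def
proof (rule integral_mono_AE)
  show "integrable lebesgue (\<lambda>x. indicat_real S x *\<^sub>R f x)" "integrable lebesgue (\<lambda>x. indicat_real S x *\<^sub>R g x)"
    using assms(1,2) by (auto simp: set_integrable_def)
  show "AE x in lebesgue. indicat_real S x *\<^sub>R f x \<le> indicat_real S x *\<^sub>R g x"
    using assms(3) by eventually_elim (auto simp: indicator_def)
qed

lemma integral_cong_AE_on:
  fixes f g :: "real \<Rightarrow> real"
  assumes "f absolutely_integrable_on S" "g absolutely_integrable_on S" "AE t in lebesgue. t \<in> S \<longrightarrow> f t = g t"
  shows "integral S f = integral S g"
  by (intro antisym integral_mono_AE_on assms) (use assms(3) in \<open>eventually_elim, simp\<close>)+

lemma abs_int_on_sub: "f absolutely_integrable_on {a..b} \<Longrightarrow> a \<le> c \<Longrightarrow> d \<le> b \<Longrightarrow> f absolutely_integrable_on {c..d}"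
  for f :: "real \<Rightarrow> real"
  by (rule absolutely_integrable_on_subinterval) auto

lemma int_on_sub: "f absolutely_integrable_on {a..b} \<Longrightarrow> a \<le> c \<Longrightarrow> d \<le> b \<Longrightarrow> f integrable_on {c..d}"
  for f :: "real \<Rightarrow> real"
  using abs_int_on_sub set_lebesgue_integral_eq_integral(1) by blast

lemma integral_nonneg_subset:
  fixes f :: "real \<Rightarrow> real"
  assumes "f absolutely_integrable_on {a..b}" "\<And>x. 0 \<le> f x" "a \<le> c" "d \<le> b"
  shows "integral {c..d} f \<le> integral {a..b} f"
  by (rule integral_subset_le) (use assms int_on_sub[OF assms(1)] in auto)

text \<open>The error term is evaluated at the right end points \<open>y\<close> of a partition.  Since \<open>E\<close> is merely
  integrable, the Riemann sums \<open>\<Sum> (y - x) E y\<close> are controlled only on average over translates of an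
  equidistant partition, which is why the hypotheses reach beyond \<open>t\<close>.\<close>

lemma right_tagged_inequality:
  fixes \<Phi> b k :: "real \<Rightarrow> real"
  assumes st: "s < t" "t < T" and cont: "continuous_on {s..T} \<Phi>"
    and b: "b absolutely_integrable_on {s..T}" and k: "k absolutely_integrable_on {s..T}" and N: "negligible N"
    and step: "\<And>\<epsilon>. \<epsilon> > 0 \<Longrightarrow> \<exists>E \<delta>. E absolutely_integrable_on {s..T} \<and> integral {s..T} E \<le> \<epsilon> \<and> (\<forall>\<tau>. 0 \<le> E \<tau>) \<and> \<delta> > 0 \<and>
      (\<forall>x y. s \<le> x \<and> x < y \<and> y \<le> T \<and> y - x < \<delta> \<and> y \<notin> N \<longrightarrow>
         \<Phi> y - \<Phi> x \<le> integral {x..y} (\<lambda>\<sigma>. b \<sigma> + \<epsilon> * k \<sigma> + E \<sigma>) + (y - x) * E y)"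
  shows "\<Phi> t - \<Phi> s \<le> integral {s..t} b"
proof -
  define K where "K = integral {s..T} (\<lambda>\<sigma>. \<bar>k \<sigma>\<bar>)"
  \<comment> \<open>The excess in the claim for the interval shifted by \<theta>. It is continuous,
    so a bound at \<theta> = 0 follows from bounds at arbitrarily small \<theta>, which leaves
    freedom to choose a good translate.\<close>
  define F where "F \<theta> = \<Phi> (t + \<theta>) - \<Phi> (s + \<theta>) - (integral {s..t + \<theta>} b - integral {s..s + \<theta>} b)" for \<theta>
  have contF: "continuous_on {0..T - t} F"
  proof -
    have ci: "continuous_on {s..T} (\<lambda>x. integral {s..x} b)"
      by (rule indefinite_integral_continuous_1) (rule set_lebesgue_integral_eq_integral(1)[OF b])
    have a: "continuous_on {0..T - t} (\<lambda>\<theta>. t + \<theta>)" "continuous_on {0..T - t} (\<lambda>\<theta>. s + \<theta>)" by (intro continuous_intros)+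
    have i: "(\<lambda>\<theta>. t + \<theta>) ` {0..T - t} \<subseteq> {s..T}" "(\<lambda>\<theta>. s + \<theta>) ` {0..T - t} \<subseteq> {s..T}" using st by auto
    show ?thesis unfolding F_def
      by (rule continuous_on_diff[OF continuous_on_diff[OF continuous_on_compose2[OF cont a(1) i(1)] continuous_on_compose2[OF cont a(2) i(2)]]
          continuous_on_diff[OF continuous_on_compose2[OF ci a(1) i(1)] continuous_on_compose2[OF ci a(2) i(2)]]])
  qed
  have F0: "F 0 = \<Phi> t - \<Phi> s - integral {s..t} b" by (simp add: F_def)
  \<comment> \<open>The term with K comes from k; of the three \<epsilon>, two come from the sampled
    values of E and one from its integral.\<close>
  have bound: "F 0 \<le> \<epsilon> * K + 3 * \<epsilon>" if \<epsilon>: "\<epsilon> > 0" for \<epsilon>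
  proof -
    from step[OF \<epsilon>] obtain E \<delta> where E1: "E absolutely_integrable_on {s..T}" "integral {s..T} E \<le> \<epsilon>" "\<forall>\<tau>. 0 \<le> E \<tau>" and \<delta>: "\<delta> > 0"
      and ineq1: "\<forall>x y. s \<le> x \<and> x < y \<and> y \<le> T \<and> y - x < \<delta> \<and> y \<notin> N \<longrightarrow>
         \<Phi> y - \<Phi> x \<le> integral {x..y} (\<lambda>\<sigma>. b \<sigma> + \<epsilon> * k \<sigma> + E \<sigma>) + (y - x) * E y"
      by (elim exE conjE)
    note E = E1(1,2) E1(3)[rule_format]
    have ineq: "\<Phi> y - \<Phi> x \<le> integral {x..y} (\<lambda>\<sigma>. b \<sigma> + \<epsilon> * k \<sigma> + E \<sigma>) + (y - x) * E y"
      if "s \<le> x" "x < y" "y \<le> T" "y - x < \<delta>" "y \<notin> N" for x y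
      by (rule ineq1[rule_format], intro conjI that)
    let ?g = "\<lambda>\<sigma>. b \<sigma> + \<epsilon> * k \<sigma> + E \<sigma>"
    have g: "?g absolutely_integrable_on {s..T}"
      by (intro set_integral_add(1) set_integrable_mult_right impI b k E)
    have near: "\<exists>\<theta>. 0 < \<theta> \<and> \<theta> < \<eta> \<and> \<theta> \<le> T - t \<and> F \<theta> \<le> \<epsilon> * K + 3 * \<epsilon>" if \<eta>: "\<eta> > 0" for \<eta>
    proof -
      obtain n :: nat where n: "(t - s) / real (Suc n) < min \<eta> (min \<delta> (T - t))"
      proof -
        have "0 < min \<eta> (min \<delta> (T - t))" using \<eta> \<delta> st by simp
        from reals_Archimedean[OF divide_pos_pos[OF this, of "t - s"]] st obtain n
          where "inverse (real (Suc n)) < min \<eta> (min \<delta> (T - t)) / (t - s)" by auto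
        then have "(t - s) / real (Suc n) < min \<eta> (min \<delta> (T - t))"
          using st by (simp add: field_simps)
        then show thesis by (rule that)
      qed
      \<comment> \<open>The mesh is below \<delta> so that the local inequality applies, below
        \<eta> so that the shift is small, and below T - t so that the translated nodes stay in
        [s, T].\<close>
      define h where "h = (t - s) / real (Suc n)"
      have h: "h > 0" "h < \<eta>" "h < \<delta>" "h < T - t" "real (Suc n) * h = t - s"
        using n st by (auto simp: h_def)
      define x where "x \<theta> i = s + real i * h + \<theta>" for \<theta> i
      have xle: "x \<theta> i \<le> T" "s \<le> x \<theta> i" if "i \<le> Suc n" "0 \<le> \<theta>" "\<theta> \<le> h" for \<theta> i
      proof -
        have "real i * h \<le> real (Suc n) * h" using that h by (intro mult_right_mono) auto
        then show "x \<theta> i \<le> T" using that h unfolding x_def by linarith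
        show "s \<le> x \<theta> i" using that h by (simp add: x_def)
      qed
      \<comment> \<open>Averaging: over \<theta> in (0, h) the sums h \<Sum> E (x \<theta> i) have
        as mean the integral of E over [s + h, t + h], which is at most \<epsilon>. They cannot
        exceed 2 \<epsilon> for almost every \<theta>, so some \<theta> works that also keeps the
        nodes outside N.\<close>
      have "\<exists>\<theta>. 0 < \<theta> \<and> \<theta> < h \<and> (\<forall>i\<in>{1..Suc n}. x \<theta> i \<notin> N) \<and> h * (\<Sum>i=1..Suc n. E (x \<theta> i)) \<le> 2 * \<epsilon>"
      proof (rule ccontr)
        assume no: "\<not> ?thesis"
        define Bad where "Bad = (\<Union>i\<in>{1..Suc n}. (+) (- (s + real i * h)) ` N) \<union> {0, h}"
        have "negligible Bad" unfolding Bad_def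
          by (intro negligible_Un negligible_Union finite_imageI) (auto intro: negligible_translation[OF N])
        have EI: "(\<lambda>\<theta>. E (x \<theta> i)) absolutely_integrable_on {0..h} \<and> integral {0..h} (\<lambda>\<theta>. E (x \<theta> i)) = integral {s + real i * h..s + real (Suc i) * h} E"
          if "i \<in> {1..Suc n}" for i
        proof -
          let ?c = "s + real i * h"
          have end': "s + real (Suc i) * h = ?c + h" by (simp add: algebra_simps)
          have e: "x \<theta> i = \<theta> + ?c" for \<theta> by (simp add: x_def)
          have "real i * h \<le> real (Suc n) * h" using that h by (intro mult_right_mono) auto
          then have "?c + h \<le> T" using h(4,5) by linarith
          moreover have "s \<le> ?c" using h(1) by simp
          ultimately have sub: "s \<le> ?c" "?c + h \<le> T" by auto
          have "E integrable_on {?c..?c + h}" by (rule int_on_sub[OF E(1) sub])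
          then have "(\<lambda>\<theta>. E (\<theta> + ?c)) integrable_on {0..h}"
            using integrable_shift_real_ivl[of E ?c "?c + h" ?c] by simp
          then have "(\<lambda>\<theta>. E (\<theta> + ?c)) absolutely_integrable_on {0..h}"
            by (intro nonnegative_absolutely_integrable_1) (auto simp: E(3))
          moreover have "integral {0..h} (\<lambda>\<theta>. E (\<theta> + ?c)) = integral {?c..?c + h} E"
            using integral_shift_real_ivl[of ?c ?c "?c + h" E] by simp
          ultimately show ?thesis unfolding e end' by blast
        qed
        have sum_int: "(\<Sum>i=1..m. integral {s + real i * h..s + real (Suc i) * h} E) = integral {s + h..s + real (Suc m) * h} E"
          if "m \<le> Suc n" for m
          using that
        proof (induction m)
          case (Suc m)
          have "real (Suc (Suc m)) * h \<le> real (Suc (Suc n)) * h" using Suc.prems h by (intro mult_right_mono) auto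
          also have "\<dots> = (t - s) + h" using h(5) by (simp add: algebra_simps)
          finally have "s + real (Suc (Suc m)) * h \<le> T" using h by linarith
          then have "E integrable_on {s + h..s + real (Suc (Suc m)) * h}" using h by (intro int_on_sub[OF E(1)]) auto
          from Henstock_Kurzweil_Integration.integral_combine[OF _ _ this, of "s + real (Suc m) * h"] h Suc
          show ?case by (simp add: algebra_simps)
        qed simp
        have sI: "(\<lambda>\<theta>. \<Sum>i=1..Suc n. E (x \<theta> i)) absolutely_integrable_on {0..h}"
          using EI by (intro absolutely_integrable_sum) auto
        have "2 * \<epsilon> = integral {0..h} (\<lambda>_. 2 * \<epsilon> / h)" using h by simp
        also have "\<dots> \<le> integral {0..h} (\<lambda>\<theta>. \<Sum>i=1..Suc n. E (x \<theta> i))"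
        proof (rule integral_mono_AE_on[OF _ sI])
          show "(\<lambda>_. 2 * \<epsilon> / h) absolutely_integrable_on {0..h}"
            by (intro absolutely_integrable_continuous_real continuous_intros)
          show "AE \<theta> in lebesgue. \<theta> \<in> {0..h} \<longrightarrow> 2 * \<epsilon> / h \<le> (\<Sum>i=1..Suc n. E (x \<theta> i))"
            unfolding eventually_ae_filter_negligible
          proof (intro exI conjI subsetI, rule \<open>negligible Bad\<close>)
            fix \<theta> assume "\<theta> \<in> {\<theta>. \<not> (\<theta> \<in> {0..h} \<longrightarrow> 2 * \<epsilon> / h \<le> (\<Sum>i=1..Suc n. E (x \<theta> i)))}"
            then have \<theta>: "\<theta> \<in> {0..h}" and "(\<Sum>i=1..Suc n. E (x \<theta> i)) < 2 * \<epsilon> / h" by (simp_all only: mem_Collect_eq not_imp not_le)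
            then have \<theta>: "\<theta> \<in> {0..h}" "h * (\<Sum>i=1..Suc n. E (x \<theta> i)) < 2 * \<epsilon>"
              using h(1) by (simp_all only: pos_less_divide_eq mult.commute)
            show "\<theta> \<in> Bad"
            proof (rule ccontr)
              assume nb: "\<theta> \<notin> Bad"
              then have "\<theta> \<noteq> 0" "\<theta> \<noteq> h" by (simp_all add: Bad_def)
              then have c: "0 < \<theta>" "\<theta> < h" using \<theta>(1) by simp_all
              have d: "x \<theta> i \<notin> N" if "i \<in> {1..Suc n}" for i
              proof
                assume "x \<theta> i \<in> N"
                then have "\<theta> \<in> (+) (- (s + real i * h)) ` N" by (intro image_eqI[of _ _ "x \<theta> i"]) (simp_all add: x_def)
                then have "\<theta> \<in> Bad" unfolding Bad_def using that by (intro UnI1 UN_I)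
                then show False using nb by (rule notE[rotated])
              qed
              have "0 < \<theta> \<and> \<theta> < h \<and> (\<forall>i\<in>{1..Suc n}. x \<theta> i \<notin> N) \<and> h * (\<Sum>i=1..Suc n. E (x \<theta> i)) \<le> 2 * \<epsilon>"
                by (intro conjI ballI c d less_imp_le[OF \<theta>(2)])
              then show False using no by (rule notE[rotated, OF exI])
            qed
          qed
        qed
        also have "\<dots> = (\<Sum>i=1..Suc n. integral {0..h} (\<lambda>\<theta>. E (x \<theta> i)))"
          using EI set_lebesgue_integral_eq_integral(1) by (intro Henstock_Kurzweil_Integration.integral_sum) auto
        also have "\<dots> = (\<Sum>i=1..Suc n. integral {s + real i * h..s + real (Suc i) * h} E)"
          using EI by (intro sum.cong) auto
        also have "\<dots> = integral {s + h..s + real (Suc (Suc n)) * h} E" by (rule sum_int) simp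
        also have "\<dots> \<le> integral {s..T} E"
        proof (rule integral_nonneg_subset[OF E(1,3)])
          have "real (Suc (Suc n)) * h = (t - s) + h" using h(5) by (simp add: algebra_simps)
          then show "s + real (Suc (Suc n)) * h \<le> T" using h by linarith
        qed (use h in simp)
        also have "\<dots> \<le> \<epsilon>" by (rule E(2))
        finally show False using \<epsilon> by simp
      qed
      then obtain \<theta> where \<theta>: "0 < \<theta>" "\<theta> < h" "\<And>i. i \<in> {1..Suc n} \<Longrightarrow> x \<theta> i \<notin> N" "h * (\<Sum>i=1..Suc n. E (x \<theta> i)) \<le> 2 * \<epsilon>"
        by blast
      have tel: "\<Phi> (x \<theta> m) - \<Phi> (x \<theta> 0) \<le> integral {x \<theta> 0..x \<theta> m} ?g + h * (\<Sum>i=1..m. E (x \<theta> i))" if "m \<le> Suc n" for m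
        using that
      proof (induction m)
        case (Suc m)
        have x1: "x \<theta> (Suc m) - x \<theta> m = h" by (simp add: x_def algebra_simps)
        have th: "0 \<le> \<theta>" "\<theta> \<le> h" using \<theta>(1,2) by simp_all
        have m: "m \<le> Suc n" "Suc m \<in> {1..Suc n}" using Suc.prems by simp_all
        note xl = xle(2)[OF m(1) th] xle(1)[OF Suc.prems th] xle(2)[of 0, OF _ th, simplified]
        have lt: "x \<theta> m < x \<theta> (Suc m)" "x \<theta> (Suc m) - x \<theta> m < \<delta>" using x1 h(1,3) by linarith+
        have le0: "x \<theta> 0 \<le> x \<theta> m" using h(1) by (simp add: x_def)
        have "\<Phi> (x \<theta> (Suc m)) - \<Phi> (x \<theta> m) \<le> integral {x \<theta> m..x \<theta> (Suc m)} ?g + (x \<theta> (Suc m) - x \<theta> m) * E (x \<theta> (Suc m))"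
          by (rule ineq[OF xl(1) lt(1) xl(2) lt(2) \<theta>(3)[OF m(2)]])
        moreover have "integral {x \<theta> 0..x \<theta> m} ?g + integral {x \<theta> m..x \<theta> (Suc m)} ?g = integral {x \<theta> 0..x \<theta> (Suc m)} ?g"
          by (rule Henstock_Kurzweil_Integration.integral_combine[OF le0 less_imp_le[OF lt(1)] int_on_sub[OF g xl(3,2)]])
        moreover have "\<Phi> (x \<theta> m) - \<Phi> (x \<theta> 0) \<le> integral {x \<theta> 0..x \<theta> m} ?g + h * (\<Sum>i=1..m. E (x \<theta> i))"
          by (rule Suc.IH[OF m(1)])
        moreover have "h * (\<Sum>i=1..Suc m. E (x \<theta> i)) = h * (\<Sum>i=1..m. E (x \<theta> i)) + h * E (x \<theta> (Suc m))"
          by (simp add: distrib_left)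
        ultimately show ?case unfolding x1 by linarith
      qed simp
      have ends: "x \<theta> 0 = s + \<theta>" "x \<theta> (Suc n) = t + \<theta>" using h(5) by (auto simp: x_def)
      have sub: "s \<le> s + \<theta>" "t + \<theta> \<le> T" "s + \<theta> \<le> t + \<theta>" using \<theta>(1,2) h(4) st by linarith+
      have "\<Phi> (t + \<theta>) - \<Phi> (s + \<theta>) \<le> integral {s + \<theta>..t + \<theta>} ?g + 2 * \<epsilon>"
        using tel[of "Suc n"] \<theta>(4) unfolding ends by simp
      also have "integral {s + \<theta>..t + \<theta>} ?g = integral {s + \<theta>..t + \<theta>} b + \<epsilon> * integral {s + \<theta>..t + \<theta>} k + integral {s + \<theta>..t + \<theta>} E"
      proof -
        have "(\<lambda>\<sigma>. \<epsilon> * k \<sigma>) absolutely_integrable_on {s..T}" by (intro set_integrable_mult_right impI k)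
        note i = int_on_sub[OF b sub(1,2)] int_on_sub[OF this sub(1,2)] int_on_sub[OF E(1) sub(1,2)]
        have "integral {s + \<theta>..t + \<theta>} ?g = integral {s + \<theta>..t + \<theta>} (\<lambda>\<sigma>. b \<sigma> + \<epsilon> * k \<sigma>) + integral {s + \<theta>..t + \<theta>} E"
          by (intro Henstock_Kurzweil_Integration.integral_add integrable_add i)
        also have "integral {s + \<theta>..t + \<theta>} (\<lambda>\<sigma>. b \<sigma> + \<epsilon> * k \<sigma>) = integral {s + \<theta>..t + \<theta>} b + integral {s + \<theta>..t + \<theta>} (\<lambda>\<sigma>. \<epsilon> * k \<sigma>)"
          by (intro Henstock_Kurzweil_Integration.integral_add i)
        finally show ?thesis by simp
      qed
      also have "integral {s + \<theta>..t + \<theta>} b = integral {s..t + \<theta>} b - integral {s..s + \<theta>} b"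
        using Henstock_Kurzweil_Integration.integral_combine[of s "s + \<theta>" "t + \<theta>" b] int_on_sub[OF b, of s "t + \<theta>"] sub by simp
      also have "integral {s + \<theta>..t + \<theta>} k \<le> K"
      proof -
        have ka: "(\<lambda>\<sigma>. \<bar>k \<sigma>\<bar>) absolutely_integrable_on {s..T}" by (rule set_integrable_abs[OF k])
        have "integral {s + \<theta>..t + \<theta>} k \<le> integral {s + \<theta>..t + \<theta>} (\<lambda>\<sigma>. \<bar>k \<sigma>\<bar>)"
          by (intro integral_le int_on_sub[OF k] int_on_sub[OF ka] sub) auto
        also have "\<dots> \<le> K" unfolding K_def by (rule integral_nonneg_subset[OF ka _ sub(1,2)]) simp
        finally show ?thesis .
      qed
      also have "integral {s + \<theta>..t + \<theta>} E \<le> \<epsilon>"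
        using integral_nonneg_subset[OF E(1,3) sub(1,2)] E(2) by linarith
      finally have "F \<theta> \<le> \<epsilon> * K + 3 * \<epsilon>" using \<epsilon> by (simp add: F_def)
      moreover have "\<theta> < \<eta>" "\<theta> \<le> T - t" using \<theta>(2) h(2,4) by linarith+
      ultimately show ?thesis using \<theta>(1) by blast
    qed
    show ?thesis
    proof (rule ccontr)
      assume "\<not> ?thesis"
      then have p: "F 0 - (\<epsilon> * K + 3 * \<epsilon>) > 0" by simp
      have "0 \<in> {0..T - t}" using st by simp
      from contF[unfolded continuous_on_iff, rule_format, OF this p]
      obtain d where d: "d > 0" "\<forall>\<theta>\<in>{0..T - t}. dist \<theta> 0 < d \<longrightarrow> dist (F \<theta>) (F 0) < F 0 - (\<epsilon> * K + 3 * \<epsilon>)"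
        by (elim exE conjE)
      obtain \<theta> where \<theta>: "0 < \<theta>" "\<theta> < d" "\<theta> \<le> T - t" "F \<theta> \<le> \<epsilon> * K + 3 * \<epsilon>" using near[OF d(1)] by blast
      have "\<theta> \<in> {0..T - t}" "dist \<theta> 0 < d" using \<theta>(1-3) by simp_all
      then have "dist (F \<theta>) (F 0) < F 0 - (\<epsilon> * K + 3 * \<epsilon>)" using d(2) by blast
      then show False using \<theta>(4) unfolding dist_real_def by linarith
    qed
  qed
  have "0 \<le> K" unfolding K_def using set_integrable_abs[OF k]
    by (intro Henstock_Kurzweil_Integration.integral_nonneg) (auto simp: set_lebesgue_integral_eq_integral(1))
  have "F 0 \<le> 0"
  proof (rule field_le_epsilon)
    fix e :: real assume "e > 0"
    have K3: "K + 3 > 0" using \<open>0 \<le> K\<close> by simp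
    have "F 0 \<le> e / (K + 3) * K + 3 * (e / (K + 3))" by (rule bound) (simp add: \<open>e > 0\<close> K3)
    also have "\<dots> = e / (K + 3) * (K + 3)" by (metis distrib_left mult.commute)
    also have "\<dots> = e" using K3 by simp
    finally show "F 0 \<le> 0 + e" by simp
  qed
  then show ?thesis unfolding F0 by simp
qed

text \<open>The test functions are smoothed indicators of (s, t], differences of two steps of width
  1 / (n + 1) starting at s and at t. Their derivatives are differences of kernels that concentrate
  at s and at t from the right, and s > 0 keeps the support inside the open half-line.\<close>

lemma weak_time_derivative_integral_pos:
  fixes f g :: "real \<Rightarrow> real"
  assumes f: "continuous_on {0..} f" and g: "\<And>T. T > 0 \<Longrightarrow> g absolutely_integrable_on {0..T}"
    and w: "\<And>\<phi>. \<phi> \<in> time_test_functions \<Longrightarrow> (\<integral>t. deriv \<phi> t * f t \<partial>lebesgue) = - (\<integral>t. \<phi> t * g t \<partial>lebesgue)"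
    and st: "0 < s" "s \<le> t"
  shows "f t - f s = integral {s..t} g"
proof -
  obtain R :: "real \<Rightarrow> real" where R: "C_infinity R" "\<And>x. x \<le> 0 \<Longrightarrow> R x = 0" "\<And>x. 1 \<le> x \<Longrightarrow> R x = 1"
    "\<And>x. 0 \<le> R x \<and> R x \<le> 1" using smooth_step_exists by blast
  note dR = C_infinity_real_deriv[OF R(1)]
  have dR0: "deriv R x = 0" if "x < 0 \<or> 1 < x" for x
  proof -
    have "\<forall>\<^sub>F y in nhds x. R y = (if x < 0 then 0 else 1)"
      using that eventually_nhds_in_open[of "{..<0}" x] eventually_nhds_in_open[of "{1<..}" x]
      by (auto simp: R(2,3) elim!: eventually_mono)
    then have "(R has_real_derivative 0) (at x)" by (subst DERIV_cong_ev[OF refl _ refl]) auto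
    then show ?thesis by (rule DERIV_imp_deriv)
  qed
  have "continuous_on {0..1} (deriv R)" using dR(2) by (rule continuous_on_subset) simp
  \<comment> \<open>A bound replaces positivity of the kernel: its height is at most (n + 1) B on an
    interval of length 1 / (n + 1).\<close>
  then obtain B where B: "\<And>x. x \<in> {0..1} \<Longrightarrow> \<bar>deriv R x\<bar> \<le> B"
    using compact_imp_bounded[OF compact_continuous_image[OF _ compact_Icc]] by (force simp: bounded_iff)
  have B0: "B \<ge> 0" using B[of 0] by simp
  define k where "k r n \<tau> = real (Suc n) * deriv R (real (Suc n) * (\<tau> - r))" for r n \<tau>
  define P where "P r n \<tau> = R (real (Suc n) * \<tau> + - real (Suc n) * r)" for r n \<tau>
  have Peq: "P r n \<tau> = R (real (Suc n) * (\<tau> - r))" for r n \<tau> by (simp add: P_def algebra_simps)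
  have dP: "(P r n has_real_derivative k r n \<tau>) (at \<tau>)" for r n \<tau>
  proof -
    have "((\<lambda>\<tau>. R (real (Suc n) * (\<tau> - r))) has_real_derivative deriv R (real (Suc n) * (\<tau> - r)) * (real (Suc n) * 1)) (at \<tau>)"
      by (rule DERIV_chain2[OF dR(1)]) (auto intro!: derivative_eq_intros)
    then show ?thesis unfolding Peq[abs_def] k_def by (simp add: mult.commute)
  qed
  have kz: "k r n \<tau> = 0" if "\<tau> \<notin> {r..r + 1 / real (Suc n)}" for r n \<tau>
  proof -
    have "real (Suc n) * (\<tau> - r) < 0 \<or> 1 < real (Suc n) * (\<tau> - r)"
    proof (cases "\<tau> < r")
      case True then show ?thesis by (auto simp: mult_less_0_iff)
    next
      case False
      then have "\<tau> - r > 1 / real (Suc n)" using that by auto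
      then show ?thesis by (simp add: field_simps)
    qed
    then show ?thesis using dR0 by (simp add: k_def)
  qed
  have kc: "continuous_on A (k r n)" for A r n
    unfolding k_def by (intro continuous_intros continuous_on_compose2[OF dR(2)]) auto
  have kf: "integrable lebesgue (\<lambda>\<tau>. k r n \<tau> * f \<tau>) \<and> (\<integral>\<tau>. k r n \<tau> * f \<tau> \<partial>lebesgue) = integral {r..r + 1 / real (Suc n)} (\<lambda>\<tau>. k r n \<tau> * f \<tau>)"
    if "r \<ge> 0" for r n
  proof -
    let ?I = "{r..r + 1 / real (Suc n)}"
    have "(\<lambda>\<tau>. k r n \<tau> * f \<tau>) absolutely_integrable_on ?I"
      using that by (intro absolutely_integrable_continuous_real continuous_on_mult kc continuous_on_subset[OF f]) auto
    moreover have "(\<lambda>\<tau>. indicator ?I \<tau> *\<^sub>R (k r n \<tau> * f \<tau>)) = (\<lambda>\<tau>. k r n \<tau> * f \<tau>)"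
    proof
      fix \<tau> show "indicator ?I \<tau> *\<^sub>R (k r n \<tau> * f \<tau>) = k r n \<tau> * f \<tau>"
        using kz[of \<tau> r n] by (cases "\<tau> \<in> ?I") simp_all
    qed
    ultimately show ?thesis
      using set_lebesgue_integral_eq_integral(2)[of ?I "\<lambda>\<tau>. k r n \<tau> * f \<tau>"]
      by (simp add: set_integrable_def set_lebesgue_integral_def)
  qed
  have klim: "(\<lambda>n. \<integral>\<tau>. k r n \<tau> * f \<tau> \<partial>lebesgue) \<longlonglongrightarrow> f r" if r: "r \<ge> 0" for r
  proof (rule LIMSEQ_I)
    fix e :: real assume e: "e > 0"
    have "e / (B + 1) > 0" using e B0 by simp
    moreover have "r \<in> {0..}" using r by simp
    ultimately obtain d where d: "d > 0" "\<And>\<tau>. \<tau> \<in> {0..} \<Longrightarrow> dist \<tau> r < d \<Longrightarrow> dist (f \<tau>) (f r) < e / (B + 1)"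
      using f unfolding continuous_on_iff by meson
    obtain n0 where n0: "1 / real (Suc n0) < d" using reals_Archimedean[OF d(1)] by (auto simp: inverse_eq_divide)
    show "\<exists>n0. \<forall>n\<ge>n0. norm ((\<integral>\<tau>. k r n \<tau> * f \<tau> \<partial>lebesgue) - f r) < e"
    proof (intro exI allI impI)
      fix n assume n: "n0 \<le> n"
      let ?I = "{r..r + 1 / real (Suc n)}"
      have "1 / real (Suc n) \<le> 1 / real (Suc n0)" using n by (intro divide_left_mono) auto
      then have small: "1 / real (Suc n) < d" using n0 by linarith
      have cI: "continuous_on ?I f" using r by (intro continuous_on_subset[OF f]) auto
      have ki: "(k r n has_integral (P r n (r + 1 / real (Suc n)) - P r n r)) ?I"
        using dP by (intro fundamental_theorem_of_calculus)
          (auto simp: has_real_derivative_iff_has_vector_derivative[symmetric] intro: has_field_derivative_at_within)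
      have "P r n (r + 1 / real (Suc n)) - P r n r = 1" by (simp add: Peq R)
      with ki have k1: "k r n integrable_on ?I" "integral ?I (k r n) = 1" by (auto simp: integral_unique integrable_on_def)
      have "(\<integral>\<tau>. k r n \<tau> * f \<tau> \<partial>lebesgue) - f r = integral ?I (\<lambda>\<tau>. k r n \<tau> * f \<tau>) - integral ?I (\<lambda>\<tau>. k r n \<tau> * f r)"
        using kf[OF r, of n] k1 by simp
      also have "\<dots> = integral ?I (\<lambda>\<tau>. k r n \<tau> * f \<tau> - k r n \<tau> * f r)"
        by (intro Henstock_Kurzweil_Integration.integral_diff[symmetric] integrable_continuous_real continuous_intros kc cI)
      also have "norm \<dots> \<le> (real (Suc n) * B * (e / (B + 1))) * (r + 1 / real (Suc n) - r)"
      proof (rule integral_bound)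
        show "continuous_on ?I (\<lambda>\<tau>. k r n \<tau> * f \<tau> - k r n \<tau> * f r)" by (intro continuous_intros kc cI)
        fix \<tau> assume \<tau>: "\<tau> \<in> ?I"
        then have "0 \<le> \<tau> - r" "\<tau> - r \<le> 1 / real (Suc n)" by simp_all
        then have "real (Suc n) * (\<tau> - r) \<in> {0..1}" by (simp add: pos_le_divide_eq mult.commute del: of_nat_Suc)
        then have kb: "\<bar>k r n \<tau>\<bar> \<le> real (Suc n) * B" unfolding k_def abs_mult by (intro mult_mono B) auto
        have "dist (f \<tau>) (f r) < e / (B + 1)" using \<tau> small r by (intro d(2)) (auto simp: dist_real_def)
        then have "\<bar>k r n \<tau>\<bar> * \<bar>f \<tau> - f r\<bar> \<le> real (Suc n) * B * (e / (B + 1))"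
          using kb B0 by (intro mult_mono) (auto simp: dist_real_def)
        then show "norm (k r n \<tau> * f \<tau> - k r n \<tau> * f r) \<le> real (Suc n) * B * (e / (B + 1))"
          by (simp add: abs_mult right_diff_distrib[symmetric])
      qed simp
      also have "\<dots> = B * (e / (B + 1))" by simp
      also have "\<dots> < e" using e B0 by (simp add: field_simps)
      finally show "norm ((\<integral>\<tau>. k r n \<tau> * f \<tau> \<partial>lebesgue) - f r) < e" .
    qed
  qed
  let ?\<phi> = "\<lambda>n \<tau>. P s n \<tau> - P t n \<tau>"
  have t0: "0 \<le> t" using st by simp
  have dphi: "deriv (?\<phi> n) \<tau> = k s n \<tau> - k t n \<tau>" for n \<tau>
    by (rule DERIV_imp_deriv) (intro DERIV_diff dP)
  have Pz: "?\<phi> n \<tau> = 0" if "\<tau> \<notin> {s..t + 1}" for n \<tau>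
  proof (cases "\<tau> < s")
    case True
    then have "real (Suc n) * (\<tau> - s) \<le> 0" "real (Suc n) * (\<tau> - t) \<le> 0" using st by (auto intro: mult_nonneg_nonpos)
    then show ?thesis by (simp only: Peq R(2))
  next
    case False
    then have "1 \<le> \<tau> - s" "1 \<le> \<tau> - t" using that st by auto
    then have "1 * 1 \<le> real (Suc n) * (\<tau> - s)" "1 * 1 \<le> real (Suc n) * (\<tau> - t)" by (intro mult_mono; simp)+
    then show ?thesis by (simp only: Peq R(3) mult_1)
  qed
  have tt: "?\<phi> n \<in> time_test_functions" for n
  proof -
    have "C_infinity (?\<phi> n)" unfolding P_def
      by (intro C_infinity_diff C_infinity_compose[OF R(1)] C_infinity_add C_infinity_mult C_infinity_const)
        (use C_infinity_inner[of "1::real"] in simp)+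
    then show ?thesis unfolding time_test_functions_def using Pz st(1) by blast
  qed
  have eq0: "(\<integral>\<tau>. k s n \<tau> * f \<tau> \<partial>lebesgue) - (\<integral>\<tau>. k t n \<tau> * f \<tau> \<partial>lebesgue) = - (\<integral>\<tau>. ?\<phi> n \<tau> * g \<tau> \<partial>lebesgue)" if "?\<phi> n \<in> time_test_functions" for n
  proof -
    have "(\<integral>\<tau>. deriv (?\<phi> n) \<tau> * f \<tau> \<partial>lebesgue) = (\<integral>\<tau>. k s n \<tau> * f \<tau> - k t n \<tau> * f \<tau> \<partial>lebesgue)"
      by (simp only: dphi left_diff_distrib)
    also have "\<dots> = (\<integral>\<tau>. k s n \<tau> * f \<tau> \<partial>lebesgue) - (\<integral>\<tau>. k t n \<tau> * f \<tau> \<partial>lebesgue)"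
      using kf[of s n] kf[OF t0, of n] st by (intro Bochner_Integration.integral_diff) auto
    finally show ?thesis using w[OF that] by simp
  qed
  note eq = eq0[OF tt]
  have gt: "g absolutely_integrable_on {0..t + 1}" using g[of "t + 1"] t0 by simp
  have step: "(\<lambda>n. P r n \<tau>) \<longlonglongrightarrow> (if \<tau> > r then 1 else 0)" for r \<tau>
  proof (cases "\<tau> > r")
    case True
    obtain n0 where n0: "1 / (\<tau> - r) < real n0" using reals_Archimedean2 by blast
    have "P r n \<tau> = 1" if "n \<ge> n0" for n
    proof -
      have "1 / (\<tau> - r) \<le> real (Suc n)" using n0 that by linarith
      then have "1 \<le> real (Suc n) * (\<tau> - r)" using True by (simp add: field_simps)
      then show ?thesis by (simp only: Peq R(3))
    qed
    then have "\<forall>\<^sub>F n in sequentially. P r n \<tau> = 1" using eventually_sequentially by blast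
    then show ?thesis using True by (simp add: tendsto_eventually)
  next
    case False
    then have "real (Suc n) * (\<tau> - r) \<le> 0" for n by (intro mult_nonneg_nonpos) auto
    then have "P r n \<tau> = 0" for n by (simp only: Peq R(2))
    then show ?thesis using False by simp
  qed
  \<comment> \<open>The steps vanish at their starting points, hence the half-open interval in the
    limit; the end point s is restored afterwards as a null set.\<close>
  have "(\<lambda>n. \<integral>\<tau>. ?\<phi> n \<tau> * g \<tau> \<partial>lebesgue) \<longlonglongrightarrow> (\<integral>\<tau>. indicator {s<..t} \<tau> *\<^sub>R g \<tau> \<partial>lebesgue)"
  proof (rule integral_dominated_convergence[where w = "\<lambda>\<tau>. norm (indicator {0..t + 1} \<tau> *\<^sub>R g \<tau>)"])
    have gm: "(\<lambda>\<tau>. indicator {0..t + 1} \<tau> *\<^sub>R g \<tau>) \<in> borel_measurable lebesgue"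
      using gt by (auto simp: set_integrable_def)
    show "integrable lebesgue (\<lambda>\<tau>. norm (indicator {0..t + 1} \<tau> *\<^sub>R g \<tau>))"
      using gt by (auto simp: set_integrable_def)
    have "(\<lambda>\<tau>. indicator {s<..t} \<tau> *\<^sub>R (indicator {0..t + 1} \<tau> *\<^sub>R g \<tau>)) \<in> borel_measurable lebesgue"
      by (intro borel_measurable_scaleR gm borel_measurable_indicator) auto
    moreover have "(\<lambda>\<tau>. indicator {s<..t} \<tau> *\<^sub>R (indicator {0..t + 1} \<tau> *\<^sub>R g \<tau>)) = (\<lambda>\<tau>. indicator {s<..t} \<tau> *\<^sub>R g \<tau>)"
      using st by (auto simp: indicator_def)
    ultimately show "(\<lambda>\<tau>. indicator {s<..t} \<tau> *\<^sub>R g \<tau>) \<in> borel_measurable lebesgue" by simp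
    show "(\<lambda>\<tau>. ?\<phi> n \<tau> * g \<tau>) \<in> borel_measurable lebesgue" for n
    proof -
      have "continuous_on UNIV (?\<phi> n)"
        using DERIV_isCont[OF dP] by (intro continuous_on_diff continuous_at_imp_continuous_on) auto
      then have "?\<phi> n \<in> borel_measurable lebesgue"
        by (intro measurable_completion) (simp add: borel_measurable_continuous_onI)
      then have "(\<lambda>\<tau>. ?\<phi> n \<tau> * (indicator {0..t + 1} \<tau> *\<^sub>R g \<tau>)) \<in> borel_measurable lebesgue" by (intro borel_measurable_times gm)
      moreover have "(\<lambda>\<tau>. ?\<phi> n \<tau> * (indicator {0..t + 1} \<tau> *\<^sub>R g \<tau>)) = (\<lambda>\<tau>. ?\<phi> n \<tau> * g \<tau>)"
      proof
        fix \<tau> show "?\<phi> n \<tau> * (indicator {0..t + 1} \<tau> *\<^sub>R g \<tau>) = ?\<phi> n \<tau> * g \<tau>"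
          using Pz[of \<tau> n] st by (cases "\<tau> \<in> {s..t + 1}") simp_all
      qed
      ultimately show ?thesis by simp
    qed
    show "AE \<tau> in lebesgue. (\<lambda>n. ?\<phi> n \<tau> * g \<tau>) \<longlonglongrightarrow> indicator {s<..t} \<tau> *\<^sub>R g \<tau>"
    proof (rule AE_I2)
      fix \<tau>
      have "(\<lambda>n. ?\<phi> n \<tau> * g \<tau>) \<longlonglongrightarrow> ((if \<tau> > s then 1 else 0) - (if \<tau> > t then 1 else 0)) * g \<tau>"
        by (intro tendsto_intros step)
      moreover have "((if \<tau> > s then 1 else 0) - (if \<tau> > t then 1 else 0)) * g \<tau> = indicator {s<..t} \<tau> *\<^sub>R g \<tau>"
        using st by (auto simp: indicator_def)
      ultimately show "(\<lambda>n. ?\<phi> n \<tau> * g \<tau>) \<longlonglongrightarrow> indicator {s<..t} \<tau> *\<^sub>R g \<tau>" by simp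
    qed
    show "AE \<tau> in lebesgue. norm (?\<phi> n \<tau> * g \<tau>) \<le> norm (indicator {0..t + 1} \<tau> *\<^sub>R g \<tau>)" for n
    proof (rule AE_I2)
      fix \<tau>
      have "\<bar>?\<phi> n \<tau>\<bar> \<le> 1" using R(4)[of "real (Suc n) * (\<tau> - s)"] R(4)[of "real (Suc n) * (\<tau> - t)"] unfolding Peq by linarith
      then have "\<bar>?\<phi> n \<tau>\<bar> * \<bar>g \<tau>\<bar> \<le> 1 * \<bar>g \<tau>\<bar>" by (intro mult_right_mono) auto
      then show "norm (?\<phi> n \<tau> * g \<tau>) \<le> norm (indicator {0..t + 1} \<tau> *\<^sub>R g \<tau>)"
        using Pz[of \<tau> n] st by (cases "\<tau> \<in> {s..t + 1}") (auto simp: abs_mult)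
    qed
  qed
  moreover have "(\<lambda>n. (\<integral>\<tau>. k s n \<tau> * f \<tau> \<partial>lebesgue) - (\<integral>\<tau>. k t n \<tau> * f \<tau> \<partial>lebesgue)) \<longlonglongrightarrow> f s - f t"
    using st t0 by (intro tendsto_diff klim) auto
  ultimately have "f s - f t = - (\<integral>\<tau>. indicator {s<..t} \<tau> *\<^sub>R g \<tau> \<partial>lebesgue)"
    unfolding eq using LIMSEQ_unique tendsto_minus by blast
  also have "(\<integral>\<tau>. indicator {s<..t} \<tau> *\<^sub>R g \<tau> \<partial>lebesgue) = (\<integral>\<tau>. indicator {s..t} \<tau> *\<^sub>R g \<tau> \<partial>lebesgue)"
  proof (rule Bochner_Integration.integral_cong_AE)
    have gs: "set_integrable lebesgue {s..t} g" by (rule abs_int_on_sub[OF gt]) (use st in auto)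
    then show m: "(\<lambda>\<tau>. indicator {s..t} \<tau> *\<^sub>R g \<tau>) \<in> borel_measurable lebesgue" by (auto simp: set_integrable_def)
    have "set_integrable lebesgue {s<..t} g" by (rule set_integrable_subset[OF gs]) auto
    then show "(\<lambda>\<tau>. indicator {s<..t} \<tau> *\<^sub>R g \<tau>) \<in> borel_measurable lebesgue" by (auto simp: set_integrable_def)
    show "AE \<tau> in lebesgue. indicator {s<..t} \<tau> *\<^sub>R g \<tau> = indicator {s..t} \<tau> *\<^sub>R g \<tau>"
      unfolding eventually_ae_filter_negligible by (rule exI[of _ "{s}"]) (auto simp: indicator_def)
  qed
  also have "\<dots> = integral {s..t} g"
    using set_lebesgue_integral_eq_integral(2)[OF abs_int_on_sub[OF gt, of s t]] st by (simp add: set_lebesgue_integral_def)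
  finally show ?thesis by simp
qed

text \<open>Both sides are continuous in the lower end point down to 0, so the identity for positive
  s extends to s = 0.\<close>

lemma weak_time_derivative_integral:
  fixes f g :: "real \<Rightarrow> real"
  assumes f: "continuous_on {0..} f" and g: "\<And>T. T > 0 \<Longrightarrow> g absolutely_integrable_on {0..T}"
    and w: "\<And>\<phi>. \<phi> \<in> time_test_functions \<Longrightarrow> (\<integral>t. deriv \<phi> t * f t \<partial>lebesgue) = - (\<integral>t. \<phi> t * g t \<partial>lebesgue)"
    and st: "0 \<le> s" "s \<le> t"
  shows "f t - f s = integral {s..t} g"
proof (cases "s = 0 \<and> 0 < t")
  case False
  then show ?thesis using st weak_time_derivative_integral_pos[OF f g w, of s t] by (cases "s = 0") auto
next
  case True
  then have t: "t > 0" and s: "s = 0" by auto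
  let ?G = "\<lambda>x. integral {0..x} g - (f x - f t)"
  have c: "continuous_on {0..t} ?G"
    by (intro continuous_intros indefinite_integral_continuous_1 set_lebesgue_integral_eq_integral(1)[OF g[OF t]] continuous_on_subset[OF f]) auto
  have eq: "?G x = integral {0..t} g" if "x \<in> {0<..t}" for x
    using weak_time_derivative_integral_pos[OF f g w, of x t] that
      Henstock_Kurzweil_Integration.integral_combine[of 0 x t g] set_lebesgue_integral_eq_integral(1)[OF g[OF t]] by auto
  have "(?G \<longlongrightarrow> ?G 0) (at 0 within {0..t})" by (rule c[unfolded continuous_on_def, rule_format]) (use t in simp)
  then have "(?G \<longlongrightarrow> ?G 0) (at_right 0)" using t by (simp add: at_within_Icc_at_right)
  moreover have "(?G \<longlongrightarrow> integral {0..t} g) (at_right 0)"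
    by (rule tendsto_eventually) (use eq t in \<open>auto simp: eventually_at_right intro!: exI[of _ t]\<close>)
  ultimately have "?G 0 = integral {0..t} g" using tendsto_unique[OF trivial_limit_at_right_real] by blast
  then show ?thesis unfolding s by simp
qed

section \<open>Absolutely continuous scalar functions of time\<close>

definition primitive_on_ge0 :: "(real \<Rightarrow> real) \<Rightarrow> (real \<Rightarrow> real) \<Rightarrow> bool" where
  "primitive_on_ge0 A a \<longleftrightarrow> (\<forall>T>0. a absolutely_integrable_on {0..T}) \<and>
     (\<forall>s t. 0 \<le> s \<and> s \<le> t \<longrightarrow> A t - A s = integral {s..t} a)"

lemma primitive_abs_int:
  assumes "primitive_on_ge0 A a" "0 \<le> s" shows "a absolutely_integrable_on {s..t}"
proof -
  have "a absolutely_integrable_on {0..\<bar>t\<bar> + 1}" using assms(1) by (simp add: primitive_on_ge0_def)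
  then show ?thesis by (rule abs_int_on_sub) (use assms(2) in auto)
qed

lemma primitive_int: "primitive_on_ge0 A a \<Longrightarrow> 0 \<le> s \<Longrightarrow> a integrable_on {s..t}"
  by (rule set_lebesgue_integral_eq_integral(1)[OF primitive_abs_int])

lemma primitive_eq: "primitive_on_ge0 A a \<Longrightarrow> 0 \<le> s \<Longrightarrow> s \<le> t \<Longrightarrow> A t - A s = integral {s..t} a"
  by (simp add: primitive_on_ge0_def)

lemma primitive_continuous:
  assumes "primitive_on_ge0 A a" shows "continuous_on {0..T} A"
proof -
  have "continuous_on {0..T} (\<lambda>x. A 0 + integral {0..x} a)"
    by (intro continuous_intros indefinite_integral_continuous_1 primitive_int[OF assms]) simp
  then show ?thesis
  proof (rule continuous_on_eq)
    show "A 0 + integral {0..x} a = A x" if "x \<in> {0..T}" for x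
      using primitive_eq[OF assms, of 0 x] that by simp
  qed
qed

lemma primitive_add:
  assumes "primitive_on_ge0 A a" "primitive_on_ge0 P p"
  shows "primitive_on_ge0 (\<lambda>t. A t + P t) (\<lambda>t. a t + p t)"
  unfolding primitive_on_ge0_def
proof (intro conjI allI impI)
  show "(\<lambda>t. a t + p t) absolutely_integrable_on {0..T}" for T
    by (intro set_integral_add(1) primitive_abs_int[OF assms(1)] primitive_abs_int[OF assms(2)]) auto
  fix s t :: real assume st: "0 \<le> s \<and> s \<le> t"
  have "integral {s..t} (\<lambda>t. a t + p t) = integral {s..t} a + integral {s..t} p"
    using st by (intro Henstock_Kurzweil_Integration.integral_add primitive_int[OF assms(1)] primitive_int[OF assms(2)]) auto
  then show "A t + P t - (A s + P s) = integral {s..t} (\<lambda>t. a t + p t)"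
    using primitive_eq[OF assms(1), of s t] primitive_eq[OF assms(2), of s t] st by simp
qed

lemma primitive_cmult:
  assumes "primitive_on_ge0 A a"
  shows "primitive_on_ge0 (\<lambda>t. c * A t) (\<lambda>t. c * a t)"
  unfolding primitive_on_ge0_def
proof (intro conjI allI impI)
  show "(\<lambda>t. c * a t) absolutely_integrable_on {0..T}" for T
    by (intro set_integrable_mult_right impI primitive_abs_int[OF assms]) auto
  fix s t :: real assume st: "0 \<le> s \<and> s \<le> t"
  then show "c * A t - c * A s = integral {s..t} (\<lambda>t. c * a t)"
    using primitive_eq[OF assms, of s t] by (simp flip: right_diff_distrib)
qed

lemma primitive_zero: "primitive_on_ge0 (\<lambda>_. 0) (\<lambda>_. 0)"
  by (simp add: primitive_on_ge0_def)

lemma primitive_sum: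
  "(\<And>i. i \<in> I \<Longrightarrow> primitive_on_ge0 (A i) (a i)) \<Longrightarrow> primitive_on_ge0 (\<lambda>t. \<Sum>i\<in>I. A i t) (\<lambda>t. \<Sum>i\<in>I. a i t)"
  by (induction I rule: infinite_finite_induct) (auto intro: primitive_zero primitive_add)

lemma abs_int_mult_continuous:
  fixes a P :: "real \<Rightarrow> real"
  assumes "a absolutely_integrable_on {s..t}" "continuous_on {s..t} P"
  shows "(\<lambda>x. P x * a x) absolutely_integrable_on {s..t}"
proof (rule absolutely_integrable_bounded_measurable_product_real[OF _ _ _ assms(1)])
  show "P \<in> borel_measurable (lebesgue_on {s..t})"
    by (rule continuous_imp_measurable_on_sets_lebesgue[OF assms(2)]) simp
  show "bounded (P ` {s..t})" by (intro compact_imp_bounded compact_continuous_image assms(2)) simp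
qed simp

text \<open>The exact increment P y (A y - A x) + A x (P y - P x) has frozen factors, and uniform
  continuity replaces them by their values at \<sigma> at the cost of \<epsilon> (|a| + |p|). The
  tagged error of \<open>right_tagged_inequality\<close> is 0 here.\<close>

lemma primitive_mult_le:
  assumes A: "primitive_on_ge0 A a" and P: "primitive_on_ge0 P p" and st: "0 \<le> s" "s < t"
  shows "A t * P t - A s * P s \<le> integral {s..t} (\<lambda>x. P x * a x + A x * p x)"
proof (rule right_tagged_inequality[OF st(2), of "t + 1" "\<lambda>x. A x * P x" "\<lambda>x. P x * a x + A x * p x" "\<lambda>x. \<bar>a x\<bar> + \<bar>p x\<bar>" "{}"])
  let ?T = "t + 1"
  have c: "continuous_on {s..?T} A" "continuous_on {s..?T} P"
    using st by (auto intro: continuous_on_subset[OF primitive_continuous[OF A]] continuous_on_subset[OF primitive_continuous[OF P]])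
  note ai = primitive_abs_int[OF A st(1)] and pi = primitive_abs_int[OF P st(1)]
  show "continuous_on {s..?T} (\<lambda>x. A x * P x)" by (intro continuous_on_mult c)
  show b: "(\<lambda>x. P x * a x + A x * p x) absolutely_integrable_on {s..?T}"
    by (intro set_integral_add(1) abs_int_mult_continuous ai pi c)
  show k: "(\<lambda>x. \<bar>a x\<bar> + \<bar>p x\<bar>) absolutely_integrable_on {s..?T}"
    by (intro set_integral_add(1) set_integrable_abs ai pi)
  fix \<epsilon> :: real assume \<epsilon>: "\<epsilon> > 0"
  obtain d1 where d1: "d1 > 0" "\<And>x y. x \<in> {s..?T} \<Longrightarrow> y \<in> {s..?T} \<Longrightarrow> dist y x < d1 \<Longrightarrow> dist (A y) (A x) < \<epsilon>"
    by (rule uniformly_continuous_onE[OF compact_uniformly_continuous[OF c(1) compact_Icc] \<epsilon>], rule that)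
  obtain d2 where d2: "d2 > 0" "\<And>x y. x \<in> {s..?T} \<Longrightarrow> y \<in> {s..?T} \<Longrightarrow> dist y x < d2 \<Longrightarrow> dist (P y) (P x) < \<epsilon>"
    by (rule uniformly_continuous_onE[OF compact_uniformly_continuous[OF c(2) compact_Icc] \<epsilon>], rule that)
  have main: "A y * P y - A x * P x \<le> integral {x..y} (\<lambda>\<sigma>. P \<sigma> * a \<sigma> + A \<sigma> * p \<sigma> + \<epsilon> * (\<bar>a \<sigma>\<bar> + \<bar>p \<sigma>\<bar>) + 0) + (y - x) * 0"
    if xy: "s \<le> x" "x < y" "y \<le> ?T" "y - x < min d1 d2" for x y
  proof -
    have x0: "0 \<le> x" using st xy by simp
    have i: "a integrable_on {x..y}" "p integrable_on {x..y}" by (rule primitive_int[OF A x0], rule primitive_int[OF P x0])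
    have "A y * P y - A x * P x = P y * (A y - A x) + A x * (P y - P x)" by (simp add: algebra_simps)
    also have "\<dots> = integral {x..y} (\<lambda>\<sigma>. P y * a \<sigma>) + integral {x..y} (\<lambda>\<sigma>. A x * p \<sigma>)"
      using primitive_eq[OF A x0, of y] primitive_eq[OF P x0, of y] xy by simp
    also have "\<dots> = integral {x..y} (\<lambda>\<sigma>. P y * a \<sigma> + A x * p \<sigma>)"
      using i by (intro Henstock_Kurzweil_Integration.integral_add[symmetric]) (auto intro: integrable_on_mult_right)
    also have "\<dots> \<le> integral {x..y} (\<lambda>\<sigma>. P \<sigma> * a \<sigma> + A \<sigma> * p \<sigma> + \<epsilon> * (\<bar>a \<sigma>\<bar> + \<bar>p \<sigma>\<bar>))"
    proof (rule integral_le)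
      show "(\<lambda>\<sigma>. P y * a \<sigma> + A x * p \<sigma>) integrable_on {x..y}" using i by (intro integrable_add) (auto intro: integrable_on_mult_right)
      have "(\<lambda>\<sigma>. P \<sigma> * a \<sigma> + A \<sigma> * p \<sigma> + \<epsilon> * (\<bar>a \<sigma>\<bar> + \<bar>p \<sigma>\<bar>)) absolutely_integrable_on {s..?T}"
        by (intro set_integral_add(1)[OF b] set_integrable_mult_right impI k)
      then show "(\<lambda>\<sigma>. P \<sigma> * a \<sigma> + A \<sigma> * p \<sigma> + \<epsilon> * (\<bar>a \<sigma>\<bar> + \<bar>p \<sigma>\<bar>)) integrable_on {x..y}"
        by (rule int_on_sub) (use xy in auto)
      fix \<sigma> assume \<sigma>: "\<sigma> \<in> {x..y}"
      have "\<bar>P y - P \<sigma>\<bar> \<le> \<epsilon>" "\<bar>A x - A \<sigma>\<bar> \<le> \<epsilon>"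
      proof -
        have "dist y \<sigma> < d2" "dist x \<sigma> < d1" "x \<in> {s..?T}" "y \<in> {s..?T}" "\<sigma> \<in> {s..?T}"
          using \<sigma> xy by (simp_all add: dist_real_def)
        from d2(2)[OF this(5,4,1)] d1(2)[OF this(5,3,2)]
        show "\<bar>P y - P \<sigma>\<bar> \<le> \<epsilon>" "\<bar>A x - A \<sigma>\<bar> \<le> \<epsilon>" by (simp_all add: dist_real_def)
      qed
      then have "\<bar>P y - P \<sigma>\<bar> * \<bar>a \<sigma>\<bar> \<le> \<epsilon> * \<bar>a \<sigma>\<bar>" "\<bar>A x - A \<sigma>\<bar> * \<bar>p \<sigma>\<bar> \<le> \<epsilon> * \<bar>p \<sigma>\<bar>" by (auto intro: mult_right_mono)
      then have "(P y - P \<sigma>) * a \<sigma> \<le> \<epsilon> * \<bar>a \<sigma>\<bar>" "(A x - A \<sigma>) * p \<sigma> \<le> \<epsilon> * \<bar>p \<sigma>\<bar>"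
        using abs_ge_self[of "(P y - P \<sigma>) * a \<sigma>"] abs_ge_self[of "(A x - A \<sigma>) * p \<sigma>"] unfolding abs_mult by linarith+
      then show "P y * a \<sigma> + A x * p \<sigma> \<le> P \<sigma> * a \<sigma> + A \<sigma> * p \<sigma> + \<epsilon> * (\<bar>a \<sigma>\<bar> + \<bar>p \<sigma>\<bar>)"
        by (simp add: algebra_simps)
    qed
    finally show ?thesis by simp
  qed
  show "\<exists>E \<delta>. E absolutely_integrable_on {s..?T} \<and> integral {s..?T} E \<le> \<epsilon> \<and> (\<forall>\<tau>. 0 \<le> E \<tau>) \<and> \<delta> > 0 \<and>
      (\<forall>x y. s \<le> x \<and> x < y \<and> y \<le> ?T \<and> y - x < \<delta> \<and> y \<notin> {} \<longrightarrow>
         A y * P y - A x * P x \<le> integral {x..y} (\<lambda>\<sigma>. P \<sigma> * a \<sigma> + A \<sigma> * p \<sigma> + \<epsilon> * (\<bar>a \<sigma>\<bar> + \<bar>p \<sigma>\<bar>) + E \<sigma>) + (y - x) * E y)"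
  proof (intro exI[of _ "\<lambda>_. 0"] exI[of _ "min d1 d2"] conjI allI impI)
    show "(\<lambda>_. 0 :: real) absolutely_integrable_on {s..?T}" by simp
    show "integral {s..?T} (\<lambda>_. 0) \<le> \<epsilon>" using \<epsilon> by simp
    show "0 < min d1 d2" using d1(1) d2(1) by simp
    fix x y assume "s \<le> x \<and> x < y \<and> y \<le> ?T \<and> y - x < min d1 d2 \<and> y \<notin> {}"
    then show "A y * P y - A x * P x \<le> integral {x..y} (\<lambda>\<sigma>. P \<sigma> * a \<sigma> + A \<sigma> * p \<sigma> + \<epsilon> * (\<bar>a \<sigma>\<bar> + \<bar>p \<sigma>\<bar>) + 0) + (y - x) * 0"
      by (elim conjE) (rule main)
  qed simp
qed simp_all

text \<open>The inequality applied to P and to - P gives equality.\<close>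

lemma primitive_mult:
  assumes A: "primitive_on_ge0 A a" and P: "primitive_on_ge0 P p"
  shows "primitive_on_ge0 (\<lambda>t. A t * P t) (\<lambda>t. P t * a t + A t * p t)"
  unfolding primitive_on_ge0_def
proof (intro conjI allI impI)
  show "(\<lambda>t. P t * a t + A t * p t) absolutely_integrable_on {0..T}" for T
    by (intro set_integral_add(1) abs_int_mult_continuous primitive_abs_int[OF A] primitive_abs_int[OF P]
        primitive_continuous[OF A] primitive_continuous[OF P]) auto
  fix s t :: real assume st: "0 \<le> s \<and> s \<le> t"
  show "A t * P t - A s * P s = integral {s..t} (\<lambda>t. P t * a t + A t * p t)"
  proof (cases "s = t")
    case False
    then have st: "0 \<le> s" "s < t" using st by auto
    have P': "primitive_on_ge0 (\<lambda>t. - 1 * P t) (\<lambda>t. - 1 * p t)" by (rule primitive_cmult[OF P])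
    have "A t * (- 1 * P t) - A s * (- 1 * P s) \<le> integral {s..t} (\<lambda>x. (- 1 * P x) * a x + A x * (- 1 * p x))"
      by (rule primitive_mult_le[OF A P' st])
    also have "\<dots> = - integral {s..t} (\<lambda>x. P x * a x + A x * p x)"
      unfolding integral_neg[symmetric] by (intro arg_cong[of _ _ "integral {s..t}"] ext) (simp add: algebra_simps)
    finally show ?thesis using primitive_mult_le[OF A P st] by simp
  qed simp
qed

text \<open>The simple functions have finitely many values, so G composed with them is measurable,
  and sequential continuity of G on X in the seminorm passes this to the limit. It is the source of
  measurability for norms and pairings of \<open>u\<close> and \<open>m\<close> and for the Fourier
  coefficients of \<open>ht\<close>.\<close>

lemma bochner_measurable_apply:
  fixes G :: "('a \<Rightarrow> 'b::real_normed_vector) \<Rightarrow> real"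
  assumes f: "bochner_measurable S X nrm f" and S: "S \<in> sets lebesgue" and X: "AE t in lebesgue. t \<in> S \<longrightarrow> f t \<in> X"
    and G: "\<And>p q. p \<in> X \<Longrightarrow> (\<And>k::nat. q k \<in> X) \<Longrightarrow> (\<lambda>k. nrm (\<lambda>x. q k x - p x)) \<longlonglongrightarrow> 0 \<Longrightarrow> (\<lambda>k. G (q k)) \<longlonglongrightarrow> G p"
  shows "(\<lambda>t. G (f t)) \<in> borel_measurable (lebesgue_on S)"
proof -
  obtain s :: "nat \<Rightarrow> real \<Rightarrow> 'a \<Rightarrow> 'b" where s: "\<And>k. finite (range (s k))" "\<And>k. range (s k) \<subseteq> X" "\<And>k p. s k -` {p} \<in> sets lebesgue"
    "AE t in lebesgue. t \<in> S \<longrightarrow> (\<lambda>k. nrm (\<lambda>x. s k t x - f t x)) \<longlonglongrightarrow> 0"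
    using f unfolding bochner_measurable_def by blast
  have m: "(\<lambda>t. G (s k t)) \<in> borel_measurable lebesgue" for k
  proof (rule measurableI)
    fix B :: "real set" assume "B \<in> sets borel"
    have "(\<lambda>t. G (s k t)) -` B \<inter> space lebesgue = (\<Union>p\<in>{p \<in> range (s k). G p \<in> B}. s k -` {p})" by auto
    also have "\<dots> \<in> sets lebesgue" using s(1,3) by (intro sets.finite_UN) auto
    finally show "(\<lambda>t. G (s k t)) -` B \<inter> space lebesgue \<in> sets lebesgue" .
  qed simp
  let ?h = "\<lambda>k t. indicator S t * G (s k t)"
  have "(\<lambda>t. lim (\<lambda>k. ?h k t)) \<in> borel_measurable lebesgue"
    using S by (intro borel_measurable_lim_metric borel_measurable_times m borel_measurable_indicator)
  moreover have "AE t in lebesgue. lim (\<lambda>k. ?h k t) = indicator S t * G (f t)"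
    using X s(4)
  proof eventually_elim
    case (elim t)
    have "(\<lambda>k. ?h k t) \<longlonglongrightarrow> indicator S t * G (f t)"
    proof (cases "t \<in> S")
      case True
      then have "(\<lambda>k. G (s k t)) \<longlonglongrightarrow> G (f t)" using elim s(2) by (intro G) auto
      then show ?thesis using True by simp
    qed simp
    then show ?case by (rule limI)
  qed
  ultimately have "(\<lambda>t. indicator S t * G (f t)) \<in> borel_measurable lebesgue" by (rule borel_measurable_AE)
  then show ?thesis using S by (simp add: borel_measurable_restrict_space_iff mult.commute)
qed

text \<open>Regularity of Lebesgue measure places A between a closed and an open set whose
  difference has small measure. A Urysohn function between them has values in [0, 1], so the squared
  error is at most the indicator of that difference.\<close>

lemma indicator_approx_continuous:
  fixes \<epsilon> :: real
  assumes A: "A \<in> sets lebesgue" and \<epsilon>: "\<epsilon> > 0"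
  shows "\<exists>\<phi>::real \<Rightarrow> real. continuous_on UNIV \<phi> \<and> (\<lambda>t. (indicator A t - \<phi> t)\<^sup>2) absolutely_integrable_on {0..T} \<and>
     integral {0..T} (\<lambda>t. (indicator A t - \<phi> t)\<^sup>2) \<le> \<epsilon>"
proof -
  obtain U where U: "open U" "A \<subseteq> U" "U - A \<in> lmeasurable" "emeasure lebesgue (U - A) < ennreal (\<epsilon> / 2)"
    using sets_lebesgue_outer_open[OF A, of "\<epsilon> / 2"] \<epsilon> by auto
  obtain K where K: "closed K" "K \<subseteq> A" "A - K \<in> lmeasurable" "emeasure lebesgue (A - K) < ennreal (\<epsilon> / 2)"
    using sets_lebesgue_inner_closed[OF A, of "\<epsilon> / 2"] \<epsilon> by auto
  have "K \<inter> - U = {}" using U(2) K(2) by auto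
  with K(1) U(1) obtain \<phi> :: "real \<Rightarrow> real" where \<phi>: "continuous_on UNIV \<phi>" "\<And>x. \<phi> x \<in> closed_segment 1 0"
    "\<And>x. x \<in> K \<Longrightarrow> \<phi> x = 1" "\<And>x. x \<in> - U \<Longrightarrow> \<phi> x = 0"
    using Urysohn[of K "- U" 1 0] by auto
  have \<phi>01: "0 \<le> \<phi> x" "\<phi> x \<le> 1" for x using \<phi>(2)[of x] by (auto simp: closed_segment_eq_real_ivl)
  let ?D = "(U - A) \<union> (A - K)"
  have D: "?D \<in> lmeasurable" using U(3) K(3) by (rule fmeasurable.Un)
  have mD: "measure lebesgue ?D \<le> \<epsilon>"
  proof -
    have "measure lebesgue (U - A) \<le> \<epsilon> / 2" "measure lebesgue (A - K) \<le> \<epsilon> / 2"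
      unfolding measure_def using less_imp_le[OF U(4)] less_imp_le[OF K(4)] \<epsilon> by (auto intro!: enn2real_leI simp del: le_divide_eq_numeral1)
    then show ?thesis using measure_Un_le[of "U - A" lebesgue "A - K"] U(3) K(3) by (auto simp: fmeasurableD)
  qed
  have le: "(indicator A t - \<phi> t)\<^sup>2 \<le> indicator ?D t" for t
  proof (cases "t \<in> ?D")
    case True
    have "\<bar>indicator A t - \<phi> t\<bar> \<le> 1" using \<phi>01[of t] by (auto simp: indicator_def)
    then show ?thesis using True by (simp add: abs_square_le_1)
  next
    case False
    then have "indicator A t - \<phi> t = 0" using \<phi>(3,4)[of t] U(2) K(2) by (auto simp: indicator_def)
    then show ?thesis by simp
  qed
  have iD: "integrable lebesgue (indicator ?D :: real \<Rightarrow> real)" using D by (intro integrable_real_indicator) (auto simp: fmeasurable_def)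
  have sD: "set_integrable lebesgue {0..T} (indicator ?D :: real \<Rightarrow> real)"
    unfolding set_integrable_def by (rule integrable_mult_indicator[OF _ iD]) simp
  have m: "(\<lambda>t. (indicator A t - \<phi> t)\<^sup>2) \<in> borel_measurable lebesgue"
  proof -
    have "\<phi> \<in> borel_measurable lebesgue"
      by (intro measurable_completion) (simp add: borel_measurable_continuous_onI[OF \<phi>(1)])
    then show ?thesis using A by (intro borel_measurable_power borel_measurable_diff borel_measurable_indicator) auto
  qed
  have ai: "(\<lambda>t. (indicator A t - \<phi> t)\<^sup>2) absolutely_integrable_on {0..T}"
    by (rule absolutely_integrable_bound_AE[OF _ _ sD]) (use m le in \<open>auto intro: measurable_restrict_space1\<close>)
  have "integral {0..T} (\<lambda>t. (indicator A t - \<phi> t)\<^sup>2) \<le> integral {0..T} (indicator ?D)"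
    by (rule integral_mono_AE_on[OF ai sD]) (use le in auto)
  also have "\<dots> = (\<integral>t. indicator {0..T} t *\<^sub>R indicator ?D t \<partial>lebesgue)"
    using set_lebesgue_integral_eq_integral(2)[OF sD] by (simp add: set_lebesgue_integral_def)
  also have "\<dots> \<le> (\<integral>t. indicator ?D t \<partial>lebesgue)"
    by (rule integral_mono[OF sD[unfolded set_integrable_def] iD]) (auto simp: indicator_def)
  also have "\<dots> = measure lebesgue ?D" by simp
  finally show ?thesis using \<phi>(1) ai mD by (intro exI[of _ \<phi>]) auto
qed

lemma L2_time_integrable_sq:
  assumes f: "f \<in> L2_time {0..T} X nrm" and m: "(\<lambda>t. nrm (f t)) \<in> borel_measurable (lebesgue_on {0..T})"
  shows "(\<lambda>t. (nrm (f t))\<^sup>2) absolutely_integrable_on {0..T}"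
  unfolding set_integrable_def
proof (rule integrableI_bounded)
  have "(\<lambda>t. (nrm (f t))\<^sup>2) \<in> borel_measurable (lebesgue_on {0..T})" using m by simp
  then show "(\<lambda>t. indicat_real {0..T} t *\<^sub>R (nrm (f t))\<^sup>2) \<in> borel_measurable lebesgue"
    by (simp add: borel_measurable_restrict_space_iff mult.commute)
  have "(\<integral>\<^sup>+t. ennreal (norm (indicat_real {0..T} t *\<^sub>R (nrm (f t))\<^sup>2)) \<partial>lebesgue) = (\<integral>\<^sup>+t\<in>{0..T}. ennreal ((nrm (f t))\<^sup>2) \<partial>lebesgue)"
    by (intro nn_integral_cong) (auto simp: indicator_def)
  then show "(\<integral>\<^sup>+t. ennreal (norm (indicat_real {0..T} t *\<^sub>R (nrm (f t))\<^sup>2)) \<partial>lebesgue) < \<infinity>"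
    using f by (simp add: L2_time_def)
qed

section \<open>Functions of time with values in a function space\<close>

text \<open>A quantitative Lusin property. \<open>u\<close> is close in mean square to a function
  with finitely many values, and the indicators of its level sets are close to continuous functions;
  e collects both errors at a given time and \<eta> absorbs the modulus of the continuous functions.
  The error e is small only in mean square, and its square later feeds the error function of
  \<open>right_tagged_inequality\<close>.\<close>

lemma L2_time_modulus:
  fixes u :: "real \<Rightarrow> 'a \<Rightarrow> 'b::real_normed_vector" and nrm :: "('a \<Rightarrow> 'b) \<Rightarrow> real"
  assumes u: "u \<in> L2_time {0..T} X nrm" and zero: "(\<lambda>_. 0) \<in> X" "nrm (\<lambda>_. 0) = 0"
    and nonneg: "\<And>p. 0 \<le> nrm p"
    and tri: "\<And>p q r. p \<in> X \<Longrightarrow> q \<in> X \<Longrightarrow> r \<in> X \<Longrightarrow> nrm (\<lambda>x. p x - r x) \<le> nrm (\<lambda>x. p x - q x) + nrm (\<lambda>x. q x - r x)"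
    and comm: "\<And>p q. p \<in> X \<Longrightarrow> q \<in> X \<Longrightarrow> nrm (\<lambda>x. p x - q x) = nrm (\<lambda>x. q x - p x)"
    and \<epsilon>: "\<epsilon> > 0"
  shows "\<exists>e. e \<in> borel_measurable (lebesgue_on {0..T}) \<and> (\<lambda>t. (e t)\<^sup>2) absolutely_integrable_on {0..T} \<and>
     integral {0..T} (\<lambda>t. (e t)\<^sup>2) \<le> \<epsilon> \<and> (\<forall>t. 0 \<le> e t) \<and>
     (\<forall>\<eta>>0. \<exists>\<delta>>0. \<forall>\<sigma>\<in>{0..T}. \<forall>\<tau>\<in>{0..T}. \<bar>\<sigma> - \<tau>\<bar> < \<delta> \<and> u \<sigma> \<in> X \<and> u \<tau> \<in> X \<longrightarrow>
        nrm (\<lambda>x. u \<sigma> x - u \<tau> x) \<le> e \<sigma> + e \<tau> + \<eta>)"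
proof -
  let ?S = "{0..T}" and ?d = "\<lambda>p q. nrm (\<lambda>x. p x - q x)"
  have bm: "bochner_measurable ?S X nrm u" and uX: "AE t in lebesgue. t \<in> ?S \<longrightarrow> u t \<in> X"
    using u by (auto simp: L2_time_def)
  obtain s :: "nat \<Rightarrow> real \<Rightarrow> 'a \<Rightarrow> 'b" where s: "\<And>k. finite (range (s k))" "\<And>k. range (s k) \<subseteq> X" "\<And>k p. s k -` {p} \<in> sets lebesgue"
    "AE t in lebesgue. t \<in> ?S \<longrightarrow> (\<lambda>k. ?d (s k t) (u t)) \<longlonglongrightarrow> 0"
    using bm unfolding bochner_measurable_def by blast
  have sX: "s k t \<in> X" for k t using s(2)[of k] by auto
  have d0: "?d p p = 0" for p by (simp add: zero)
  have cont: "(\<lambda>k. ?d p (q k)) \<longlonglongrightarrow> ?d p r" if "p \<in> X" "r \<in> X" "\<And>k::nat. q k \<in> X" "(\<lambda>k. ?d (q k) r) \<longlonglongrightarrow> 0" for p q r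
  proof (rule LIM_zero_cancel, rule Lim_null_comparison[OF _ that(4)], rule always_eventually, rule allI)
    fix k
    show "norm (?d p (q k) - ?d p r) \<le> ?d (q k) r"
      using tri[OF that(1) that(3) that(2), of k] tri[OF that(1,2) that(3), of k] comm[OF that(3) that(2), of k] by (auto simp: abs_le_iff)
  qed
  have m0: "(\<lambda>t. ?d p (u t)) \<in> borel_measurable (lebesgue_on ?S)" if "p \<in> X" for p
    by (rule bochner_measurable_apply[OF bm _ uX]) (use cont[OF that] in auto)
  have nrm0: "?d (\<lambda>_. 0) p = nrm p" if "p \<in> X" for p using comm[OF that zero(1)] by simp
  have sq: "(\<lambda>t. (nrm (u t))\<^sup>2) absolutely_integrable_on ?S"
  proof (rule L2_time_integrable_sq[OF u], rule bochner_measurable_apply[where G = nrm and f = u and X = X and nrm = nrm, OF bm _ uX])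
    fix p :: "'a \<Rightarrow> 'b" and q :: "nat \<Rightarrow> 'a \<Rightarrow> 'b"
    assume pq: "p \<in> X" "\<And>k. q k \<in> X" "(\<lambda>k. ?d (q k) p) \<longlonglongrightarrow> 0"
    show "(\<lambda>k. nrm (q k)) \<longlonglongrightarrow> nrm p" using cont[OF zero(1) pq] unfolding nrm0[OF pq(1)] nrm0[OF pq(2)] .
  qed simp
  have ms: "(\<lambda>t. ?d (s k t) (u t)) \<in> borel_measurable (lebesgue_on ?S)" for k
  proof -
    have "(\<lambda>t. \<Sum>p\<in>range (s k). indicator (s k -` {p}) t * ?d p (u t)) \<in> borel_measurable (lebesgue_on ?S)"
      using s(2,3)[of k]
      by (intro borel_measurable_sum borel_measurable_times m0) (auto intro!: measurable_restrict_space1)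
    moreover have "(\<Sum>p\<in>range (s k). indicator (s k -` {p}) t * ?d p (u t)) = ?d (s k t) (u t)" for t
    proof -
      have "(\<Sum>p\<in>range (s k). indicator (s k -` {p}) t * ?d p (u t)) = (\<Sum>p\<in>range (s k). if p = s k t then ?d p (u t) else 0)"
        by (intro sum.cong) (auto simp: indicator_def)
      then show ?thesis using s(1)[of k] by simp
    qed
    ultimately show ?thesis by simp
  qed
  \<comment> \<open>The simple functions converge only pointwise. Resetting them to 0 where the
    error exceeds 1 gives the dominating function 1 + |u|^2 and leaves the limit unchanged.\<close>
  define B where "B k = {t \<in> ?S. ?d (s k t) (u t) \<le> 1}" for k
  have B: "B k \<in> sets lebesgue" for k
  proof -
    have "{t \<in> space (lebesgue_on ?S). ?d (s k t) (u t) \<le> 1} \<in> sets (lebesgue_on ?S)"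
      by (rule borel_measurable_le[OF ms]) simp
    then show ?thesis by (simp add: B_def space_restrict_space sets_restrict_space_iff)
  qed
  define w where "w k t = (if t \<in> B k then s k t else (\<lambda>_. 0))" for k t
  have wX: "w k t \<in> X" for k t using sX zero by (simp add: w_def)
  have mw: "(\<lambda>t. ?d (w k t) (u t)) \<in> borel_measurable (lebesgue_on ?S)" for k
  proof -
    have "(\<lambda>t. indicator (B k) t * ?d (s k t) (u t) + (1 - indicator (B k) t) * ?d (\<lambda>_. 0) (u t)) \<in> borel_measurable (lebesgue_on ?S)"
      using B[of k] by (intro borel_measurable_add borel_measurable_times borel_measurable_diff ms m0 zero)
        (auto intro!: measurable_restrict_space1)
    also have "(\<lambda>t. indicator (B k) t * ?d (s k t) (u t) + (1 - indicator (B k) t) * ?d (\<lambda>_. 0) (u t)) = (\<lambda>t. ?d (w k t) (u t))"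
      by (auto simp: w_def indicator_def)
    finally show ?thesis .
  qed
  have bound: "(?d (w k t) (u t))\<^sup>2 \<le> 1 + (nrm (u t))\<^sup>2" if "u t \<in> X" for k t
  proof (cases "t \<in> B k")
    case True
    then have "(?d (w k t) (u t))\<^sup>2 \<le> 1" using nonneg by (simp add: w_def B_def abs_square_le_1)
    then show ?thesis by (simp add: add_increasing2)
  next
    case False
    then have "w k t = (\<lambda>_. 0)" by (simp add: w_def)
    then have "?d (w k t) (u t) = nrm (u t)" using nrm0[OF that] by simp
    then show ?thesis by simp
  qed
  have b_int: "(\<lambda>t. 1 + (nrm (u t))\<^sup>2) absolutely_integrable_on ?S"
    by (intro set_integral_add(1) sq) (auto intro!: absolutely_integrable_continuous_real)
  have ai: "(\<lambda>t. (?d (w k t) (u t))\<^sup>2) absolutely_integrable_on ?S" for k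
  proof (rule absolutely_integrable_bound_AE[OF _ _ b_int])
    show "AE t in lebesgue. t \<in> ?S \<longrightarrow> \<bar>(?d (w k t) (u t))\<^sup>2\<bar> \<le> 1 + (nrm (u t))\<^sup>2"
      using uX by eventually_elim (use bound in auto)
  qed (use mw in \<open>auto intro!: borel_measurable_power\<close>)
  have "(\<lambda>k. \<integral>t. indicator ?S t *\<^sub>R (?d (w k t) (u t))\<^sup>2 \<partial>lebesgue) \<longlonglongrightarrow> (\<integral>t. 0 \<partial>(lebesgue :: real measure))"
  proof (rule integral_dominated_convergence[where w = "\<lambda>t. indicator ?S t *\<^sub>R (1 + (nrm (u t))\<^sup>2)"])
    show "integrable lebesgue (\<lambda>t. indicator ?S t *\<^sub>R (1 + (nrm (u t))\<^sup>2))" using b_int by (simp add: set_integrable_def)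
    show "(\<lambda>t. indicator ?S t *\<^sub>R (?d (w k t) (u t))\<^sup>2) \<in> borel_measurable lebesgue" for k
      using ai[of k] by (simp only: set_integrable_def borel_measurable_integrable)
    show "AE t in lebesgue. norm (indicator ?S t *\<^sub>R (?d (w k t) (u t))\<^sup>2) \<le> indicator ?S t *\<^sub>R (1 + (nrm (u t))\<^sup>2)" for k
      using uX by eventually_elim (use bound in \<open>auto simp: indicator_def\<close>)
    show "AE t in lebesgue. (\<lambda>k. indicator ?S t *\<^sub>R (?d (w k t) (u t))\<^sup>2) \<longlonglongrightarrow> 0"
      using s(4)
    proof eventually_elim
      case (elim t)
      show ?case
      proof (cases "t \<in> ?S")
        case True
        with elim have l: "(\<lambda>k. ?d (s k t) (u t)) \<longlonglongrightarrow> 0" by simp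
        then have "(\<lambda>k. (?d (s k t) (u t))\<^sup>2) \<longlonglongrightarrow> 0\<^sup>2" by (rule tendsto_power)
        then have l2: "(\<lambda>k. (?d (s k t) (u t))\<^sup>2) \<longlonglongrightarrow> 0" by simp
        have "eventually (\<lambda>k. ?d (s k t) (u t) < 1) sequentially" using l by (rule order_tendstoD) simp
        then have "eventually (\<lambda>k. (?d (s k t) (u t))\<^sup>2 = indicator ?S t *\<^sub>R (?d (w k t) (u t))\<^sup>2) sequentially"
          by eventually_elim (use True in \<open>simp add: w_def B_def\<close>)
        with l2 show ?thesis by (rule Lim_transform_eventually)
      qed simp
    qed
  qed simp
  then have "(\<lambda>k. integral ?S (\<lambda>t. (?d (w k t) (u t))\<^sup>2)) \<longlonglongrightarrow> 0"
    using set_lebesgue_integral_eq_integral(2)[OF ai] by (simp add: set_lebesgue_integral_def)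
  then have "eventually (\<lambda>k. integral ?S (\<lambda>t. (?d (w k t) (u t))\<^sup>2) < \<epsilon> / 4) sequentially"
    by (rule order_tendstoD) (use \<epsilon> in simp)
  then obtain k where k: "integral ?S (\<lambda>t. (?d (w k t) (u t))\<^sup>2) < \<epsilon> / 4" by (auto simp: eventually_sequentially)
  \<comment> \<open>0 is added because it is the value of \<open>w k\<close> outside
    \<open>B k\<close>.\<close>
  define V where "V = insert (\<lambda>_. 0) (range (s k))"
  have V: "finite V" "w k t \<in> V" for t using s(1)[of k] by (auto simp: V_def w_def)
  define D where "D = (\<Sum>p\<in>V. \<Sum>q\<in>V. ?d p q)"
  have D: "?d p q \<le> D" if "p \<in> V" "q \<in> V" for p q
  proof -
    have "?d p q \<le> (\<Sum>q\<in>V. ?d p q)" using that V(1) nonneg by (intro member_le_sum) auto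
    also have "\<dots> \<le> D" unfolding D_def using that V(1) nonneg
      by (intro member_le_sum[of p V "\<lambda>p. \<Sum>q\<in>V. ?d p q"]) (auto intro: sum_nonneg)
    finally show ?thesis .
  qed
  have D0: "0 \<le> D" unfolding D_def by (intro sum_nonneg nonneg)
  define A where "A p = w k -` {p}" for p
  have A: "A p \<in> sets lebesgue" for p
  proof -
    have "A p = (s k -` {p} \<inter> B k) \<union> (if p = (\<lambda>_. 0) then - B k else {})" by (auto simp: A_def w_def split: if_splits)
    also have "\<dots> \<in> sets lebesgue" using s(3) B[of k] by (intro sets.Un sets.Int) (auto simp: Compl_in_sets_lebesgue)
    finally show ?thesis .
  qed
  define N where "N = real (card V)"
  \<comment> \<open>Chosen to make 2 D^2 N^2 \<epsilon>' at most \<epsilon> / 2; the added 1s keep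
    the denominator positive.\<close>
  define \<epsilon>' where "\<epsilon>' = \<epsilon> / (4 * (D\<^sup>2 + 1) * (N\<^sup>2 + 1))"
  have \<epsilon>': "\<epsilon>' > 0" unfolding \<epsilon>'_def using \<epsilon> by (intro divide_pos_pos mult_pos_pos) (auto intro: add_nonneg_pos)
  have "\<forall>p. \<exists>\<phi>::real \<Rightarrow> real. continuous_on UNIV \<phi> \<and> (\<lambda>t. (indicator (A p) t - \<phi> t)\<^sup>2) absolutely_integrable_on ?S \<and>
     integral ?S (\<lambda>t. (indicator (A p) t - \<phi> t)\<^sup>2) \<le> \<epsilon>'" using indicator_approx_continuous[OF A \<epsilon>'] by blast
  from choice[OF this] obtain \<phi> where \<phi>: "\<And>p. continuous_on UNIV (\<phi> p)"
    "\<And>p. (\<lambda>t. (indicator (A p) t - \<phi> p t)\<^sup>2) absolutely_integrable_on ?S"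
    "\<And>p. integral ?S (\<lambda>t. (indicator (A p) t - \<phi> p t)\<^sup>2) \<le> \<epsilon>'" by blast
  \<comment> \<open>If the values of \<open>w k\<close> at two times differ, their distance is at
    most D times a jump of the indicators of level sets. The jump splits into the errors collected
    here, at both times, and an increment of the continuous functions.\<close>
  define e where "e t = ?d (w k t) (u t) + D * (\<Sum>p\<in>V. \<bar>indicator (A p) t - \<phi> p t\<bar>)" for t
  have \<phi>m: "\<phi> p \<in> borel_measurable lebesgue" for p
    by (intro measurable_completion) (simp add: borel_measurable_continuous_onI[OF \<phi>(1)])
  have em: "e \<in> borel_measurable (lebesgue_on ?S)"
    unfolding e_def using A \<phi>m
    by (intro borel_measurable_add borel_measurable_times borel_measurable_sum borel_measurable_abs borel_measurable_diff mw)
      (auto intro!: measurable_restrict_space1)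
  let ?R = "\<lambda>t. 2 * (?d (w k t) (u t))\<^sup>2 + 2 * D\<^sup>2 * N * (\<Sum>p\<in>V. (indicator (A p) t - \<phi> p t)\<^sup>2)"
  have R: "?R absolutely_integrable_on ?S"
    using V(1) by (intro set_integral_add(1) set_integrable_mult_right impI ai absolutely_integrable_sum \<phi>(2))
  have eR: "(e t)\<^sup>2 \<le> ?R t" for t
  proof -
    have "(e t)\<^sup>2 \<le> 2 * (?d (w k t) (u t))\<^sup>2 + 2 * (D * (\<Sum>p\<in>V. \<bar>indicator (A p) t - \<phi> p t\<bar>))\<^sup>2"
      unfolding e_def using sum_squares_bound[of "?d (w k t) (u t)" "D * (\<Sum>p\<in>V. \<bar>indicator (A p) t - \<phi> p t\<bar>)"] by (simp add: power2_sum)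
    also have "(\<Sum>p\<in>V. \<bar>indicator (A p) t - \<phi> p t\<bar>)\<^sup>2 \<le> N * (\<Sum>p\<in>V. (indicator (A p) t - \<phi> p t)\<^sup>2)"
      using sum_squared_le_sum_of_squares[of "\<lambda>p. \<bar>indicator (A p) t - \<phi> p t\<bar>" V] V(1) by (simp add: N_def mult.commute)
    then have "2 * (D * (\<Sum>p\<in>V. \<bar>indicator (A p) t - \<phi> p t\<bar>))\<^sup>2 \<le> 2 * D\<^sup>2 * N * (\<Sum>p\<in>V. (indicator (A p) t - \<phi> p t)\<^sup>2)"
      by (simp add: power_mult_distrib mult.assoc mult_left_mono)
    finally show ?thesis by simp
  qed
  have e2: "(\<lambda>t. (e t)\<^sup>2) absolutely_integrable_on ?S"
    by (rule absolutely_integrable_bound_AE[OF _ _ R]) (use em eR in \<open>auto intro!: borel_measurable_power\<close>)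
  have "integral ?S (\<lambda>t. (e t)\<^sup>2) \<le> integral ?S ?R"
    by (rule integral_mono_AE_on[OF e2 R]) (use eR in auto)
  also have "\<dots> = 2 * integral ?S (\<lambda>t. (?d (w k t) (u t))\<^sup>2) + 2 * D\<^sup>2 * N * (\<Sum>p\<in>V. integral ?S (\<lambda>t. (indicator (A p) t - \<phi> p t)\<^sup>2))"
  proof -
    note i = set_lebesgue_integral_eq_integral(1)
    have 1: "(\<lambda>t. \<Sum>p\<in>V. (indicator (A p) t - \<phi> p t)\<^sup>2) integrable_on ?S" using V(1) by (intro integrable_sum i[OF \<phi>(2)])
    have "integral ?S ?R = integral ?S (\<lambda>t. 2 * (?d (w k t) (u t))\<^sup>2) + integral ?S (\<lambda>t. 2 * D\<^sup>2 * N * (\<Sum>p\<in>V. (indicator (A p) t - \<phi> p t)\<^sup>2))"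
      using 1 i[OF ai] by (intro Henstock_Kurzweil_Integration.integral_add) (auto intro: integrable_on_mult_right)
    then show ?thesis using V(1) i[OF \<phi>(2)] by (simp add: integral_sum)
  qed
  also have "\<dots> \<le> 2 * (\<epsilon> / 4) + 2 * D\<^sup>2 * N * (N * \<epsilon>')"
  proof -
    have "(\<Sum>p\<in>V. integral ?S (\<lambda>t. (indicator (A p) t - \<phi> p t)\<^sup>2)) \<le> N * \<epsilon>'"
      unfolding N_def by (rule sum_bounded_above) (rule \<phi>(3))
    then have "2 * D\<^sup>2 * N * (\<Sum>p\<in>V. integral ?S (\<lambda>t. (indicator (A p) t - \<phi> p t)\<^sup>2)) \<le> 2 * D\<^sup>2 * N * (N * \<epsilon>')"
      by (rule mult_left_mono) (simp add: N_def)
    then show ?thesis using k by linarith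
  qed
  also have "2 * D\<^sup>2 * N * (N * \<epsilon>') \<le> \<epsilon> / 2"
  proof -
    have "D\<^sup>2 * N\<^sup>2 \<le> (D\<^sup>2 + 1) * (N\<^sup>2 + 1)" by (intro mult_mono) auto
    then have "D\<^sup>2 * N\<^sup>2 * \<epsilon>' \<le> (D\<^sup>2 + 1) * (N\<^sup>2 + 1) * \<epsilon>'" using \<epsilon>' by (intro mult_right_mono) auto
    also have "\<dots> = \<epsilon> / 4"
    proof -
      have "D\<^sup>2 + 1 > 0" "N\<^sup>2 + 1 > 0" by (auto intro: add_nonneg_pos)
      then show ?thesis unfolding \<epsilon>'_def by (simp add: divide_simps)
    qed
    finally show ?thesis by (simp add: power2_eq_square algebra_simps)
  qed
  finally have ei: "integral ?S (\<lambda>t. (e t)\<^sup>2) \<le> \<epsilon>" by simp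
  have e0: "0 \<le> e t" for t unfolding e_def using D0 nonneg by (intro add_nonneg_nonneg mult_nonneg_nonneg sum_nonneg) auto
  have mod: "\<exists>\<delta>>0. \<forall>\<sigma>\<in>?S. \<forall>\<tau>\<in>?S. \<bar>\<sigma> - \<tau>\<bar> < \<delta> \<and> u \<sigma> \<in> X \<and> u \<tau> \<in> X \<longrightarrow>
        nrm (\<lambda>x. u \<sigma> x - u \<tau> x) \<le> e \<sigma> + e \<tau> + \<eta>" if \<eta>: "\<eta> > 0" for \<eta>
  proof -
    have "\<exists>\<delta>>0. \<forall>\<sigma>\<in>?S. \<forall>\<tau>\<in>?S. \<bar>\<sigma> - \<tau>\<bar> < \<delta> \<longrightarrow> \<bar>\<phi> p \<sigma> - \<phi> p \<tau>\<bar> < \<eta> / ((D + 1) * (N + 1))" for p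
    proof -
      have "uniformly_continuous_on ?S (\<phi> p)"
        by (rule compact_uniformly_continuous[OF continuous_on_subset[OF \<phi>(1)]]) auto
      moreover have "\<eta> / ((D + 1) * (N + 1)) > 0" using \<eta> D0 by (auto intro!: divide_pos_pos mult_pos_pos add_nonneg_pos simp: N_def)
      ultimately show ?thesis unfolding uniformly_continuous_on_def dist_real_def by (simp add: abs_minus_commute)
    qed
    then have "\<forall>p. \<exists>\<delta>>0. \<forall>\<sigma>\<in>?S. \<forall>\<tau>\<in>?S. \<bar>\<sigma> - \<tau>\<bar> < \<delta> \<longrightarrow> \<bar>\<phi> p \<sigma> - \<phi> p \<tau>\<bar> < \<eta> / ((D + 1) * (N + 1))" by blast
    from choice[OF this] obtain \<delta> where \<delta>: "\<And>p. \<delta> p > 0"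
      "\<And>p \<sigma> \<tau>. \<sigma> \<in> ?S \<Longrightarrow> \<tau> \<in> ?S \<Longrightarrow> \<bar>\<sigma> - \<tau>\<bar> < \<delta> p \<Longrightarrow> \<bar>\<phi> p \<sigma> - \<phi> p \<tau>\<bar> < \<eta> / ((D + 1) * (N + 1))" by blast
    have V0: "V \<noteq> {}" by (simp add: V_def)
    have main: "nrm (\<lambda>x. u \<sigma> x - u \<tau> x) \<le> e \<sigma> + e \<tau> + \<eta>"
      if st: "\<sigma> \<in> ?S" "\<tau> \<in> ?S" "\<bar>\<sigma> - \<tau>\<bar> < Min (\<delta> ` V)" "u \<sigma> \<in> X" "u \<tau> \<in> X" for \<sigma> \<tau>
    proof -
      have "?d (u \<sigma>) (u \<tau>) \<le> ?d (u \<sigma>) (w k \<sigma>) + (?d (w k \<sigma>) (w k \<tau>) + ?d (w k \<tau>) (u \<tau>))"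
        using tri[OF st(4) wX st(5), of k \<sigma>] tri[OF wX wX st(5), of k \<sigma> k \<tau>] by linarith
      moreover have "?d (w k \<sigma>) (w k \<tau>) \<le> D * (\<Sum>p\<in>V. \<bar>indicator (A p) \<sigma> - indicator (A p) \<tau>\<bar>)"
      proof (cases "w k \<sigma> = w k \<tau>")
        case True
        then show ?thesis using D0 d0[of "w k \<tau>"] by (auto intro!: mult_nonneg_nonneg sum_nonneg)
      next
        case False
        have "(1::real) = \<bar>indicator (A (w k \<sigma>)) \<sigma> - indicator (A (w k \<sigma>)) \<tau>\<bar>" using False by (auto simp: A_def indicator_def)
        also have "\<dots> \<le> (\<Sum>p\<in>V. \<bar>indicator (A p) \<sigma> - indicator (A p) \<tau>\<bar>)"
          by (rule member_le_sum[OF V(2) _ V(1)]) simp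
        finally have "D * 1 \<le> D * (\<Sum>p\<in>V. \<bar>indicator (A p) \<sigma> - indicator (A p) \<tau>\<bar>)" using D0 by (rule mult_left_mono)
        then show ?thesis using D[OF V(2) V(2), of \<sigma> \<tau>] by simp
      qed
      moreover have "D * (\<Sum>p\<in>V. \<bar>indicator (A p) \<sigma> - indicator (A p) \<tau> :: real\<bar>) \<le>
        D * ((\<Sum>p\<in>V. \<bar>indicator (A p) \<sigma> - \<phi> p \<sigma>\<bar>) + (\<Sum>p\<in>V. \<bar>indicator (A p) \<tau> - \<phi> p \<tau>\<bar>) + N * (\<eta> / ((D + 1) * (N + 1))))"
      proof (rule mult_left_mono[OF _ D0])
        have "(\<Sum>p\<in>V. \<bar>indicator (A p) \<sigma> - indicator (A p) \<tau> :: real\<bar>) \<le>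
          (\<Sum>p\<in>V. \<bar>indicator (A p) \<sigma> - \<phi> p \<sigma>\<bar> + \<bar>indicator (A p) \<tau> - \<phi> p \<tau>\<bar> + \<eta> / ((D + 1) * (N + 1)))"
        proof (rule sum_mono)
          fix p assume "p \<in> V"
          then have "\<bar>\<sigma> - \<tau>\<bar> < \<delta> p" using st(3) V(1) V0 by (simp add: Min_gr_iff)
          then have "\<bar>\<phi> p \<sigma> - \<phi> p \<tau>\<bar> < \<eta> / ((D + 1) * (N + 1))" by (rule \<delta>(2)[OF st(1,2)])
          then show "\<bar>indicator (A p) \<sigma> - indicator (A p) \<tau> :: real\<bar> \<le> \<bar>indicator (A p) \<sigma> - \<phi> p \<sigma>\<bar> + \<bar>indicator (A p) \<tau> - \<phi> p \<tau>\<bar> + \<eta> / ((D + 1) * (N + 1))"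
            by linarith
        qed
        then show "(\<Sum>p\<in>V. \<bar>indicator (A p) \<sigma> - indicator (A p) \<tau> :: real\<bar>) \<le>
           (\<Sum>p\<in>V. \<bar>indicator (A p) \<sigma> - \<phi> p \<sigma>\<bar>) + (\<Sum>p\<in>V. \<bar>indicator (A p) \<tau> - \<phi> p \<tau>\<bar>) + N * (\<eta> / ((D + 1) * (N + 1)))"
          by (simp add: sum.distrib N_def)
      qed
      moreover have "D * (N * (\<eta> / ((D + 1) * (N + 1)))) \<le> \<eta>"
      proof -
        have N0: "0 \<le> N" by (simp add: N_def)
        have "D * N \<le> (D + 1) * (N + 1)" using D0 N0 by (intro mult_mono) auto
        then have "D * N * \<eta> \<le> (D + 1) * (N + 1) * \<eta>" using \<eta> by (intro mult_right_mono) auto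
        moreover have "0 < (D + 1) * (N + 1)" using D0 N0 by (intro mult_pos_pos) auto
        ultimately show ?thesis by (simp add: pos_divide_le_eq mult.commute mult.left_commute)
      qed
      ultimately show ?thesis using comm[OF st(4) wX, of k \<sigma>] by (simp add: e_def distrib_left)
    qed
    show ?thesis
    proof (intro exI[of _ "Min (\<delta> ` V)"] conjI ballI impI)
      show "0 < Min (\<delta> ` V)" using V(1) V0 \<delta>(1) by simp
    qed (elim conjE, rule main)
  qed
  show ?thesis
    by (intro exI[of _ e] conjI allI impI em e2 ei e0 mod)
qed

section \<open>Linearized flows\<close>

lemma AE_ge0_of_intervals:
  assumes "\<And>T. T > 0 \<Longrightarrow> AE t in lebesgue. t \<in> {0..T::real} \<longrightarrow> P t"
  shows "AE t in lebesgue. 0 \<le> t \<longrightarrow> P t"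
proof -
  have "AE t in lebesgue. \<forall>n::nat. t \<in> {0..real (Suc n)} \<longrightarrow> P t"
    unfolding AE_all_countable using assms by simp
  then show ?thesis
  proof eventually_elim
    case (elim t)
    show ?case
    proof
      assume "0 \<le> t"
      moreover obtain n :: nat where "t \<le> real n" using real_arch_simple by blast
      ultimately have "t \<in> {0..real (Suc n)}" by simp
      then show "P t" using elim by blast
    qed
  qed
qed

lemma continuous_L2_inner:
  assumes "continuous_L2 M f" "w \<in> L2 M"
  shows "continuous_on {0..} (\<lambda>t. L2_inner M (f t) w)"
  unfolding continuous_on_def
proof
  fix t :: real assume t: "t \<in> {0..}"
  have f: "f s \<in> L2 M" if "0 \<le> s" for s using assms(1) that by (simp add: continuous_L2_def)
  have l: "((\<lambda>s. L2_norm M (\<lambda>x. f s x - f t x) * L2_norm M w) \<longlongrightarrow> 0) (at t within {0..})"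
    using tendsto_mult_right[of _ 0 _ "L2_norm M w"] assms(1) t by (fastforce simp: continuous_L2_def)
  show "((\<lambda>t. L2_inner M (f t) w) \<longlongrightarrow> L2_inner M (f t) w) (at t within {0..})"
  proof (rule LIM_zero_cancel, rule Lim_null_comparison[OF _ l])
    show "\<forall>\<^sub>F s in at t within {0..}. norm (L2_inner M (f s) w - L2_inner M (f t) w) \<le> L2_norm M (\<lambda>x. f s x - f t x) * L2_norm M w"
      unfolding eventually_at_filter
    proof (rule always_eventually, intro allI impI)
      fix s :: real assume "s \<in> {0..}"
      then show "norm (L2_inner M (f s) w - L2_inner M (f t) w) \<le> L2_norm M (\<lambda>x. f s x - f t x) * L2_norm M w"
        using L2_Cauchy_Schwarz[OF L2_diff[OF f f] assms(2), of s t] L2_inner_diff_left[OF f f assms(2), of s t] t by simp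
    qed
  qed
qed

lemma continuous_L2_norm:
  assumes "continuous_L2 M f"
  shows "continuous_on {0..} (\<lambda>t. L2_norm M (f t))"
  unfolding continuous_on_def
proof
  fix t :: real assume t: "t \<in> {0..}"
  have f: "f s \<in> L2 M" if "0 \<le> s" for s using assms that by (simp add: continuous_L2_def)
  have l: "((\<lambda>s. L2_norm M (\<lambda>x. f s x - f t x)) \<longlongrightarrow> 0) (at t within {0..})"
    using assms t by (simp add: continuous_L2_def)
  show "((\<lambda>t. L2_norm M (f t)) \<longlongrightarrow> L2_norm M (f t)) (at t within {0..})"
  proof (rule LIM_zero_cancel, rule Lim_null_comparison[OF _ l])
    show "\<forall>\<^sub>F s in at t within {0..}. norm (L2_norm M (f s) - L2_norm M (f t)) \<le> L2_norm M (\<lambda>x. f s x - f t x)"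
      unfolding eventually_at_filter
    proof (rule always_eventually, intro allI impI)
      fix s :: real assume "s \<in> {0..}"
      then show "norm (L2_norm M (f s) - L2_norm M (f t)) \<le> L2_norm M (\<lambda>x. f s x - f t x)"
        using L2_norm_triangle_diff[OF f f, of s t] t by simp
    qed
  qed
qed

lemma Hs_L2: "f \<in> Hs s \<Longrightarrow> f \<in> L2 torus"
  by (simp add: Hs_def)

text \<open>Each single Fourier coefficient is continuous for this seminorm, which makes those of
  \<open>ht\<close> measurable in time.\<close>

lemma Hs_fourier_le:
  assumes "f \<in> Hs s" "0 \<le> s" shows "cmod (fourier f \<xi>) \<le> Hs_norm s f"
proof -
  let ?t = "\<lambda>\<xi>. (1 + (norm (freq \<xi>))\<^sup>2) powr s * (cmod (fourier f \<xi>))\<^sup>2"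
  have "(cmod (fourier f \<xi>))\<^sup>2 \<le> ?t \<xi>"
    using ge_one_powr_ge_zero[of "1 + (norm (freq \<xi>))\<^sup>2" s] assms(2) by (intro mult_le_cancel_right1[THEN iffD2]) auto
  also have "\<dots> = (\<Sum>\<^sub>\<infinity>\<eta>\<in>{\<xi>}. ?t \<eta>)" by simp
  also have "\<dots> \<le> (\<Sum>\<^sub>\<infinity>\<eta>. ?t \<eta>)"
    by (rule infsum_mono_neutral) (use assms(1) in \<open>auto simp: Hs_def\<close>)
  finally show ?thesis unfolding Hs_norm_def by (rule real_le_rsqrt)
qed

lemma Hs_diff:
  assumes f: "f \<in> Hs s" and g: "g \<in> Hs s" shows "(\<lambda>x. f x - g x) \<in> Hs s"
proof -
  let ?t = "\<lambda>f \<xi>. (1 + (norm (freq \<xi>))\<^sup>2) powr s * (cmod (fourier f \<xi>))\<^sup>2"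
  note fg = f[THEN Hs_L2] g[THEN Hs_L2]
  have "(\<lambda>\<xi>. 2 * ?t f \<xi> + 2 * ?t g \<xi>) summable_on UNIV"
    using f g by (intro summable_on_add summable_on_cmult_right) (auto simp: Hs_def)
  then have "?t (\<lambda>x. f x - g x) summable_on UNIV"
  proof (rule summable_on_comparison_test)
    fix \<xi>
    have "(cmod (fourier (\<lambda>x. f x - g x) \<xi>))\<^sup>2 \<le> (cmod (fourier f \<xi>) + cmod (fourier g \<xi>))\<^sup>2"
      using norm_triangle_ineq4 by (intro power_mono) (auto simp: fourier_diff[OF fg])
    also have "\<dots> \<le> 2 * (cmod (fourier f \<xi>))\<^sup>2 + 2 * (cmod (fourier g \<xi>))\<^sup>2"
      using sum_squares_bound[of "cmod (fourier f \<xi>)" "cmod (fourier g \<xi>)"] by (simp add: power2_sum)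
    finally have "?t (\<lambda>x. f x - g x) \<xi> \<le> (1 + (norm (freq \<xi>))\<^sup>2) powr s * (2 * (cmod (fourier f \<xi>))\<^sup>2 + 2 * (cmod (fourier g \<xi>))\<^sup>2)"
      by (rule mult_left_mono) simp
    then show "?t (\<lambda>x. f x - g x) \<xi> \<le> 2 * ?t f \<xi> + 2 * ?t g \<xi>" by (simp add: algebra_simps)
  qed simp
  then show ?thesis using L2_diff[OF fg] by (simp add: Hs_def)
qed

text \<open>A sequence cofinal among the finite sets of frequencies. Limits along the net of finite
  sets become limits of sequences, as dominated convergence requires.\<close>

definition freq_box :: "nat \<Rightarrow> (int^'n) set" where
  "freq_box n = {\<xi>. \<forall>i. \<bar>\<xi> $ i\<bar> \<le> int n}"

lemma finite_freq_box: "finite (freq_box n :: (int^'n::finite) set)"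
proof -
  have "finite ((\<lambda>f. \<chi> i. f i) ` (Pi\<^sub>E (UNIV :: 'n set) (\<lambda>_. {- int n..int n})))"
    by (intro finite_imageI finite_PiE) auto
  moreover have "freq_box n \<subseteq> (\<lambda>f. \<chi> i. f i) ` (Pi\<^sub>E (UNIV :: 'n set) (\<lambda>_. {- int n..int n}))"
  proof
    fix \<xi> :: "int^'n" assume "\<xi> \<in> freq_box n"
    then have "(\<lambda>i. \<xi> $ i) \<in> Pi\<^sub>E (UNIV :: 'n set) (\<lambda>_. {- int n..int n})" by (auto simp: freq_box_def abs_le_iff) (metis minus_le_iff)
    then show "\<xi> \<in> (\<lambda>f. \<chi> i. f i) ` (Pi\<^sub>E (UNIV :: 'n set) (\<lambda>_. {- int n..int n}))" by (rule image_eqI[rotated]) (simp add: vec_eq_iff)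
  qed
  ultimately show ?thesis by (rule finite_subset[rotated])
qed

lemma filterlim_freq_box: "filterlim (freq_box :: nat \<Rightarrow> (int^'n::finite) set) (finite_subsets_at_top UNIV) sequentially"
  unfolding filterlim_finite_subsets_at_top
proof (intro allI impI)
  fix X :: "(int^'n) set" assume X: "finite X \<and> X \<subseteq> UNIV"
  let ?N = "\<Sum>\<xi>\<in>X. \<Sum>i\<in>UNIV. nat \<bar>\<xi> $ i\<bar>"
  have "nat \<bar>\<xi> $ i\<bar> \<le> ?N" if "\<xi> \<in> X" for \<xi> i
  proof -
    have "nat \<bar>\<xi> $ i\<bar> \<le> (\<Sum>i\<in>UNIV. nat \<bar>\<xi> $ i\<bar>)" by (rule member_le_sum) auto
    also have "\<dots> \<le> ?N" using X that by (intro member_le_sum[of \<xi> X "\<lambda>\<xi>. \<Sum>i\<in>UNIV. nat \<bar>\<xi> $ i\<bar>"]) auto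
    finally show ?thesis .
  qed
  note N = this
  have "X \<subseteq> freq_box n" if "n \<ge> ?N" for n unfolding freq_box_def
  proof (rule subsetI, rule CollectI, rule allI)
    fix \<xi> i assume "\<xi> \<in> X"
    from N[OF this, of i] that show "\<bar>\<xi> $ i\<bar> \<le> int n" by linarith
  qed
  then show "\<forall>\<^sub>F n in sequentially. finite (freq_box n) \<and> X \<subseteq> freq_box n \<and> freq_box n \<subseteq> UNIV"
    using finite_freq_box by (intro eventually_sequentiallyI[of ?N]) auto
qed

lemma sym_grad_inner_tendsto:
  assumes p: "p \<in> H1_sol ell" and q: "\<And>k::nat. q k \<in> H1_sol ell" and v: "v \<in> H1_sol ell"
    and l: "(\<lambda>k. H1_sol_norm ell (\<lambda>x. q k x - p x)) \<longlonglongrightarrow> 0"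
  shows "(\<lambda>k. sym_grad_inner ell (q k) v) \<longlonglongrightarrow> sym_grad_inner ell p v"
proof (rule LIM_zero_cancel, rule Lim_null_comparison)
  show "(\<lambda>k. 2 * H1_sol_norm ell (\<lambda>x. q k x - p x) * sym_norm ell v) \<longlonglongrightarrow> 0"
    using tendsto_mult_right[OF tendsto_mult_left[OF l, of 2], of "sym_norm ell v"] by simp
  show "\<forall>\<^sub>F k in sequentially. norm (sym_grad_inner ell (q k) v - sym_grad_inner ell p v) \<le> 2 * H1_sol_norm ell (\<lambda>x. q k x - p x) * sym_norm ell v"
  proof (rule always_eventually, rule allI)
    fix k
    have d: "(\<lambda>x. q k x - p x) \<in> H1_sol ell" by (rule H1_sol_diff[OF q p])
    have "sym_grad_inner ell (q k) v - sym_grad_inner ell p v = sym_grad_inner ell v (\<lambda>x. q k x - p x)"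
      using sym_grad_inner_diff_right[OF q p v, of k] by (simp add: sym_grad_inner_commute)
    then have "norm (sym_grad_inner ell (q k) v - sym_grad_inner ell p v) \<le> sym_norm ell v * sym_norm ell (\<lambda>x. q k x - p x)"
      using sym_grad_inner_bound[OF v d] by simp
    also have "\<dots> \<le> sym_norm ell v * (2 * H1_sol_norm ell (\<lambda>x. q k x - p x))" by (intro mult_left_mono sym_norm_le[OF d]) simp
    finally show "norm (sym_grad_inner ell (q k) v - sym_grad_inner ell p v) \<le> 2 * H1_sol_norm ell (\<lambda>x. q k x - p x) * sym_norm ell v"
      by (simp add: mult.commute)
  qed
qed

text \<open>With d = q k - p, the form at (d, d) tends to 0; expanding it reduces the quadratic term
  to the linear ones already treated.\<close>

lemma sym_grad_inner_self_tendsto: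
  assumes p: "p \<in> H1_sol ell" and q: "\<And>k::nat. q k \<in> H1_sol ell"
    and l: "(\<lambda>k. H1_sol_norm ell (\<lambda>x. q k x - p x)) \<longlonglongrightarrow> 0"
  shows "(\<lambda>k. sym_grad_inner ell (q k) (q k)) \<longlonglongrightarrow> sym_grad_inner ell p p"
proof -
  let ?d = "\<lambda>k x. q k x - p x"
  have d: "?d k \<in> H1_sol ell" for k by (rule H1_sol_diff[OF q p])
  have "(\<lambda>k. (2 * H1_sol_norm ell (?d k))\<^sup>2) \<longlonglongrightarrow> (2 * 0)\<^sup>2" by (intro tendsto_intros l)
  then have "(\<lambda>k. (2 * H1_sol_norm ell (?d k))\<^sup>2) \<longlonglongrightarrow> 0" by simp
  then have "(\<lambda>k. sym_grad_inner ell (?d k) (?d k)) \<longlonglongrightarrow> 0"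
  proof (rule Lim_null_comparison[rotated], intro always_eventually allI)
    show "norm (sym_grad_inner ell (?d k) (?d k)) \<le> (2 * H1_sol_norm ell (?d k))\<^sup>2" for k
      unfolding sym_norm_sq[symmetric] using power_mono[OF sym_norm_le[OF d], of k 2] by simp
  qed
  from tendsto_diff[OF this tendsto_minus[OF tendsto_mult_left[OF sym_grad_inner_tendsto[OF p q p l], of 2]]]
  have "(\<lambda>k. sym_grad_inner ell (?d k) (?d k) + 2 * sym_grad_inner ell (q k) p) \<longlonglongrightarrow> 2 * sym_grad_inner ell p p" by simp
  from tendsto_diff[OF this tendsto_const[of "sym_grad_inner ell p p"]]
  have "(\<lambda>k. sym_grad_inner ell (?d k) (?d k) + 2 * sym_grad_inner ell (q k) p - sym_grad_inner ell p p) \<longlonglongrightarrow> sym_grad_inner ell p p" by simp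
  moreover have "sym_grad_inner ell (?d k) (?d k) = sym_grad_inner ell (q k) (q k) - 2 * sym_grad_inner ell (q k) p + sym_grad_inner ell p p" for k
    using sym_grad_inner_diff_right[OF q p d, of k k] sym_grad_inner_diff_right[OF q p q, of k k] sym_grad_inner_diff_right[OF q p p, of k]
    by (simp add: sym_grad_inner_commute)
  ultimately show ?thesis by simp
qed

lemma abs_int_of_all_pos:
  fixes f :: "real \<Rightarrow> real"
  assumes "\<And>T. T > 0 \<Longrightarrow> f absolutely_integrable_on {0..T::real}" shows "f absolutely_integrable_on {0..T}"
  by (rule abs_int_on_sub[OF assms[of "\<bar>T\<bar> + 1"]]) auto

text \<open>The weak formulation with \<open>ut\<close> eliminated: only stationary test fields
  remain, and the equation becomes a family of scalar distributional identities in time. Nothing is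
  assumed about the symbol at this stage.\<close>

locale linearized_flow =
  fixes ell :: real and \<mu> :: "int^'n::finite \<Rightarrow> real" and u :: "real \<Rightarrow> 'n pt \<Rightarrow> 'n pt"
    and h m ht :: "real \<Rightarrow> real^'n \<Rightarrow> real"
  assumes ell_pos: "ell > 0"
    and u_L2_loc: "u \<in> L2_loc (H1_sol ell) (H1_sol_norm ell)"
    and m_L2_loc: "m \<in> L2_loc (L2 torus) (L2_norm torus)"
    and ht_L2_loc: "ht \<in> L2_loc (Hs (1/2)) (Hs_norm (1/2))"
    and u_cont: "continuous_L2 (slab ell) u" and h_cont: "continuous_L2 torus h"
    and m_fourier: "AE t in lebesgue. t \<ge> 0 \<longrightarrow> fourier (m t) = M_hat \<mu> (h t)"
    and ht_trace: "AE t in lebesgue. t \<ge> 0 \<longrightarrow> has_trace ell ell (\<lambda>z. snd (u t z)) (ht t)"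
    and u_weak: "\<And>v q \<phi>. v \<in> H1_sol ell \<Longrightarrow> has_trace ell ell (\<lambda>z. snd (v z)) q \<Longrightarrow> \<phi> \<in> time_test_functions \<Longrightarrow>
       (\<integral>t. deriv \<phi> t * L2_inner (slab ell) (u t) v \<partial>lebesgue) =
         - (\<integral>t. \<phi> t * (- 1/2 * sym_grad_inner ell (u t) v - L2_inner torus (m t) q) \<partial>lebesgue)"
    and h_weak: "has_weak_time_derivative (L2 torus) (\<lambda>t. L2_inner torus (h t)) (\<lambda>t. L2_inner torus (ht t))"
    and h_mean: "\<And>t. t \<ge> 0 \<Longrightarrow> (\<integral>x. h t x \<partial>torus) = 0"
begin

text \<open>What the weak formulation grants at almost every time. Energies are evaluated at all
  times through the continuous representatives, whereas bounds involving the gradient or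
  \<open>ht\<close> are available at these times.\<close>

definition regular_time :: "real \<Rightarrow> bool" where
  "regular_time t \<longleftrightarrow> u t \<in> H1_sol ell \<and> m t \<in> L2 torus \<and> ht t \<in> Hs (1/2) \<and>
     fourier (m t) = M_hat \<mu> (h t) \<and> has_trace ell ell (\<lambda>z. snd (u t z)) (ht t)"

lemma AE_regular_time: "AE t in lebesgue. 0 \<le> t \<longrightarrow> regular_time t"
proof -
  have "AE t in lebesgue. 0 \<le> t \<longrightarrow> u t \<in> H1_sol ell"
    by (rule AE_ge0_of_intervals) (use u_L2_loc in \<open>simp add: L2_loc_def L2_time_def\<close>)
  moreover have "AE t in lebesgue. 0 \<le> t \<longrightarrow> m t \<in> L2 torus"
    by (rule AE_ge0_of_intervals) (use m_L2_loc in \<open>simp add: L2_loc_def L2_time_def\<close>)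
  moreover have "AE t in lebesgue. 0 \<le> t \<longrightarrow> ht t \<in> Hs (1/2)"
    by (rule AE_ge0_of_intervals) (use ht_L2_loc in \<open>simp add: L2_loc_def L2_time_def\<close>)
  ultimately show ?thesis using m_fourier ht_trace by eventually_elim (auto simp: regular_time_def)
qed

lemma AE_regular_on:
  assumes "\<And>t. 0 \<le> t \<Longrightarrow> t \<in> S \<Longrightarrow> regular_time t \<Longrightarrow> P t" "S \<subseteq> {0..}"
  shows "AE t in lebesgue. t \<in> S \<longrightarrow> P t"
  using AE_regular_time by eventually_elim (use assms in auto)

lemma u_L2: "0 \<le> t \<Longrightarrow> u t \<in> L2 (slab ell)"
  using u_cont by (simp add: continuous_L2_def)

lemma h_L2: "0 \<le> t \<Longrightarrow> h t \<in> L2 torus"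
  using h_cont by (simp add: continuous_L2_def)

lemma h_fourier_0: "0 \<le> t \<Longrightarrow> fourier (h t) 0 = 0"
proof -
  assume t: "0 \<le> t"
  have "fourier (h t) 0 = (\<integral>x. of_real (h t x) \<partial>torus)" by (simp add: fourier_chr chr_0)
  also have "\<dots> = of_real (\<integral>x. h t x \<partial>torus)" by (intro integral_of_real L2_integrable[OF finite_measure_torus h_L2[OF t]])
  finally show ?thesis using h_mean[OF t] by simp
qed

lemma measurable_of_u:
  fixes G :: "('n pt \<Rightarrow> 'n pt) \<Rightarrow> real"
  assumes "\<And>p q. p \<in> H1_sol ell \<Longrightarrow> (\<And>k::nat. q k \<in> H1_sol ell) \<Longrightarrow> (\<lambda>k. H1_sol_norm ell (\<lambda>x. q k x - p x)) \<longlonglongrightarrow> 0 \<Longrightarrow> (\<lambda>k. G (q k)) \<longlonglongrightarrow> G p"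
  shows "(\<lambda>t. G (u t)) \<in> borel_measurable (lebesgue_on {0..T})"
proof -
  \<comment> \<open>Local integrability speaks of intervals of positive length; the length |T| + 1
    covers every T, nonpositive ones included.\<close>
  have "\<bar>T\<bar> + 1 > 0" by simp
  then have L: "u \<in> L2_time {0..\<bar>T\<bar> + 1} (H1_sol ell) (H1_sol_norm ell)" using u_L2_loc by (simp add: L2_loc_def)
  have "(\<lambda>t. G (u t)) \<in> borel_measurable (lebesgue_on {0..\<bar>T\<bar> + 1})"
    by (rule bochner_measurable_apply[OF _ _ _ assms, of _ "H1_sol ell" "H1_sol_norm ell"]) (use L in \<open>auto simp: L2_time_def\<close>)
  then show ?thesis by (rule measurable_restrict_mono) auto
qed

lemma measurable_of_m:
  fixes G :: "(real^'n \<Rightarrow> real) \<Rightarrow> real"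
  assumes "\<And>p q. p \<in> L2 torus \<Longrightarrow> (\<And>k::nat. q k \<in> L2 torus) \<Longrightarrow> (\<lambda>k. L2_norm torus (\<lambda>x. q k x - p x)) \<longlonglongrightarrow> 0 \<Longrightarrow> (\<lambda>k. G (q k)) \<longlonglongrightarrow> G p"
  shows "(\<lambda>t. G (m t)) \<in> borel_measurable (lebesgue_on {0..T})"
proof -
  have "\<bar>T\<bar> + 1 > 0" by simp
  then have L: "m \<in> L2_time {0..\<bar>T\<bar> + 1} (L2 torus) (L2_norm torus)" using m_L2_loc by (simp add: L2_loc_def)
  have "(\<lambda>t. G (m t)) \<in> borel_measurable (lebesgue_on {0..\<bar>T\<bar> + 1})"
    by (rule bochner_measurable_apply[OF _ _ _ assms, of _ "L2 torus" "L2_norm torus"]) (use L in \<open>auto simp: L2_time_def\<close>)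
  then show ?thesis by (rule measurable_restrict_mono) auto
qed

abbreviation "dissipation t \<equiv> sym_grad_inner ell (u t) (u t)"
abbreviation "work t \<equiv> L2_inner torus (m t) (ht t)"

lemma measurable_u_norm: "(\<lambda>t. H1_sol_norm ell (u t)) \<in> borel_measurable (lebesgue_on {0..T})"
proof (rule measurable_of_u)
  fix p :: "'n pt \<Rightarrow> 'n pt" and q :: "nat \<Rightarrow> 'n pt \<Rightarrow> 'n pt"
  assume p: "p \<in> H1_sol ell" and q: "\<And>k. q k \<in> H1_sol ell" and l: "(\<lambda>k. H1_sol_norm ell (\<lambda>x. q k x - p x)) \<longlonglongrightarrow> 0"
  show "(\<lambda>k. H1_sol_norm ell (q k)) \<longlonglongrightarrow> H1_sol_norm ell p"
  proof (rule LIM_zero_cancel, rule Lim_null_comparison[OF _ l], intro always_eventually allI)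
    fix k
    show "norm (H1_sol_norm ell (q k) - H1_sol_norm ell p) \<le> H1_sol_norm ell (\<lambda>x. q k x - p x)"
      using H1_sol_norm_triangle[OF H1_sol_diff[OF q p] p, of k] H1_sol_norm_triangle[OF H1_sol_diff[OF p q] q, of k k]
        H1_sol_norm_minus_commute[OF p q, of k] by simp
  qed
qed

lemma u_norm_sq_int: "(\<lambda>t. (H1_sol_norm ell (u t))\<^sup>2) absolutely_integrable_on {0..T}"
  by (rule abs_int_of_all_pos, rule L2_time_integrable_sq[where X = "H1_sol ell" and nrm = "H1_sol_norm ell" and f = u, OF _ measurable_u_norm]) (use u_L2_loc in \<open>simp add: L2_loc_def\<close>)

lemma measurable_m_norm: "(\<lambda>t. L2_norm torus (m t)) \<in> borel_measurable (lebesgue_on {0..T})"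
proof (rule measurable_of_m)
  fix p :: "real^'n \<Rightarrow> real" and q :: "nat \<Rightarrow> real^'n \<Rightarrow> real"
  assume p: "p \<in> L2 torus" and q: "\<And>k. q k \<in> L2 torus" and l: "(\<lambda>k. L2_norm torus (\<lambda>x. q k x - p x)) \<longlonglongrightarrow> 0"
  show "(\<lambda>k. L2_norm torus (q k)) \<longlonglongrightarrow> L2_norm torus p"
    by (rule LIM_zero_cancel, rule Lim_null_comparison[OF _ l], intro always_eventually allI)
      (use L2_norm_triangle_diff[OF q p] in simp)
qed

lemma m_norm_sq_int: "(\<lambda>t. (L2_norm torus (m t))\<^sup>2) absolutely_integrable_on {0..T}"
  by (rule abs_int_of_all_pos, rule L2_time_integrable_sq[where X = "L2 torus" and nrm = "L2_norm torus" and f = m, OF _ measurable_m_norm]) (use m_L2_loc in \<open>simp add: L2_loc_def\<close>)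

lemma measurable_m_inner:
  assumes w: "w \<in> L2 torus" shows "(\<lambda>t. L2_inner torus (m t) w) \<in> borel_measurable (lebesgue_on {0..T})"
proof (rule measurable_of_m)
  fix p :: "real^'n \<Rightarrow> real" and q :: "nat \<Rightarrow> real^'n \<Rightarrow> real"
  assume p: "p \<in> L2 torus" and q: "\<And>k. q k \<in> L2 torus" and l: "(\<lambda>k. L2_norm torus (\<lambda>x. q k x - p x)) \<longlonglongrightarrow> 0"
  show "(\<lambda>k. L2_inner torus (q k) w) \<longlonglongrightarrow> L2_inner torus p w"
    by (rule L2_inner_tendsto[OF q p w w l]) simp
qed

lemma ht_norm_le: "regular_time t \<Longrightarrow> L2_norm torus (ht t) \<le> sqrt ell * sym_norm ell (u t)"
  using trace_top_sym_norm[OF _ ell_pos] by (auto simp: regular_time_def)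

lemma dissipation_int: "dissipation absolutely_integrable_on {0..T}"
proof (rule absolutely_integrable_bound_AE)
  show "dissipation \<in> borel_measurable (lebesgue_on {0..T})"
    by (rule measurable_of_u) (rule sym_grad_inner_self_tendsto)
  show "(\<lambda>t. 4 * (H1_sol_norm ell (u t))\<^sup>2) absolutely_integrable_on {0..T}"
    by (intro set_integrable_mult_right impI u_norm_sq_int)
  show "AE t in lebesgue. t \<in> {0..T} \<longrightarrow> \<bar>dissipation t\<bar> \<le> 4 * (H1_sol_norm ell (u t))\<^sup>2"
  proof (rule AE_regular_on)
    fix t assume "regular_time t"
    then have "sym_norm ell (u t) \<le> 2 * H1_sol_norm ell (u t)" by (intro sym_norm_le) (simp add: regular_time_def)
    from power_mono[OF this, of 2] show "\<bar>dissipation t\<bar> \<le> 4 * (H1_sol_norm ell (u t))\<^sup>2"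
      by (simp flip: sym_norm_sq add: power_mult_distrib)
  qed auto
qed simp

lemma weak_density_int:
  assumes v: "v \<in> H1_sol ell" and q: "q \<in> L2 torus"
  shows "(\<lambda>t. - 1/2 * sym_grad_inner ell (u t) v - L2_inner torus (m t) q) absolutely_integrable_on {0..T}"
proof (rule absolutely_integrable_bound_AE)
  have "(\<lambda>t. sym_grad_inner ell (u t) v) \<in> borel_measurable (lebesgue_on {0..T})"
    by (rule measurable_of_u) (rule sym_grad_inner_tendsto[OF _ _ v])
  then show "(\<lambda>t. - 1/2 * sym_grad_inner ell (u t) v - L2_inner torus (m t) q) \<in> borel_measurable (lebesgue_on {0..T})"
    using measurable_m_inner[OF q] by (intro borel_measurable_diff borel_measurable_times) auto
  let ?b = "\<lambda>t. (H1_sol_norm ell (u t))\<^sup>2 + (sym_norm ell v)\<^sup>2 + ((L2_norm torus (m t))\<^sup>2 + (L2_norm torus q)\<^sup>2)"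
  show "?b absolutely_integrable_on {0..T}"
    by (intro set_integral_add(1) u_norm_sq_int m_norm_sq_int absolutely_integrable_continuous_real continuous_intros)
  show "AE t in lebesgue. t \<in> {0..T} \<longrightarrow> \<bar>- 1/2 * sym_grad_inner ell (u t) v - L2_inner torus (m t) q\<bar> \<le> ?b t"
  proof (rule AE_regular_on)
    fix t assume t: "regular_time t"
    then have X: "u t \<in> H1_sol ell" "m t \<in> L2 torus" by (auto simp: regular_time_def)
    let ?U = "H1_sol_norm ell (u t)" and ?V = "sym_norm ell v" and ?M = "L2_norm torus (m t)" and ?Q = "L2_norm torus q"
    have "\<bar>sym_grad_inner ell (u t) v\<bar> \<le> 2 * ?U * ?V"
      by (rule order_trans[OF sym_grad_inner_bound[OF X(1) v]]) (intro mult_right_mono sym_norm_le X, simp)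
    moreover have "\<bar>L2_inner torus (m t) q\<bar> \<le> ?M * ?Q" by (rule L2_Cauchy_Schwarz[OF X(2) q])
    moreover have "2 * ?M * ?Q \<le> ?M\<^sup>2 + ?Q\<^sup>2" "2 * ?U * ?V \<le> ?U\<^sup>2 + ?V\<^sup>2" by (rule sum_squares_bound)+
    moreover have "0 \<le> ?M * ?Q" "0 \<le> ?U * ?V" "2 * ?M * ?Q = 2 * (?M * ?Q)" "2 * ?U * ?V = 2 * (?U * ?V)" by simp_all
    ultimately show "\<bar>- 1/2 * sym_grad_inner ell (u t) v - L2_inner torus (m t) q\<bar> \<le> ?b t" by linarith
  qed auto
qed simp

text \<open>Against a fixed field the solution is an absolutely continuous scalar function.
  Continuity of \<open>u\<close> in L2 makes the integral form hold between any two times and not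
  just between almost all.\<close>

lemma u_primitive:
  assumes v: "v \<in> H1_sol ell" and q: "has_trace ell ell (\<lambda>z. snd (v z)) q"
  shows "primitive_on_ge0 (\<lambda>t. L2_inner (slab ell) (u t) v) (\<lambda>t. - 1/2 * sym_grad_inner ell (u t) v - L2_inner torus (m t) q)"
proof -
  have q2: "q \<in> L2 torus" using q by (simp add: has_trace_def)
  show ?thesis
    unfolding primitive_on_ge0_def
    by (intro conjI allI impI weak_density_int v q2 weak_time_derivative_integral
        [OF continuous_L2_inner[OF u_cont H1_sol_L2[OF v]] weak_density_int[OF v q2] u_weak[OF v q]]) auto
qed

lemma measurable_ht_fourier:
  "(\<lambda>t. Re (fourier (ht t) \<xi>)) \<in> borel_measurable (lebesgue_on {0..T})"
  "(\<lambda>t. Im (fourier (ht t) \<xi>)) \<in> borel_measurable (lebesgue_on {0..T})"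
proof -
  have "\<bar>T\<bar> + 1 > 0" by simp
  then have L: "ht \<in> L2_time {0..\<bar>T\<bar> + 1} (Hs (1/2)) (Hs_norm (1/2))" using ht_L2_loc by (simp add: L2_loc_def)
  have *: "(\<lambda>t. G (fourier (ht t) \<xi>)) \<in> borel_measurable (lebesgue_on {0..T})"
    if G: "\<And>c d. \<bar>G c - G d\<bar> \<le> cmod (c - d)" for G :: "complex \<Rightarrow> real"
  proof -
    have "(\<lambda>t. G (fourier (ht t) \<xi>)) \<in> borel_measurable (lebesgue_on {0..\<bar>T\<bar> + 1})"
    proof (rule bochner_measurable_apply[where f = ht and G = "\<lambda>q. G (fourier q \<xi>)" and X = "Hs (1/2)" and nrm = "Hs_norm (1/2)"])
      fix p :: "real^'n \<Rightarrow> real" and q :: "nat \<Rightarrow> real^'n \<Rightarrow> real"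
      assume p: "p \<in> Hs (1/2)" and q: "\<And>k. q k \<in> Hs (1/2)" and l: "(\<lambda>k. Hs_norm (1/2) (\<lambda>x. q k x - p x)) \<longlonglongrightarrow> 0"
      show "(\<lambda>k. G (fourier (q k) \<xi>)) \<longlonglongrightarrow> G (fourier p \<xi>)"
      proof (rule LIM_zero_cancel, rule Lim_null_comparison[OF _ l], intro always_eventually allI)
        fix k
        have "\<bar>G (fourier (q k) \<xi>) - G (fourier p \<xi>)\<bar> \<le> cmod (fourier (\<lambda>x. q k x - p x) \<xi>)"
          using G fourier_diff[OF Hs_L2[OF q] Hs_L2[OF p]] by simp
        also have "\<dots> \<le> Hs_norm (1/2) (\<lambda>x. q k x - p x)" by (intro Hs_fourier_le Hs_diff p q) simp
        finally show "norm (G (fourier (q k) \<xi>) - G (fourier p \<xi>)) \<le> Hs_norm (1/2) (\<lambda>x. q k x - p x)" by simp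
      qed
    qed (use L in \<open>auto simp: L2_time_def\<close>)
    then show ?thesis by (rule measurable_restrict_mono) auto
  qed
  show "(\<lambda>t. Re (fourier (ht t) \<xi>)) \<in> borel_measurable (lebesgue_on {0..T})"
    by (rule *) (metis abs_Re_le_cmod minus_complex.simps(1))
  show "(\<lambda>t. Im (fourier (ht t) \<xi>)) \<in> borel_measurable (lebesgue_on {0..T})"
    by (rule *) (metis abs_Im_le_cmod minus_complex.simps(2))
qed

text \<open>Goes through the gradient of \<open>u\<close>, whose norm is already known to be
  measurable and square integrable in time.\<close>

lemma fourier_ht_le: "regular_time t \<Longrightarrow> cmod (fourier (ht t) \<xi>) \<le> 2 * sqrt ell * H1_sol_norm ell (u t)"
proof -
  assume t: "regular_time t"
  have "(cmod (fourier (ht t) \<xi>))\<^sup>2 \<le> (L2_norm torus (ht t))\<^sup>2"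
    using bessel[of "ht t" "{\<xi>}"] t Hs_L2[of "ht t" "1/2"] by (simp add: regular_time_def)
  then have "cmod (fourier (ht t) \<xi>) \<le> L2_norm torus (ht t)" by (rule power2_le_imp_le) simp
  also have "\<dots> \<le> sqrt ell * sym_norm ell (u t)" by (rule ht_norm_le[OF t])
  also have "\<dots> \<le> sqrt ell * (2 * H1_sol_norm ell (u t))"
    using t ell_pos by (intro mult_left_mono sym_norm_le) (auto simp: regular_time_def)
  finally show ?thesis by simp
qed

text \<open>P stands for the real or imaginary part of a Fourier coefficient, which is known to be
  the inner product with w only on L2. Measurability in time is available for
  \<open>P (ht t)\<close> while the weak derivative is stated with the inner product; the two agree
  at almost every time, and the integrals are transferred accordingly.\<close>

lemma h_primitive_aux:
  assumes w: "w \<in> L2 torus" and P: "\<And>f. f \<in> L2 torus \<Longrightarrow> P f = L2_inner torus f w"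
    and meas: "\<And>T. (\<lambda>t. P (ht t)) \<in> borel_measurable (lebesgue_on {0..T})"
    and le: "\<And>f. \<bar>P f\<bar> \<le> cmod (fourier f \<xi>)"
  shows "primitive_on_ge0 (\<lambda>t. P (h t)) (\<lambda>t. P (ht t))"
proof -
  have eq: "AE t in lebesgue. t \<in> {0..T} \<longrightarrow> P (ht t) = L2_inner torus (ht t) w" for T
    by (rule AE_regular_on) (auto simp: regular_time_def P Hs_L2)
  have int: "(\<lambda>t. P (ht t)) absolutely_integrable_on {0..T}" for T
  proof (rule absolutely_integrable_bound_AE[OF meas])
    show "(\<lambda>t. 1 + ell * (H1_sol_norm ell (u t))\<^sup>2) absolutely_integrable_on {0..T}"
      by (intro set_integral_add(1) set_integrable_mult_right impI u_norm_sq_int absolutely_integrable_continuous_real continuous_intros)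
    show "AE t in lebesgue. t \<in> {0..T} \<longrightarrow> \<bar>P (ht t)\<bar> \<le> 1 + ell * (H1_sol_norm ell (u t))\<^sup>2"
    proof (rule AE_regular_on)
      fix t assume "regular_time t"
      from fourier_ht_le[OF this, of \<xi>] le[of "ht t"] have "\<bar>P (ht t)\<bar> \<le> 2 * 1 * (sqrt ell * H1_sol_norm ell (u t))" by simp
      also have "\<dots> \<le> 1\<^sup>2 + (sqrt ell * H1_sol_norm ell (u t))\<^sup>2" by (rule sum_squares_bound)
      finally show "\<bar>P (ht t)\<bar> \<le> 1 + ell * (H1_sol_norm ell (u t))\<^sup>2" using ell_pos by (simp add: power_mult_distrib)
    qed auto
  qed simp
  have int': "(\<lambda>t. L2_inner torus (ht t) w) absolutely_integrable_on {0..T}" for T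
    using int[of T] unfolding set_integrable_def
  proof (rule integrable_cong_AE_imp)
    show "(\<lambda>x. indicat_real {0..T} x *\<^sub>R L2_inner torus (ht x) w) \<in> borel_measurable lebesgue"
    proof (rule borel_measurable_AE)
      show "(\<lambda>x. indicat_real {0..T} x *\<^sub>R P (ht x)) \<in> borel_measurable lebesgue"
        using int[of T] by (simp only: set_integrable_def borel_measurable_integrable)
      show "AE x in lebesgue. indicat_real {0..T} x *\<^sub>R P (ht x) = indicat_real {0..T} x *\<^sub>R L2_inner torus (ht x) w"
        using eq[of T] by eventually_elim (auto simp: indicator_def)
    qed
    show "AE x in lebesgue. indicat_real {0..T} x *\<^sub>R P (ht x) = indicat_real {0..T} x *\<^sub>R L2_inner torus (ht x) w"
      using eq[of T] by eventually_elim (auto simp: indicator_def)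
  qed
  show ?thesis
    unfolding primitive_on_ge0_def
  proof (intro conjI allI impI int)
    fix s t :: real assume st: "0 \<le> s \<and> s \<le> t"
    have "L2_inner torus (h t) w - L2_inner torus (h s) w = integral {s..t} (\<lambda>t. L2_inner torus (ht t) w)"
      using st h_weak w by (intro weak_time_derivative_integral continuous_L2_inner h_cont int') (auto simp: has_weak_time_derivative_def)
    also have "\<dots> = integral {s..t} (\<lambda>t. P (ht t))"
    proof (rule integral_cong_AE_on)
      show "(\<lambda>t. L2_inner torus (ht t) w) absolutely_integrable_on {s..t}" "(\<lambda>t. P (ht t)) absolutely_integrable_on {s..t}"
        using st by (auto intro: abs_int_on_sub[OF int'[of t]] abs_int_on_sub[OF int[of t]])
      show "AE x in lebesgue. x \<in> {s..t} \<longrightarrow> L2_inner torus (ht x) w = P (ht x)"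
        using eq[of t] by eventually_elim (use st in auto)
    qed
    finally show "P (h t) - P (h s) = integral {s..t} (\<lambda>t. P (ht t))" using P[OF h_L2] st by simp
  qed
qed

lemma h_primitive:
  "primitive_on_ge0 (\<lambda>t. Re (fourier (h t) \<xi>)) (\<lambda>t. Re (fourier (ht t) \<xi>))"
  "primitive_on_ge0 (\<lambda>t. Im (fourier (h t) \<xi>)) (\<lambda>t. Im (fourier (ht t) \<xi>))"
proof -
  have c: "(\<lambda>x. Re (chr \<xi> x)) \<in> L2 torus" "(\<lambda>x. - Im (chr \<xi> x)) \<in> L2 torus"
    by (intro continuous_L2_torus continuous_intros continuous_chr)+
  show "primitive_on_ge0 (\<lambda>t. Re (fourier (h t) \<xi>)) (\<lambda>t. Re (fourier (ht t) \<xi>))"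
    by (rule h_primitive_aux[OF c(1) fourier_Re measurable_ht_fourier(1) abs_Re_le_cmod])
  show "primitive_on_ge0 (\<lambda>t. Im (fourier (h t) \<xi>)) (\<lambda>t. Im (fourier (ht t) \<xi>))"
    by (rule h_primitive_aux[OF c(2) fourier_Im measurable_ht_fourier(2) abs_Im_le_cmod])
qed

end

section \<open>The energy inequality\<close>

context linearized_flow
begin

text \<open>At regular times the truncated power of \<open>M(h)\<close> against the surface
  velocity. Written with \<mu> and the coefficients of \<open>h\<close> instead of \<open>m\<close>,
  it is exactly the derivative of half of \<open>partial_potential\<close>, with no exceptional
  times.\<close>

definition partial_work :: "(int^'n) set \<Rightarrow> real \<Rightarrow> real" where
  "partial_work F t = (\<Sum>\<xi>\<in>F. \<mu> \<xi> * (Re (fourier (h t) \<xi>) * Re (fourier (ht t) \<xi>) + Im (fourier (h t) \<xi>) * Im (fourier (ht t) \<xi>)))"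

definition partial_potential :: "(int^'n) set \<Rightarrow> real \<Rightarrow> real" where
  "partial_potential F t = (\<Sum>\<xi>\<in>F. \<mu> \<xi> * (cmod (fourier (h t) \<xi>))\<^sup>2)"

lemma partial_potential_primitive:
  "primitive_on_ge0 (\<lambda>t. 1/2 * partial_potential F t) (partial_work F)"
proof -
  have "primitive_on_ge0 (\<lambda>t. 1/2 * (\<Sum>\<xi>\<in>F. \<mu> \<xi> * (Re (fourier (h t) \<xi>) * Re (fourier (h t) \<xi>) + Im (fourier (h t) \<xi>) * Im (fourier (h t) \<xi>))))
     (\<lambda>t. 1/2 * (\<Sum>\<xi>\<in>F. \<mu> \<xi> * ((Re (fourier (h t) \<xi>) * Re (fourier (ht t) \<xi>) + Re (fourier (h t) \<xi>) * Re (fourier (ht t) \<xi>)) +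
        (Im (fourier (h t) \<xi>) * Im (fourier (ht t) \<xi>) + Im (fourier (h t) \<xi>) * Im (fourier (ht t) \<xi>)))))"
    by (intro primitive_cmult primitive_sum primitive_add primitive_mult h_primitive)
  then show ?thesis
    unfolding partial_potential_def partial_work_def cmod_power2
    by (simp add: sum_distrib_left algebra_simps power2_eq_square)
qed

lemma partial_work_int: "partial_work F absolutely_integrable_on {0..T}"
  by (rule primitive_abs_int[OF partial_potential_primitive]) simp

lemma partial_work_regular:
  "regular_time t \<Longrightarrow> partial_work F t = (\<Sum>\<xi>\<in>F. Re (fourier (m t) \<xi> * cnj (fourier (ht t) \<xi>)))"
  unfolding partial_work_def by (intro sum.cong) (auto simp: regular_time_def M_hat_def algebra_simps)

text \<open>The right-hand side does not involve F, so it dominates the whole sequence of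
  truncations.\<close>

lemma partial_work_le:
  assumes "regular_time t" "finite F"
  shows "\<bar>partial_work F t\<bar> \<le> L2_norm torus (m t) * (2 * sqrt ell * H1_sol_norm ell (u t))"
proof -
  have X: "m t \<in> L2 torus" "ht t \<in> L2 torus" "u t \<in> H1_sol ell" using assms(1) Hs_L2 by (auto simp: regular_time_def)
  have "\<bar>partial_work F t\<bar> = \<bar>Re (\<Sum>\<xi>\<in>F. fourier (m t) \<xi> * cnj (fourier (ht t) \<xi>))\<bar>" by (simp add: partial_work_regular[OF assms(1)])
  also have "\<dots> \<le> cmod (\<Sum>\<xi>\<in>F. fourier (m t) \<xi> * cnj (fourier (ht t) \<xi>))" by (rule abs_Re_le_cmod)
  also have "\<dots> \<le> L2_norm torus (m t) * L2_norm torus (ht t)" by (rule fourier_pairing_bound[OF X(1,2) assms(2)])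
  also have "\<dots> \<le> L2_norm torus (m t) * (sqrt ell * (2 * H1_sol_norm ell (u t)))"
    by (intro mult_left_mono order_trans[OF ht_norm_le[OF assms(1)]] sym_norm_le[OF X(3)]) (use ell_pos in auto)
  finally show ?thesis by (simp add: mult_ac)
qed

text \<open>Parseval's formula applies because \<open>ht t\<close> is a trace and thus a limit of
  smooth periodic functions.\<close>

lemma partial_work_tendsto:
  assumes "regular_time t" shows "(\<lambda>n. partial_work (freq_box n) t) \<longlonglongrightarrow> work t"
proof -
  have "((\<lambda>F. \<Sum>\<xi>\<in>F. Re (fourier (m t) \<xi> * cnj (fourier (ht t) \<xi>))) \<longlongrightarrow> work t) (finite_subsets_at_top UNIV)"
    by (rule parseval_trace) (use assms in \<open>auto simp: regular_time_def\<close>)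
  from filterlim_compose[OF this filterlim_freq_box] show ?thesis by (simp add: partial_work_regular[OF assms])
qed

lemma norm_product_int: "(\<lambda>t. L2_norm torus (m t) * (2 * sqrt ell * H1_sol_norm ell (u t))) absolutely_integrable_on {0..T}"
proof (rule absolutely_integrable_bound_AE)
  show "(\<lambda>t. L2_norm torus (m t) * (2 * sqrt ell * H1_sol_norm ell (u t))) \<in> borel_measurable (lebesgue_on {0..T})"
    using measurable_m_norm measurable_u_norm by (intro borel_measurable_times) auto
  show "(\<lambda>t. (L2_norm torus (m t))\<^sup>2 + ell * (H1_sol_norm ell (u t))\<^sup>2) absolutely_integrable_on {0..T}"
    by (intro set_integral_add(1) set_integrable_mult_right impI m_norm_sq_int u_norm_sq_int)
  have "\<bar>L2_norm torus (m t) * (2 * sqrt ell * H1_sol_norm ell (u t))\<bar> \<le> (L2_norm torus (m t))\<^sup>2 + ell * (H1_sol_norm ell (u t))\<^sup>2" for t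
    using sum_squares_bound[of "L2_norm torus (m t)" "sqrt ell * H1_sol_norm ell (u t)"] ell_pos
    by (simp add: power_mult_distrib mult_ac)
  then show "AE t in lebesgue. t \<in> {0..T} \<longrightarrow> \<bar>L2_norm torus (m t) * (2 * sqrt ell * H1_sol_norm ell (u t))\<bar> \<le> (L2_norm torus (m t))\<^sup>2 + ell * (H1_sol_norm ell (u t))\<^sup>2"
    by simp
qed simp

text \<open>Both arguments of the pairing vary in time, and its measurability is inherited from the
  truncated works as their limit. The product of the two norms dominates and is integrable, both
  being square integrable in time; dominated convergence then also gives L1 convergence.\<close>

lemma work_int: "work absolutely_integrable_on {0..T}"
  and work_approx: "(\<lambda>n. integral {0..T} (\<lambda>t. \<bar>partial_work (freq_box n) t - work t\<bar>)) \<longlonglongrightarrow> 0"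
proof -
  let ?S = "{0..T}" and ?w = "\<lambda>t. L2_norm torus (m t) * (2 * sqrt ell * H1_sol_norm ell (u t))"
  have pm: "(\<lambda>t. indicat_real ?S t * partial_work F t) \<in> borel_measurable lebesgue" for F
    using partial_work_int[of T F] unfolding set_integrable_def by (metis (no_types, lifting) borel_measurable_integrable real_scaleR_def ext)
  have lim: "AE t in lebesgue. (\<lambda>n. indicat_real ?S t * partial_work (freq_box n) t) \<longlonglongrightarrow> indicat_real ?S t * work t"
    using AE_regular_time
  proof eventually_elim
    case (elim t)
    show ?case
    proof (cases "t \<in> ?S")
      case True
      then show ?thesis using partial_work_tendsto[of t] elim by simp
    qed simp
  qed
  have bd: "AE t in lebesgue. norm (indicat_real ?S t * partial_work (freq_box n) t) \<le> indicat_real ?S t *\<^sub>R ?w t" for n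
    using AE_regular_time
    by eventually_elim (auto simp: indicator_def partial_work_le finite_freq_box)
  have wm: "(\<lambda>t. indicat_real ?S t * work t) \<in> borel_measurable lebesgue"
  proof (rule borel_measurable_AE)
    show "(\<lambda>t. lim (\<lambda>n. indicat_real ?S t * partial_work (freq_box n) t)) \<in> borel_measurable lebesgue"
      by (intro borel_measurable_lim_metric pm)
    show "AE t in lebesgue. lim (\<lambda>n. indicat_real ?S t * partial_work (freq_box n) t) = indicat_real ?S t * work t"
      using lim by eventually_elim (rule limI)
  qed
  have wb: "AE t in lebesgue. norm (indicat_real ?S t * work t) \<le> indicat_real ?S t *\<^sub>R ?w t"
  proof -
    have "AE t in lebesgue. \<forall>n. norm (indicat_real ?S t * partial_work (freq_box n) t) \<le> indicat_real ?S t *\<^sub>R ?w t"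
      unfolding AE_all_countable using bd by blast
    with lim show ?thesis
    proof eventually_elim
      case (elim t)
      show ?case by (rule LIMSEQ_le_const2[OF tendsto_norm[OF elim(1)]]) (use elim(2) in blast)
    qed
  qed
  have wi: "integrable lebesgue (\<lambda>t. indicat_real ?S t *\<^sub>R ?w t)" using norm_product_int[of T] by (simp only: set_integrable_def)
  show ai: "work absolutely_integrable_on {0..T}"
    unfolding set_integrable_def real_scaleR_def
  proof (rule Bochner_Integration.integrable_bound[OF wi wm])
    show "AE x in lebesgue. norm (indicat_real ?S x * work x) \<le> norm (indicat_real ?S x *\<^sub>R ?w x)"
      using wb by eventually_elim simp
  qed
  have "(\<lambda>n. \<integral>t. indicat_real ?S t *\<^sub>R \<bar>partial_work (freq_box n) t - work t\<bar> \<partial>lebesgue) \<longlonglongrightarrow> (\<integral>t. 0 \<partial>(lebesgue :: real measure))"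
  proof (rule integral_dominated_convergence[where w = "\<lambda>t. 2 * (indicat_real ?S t *\<^sub>R ?w t)"])
    have eq: "indicat_real ?S t *\<^sub>R \<bar>partial_work F t - work t\<bar> = \<bar>indicat_real ?S t * partial_work F t - indicat_real ?S t * work t\<bar>" for t F
      by (simp add: indicator_def)
    show "(\<lambda>t. indicat_real ?S t *\<^sub>R \<bar>partial_work (freq_box n) t - work t\<bar>) \<in> borel_measurable lebesgue" for n
      unfolding eq by (intro borel_measurable_abs borel_measurable_diff pm wm)
    show "integrable lebesgue (\<lambda>t. 2 * (indicat_real ?S t *\<^sub>R ?w t))" by (rule integrable_mult_right[OF wi])
    show "AE t in lebesgue. norm (indicat_real ?S t *\<^sub>R \<bar>partial_work (freq_box n) t - work t\<bar>) \<le> 2 * (indicat_real ?S t *\<^sub>R ?w t)" for n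
      using bd[of n] wb unfolding eq
    proof eventually_elim
      case (elim t)
      then show ?case
        using abs_triangle_ineq4[of "indicat_real ?S t * partial_work (freq_box n) t" "indicat_real ?S t * work t"]
        unfolding real_norm_def abs_idempotent by linarith
    qed
    show "AE t in lebesgue. (\<lambda>n. indicat_real ?S t *\<^sub>R \<bar>partial_work (freq_box n) t - work t\<bar>) \<longlonglongrightarrow> 0"
      using lim unfolding eq
    proof eventually_elim
      case (elim t)
      from tendsto_rabs[OF tendsto_diff[OF elim tendsto_const[of "indicat_real ?S t * work t"]]] show ?case by simp
    qed
  qed simp
  moreover have "(\<lambda>t. \<bar>partial_work F t - work t\<bar>) absolutely_integrable_on ?S" for F
    by (intro set_integrable_abs set_integral_diff(1) partial_work_int ai)
  note set_lebesgue_integral_eq_integral(2)[OF this, unfolded set_lebesgue_integral_def]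
  ultimately show "(\<lambda>n. integral {0..T} (\<lambda>t. \<bar>partial_work (freq_box n) t - work t\<bar>)) \<longlonglongrightarrow> 0"
    by (simp only: integral_zero)
qed

text \<open>The increment of the kinetic energy is at most \<open>(u y - u x, u y)\<close>, where the equation can be
  tested with the time-independent field \<open>u y\<close>; no chain rule in the dual space is needed.\<close>

lemma kinetic_energy_inequality:
  assumes st: "0 \<le> s" "s < t"
  shows "1/2 * (L2_norm (slab ell) (u t))\<^sup>2 - 1/2 * (L2_norm (slab ell) (u s))\<^sup>2 \<le> integral {s..t} (\<lambda>\<sigma>. - 1/2 * dissipation \<sigma> - work \<sigma>)"
proof (rule right_tagged_inequality[where T = "t + 1" and N = "{\<tau> \<in> {0..}. \<not> regular_time \<tau>}"
      and k = "\<lambda>\<sigma>. 12 * (H1_sol_norm ell (u \<sigma>))\<^sup>2 + 12 * (ell * (L2_norm torus (m \<sigma>))\<^sup>2) + 1"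
      and \<Phi> = "\<lambda>t. 1/2 * (L2_norm (slab ell) (u t))\<^sup>2"])
  \<comment> \<open>The weight k results from three applications of Young's inequality to K = 2 |u|
    + 2 sqrt ell |m|: 3/2 K^2 is at most 12 |u|^2 + 12 ell |m|^2, with |u| the gradient norm. The 1
    pays for the remaining constant.\<close>
  let ?T = "t + 1" and ?X = "H1_sol_norm ell" and ?k = "\<lambda>\<sigma>. 12 * (H1_sol_norm ell (u \<sigma>))\<^sup>2 + 12 * (ell * (L2_norm torus (m \<sigma>))\<^sup>2) + 1"
  let ?b = "\<lambda>\<sigma>. - 1/2 * dissipation \<sigma> - work \<sigma>" and ?N = "{\<tau> \<in> {0..}. \<not> regular_time \<tau>}"
  show "s < t" by (rule st) 
  show "t < t + 1" by simp
  show "continuous_on {s..?T} (\<lambda>t. 1/2 * (L2_norm (slab ell) (u t))\<^sup>2)"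
    by (intro continuous_intros continuous_on_subset[OF continuous_L2_norm[OF u_cont]]) (use st in auto)
  have b0: "?b absolutely_integrable_on {0..T}" for T
    by (intro set_integral_diff(1) set_integrable_mult_right impI dissipation_int work_int)
  then show "?b absolutely_integrable_on {s..?T}" by (rule abs_int_on_sub) (use st in auto)
  have k0: "?k absolutely_integrable_on {0..T}" for T
    by (intro set_integral_add(1) set_integrable_mult_right impI u_norm_sq_int m_norm_sq_int absolutely_integrable_continuous_real continuous_intros)
  then show "?k absolutely_integrable_on {s..?T}" by (rule abs_int_on_sub) (use st in auto)
  \<comment> \<open>Right end points must be regular because \<open>u y\<close> is the test field
    there; left end points need only continuity in L2.\<close>
  have "?N \<in> null_sets lebesgue"
  proof -
    obtain Z where "\<And>t. t \<in> space lebesgue - Z \<Longrightarrow> 0 \<le> t \<longrightarrow> regular_time t" "Z \<in> null_sets lebesgue"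
      by (rule AE_E3[OF AE_regular_time], rule that)
    then show ?thesis by (intro completion.complete2[of ?N Z]) auto
  qed
  then show "negligible ?N" by (simp add: negligible_iff_null_sets)
  fix \<epsilon> :: real assume \<epsilon>: "\<epsilon> > 0"
  have uT: "u \<in> L2_time {0..?T} (H1_sol ell) ?X" using u_L2_loc st by (simp add: L2_loc_def)
  \<comment> \<open>The empty extension exhibits an element of the space, from which scaling by 0
    yields the zero field and its norm.\<close>
  have E0: "extension ell {} (\<lambda>_. 0) \<in> (H1_sol ell :: ('n pt \<Rightarrow> 'n pt) set)"
    by (rule extension_H1_sol(1)) (use ell_pos in auto)
  have z: "(\<lambda>_. 0) \<in> (H1_sol ell :: ('n pt \<Rightarrow> 'n pt) set)" using H1_sol_scaleR[OF E0, of 0] by simp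
  have z': "?X ((\<lambda>_. 0) :: 'n pt \<Rightarrow> 'n pt) = 0" using H1_sol_norm_scaleR[OF E0, of 0] by simp
  \<comment> \<open>The bound 2 \<epsilon>^2 is what makes the integral of \<open>?E\<close>, that
    is of e^2 / (2 \<epsilon>), at most \<epsilon>.\<close>
  have "\<exists>e. e \<in> borel_measurable (lebesgue_on {0..?T}) \<and> (\<lambda>t. (e t)\<^sup>2) absolutely_integrable_on {0..?T} \<and>
     integral {0..?T} (\<lambda>t. (e t)\<^sup>2) \<le> 2 * \<epsilon>\<^sup>2 \<and> (\<forall>t. 0 \<le> e t) \<and>
     (\<forall>\<eta>>0. \<exists>\<delta>>0. \<forall>\<sigma>\<in>{0..?T}. \<forall>\<tau>\<in>{0..?T}. \<bar>\<sigma> - \<tau>\<bar> < \<delta> \<and> u \<sigma> \<in> H1_sol ell \<and> u \<tau> \<in> H1_sol ell \<longrightarrow>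
        ?X (\<lambda>x. u \<sigma> x - u \<tau> x) \<le> e \<sigma> + e \<tau> + \<eta>)"
  proof (rule L2_time_modulus[OF uT z z'])
    fix p q r :: "'n pt \<Rightarrow> 'n pt" assume pqr: "p \<in> H1_sol ell" "q \<in> H1_sol ell"
    show "?X (\<lambda>x. p x - q x) = ?X (\<lambda>x. q x - p x)" by (rule H1_sol_norm_minus_commute[OF pqr])
    assume r: "r \<in> H1_sol ell"
    show "?X (\<lambda>x. p x - r x) \<le> ?X (\<lambda>x. p x - q x) + ?X (\<lambda>x. q x - r x)"
      using H1_sol_norm_triangle[OF H1_sol_diff[OF pqr] H1_sol_diff[OF pqr(2) r]] by simp
  qed (use \<epsilon> in auto)
  then obtain e where e: "e \<in> borel_measurable (lebesgue_on {0..?T})" "(\<lambda>t. (e t)\<^sup>2) absolutely_integrable_on {0..?T}"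
     "integral {0..?T} (\<lambda>t. (e t)\<^sup>2) \<le> 2 * \<epsilon>\<^sup>2" "\<forall>t. 0 \<le> e t" and
     "\<forall>\<eta>>0. \<exists>\<delta>>0. \<forall>\<sigma>\<in>{0..?T}. \<forall>\<tau>\<in>{0..?T}. \<bar>\<sigma> - \<tau>\<bar> < \<delta> \<and> u \<sigma> \<in> H1_sol ell \<and> u \<tau> \<in> H1_sol ell \<longrightarrow>
        ?X (\<lambda>x. u \<sigma> x - u \<tau> x) \<le> e \<sigma> + e \<tau> + \<eta>" by (elim exE conjE)
  from this(5)[rule_format, OF \<epsilon>] obtain \<delta> where \<delta>: "\<delta> > 0" "\<forall>\<sigma>\<in>{0..?T}. \<forall>\<tau>\<in>{0..?T}. \<bar>\<sigma> - \<tau>\<bar> < \<delta> \<and> u \<sigma> \<in> H1_sol ell \<and> u \<tau> \<in> H1_sol ell \<longrightarrow>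
        ?X (\<lambda>x. u \<sigma> x - u \<tau> x) \<le> e \<sigma> + e \<tau> + \<epsilon>" by (elim exE conjE)
  let ?E = "\<lambda>\<tau>. 1 / (2 * \<epsilon>) * (e \<tau>)\<^sup>2"
  have E: "?E absolutely_integrable_on {0..?T}" by (intro set_integrable_mult_right impI e(2))
  have main: "1/2 * (L2_norm (slab ell) (u y))\<^sup>2 - 1/2 * (L2_norm (slab ell) (u x))\<^sup>2 \<le> integral {x..y} (\<lambda>\<sigma>. ?b \<sigma> + \<epsilon> * ?k \<sigma> + ?E \<sigma>) + (y - x) * ?E y"
    if xy: "s \<le> x" "x < y" "y \<le> ?T" "y - x < \<delta>" "y \<notin> ?N" for x y
  proof -
    have x0: "0 \<le> x" "0 \<le> y" using st xy by auto
    have "regular_time y" using xy x0 by auto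
    then have Y: "u y \<in> H1_sol ell" "has_trace ell ell (\<lambda>z. snd (u y z)) (ht y)" "ht y \<in> L2 torus" by (auto simp: regular_time_def Hs_L2)
    let ?B = "\<lambda>\<sigma>. - 1/2 * sym_grad_inner ell (u \<sigma>) (u y) - L2_inner torus (m \<sigma>) (ht y)"
    note ux = u_L2[OF x0(1)] and uy = u_L2[OF x0(2)]
    have "0 \<le> L2_inner (slab ell) (\<lambda>z. u y z - u x z) (\<lambda>z. u y z - u x z)" by simp
    then have "1/2 * (L2_norm (slab ell) (u y))\<^sup>2 - 1/2 * (L2_norm (slab ell) (u x))\<^sup>2 \<le> L2_inner (slab ell) (u y) (u y) - L2_inner (slab ell) (u x) (u y)"
      using L2_inner_diff_left[OF uy ux L2_diff[OF uy ux]] L2_inner_diff_right[OF uy ux ux] L2_inner_diff_right[OF uy ux uy]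
        L2_inner_commute[of "slab ell" "u x" "u y"] by (simp add: L2_norm_sq)
    also have "\<dots> = integral {x..y} ?B" using primitive_eq[OF u_primitive[OF Y(1,2)] x0(1)] xy by simp
    \<comment> \<open>The density tested with u y is compared with the one tested with u \<sigma>;
      the difference is linear in u \<sigma> - u y. Of the two errors this produces, the one at y is
      constant in \<sigma> and becomes the tagged term.\<close>
    also have "\<dots> \<le> integral {x..y} (\<lambda>\<sigma>. ?b \<sigma> + \<epsilon> * ?k \<sigma> + ?E \<sigma> + ?E y)"
    proof (rule integral_mono_AE_on)
      show "?B absolutely_integrable_on {x..y}" by (rule abs_int_on_sub[OF weak_density_int[OF Y(1,3), of ?T]]) (use x0 xy in auto)
      have "(\<lambda>\<sigma>. ?b \<sigma> + \<epsilon> * ?k \<sigma> + ?E \<sigma> + ?E y) absolutely_integrable_on {0..?T}"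
        by (intro set_integral_add(1)[OF set_integral_add(1)[OF set_integral_add(1)[OF b0 set_integrable_mult_right] E]] impI k0
           absolutely_integrable_continuous_real continuous_intros)
      then show "(\<lambda>\<sigma>. ?b \<sigma> + \<epsilon> * ?k \<sigma> + ?E \<sigma> + ?E y) absolutely_integrable_on {x..y}" by (rule abs_int_on_sub) (use x0 xy in auto)
      show "AE \<sigma> in lebesgue. \<sigma> \<in> {x..y} \<longrightarrow> ?B \<sigma> \<le> ?b \<sigma> + \<epsilon> * ?k \<sigma> + ?E \<sigma> + ?E y"
      proof (rule AE_regular_on)
        fix \<sigma> assume \<sigma>: "\<sigma> \<in> {x..y}" "regular_time \<sigma>"
        then have S: "u \<sigma> \<in> H1_sol ell" "has_trace ell ell (\<lambda>z. snd (u \<sigma> z)) (ht \<sigma>)" "ht \<sigma> \<in> L2 torus" "m \<sigma> \<in> L2 torus" by (auto simp: regular_time_def Hs_L2)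
        let ?d = "?X (\<lambda>z. u \<sigma> z - u y z)" and ?U = "?X (u \<sigma>)" and ?M = "L2_norm torus (m \<sigma>)"
        have dy: "(\<lambda>z. u \<sigma> z - u y z) \<in> H1_sol ell" by (rule H1_sol_diff[OF S(1) Y(1)])
        have "?B \<sigma> - ?b \<sigma> = 1/2 * sym_grad_inner ell (u \<sigma>) (\<lambda>z. u \<sigma> z - u y z) + L2_inner torus (m \<sigma>) (\<lambda>x. ht \<sigma> x - ht y x)"
          by (simp add: sym_grad_inner_diff_right[OF S(1) Y(1) S(1)] L2_inner_diff_right[OF S(3) Y(3) S(4)])
        also have "\<dots> \<le> 2 * ?U * ?d + ?M * (2 * sqrt ell * ?d)"
        proof -
          have "sym_grad_inner ell (u \<sigma>) (\<lambda>z. u \<sigma> z - u y z) \<le> sym_norm ell (u \<sigma>) * sym_norm ell (\<lambda>z. u \<sigma> z - u y z)"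
            using sym_grad_inner_bound[OF S(1) dy] by simp
          also have "\<dots> \<le> (2 * ?U) * (2 * ?d)" by (intro mult_mono sym_norm_le S dy) auto
          finally have 1: "1/2 * sym_grad_inner ell (u \<sigma>) (\<lambda>z. u \<sigma> z - u y z) \<le> 2 * ?U * ?d" by simp
          have "L2_inner torus (m \<sigma>) (\<lambda>x. ht \<sigma> x - ht y x) \<le> ?M * L2_norm torus (\<lambda>x. ht \<sigma> x - ht y x)"
            using L2_Cauchy_Schwarz[OF S(4) L2_diff[OF S(3) Y(3)]] by simp
          also have "\<dots> \<le> ?M * (2 * sqrt ell * ?d)" by (intro mult_left_mono trace_top_diff S Y ell_pos) simp
          finally show ?thesis using 1 by simp
        qed
        also have "\<dots> = (2 * ?U + 2 * (sqrt ell * ?M)) * ?d" by (simp add: algebra_simps)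
        also have "\<dots> \<le> (2 * ?U + 2 * (sqrt ell * ?M)) * (e \<sigma> + e y + \<epsilon>)"
        proof (rule mult_left_mono)
          have "\<sigma> \<in> {0..?T}" "y \<in> {0..?T}" "\<bar>\<sigma> - y\<bar> < \<delta>" using \<sigma> x0 xy by auto
          with \<delta>(2) S(1) Y(1) show "?d \<le> e \<sigma> + e y + \<epsilon>" by simp
        qed (use ell_pos in simp)
        also have "\<dots> \<le> \<epsilon> * ?k \<sigma> + ?E \<sigma> + ?E y"
        proof -
          let ?K = "2 * ?U + 2 * (sqrt ell * ?M)"
          \<comment> \<open>Young's inequality with weight \<epsilon>, to be used for c = e
            \<sigma>, c = e y and c = \<epsilon>.\<close>
          have am: "?K * c \<le> \<epsilon> / 2 * ?K\<^sup>2 + 1 / (2 * \<epsilon>) * c\<^sup>2" for c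
          proof -
            have "(\<epsilon> * K - c)\<^sup>2 = (2 * \<epsilon>) * (\<epsilon> / 2 * K\<^sup>2 + 1 / (2 * \<epsilon>) * c\<^sup>2 - K * c)" for K :: real
              using \<epsilon> by (simp add: power2_eq_square field_simps)
            from this[of ?K] have "0 \<le> \<epsilon> / 2 * ?K\<^sup>2 + 1 / (2 * \<epsilon>) * c\<^sup>2 - ?K * c"
              using \<epsilon> zero_le_power2[of "\<epsilon> * ?K - c"] by (simp only: zero_le_mult_iff, linarith)
            then show ?thesis by simp
          qed
          have "?K\<^sup>2 \<le> 8 * ?U\<^sup>2 + 8 * (ell * ?M\<^sup>2)"
            using sum_squares_bound[of "2 * ?U" "2 * (sqrt ell * ?M)"] ell_pos by (simp add: power2_sum power_mult_distrib)
          then have "\<epsilon> * (3/2 * ?K\<^sup>2 + 1) \<le> \<epsilon> * ?k \<sigma>" using \<epsilon> by (intro mult_left_mono) auto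
          moreover have "1 / (2 * \<epsilon>) * \<epsilon>\<^sup>2 \<le> \<epsilon>" using \<epsilon> by (simp add: power2_eq_square)
          moreover have "?K * (e \<sigma> + e y + \<epsilon>) = ?K * e \<sigma> + ?K * e y + ?K * \<epsilon>" by (simp only: distrib_left)
          moreover have "\<epsilon> * (3/2 * ?K\<^sup>2 + 1) = 3 * (\<epsilon> / 2 * ?K\<^sup>2) + \<epsilon>" by (simp add: distrib_left)
          ultimately show ?thesis using am[of "e \<sigma>"] am[of "e y"] am[of \<epsilon>] by linarith
        qed
        finally show "?B \<sigma> \<le> ?b \<sigma> + \<epsilon> * ?k \<sigma> + ?E \<sigma> + ?E y" by simp
      qed (use x0 in auto)
    qed
    also have "\<dots> = integral {x..y} (\<lambda>\<sigma>. ?b \<sigma> + \<epsilon> * ?k \<sigma> + ?E \<sigma>) + integral {x..y} (\<lambda>\<sigma>. ?E y)"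
    proof (rule Henstock_Kurzweil_Integration.integral_add)
      have "(\<lambda>\<sigma>. ?b \<sigma> + \<epsilon> * ?k \<sigma> + ?E \<sigma>) absolutely_integrable_on {0..?T}"
        by (intro set_integral_add(1)[OF set_integral_add(1)[OF b0 set_integrable_mult_right] E] impI k0)
      then show "(\<lambda>\<sigma>. ?b \<sigma> + \<epsilon> * ?k \<sigma> + ?E \<sigma>) integrable_on {x..y}" by (rule int_on_sub) (use x0 xy in auto)
    qed (rule integrable_const_ivl)
    finally show ?thesis using xy by simp
  qed
  show "\<exists>E \<delta>. E absolutely_integrable_on {s..?T} \<and> integral {s..?T} E \<le> \<epsilon> \<and> (\<forall>\<tau>. 0 \<le> E \<tau>) \<and> \<delta> > 0 \<and>
      (\<forall>x y. s \<le> x \<and> x < y \<and> y \<le> ?T \<and> y - x < \<delta> \<and> y \<notin> ?N \<longrightarrow>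
         1/2 * (L2_norm (slab ell) (u y))\<^sup>2 - 1/2 * (L2_norm (slab ell) (u x))\<^sup>2 \<le> integral {x..y} (\<lambda>\<sigma>. ?b \<sigma> + \<epsilon> * ?k \<sigma> + E \<sigma>) + (y - x) * E y)"
  proof (intro exI[of _ ?E] exI[of _ \<delta>] conjI allI impI)
    show "?E absolutely_integrable_on {s..?T}" by (rule abs_int_on_sub[OF E]) (use st in auto)
    show E0: "0 \<le> ?E \<tau>" for \<tau> using \<epsilon> by simp
    have "integral {s..?T} ?E \<le> integral {0..?T} ?E" by (rule integral_nonneg_subset[OF E E0]) (use st in auto)
    also have "\<dots> = 1 / (2 * \<epsilon>) * integral {0..?T} (\<lambda>\<tau>. (e \<tau>)\<^sup>2)" by (rule integral_mult_right)
    also have "\<dots> \<le> 1 / (2 * \<epsilon>) * (2 * \<epsilon>\<^sup>2)" using e(3) \<epsilon> by (intro mult_left_mono) auto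
    finally show "integral {s..?T} ?E \<le> \<epsilon>" using \<epsilon> by (simp add: power2_eq_square)
    show "\<delta> > 0" by (rule \<delta>)
    fix x y assume "s \<le> x \<and> x < y \<and> y \<le> ?T \<and> y - x < \<delta> \<and> y \<notin> ?N"
    then show "1/2 * (L2_norm (slab ell) (u y))\<^sup>2 - 1/2 * (L2_norm (slab ell) (u x))\<^sup>2 \<le> integral {x..y} (\<lambda>\<sigma>. ?b \<sigma> + \<epsilon> * ?k \<sigma> + ?E \<sigma>) + (y - x) * ?E y"
      by (elim conjE) (rule main)
  qed
qed

end

section \<open>Recovering the surface from the dissipation\<close>

definition poincare_const :: "nat \<Rightarrow> real \<Rightarrow> real" where
  "poincare_const d ell = sqrt (real d) * (5 * ell)"

definition ext_L2_const :: "nat \<Rightarrow> real \<Rightarrow> real" where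
  "ext_L2_const d ell = real d * (ell * (1 + 9 / ell\<^sup>2))"

definition ext_H1_const :: "nat \<Rightarrow> real \<Rightarrow> real" where
  "ext_H1_const d ell = (real d)\<^sup>2 * (ell * (2 * pi\<^sup>2 + 3 / ell\<^sup>2 + 27 / ell ^ 4))"

text \<open>The summands account in turn for the kinetic energy, for the term with the extension of
  \<open>ht\<close>, for the viscous term against the extension of \<open>h\<close>, and for the
  multiplier at the two ends of the time interval. Neither the solution nor the truncation
  enters.\<close>

definition observability_const :: "nat \<Rightarrow> real \<Rightarrow> real \<Rightarrow> real \<Rightarrow> real" where
  "observability_const d ell g \<sigma> = 1/2 * (poincare_const d ell)\<^sup>2 +
     poincare_const d ell * sqrt (ext_L2_const d ell) * sqrt ell + ext_H1_const d ell / (2 * \<sigma>) + (1 + ext_L2_const d ell / g)"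

lemma consts_pos:
  assumes "d > 0" "ell > 0"
  shows "poincare_const d ell > 0" "ext_L2_const d ell > 0" "ext_H1_const d ell > 0"
  using assms unfolding poincare_const_def ext_L2_const_def ext_H1_const_def
  by (auto intro!: mult_pos_pos add_pos_nonneg)

text \<open>Two lower bounds represent the symbol: by g the potential energy controls |h|^2 and
  hence the extension in L2; by linear growth it controls the H^(1/2) seminorm and hence the
  gradient of the extension.\<close>

locale coercive_flow = linearized_flow ell \<mu> u h m ht
  for ell :: real and \<mu> :: "int^'n::finite \<Rightarrow> real" and u :: "real \<Rightarrow> 'n pt \<Rightarrow> 'n pt"
    and h m ht :: "real \<Rightarrow> real^'n \<Rightarrow> real" +
  fixes g \<sigma> :: real
  assumes g_pos: "g > 0" and \<sigma>_pos: "\<sigma> > 0"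
    and \<mu>_ge: "\<And>\<xi>. g \<le> \<mu> \<xi>" and \<mu>_ge_freq: "\<And>\<xi>. \<xi> \<noteq> 0 \<Longrightarrow> \<sigma> * norm (freq \<xi>) \<le> \<mu> \<xi>"
begin

definition partial_energy :: "(int^'n) set \<Rightarrow> real \<Rightarrow> real" where
  "partial_energy F t = 1/2 * (L2_norm (slab ell) (u t))\<^sup>2 + 1/2 * partial_potential F t"

text \<open>Taken over all of [0, T] so that one number serves every subinterval.\<close>

definition defect :: "(int^'n) set \<Rightarrow> real \<Rightarrow> real" where
  "defect F T = integral {0..T} (\<lambda>t. \<bar>partial_work F t - work t\<bar>)"

lemma partial_potential_nonneg: "0 \<le> partial_potential F t"
  unfolding partial_potential_def using g_pos \<mu>_ge by (intro sum_nonneg mult_nonneg_nonneg) (auto intro: order_trans[OF less_imp_le])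

lemma defect_int: "(\<lambda>t. \<bar>partial_work F t - work t\<bar>) absolutely_integrable_on {0..T}"
  by (intro set_integrable_abs set_integral_diff(1) partial_work_int work_int)

lemma defect_nonneg: "0 \<le> defect F T"
  unfolding defect_def by (rule integral_nonneg[OF set_lebesgue_integral_eq_integral(1)[OF defect_int]]) simp

text \<open>The kinetic energy loses the full \<open>work\<close> while the truncated potential
  gains only \<open>partial_work\<close>; their mismatch is at most the defect.\<close>

lemma partial_energy_inequality:
  assumes st: "0 \<le> s" "s \<le> t" "t \<le> T"
  shows "partial_energy F t + 1/2 * integral {s..t} dissipation \<le> partial_energy F s + defect F T"
proof (cases "s = t")
  case True
  then show ?thesis using defect_nonneg[of F T] by simp
next
  case False
  note i = int_on_sub[OF dissipation_int[of t] st(1) order_refl] int_on_sub[OF work_int[of t] st(1) order_refl]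
    int_on_sub[OF partial_work_int[of t F] st(1) order_refl] int_on_sub[OF defect_int[of t F] st(1) order_refl]
  have "1/2 * (L2_norm (slab ell) (u t))\<^sup>2 - 1/2 * (L2_norm (slab ell) (u s))\<^sup>2 \<le> integral {s..t} (\<lambda>\<tau>. - 1/2 * dissipation \<tau> - work \<tau>)"
    by (rule kinetic_energy_inequality) (use st False in auto)
  also have "\<dots> = integral {s..t} (\<lambda>\<tau>. - 1/2 * dissipation \<tau>) - integral {s..t} work"
    by (rule integral_diff) (intro integrable_on_mult_right i)+
  also have "integral {s..t} (\<lambda>\<tau>. - 1/2 * dissipation \<tau>) = - 1/2 * integral {s..t} dissipation" by (rule integral_mult_right)
  finally have 1: "1/2 * (L2_norm (slab ell) (u t))\<^sup>2 - 1/2 * (L2_norm (slab ell) (u s))\<^sup>2 \<le> - 1/2 * integral {s..t} dissipation - integral {s..t} work" .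
  have 2: "1/2 * partial_potential F t - 1/2 * partial_potential F s = integral {s..t} (partial_work F)"
    by (rule primitive_eq[OF partial_potential_primitive st(1,2)])
  have "integral {s..t} (partial_work F) - integral {s..t} work = integral {s..t} (\<lambda>\<tau>. partial_work F \<tau> - work \<tau>)"
    by (rule integral_diff[symmetric]) (rule i)+
  also have "\<dots> \<le> integral {s..t} (\<lambda>\<tau>. \<bar>partial_work F \<tau> - work \<tau>\<bar>)"
    by (rule integral_le) (intro integrable_diff i, rule i, simp)
  also have "\<dots> \<le> defect F T" unfolding defect_def by (rule integral_nonneg_subset[OF defect_int]) (use st in auto)
  finally show ?thesis using 1 2 by (simp add: partial_energy_def)
qed

text \<open>Testing the equation with the extension of \<open>h\<close> itself makes the potential energy appear.\<close>

definition multiplier :: "(int^'n) set \<Rightarrow> real \<Rightarrow> real" where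
  "multiplier F t = L2_inner (slab ell) (u t) (extension ell F (fourier (h t)))"

text \<open>The extension varies in time only through finitely many Fourier coefficients, so the
  multiplier is a finite sum of products of scalar primitives. The density d stays abstract because
  the displayed form is established at regular times only.\<close>

lemma multiplier_primitive:
  assumes F: "finite F" "0 \<notin> F"
  shows "\<exists>d. (\<forall>s t. 0 \<le> s \<and> s \<le> t \<longrightarrow> multiplier F t - multiplier F s = integral {s..t} d) \<and>
    (\<forall>T. d absolutely_integrable_on {0..T}) \<and>
    (\<forall>t\<ge>0. regular_time t \<longrightarrow> d t = L2_inner (slab ell) (u t) (extension ell F (fourier (ht t)))
       - 1/2 * sym_grad_inner ell (u t) (extension ell F (fourier (h t))) - partial_potential F t)"
proof -
  let ?e = "\<lambda>\<xi>. extension ell {\<xi>} (\<lambda>_. 1)" and ?f = "\<lambda>\<xi>. extension ell {\<xi>} (\<lambda>_. \<i>)"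
  let ?qe = "\<lambda>\<xi> x. \<Sum>\<xi>\<in>{\<xi>}. Re (1 * chr \<xi> x)" and ?qf = "\<lambda>\<xi> x. \<Sum>\<xi>\<in>{\<xi>}. Re (\<i> * chr \<xi> x)"
  let ?w = "\<lambda>t v q. - 1/2 * sym_grad_inner ell (u t) v - L2_inner torus (m t) q"
  have ex: "?e \<xi> \<in> H1_sol ell" "?f \<xi> \<in> H1_sol ell" "has_trace ell ell (\<lambda>z. snd (?e \<xi> z)) (?qe \<xi>)"
    "has_trace ell ell (\<lambda>z. snd (?f \<xi> z)) (?qf \<xi>)" if "\<xi> \<in> F" for \<xi>
    using extension_H1_sol[of "{\<xi>}" ell "\<lambda>_. 1", OF _ _ ell_pos] extension_H1_sol[of "{\<xi>}" ell "\<lambda>_. \<i>", OF _ _ ell_pos]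
      that F(2) by (simp_all del: sum.insert cong: if_cong) blast+
  define d where "d t = (\<Sum>\<xi>\<in>F. (L2_inner (slab ell) (u t) (?e \<xi>) * Re (fourier (ht t) \<xi>) + Re (fourier (h t) \<xi>) * ?w t (?e \<xi>) (?qe \<xi>))
      + (L2_inner (slab ell) (u t) (?f \<xi>) * Im (fourier (ht t) \<xi>) + Im (fourier (h t) \<xi>) * ?w t (?f \<xi>) (?qf \<xi>)))" for t
  have lin: "L2_inner (slab ell) (u t) (extension ell F c) = (\<Sum>\<xi>\<in>F. Re (c \<xi>) * L2_inner (slab ell) (u t) (?e \<xi>) + Im (c \<xi>) * L2_inner (slab ell) (u t) (?f \<xi>))"
    if "0 \<le> t" for t c
    by (rule extension_linear[OF F ell_pos]) (auto intro: L2_inner_add_right H1_sol_L2 u_L2[OF that] simp: L2_inner_scaleR_right)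
  have "primitive_on_ge0 (\<lambda>t. \<Sum>\<xi>\<in>F. Re (fourier (h t) \<xi>) * L2_inner (slab ell) (u t) (?e \<xi>) + Im (fourier (h t) \<xi>) * L2_inner (slab ell) (u t) (?f \<xi>)) d"
    unfolding d_def by (intro primitive_sum primitive_add primitive_mult h_primitive u_primitive ex)
  note p = this
  show ?thesis
  proof (intro exI[of _ d] conjI allI impI)
    show "multiplier F t - multiplier F s = integral {s..t} d" if "0 \<le> s \<and> s \<le> t" for s t
      using primitive_eq[OF p, of s t] lin[of s] lin[of t] that by (simp add: multiplier_def)
    show "d absolutely_integrable_on {0..T}" for T by (rule primitive_abs_int[OF p]) simp
    fix t :: real assume t0: "0 \<le> t" and t: "regular_time t"
    then have X: "u t \<in> H1_sol ell" "m t \<in> L2 torus" and M: "fourier (m t) = M_hat \<mu> (h t)" by (auto simp: regular_time_def)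
    have slin: "sym_grad_inner ell (u t) (extension ell F c) = (\<Sum>\<xi>\<in>F. Re (c \<xi>) * sym_grad_inner ell (u t) (?e \<xi>) + Im (c \<xi>) * sym_grad_inner ell (u t) (?f \<xi>))" for c
      by (rule extension_linear[OF F ell_pos]) (auto intro: sym_grad_inner_add_right sym_grad_inner_scaleR_right X)
    \<comment> \<open>Tested against the traces of the two basic fields, \<open>m\<close> yields the
      real and the imaginary part of its coefficient. That coefficient is \<mu> times the one of
      \<open>h\<close>, so weighting with the real and imaginary part of the latter produces \<mu>
      times its squared modulus.\<close>
    have q: "L2_inner torus (m t) (?qe \<xi>) = Re (fourier (m t) \<xi>)" "L2_inner torus (m t) (?qf \<xi>) = Im (fourier (m t) \<xi>)" for \<xi>
      using fourier_Re[OF X(2), of \<xi>] fourier_Im[OF X(2), of \<xi>] by simp_all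
    have "d t = (\<Sum>\<xi>\<in>F. (Re (fourier (ht t) \<xi>) * L2_inner (slab ell) (u t) (?e \<xi>) + Im (fourier (ht t) \<xi>) * L2_inner (slab ell) (u t) (?f \<xi>))
       - 1/2 * (Re (fourier (h t) \<xi>) * sym_grad_inner ell (u t) (?e \<xi>) + Im (fourier (h t) \<xi>) * sym_grad_inner ell (u t) (?f \<xi>))
       - \<mu> \<xi> * (cmod (fourier (h t) \<xi>))\<^sup>2)"
      unfolding d_def q M M_hat_def cmod_power2 by (intro sum.cong refl) (simp add: power2_eq_square algebra_simps)
    then show "d t = L2_inner (slab ell) (u t) (extension ell F (fourier (ht t)))
       - 1/2 * sym_grad_inner ell (u t) (extension ell F (fourier (h t))) - partial_potential F t"
      unfolding lin[OF t0] slin partial_potential_def by (simp only: sum_subtractf sum_distrib_left)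
  qed
qed

lemma consts_pos': "poincare_const DIM('n pt) ell > 0" "ext_L2_const DIM('n pt) ell > 0" "ext_H1_const DIM('n pt) ell > 0"
  by (rule consts_pos[OF _ ell_pos], simp)+

lemma sum_fourier_h_le:
  "(\<Sum>\<xi>\<in>F. (cmod (fourier (h t) \<xi>))\<^sup>2) \<le> partial_potential F t / g"
proof -
  have "g * (\<Sum>\<xi>\<in>F. (cmod (fourier (h t) \<xi>))\<^sup>2) \<le> partial_potential F t"
    unfolding partial_potential_def sum_distrib_left by (intro sum_mono mult_right_mono \<mu>_ge) simp
  then show ?thesis using g_pos by (simp add: pos_le_divide_eq mult.commute)
qed

text \<open>Controls the boundary terms in time: the energy dominates the multiplier at every single
  time, not just on average.\<close>

lemma multiplier_le:
  assumes F: "finite F" "0 \<notin> F" and t: "0 \<le> t"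
  shows "\<bar>multiplier F t\<bar> \<le> (1 + (ext_L2_const DIM('n pt) ell) / g) * partial_energy F t"
proof -
  let ?v = "extension ell F (fourier (h t))" and ?S = "partial_potential F t"
  have "\<bar>multiplier F t\<bar> \<le> L2_norm (slab ell) (u t) * L2_norm (slab ell) ?v"
    unfolding multiplier_def by (intro L2_Cauchy_Schwarz u_L2[OF t] H1_sol_L2 extension_H1_sol(1) F ell_pos)
  also have "\<dots> \<le> 1/2 * (L2_norm (slab ell) (u t))\<^sup>2 + 1/2 * (L2_norm (slab ell) ?v)\<^sup>2"
    using sum_squares_bound[of "L2_norm (slab ell) (u t)" "L2_norm (slab ell) ?v"] by simp
  also have "(L2_norm (slab ell) ?v)\<^sup>2 \<le> (ext_L2_const DIM('n pt) ell) * (?S / g)"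
    unfolding ext_L2_const_def
    by (rule order_trans[OF extension_L2_bound[OF F ell_pos]]) (intro mult_left_mono sum_fourier_h_le, use ell_pos in simp)
  finally have "\<bar>multiplier F t\<bar> \<le> 1/2 * (L2_norm (slab ell) (u t))\<^sup>2 + (ext_L2_const DIM('n pt) ell) / g * (1/2 * ?S)" by simp
  moreover have "0 \<le> (ext_L2_const DIM('n pt) ell) / g * (1/2 * (L2_norm (slab ell) (u t))\<^sup>2)" "0 \<le> 1/2 * ?S"
    using consts_pos' g_pos partial_potential_nonneg[of F t] by auto
  ultimately show ?thesis unfolding partial_energy_def distrib_left distrib_right by linarith
qed

text \<open>The first term is quadratic in the dissipation norm, since \<open>ht\<close> is the
  trace of \<open>u\<close> and its extension is bounded in L2. The second mixes dissipation and
  potential and is split so that exactly half of the potential is spent.\<close>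

lemma multiplier_density_le:
  assumes F: "finite F" "0 \<notin> F" and t: "regular_time t" "0 \<le> t"
  shows "L2_inner (slab ell) (u t) (extension ell F (fourier (ht t))) - 1/2 * sym_grad_inner ell (u t) (extension ell F (fourier (h t)))
    \<le> ((poincare_const DIM('n pt) ell) * sqrt (ext_L2_const DIM('n pt) ell) * sqrt ell + (ext_H1_const DIM('n pt) ell) / (2 * \<sigma>)) * dissipation t + 1/2 * partial_potential F t"
proof -
  let ?D = "sym_norm ell (u t)" and ?v = "extension ell F (fourier (h t))" and ?w = "extension ell F (fourier (ht t))"
  have X: "u t \<in> H1_sol ell" "ht t \<in> L2 torus" using t Hs_L2 by (auto simp: regular_time_def)
  have v: "extension ell F c \<in> H1_sol ell" for c by (rule extension_H1_sol(1)[OF F ell_pos])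
  have w2: "(L2_norm (slab ell) ?w)\<^sup>2 \<le> (ext_L2_const DIM('n pt) ell) * (sqrt ell * ?D)\<^sup>2"
  proof -
    have "(L2_norm (slab ell) ?w)\<^sup>2 \<le> (ext_L2_const DIM('n pt) ell) * (\<Sum>\<xi>\<in>F. (cmod (fourier (ht t) \<xi>))\<^sup>2)"
      unfolding ext_L2_const_def by (rule extension_L2_bound[OF F ell_pos])
    also have "\<dots> \<le> (ext_L2_const DIM('n pt) ell) * (L2_norm torus (ht t))\<^sup>2"
      using consts_pos'(2) by (intro mult_left_mono bessel[OF X(2) F(1)]) simp
    also have "\<dots> \<le> (ext_L2_const DIM('n pt) ell) * (sqrt ell * ?D)\<^sup>2"
      using consts_pos'(2) by (intro mult_left_mono power_mono ht_norm_le[OF t(1)]) auto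
    finally show ?thesis .
  qed
  have "L2_norm (slab ell) ?w \<le> sqrt (ext_L2_const DIM('n pt) ell) * (sqrt ell * ?D)"
  proof (rule power2_le_imp_le)
    show "(L2_norm (slab ell) ?w)\<^sup>2 \<le> (sqrt (ext_L2_const DIM('n pt) ell) * (sqrt ell * ?D))\<^sup>2"
      using w2 consts_pos'(2) by (simp add: power_mult_distrib)
  qed (use consts_pos'(2) ell_pos in auto)
  moreover have "L2_norm (slab ell) (u t) \<le> (poincare_const DIM('n pt) ell) * ?D"
    unfolding poincare_const_def by (rule korn_poincare[OF X(1) ell_pos])
  ultimately have "L2_norm (slab ell) (u t) * L2_norm (slab ell) ?w \<le> ((poincare_const DIM('n pt) ell) * ?D) * (sqrt (ext_L2_const DIM('n pt) ell) * (sqrt ell * ?D))"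
    using consts_pos' by (intro mult_mono) auto
  then have 1: "L2_inner (slab ell) (u t) ?w \<le> (poincare_const DIM('n pt) ell) * sqrt (ext_L2_const DIM('n pt) ell) * sqrt ell * dissipation t"
    using L2_Cauchy_Schwarz[OF u_L2[OF t(2)] H1_sol_L2[OF v], of "fourier (ht t)"]
    by (simp add: sym_norm_sq[symmetric] power2_eq_square mult_ac)
  \<comment> \<open>\<open>?a\<close> is the weight for Young's inequality: H^2 is at most a times
    the potential, so D H is at most a / 2 D^2 plus half of the potential.\<close>
  let ?H = "H1_sol_norm ell ?v" and ?a = "(ext_H1_const DIM('n pt) ell) / \<sigma>"
  have a: "?a > 0" using consts_pos' \<sigma>_pos by simp
  have "?H\<^sup>2 \<le> (ext_H1_const DIM('n pt) ell) * (\<Sum>\<xi>\<in>F. norm (freq \<xi>) * (cmod (fourier (h t) \<xi>))\<^sup>2)"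
    unfolding ext_H1_const_def by (rule extension_H1_bound[OF F ell_pos])
  also have "\<dots> \<le> (ext_H1_const DIM('n pt) ell) * (partial_potential F t / \<sigma>)"
  proof (rule mult_left_mono)
    have "\<sigma> * (\<Sum>\<xi>\<in>F. norm (freq \<xi>) * (cmod (fourier (h t) \<xi>))\<^sup>2) \<le> partial_potential F t"
      unfolding partial_potential_def sum_distrib_left mult.assoc[symmetric]
    proof (intro sum_mono mult_right_mono \<mu>_ge_freq)
      show "\<xi> \<noteq> 0" if "\<xi> \<in> F" for \<xi> using that F(2) by auto
    qed simp
    then show "(\<Sum>\<xi>\<in>F. norm (freq \<xi>) * (cmod (fourier (h t) \<xi>))\<^sup>2) \<le> partial_potential F t / \<sigma>"
      using \<sigma>_pos by (simp add: pos_le_divide_eq mult.commute)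
  qed (use consts_pos' in simp)
  finally have H: "?H\<^sup>2 \<le> ?a * partial_potential F t" by simp
  have "- sym_grad_inner ell (u t) ?v \<le> ?D * sym_norm ell ?v" using sym_grad_inner_bound[OF X(1) v, of "fourier (h t)"] by linarith
  also have "\<dots> \<le> ?D * (2 * ?H)" by (intro mult_left_mono sym_norm_le[OF v]) simp
  finally have 2: "- 1/2 * sym_grad_inner ell (u t) ?v \<le> ?D * ?H" by simp
  have "2 * ?a * (?D * ?H) \<le> ?a\<^sup>2 * ?D\<^sup>2 + ?H\<^sup>2"
    using sum_squares_bound[of "?a * ?D" ?H] by (simp only: power_mult_distrib mult.assoc)
  also have "\<dots> \<le> ?a\<^sup>2 * ?D\<^sup>2 + ?a * partial_potential F t" using H by simp
  also have "\<dots> = 2 * ?a * (?a / 2 * ?D\<^sup>2 + 1/2 * partial_potential F t)" by (simp add: power2_eq_square algebra_simps)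
  finally have "?D * ?H \<le> ?a / 2 * ?D\<^sup>2 + 1/2 * partial_potential F t"
    using a by (subst (asm) mult_le_cancel_left_pos) auto
  then have "- 1/2 * sym_grad_inner ell (u t) ?v \<le> (ext_H1_const DIM('n pt) ell) / (2 * \<sigma>) * dissipation t + 1/2 * partial_potential F t"
    using 2 by (simp add: sym_norm_sq mult.commute)
  then show ?thesis using 1 unfolding distrib_right by linarith
qed

lemma partial_energy_int: "partial_energy F absolutely_integrable_on {0..T}"
proof -
  have "continuous_on {0..T} (\<lambda>t. 2 * (1/2 * partial_potential F t))"
    by (intro continuous_on_mult continuous_on_const primitive_continuous[OF partial_potential_primitive])
  then show ?thesis
    unfolding partial_energy_def[abs_def]
    by (intro absolutely_integrable_continuous_real continuous_intros continuous_on_subset[OF continuous_L2_norm[OF u_cont]]) auto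
qed

text \<open>Half of the potential survives in the derivative of the multiplier. Adding half of
  |u|^2, bounded by the dissipation through \<open>korn_poincare\<close>, completes the energy, and
  integration in time leaves the multiplier at the end points only.\<close>

lemma observability:
  assumes F: "finite F" "0 \<notin> F" and st: "0 \<le> s" "s \<le> t"
  shows "integral {s..t} (partial_energy F) \<le>
    ((observability_const DIM('n pt) ell g \<sigma>) - (1 + (ext_L2_const DIM('n pt) ell) / g)) * integral {s..t} dissipation + (1 + (ext_L2_const DIM('n pt) ell) / g) * (partial_energy F s + partial_energy F t)"
proof -
  let ?c = "(observability_const DIM('n pt) ell g \<sigma>) - (1 + (ext_L2_const DIM('n pt) ell) / g)"
  have "\<exists>d. (\<forall>s t. 0 \<le> s \<and> s \<le> t \<longrightarrow> multiplier F t - multiplier F s = integral {s..t} d) \<and>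
    (\<forall>T. d absolutely_integrable_on {0..T}) \<and>
    (\<forall>t\<ge>0. regular_time t \<longrightarrow> d t = L2_inner (slab ell) (u t) (extension ell F (fourier (ht t)))
       - 1/2 * sym_grad_inner ell (u t) (extension ell F (fourier (h t))) - partial_potential F t)"
    by (rule multiplier_primitive[OF F])
  then obtain d where d: "\<forall>s t. 0 \<le> s \<and> s \<le> t \<longrightarrow> multiplier F t - multiplier F s = integral {s..t} d"
    "\<forall>T. d absolutely_integrable_on {0..T}"
    "\<forall>t\<ge>0. regular_time t \<longrightarrow> d t = L2_inner (slab ell) (u t) (extension ell F (fourier (ht t)))
       - 1/2 * sym_grad_inner ell (u t) (extension ell F (fourier (h t))) - partial_potential F t" by (elim exE conjE)
  have pe: "partial_energy F absolutely_integrable_on {s..t}" by (rule abs_int_on_sub[OF partial_energy_int st(1) order_refl])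
  have di: "dissipation absolutely_integrable_on {s..t}" by (rule abs_int_on_sub[OF dissipation_int st(1) order_refl])
  have dd: "d absolutely_integrable_on {s..t}" by (rule abs_int_on_sub[OF d(2)[rule_format] st(1) order_refl])
  have "integral {s..t} (partial_energy F) \<le> integral {s..t} (\<lambda>\<tau>. ?c * dissipation \<tau> - d \<tau>)"
  proof (rule integral_mono_AE_on[OF pe])
    show "(\<lambda>\<tau>. ?c * dissipation \<tau> - d \<tau>) absolutely_integrable_on {s..t}"
      by (intro set_integral_diff(1) set_integrable_mult_right impI di dd)
    show "AE \<tau> in lebesgue. \<tau> \<in> {s..t} \<longrightarrow> partial_energy F \<tau> \<le> ?c * dissipation \<tau> - d \<tau>"
    proof (rule AE_regular_on)
      fix \<tau> assume \<tau>: "0 \<le> \<tau>" "regular_time \<tau>"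
      then have X: "u \<tau> \<in> H1_sol ell" by (simp add: regular_time_def)
      have "(L2_norm (slab ell) (u \<tau>))\<^sup>2 \<le> ((poincare_const DIM('n pt) ell) * sym_norm ell (u \<tau>))\<^sup>2"
        unfolding poincare_const_def by (intro power_mono korn_poincare[OF X ell_pos]) simp
      then have "(L2_norm (slab ell) (u \<tau>))\<^sup>2 \<le> (poincare_const DIM('n pt) ell)\<^sup>2 * dissipation \<tau>" by (simp add: power_mult_distrib sym_norm_sq)
      then show "partial_energy F \<tau> \<le> ?c * dissipation \<tau> - d \<tau>"
        using multiplier_density_le[OF F \<tau>(2,1)] d(3)[rule_format, OF \<tau>]
        unfolding partial_energy_def observability_const_def by (simp add: distrib_right)
    qed (use st in auto)
  qed
  also have "\<dots> = ?c * integral {s..t} dissipation - integral {s..t} d"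
    using set_lebesgue_integral_eq_integral(1)[OF di] set_lebesgue_integral_eq_integral(1)[OF dd]
    by (subst integral_diff) (auto intro: integrable_on_mult_right)
  also have "integral {s..t} d = multiplier F t - multiplier F s" using d(1)[rule_format, of s t] st by simp
  also have "?c * integral {s..t} dissipation - (multiplier F t - multiplier F s) \<le> ?c * integral {s..t} dissipation + (1 + (ext_L2_const DIM('n pt) ell) / g) * (partial_energy F s + partial_energy F t)"
  proof -
    have "0 \<le> t" using st by simp
    from multiplier_le[OF F this] multiplier_le[OF F st(1)] show ?thesis unfolding distrib_left by linarith
  qed
  finally show ?thesis by simp
qed

text \<open>Up to the defect the energy decreases, so its integral over [s, t] is at least t - s
  times its last value, and the total dissipation is at most twice its first value. The two terms
  from \<open>observability\<close> then merge into 2 C.\<close>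

lemma partial_energy_decay:
  assumes F: "finite F" "0 \<notin> F" and st: "0 \<le> s" "s \<le> t"
  shows "(t - s) * partial_energy F t \<le> 2 * (observability_const DIM('n pt) ell g \<sigma>) * partial_energy F s + (2 * (observability_const DIM('n pt) ell g \<sigma>) + (t - s)) * defect F t"
proof -
  let ?E = "partial_energy F" and ?\<eta> = "defect F t" and ?C = "(observability_const DIM('n pt) ell g \<sigma>)" and ?c = "1 + (ext_L2_const DIM('n pt) ell) / g"
  have Cc: "0 \<le> ?C - ?c" unfolding observability_const_def using consts_pos' ell_pos \<sigma>_pos by simp
  have c: "0 \<le> ?c" using consts_pos' g_pos by simp
  have "(t - s) * (?E t - ?\<eta>) = integral {s..t} (\<lambda>\<tau>. ?E t - ?\<eta>)" using st by simp
  also have "\<dots> \<le> integral {s..t} ?E"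
  proof (rule integral_le)
    show "?E integrable_on {s..t}" by (rule int_on_sub[OF partial_energy_int st(1) order_refl])
    show "(\<lambda>\<tau>. ?E t - ?\<eta>) integrable_on {s..t}" by (rule integrable_const_ivl)
    fix \<tau> assume \<tau>: "\<tau> \<in> {s..t}"
    have "0 \<le> integral {\<tau>..t} dissipation"
    proof (rule integral_nonneg)
      show "dissipation integrable_on {\<tau>..t}" by (rule int_on_sub[OF dissipation_int _ order_refl]) (use \<tau> st in auto)
    qed (simp flip: sym_norm_sq)
    then show "?E t - ?\<eta> \<le> ?E \<tau>" using partial_energy_inequality[of \<tau> t t F] \<tau> st by simp
  qed
  also have "\<dots> \<le> (?C - ?c) * integral {s..t} dissipation + ?c * (?E s + ?E t)" by (rule observability[OF F st])
  also have "\<dots> \<le> (?C - ?c) * (2 * (?E s + ?\<eta>)) + ?c * (2 * (?E s + ?\<eta>))"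
  proof -
    have E: "?E t + 1/2 * integral {s..t} dissipation \<le> ?E s + ?\<eta>" by (rule partial_energy_inequality[OF st order_refl])
    have "0 \<le> ?E t" unfolding partial_energy_def using partial_potential_nonneg[of F t] by simp
    with E have 1: "integral {s..t} dissipation \<le> 2 * (?E s + ?\<eta>)" by simp
    have "0 \<le> integral {s..t} dissipation"
    proof (rule integral_nonneg)
      show "dissipation integrable_on {s..t}" by (rule int_on_sub[OF dissipation_int st(1) order_refl])
    qed (simp flip: sym_norm_sq)
    with E have 2: "?E s + ?E t \<le> 2 * (?E s + ?\<eta>)" using defect_nonneg[of F t] by simp
    show ?thesis by (intro add_mono mult_left_mono 1 2 Cc c)
  qed
  also have "\<dots> = 2 * ?C * (?E s + ?\<eta>)" by (simp add: algebra_simps)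
  finally show ?thesis by (simp add: algebra_simps)
qed

end

section \<open>Exponential decay\<close>

text \<open>For t - s = 2 C the last hypothesis says that e is halved. Iteration gives powers of 1/2
  at the multiples of 2 C, monotonicity fills the gaps, and the factor 2 pays for the last
  incomplete period.\<close>

lemma exponential_decay:
  fixes e :: "real \<Rightarrow> real"
  assumes C: "C > 0" and nonneg: "\<And>t. 0 \<le> t \<Longrightarrow> 0 \<le> e t"
    and mono: "\<And>s t. 0 \<le> s \<Longrightarrow> s \<le> t \<Longrightarrow> e t \<le> e s"
    and decay: "\<And>s t. 0 \<le> s \<Longrightarrow> s \<le> t \<Longrightarrow> (t - s) * e t \<le> C * e s"
    and t: "0 \<le> t"
  shows "e t \<le> 2 * exp (- (ln 2 / (2 * C)) * t) * e 0"
proof -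
  have half: "e (s + 2 * C) \<le> e s / 2" if "0 \<le> s" for s
    using decay[of s "s + 2 * C"] that C by (simp add: field_simps)
  have k: "e (real k * (2 * C)) \<le> (1/2) ^ k * e 0" for k :: nat
  proof (induction k)
    case (Suc k)
    have "e (real (Suc k) * (2 * C)) \<le> e (real k * (2 * C)) / 2"
      using half[of "real k * (2 * C)"] C by (simp add: algebra_simps)
    also have "\<dots> \<le> ((1/2) ^ k * e 0) / 2" using Suc by simp
    finally show ?case by simp
  qed simp
  define n where "n = nat \<lfloor>t / (2 * C)\<rfloor>"
  have n: "real n \<le> t / (2 * C)" "t / (2 * C) < real n + 1" using t C by (auto simp: n_def)
  have "real n * (2 * C) \<le> t" using n(1) C by (simp add: pos_le_divide_eq)
  then have "e t \<le> e (real n * (2 * C))" using C by (intro mono) auto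
  also have "\<dots> \<le> (1/2) ^ n * e 0" by (rule k)
  also have "\<dots> \<le> (2 * exp (- (ln 2 / (2 * C)) * t)) * e 0"
  proof (rule mult_right_mono)
    have "(1/2::real) ^ n = exp (- ln 2) ^ n" by (simp add: exp_minus)
    also have "\<dots> = exp (- (real n * ln 2))" by (simp flip: exp_of_nat_mult)
    also have "\<dots> \<le> exp (ln 2 + - (t / (2 * C)) * ln 2)"
    proof -
      have "t / (2 * C) * ln 2 \<le> (real n + 1) * ln 2" using n(2) by (intro mult_right_mono) auto
      then show ?thesis by (simp add: algebra_simps)
    qed
    also have "\<dots> = 2 * exp (- (ln 2 / (2 * C)) * t)" unfolding exp_add by (simp add: mult.commute)
    finally show "(1/2::real) ^ n \<le> 2 * exp (- (ln 2 / (2 * C)) * t)" .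
  qed (rule nonneg, simp)
  finally show ?thesis .
qed

context coercive_flow
begin

lemma defect_tendsto: "(\<lambda>n. defect (freq_box n) T) \<longlonglongrightarrow> 0"
  unfolding defect_def by (rule work_approx)

text \<open>The mean of \<open>h\<close> vanishes, so frequency 0, for which there is no extension,
  carries no energy and may be dropped.\<close>

lemma partial_energy_remove_0:
  assumes "0 \<le> t" shows "partial_energy (F - {0}) t = partial_energy F t"
proof (cases "finite F")
  case True
  have "partial_potential F t = partial_potential (F - {0}) t"
    unfolding partial_potential_def using True h_fourier_0[OF assms] by (intro sum.mono_neutral_right) auto
  then show ?thesis by (simp add: partial_energy_def)
qed (simp add: partial_energy_def partial_potential_def)

lemma partial_work_remove_0:
  assumes "0 \<le> t" shows "partial_work (F - {0}) t = partial_work F t"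
proof (cases "finite F")
  case True
  show ?thesis
    unfolding partial_work_def using True h_fourier_0[OF assms] by (intro sum.mono_neutral_left) auto
qed (simp add: partial_work_def)

lemma defect_remove_0: "defect (F - {0}) T = defect F T"
  unfolding defect_def by (rule integral_cong) (simp add: partial_work_remove_0)

text \<open>The limit is taken in the extended reals, where a series of nonnegative terms always
  converges.\<close>

lemma energy_tendsto:
  assumes t: "0 \<le> t"
  shows "(\<lambda>n. ennreal (partial_energy (freq_box n) t)) \<longlonglongrightarrow> energy ell \<mu> u h t"
proof -
  let ?c = "\<lambda>\<xi>. ennreal (\<mu> \<xi> * (cmod (fourier (h t) \<xi>))\<^sup>2)"
  have \<mu>0: "0 \<le> \<mu> \<xi>" for \<xi> using g_pos \<mu>_ge[of \<xi>] by simp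
  have "(?c has_sum infsum ?c UNIV) UNIV" by (rule has_sum_infsum) (rule nonneg_summable_on_complete, simp)
  from filterlim_compose[OF this[unfolded has_sum_def] filterlim_freq_box]
  have "(\<lambda>n. \<Sum>\<xi>\<in>freq_box n. ?c \<xi>) \<longlonglongrightarrow> infsum ?c UNIV" .
  also have "(\<lambda>n. \<Sum>\<xi>\<in>freq_box n. ?c \<xi>) = (\<lambda>n. ennreal (partial_potential (freq_box n) t))"
    unfolding partial_potential_def using \<mu>0 by (intro ext sum_ennreal) simp
  finally have l: "(\<lambda>n. ennreal (partial_potential (freq_box n) t)) \<longlonglongrightarrow> infsum ?c UNIV" .
  have c: "ennreal (Re (M_hat \<mu> (h t) \<xi> * cnj (fourier (h t) \<xi>))) = ?c \<xi>" for \<xi>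
  proof -
    have "M_hat \<mu> (h t) \<xi> * cnj (fourier (h t) \<xi>) = of_real (\<mu> \<xi> * (cmod (fourier (h t) \<xi>))\<^sup>2)"
      unfolding M_hat_def of_real_mult complex_norm_square by (simp only: mult.assoc)
    then show ?thesis by (simp only: Re_complex_of_real)
  qed
  have k: "(\<integral>\<^sup>+z. ennreal ((norm (u t z))\<^sup>2) \<partial>slab ell) = ennreal ((L2_norm (slab ell) (u t))\<^sup>2)"
    unfolding L2_norm_sq_integral by (intro nn_integral_eq_integral L2_integrable_sq u_L2[OF t]) simp
  have "(\<lambda>n. ennreal (1/2) * ennreal ((L2_norm (slab ell) (u t))\<^sup>2) + ennreal (1/2) * ennreal (partial_potential (freq_box n) t))
     \<longlonglongrightarrow> energy ell \<mu> u h t"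
    unfolding energy_def k c by (intro tendsto_add tendsto_const ennreal_tendsto_cmult l) (rule ennreal_less_top)
  moreover have "ennreal (1/2) * ennreal ((L2_norm (slab ell) (u t))\<^sup>2) + ennreal (1/2) * ennreal (partial_potential F t) = ennreal (partial_energy F t)" for F
    unfolding partial_energy_def using partial_potential_nonneg[of F t] by (simp only: ennreal_mult'[symmetric] ennreal_plus[symmetric]) (simp add: ennreal_mult'[symmetric])
  ultimately show ?thesis by simp
qed

lemma partial_energy_nonneg: "0 \<le> partial_energy F t"
  unfolding partial_energy_def using partial_potential_nonneg[of F t] by simp

lemma observability_const_pos: "observability_const DIM('n pt) ell g \<sigma> > 0"
  using consts_pos' g_pos \<sigma>_pos ell_pos unfolding observability_const_def by (intro add_nonneg_pos add_pos_nonneg) auto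

text \<open>The inequalities for truncations hold up to multiples of the defect and pass to the
  limit. Monotonicity comes first: it propagates finiteness from time 0, after which the argument
  runs with real numbers.\<close>

lemma energy_decay:
  assumes "0 \<le> t"
  shows "energy ell \<mu> u h t \<le> ennreal (2 * exp (- (ln 2 / (4 * observability_const DIM('n pt) ell g \<sigma>)) * t)) * energy ell \<mu> u h 0"
proof (cases "energy ell \<mu> u h 0 = \<infinity>")
  \<comment> \<open>A positive multiple of infinity is infinity, so the bound is trivial.\<close>
  case True
  then show ?thesis by (simp add: ennreal_mult_top)
next
  case False
  let ?E = "\<lambda>n. partial_energy (freq_box n)" and ?C = "observability_const DIM('n pt) ell g \<sigma>"
  have le0: "energy ell \<mu> u h t \<le> energy ell \<mu> u h 0" if t: "0 \<le> t" for t
  proof (rule LIMSEQ_le)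
    show "(\<lambda>n. ennreal (?E n t)) \<longlonglongrightarrow> energy ell \<mu> u h t" by (rule energy_tendsto[OF t])
    have "(\<lambda>n. ennreal (?E n 0) + ennreal (defect (freq_box n) t)) \<longlonglongrightarrow> energy ell \<mu> u h 0 + ennreal 0"
      by (intro tendsto_add energy_tendsto tendsto_ennrealI defect_tendsto) simp
    then show "(\<lambda>n. ennreal (?E n 0) + ennreal (defect (freq_box n) t)) \<longlonglongrightarrow> energy ell \<mu> u h 0" by simp
    have "?E n t \<le> ?E n 0 + defect (freq_box n) t" for n
    proof -
      have "0 \<le> integral {0..t} dissipation"
        by (rule integral_nonneg[OF set_lebesgue_integral_eq_integral(1)[OF dissipation_int]]) (simp flip: sym_norm_sq)
      then show ?thesis using partial_energy_inequality[of 0 t t "freq_box n"] t by simp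
    qed
    then have "ennreal (?E n t) \<le> ennreal (?E n 0) + ennreal (defect (freq_box n) t)" for n
      using partial_energy_nonneg defect_nonneg by (simp flip: ennreal_plus add: ennreal_leI)
    then show "\<exists>N. \<forall>n\<ge>N. ennreal (?E n t) \<le> ennreal (?E n 0) + ennreal (defect (freq_box n) t)" by blast
  qed
  define e where "e t = enn2real (energy ell \<mu> u h t)" for t
  have en: "energy ell \<mu> u h t = ennreal (e t)" if "0 \<le> t" for t
  proof -
    have "energy ell \<mu> u h 0 < top" using False by (simp add: less_top)
    from ennreal_enn2real[OF le_less_trans[OF le0[OF that] this]] show ?thesis by (simp add: e_def)
  qed
  have e0: "0 \<le> e t" for t by (simp add: e_def)
  have lim: "(\<lambda>n. ?E n t) \<longlonglongrightarrow> e t" if "0 \<le> t" for t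
    using energy_tendsto[OF that] unfolding en[OF that]
    by (subst (asm) tendsto_ennreal_iff) (auto simp: partial_energy_nonneg e0)
  \<comment> \<open>The decay constant of the abstract lemma is 2 C here, the factor that
    \<open>partial_energy_decay\<close> puts before the initial energy.\<close>
  have "e t \<le> 2 * exp (- (ln 2 / (2 * (2 * ?C))) * t) * e 0"
  proof (rule exponential_decay)
    show "0 < 2 * ?C" using observability_const_pos by simp
    fix s t :: real assume st: "0 \<le> s" "s \<le> t"
    then have t: "0 \<le> t" by simp
    have dis: "0 \<le> integral {s..t} dissipation"
      by (rule integral_nonneg[OF int_on_sub[OF dissipation_int st(1) order_refl]]) (simp flip: sym_norm_sq)
    show "e t \<le> e s"
    proof (rule LIMSEQ_le[OF lim[OF t]])
      show "(\<lambda>n. ?E n s + defect (freq_box n) t) \<longlonglongrightarrow> e s"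
        using tendsto_add[OF lim[OF st(1)] defect_tendsto[of t]] by simp
      show "\<exists>N. \<forall>n\<ge>N. ?E n t \<le> ?E n s + defect (freq_box n) t"
      proof (intro exI allI impI)
        show "?E n t \<le> ?E n s + defect (freq_box n) t" for n
          using partial_energy_inequality[OF st order_refl, of "freq_box n"] dis by simp
      qed
    qed
    show "(t - s) * e t \<le> 2 * ?C * e s"
    proof (rule LIMSEQ_le[OF tendsto_mult_left[OF lim[OF t]]])
      have "(\<lambda>n. 2 * ?C * ?E n s + (2 * ?C + (t - s)) * defect (freq_box n) t) \<longlonglongrightarrow> 2 * ?C * e s + (2 * ?C + (t - s)) * 0"
        by (intro tendsto_intros lim st defect_tendsto)
      then show "(\<lambda>n. 2 * ?C * ?E n s + (2 * ?C + (t - s)) * defect (freq_box n) t) \<longlonglongrightarrow> 2 * ?C * e s" by simp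
      show "\<exists>N. \<forall>n\<ge>N. (t - s) * ?E n t \<le> 2 * ?C * ?E n s + (2 * ?C + (t - s)) * defect (freq_box n) t"
      proof (intro exI allI impI)
        fix n
        have "finite (freq_box n - {0} :: (int^'n) set)" "0 \<notin> (freq_box n - {0} :: (int^'n) set)" using finite_freq_box by auto
        from partial_energy_decay[OF this st] show "(t - s) * ?E n t \<le> 2 * ?C * ?E n s + (2 * ?C + (t - s)) * defect (freq_box n) t"
          unfolding partial_energy_remove_0[OF st(1)] partial_energy_remove_0[OF t] defect_remove_0 .
      qed
    qed
  qed (use assms e0 in auto)
  then have "ennreal (e t) \<le> ennreal (2 * exp (- (ln 2 / (4 * ?C)) * t) * e 0)" by (intro ennreal_leI) simp
  then show ?thesis unfolding en[OF assms] en[OF order_refl] using e0 by (simp add: ennreal_mult)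
qed

end

text \<open>Testing with stationary fields identifies \<open>ut t v\<close> for almost every t. The
  exceptional set depends on v, which is harmless because v is fixed before integrating in
  time.\<close>

lemma weak_solution_coercive_flow:
  fixes ell g \<sigma> r :: real and \<mu> :: "int^'n::finite \<Rightarrow> real"
  assumes ell: "ell > 0" and g: "g > 0" and \<sigma>: "\<sigma> > 0" and r: "r \<ge> 1/2"
    and \<mu>: "\<mu> = (\<lambda>\<xi>. g + \<sigma> * (2 * pi * norm (freq \<xi>)) powr (2 * r))"
    and sol: "weak_solution ell \<mu> u0 h0 u h"
  shows "\<exists>m ht. coercive_flow ell \<mu> u h m ht g \<sigma>"
proof -
  obtain ut m ht where S: "u \<in> L2_loc (H1_sol ell) (H1_sol_norm ell) \<and>
     ut \<in> L2_loc (H1_sol_dual ell) (H1_sol_dual_norm ell) \<and>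
     has_weak_time_derivative (H1_sol ell) (\<lambda>t. L2_inner (slab ell) (u t)) ut \<and>
     h \<in> L2_loc (L2 torus) (L2_norm torus) \<and>
     m \<in> L2_loc (L2 torus) (L2_norm torus) \<and>
     (AE t in lebesgue. t \<ge> 0 \<longrightarrow> fourier (m t) = M_hat \<mu> (h t)) \<and>
     ht \<in> L2_loc (Hs (1/2)) (Hs_norm (1/2)) \<and>
     has_weak_time_derivative (L2 torus) (\<lambda>t. L2_inner torus (h t)) (\<lambda>t. L2_inner torus (ht t)) \<and>
     continuous_L2 (slab ell) u \<and> continuous_L2 torus h \<and>
     (\<forall>T>0. \<forall>v\<in>L2_time {0..T} (H1_sol ell) (H1_sol_norm ell).
        AE t in lebesgue. t \<in> {0..T} \<longrightarrow>
          (\<forall>q. has_trace ell ell (\<lambda>z. snd (v t z)) q \<longrightarrow>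
             ut t (v t) + 1/2 * sym_grad_inner ell (u t) (v t) + L2_inner torus (m t) q = 0)) \<and>
     (AE t in lebesgue. t \<ge> 0 \<longrightarrow> div_free ell (u t)) \<and>
     (AE t in lebesgue. t \<ge> 0 \<longrightarrow> has_trace ell ell (\<lambda>z. snd (u t z)) (ht t)) \<and>
     (AE z in slab ell. u 0 z = u0 z) \<and> (AE x in torus. h 0 x = h0 x) \<and>
     (\<forall>t\<ge>0. (\<integral>x. h t x \<partial>torus) = 0)"
    using sol unfolding weak_solution_def by (elim exE)
  have
     u: "u \<in> L2_loc (H1_sol ell) (H1_sol_norm ell)" and
     wu: "has_weak_time_derivative (H1_sol ell) (\<lambda>t. L2_inner (slab ell) (u t)) ut" and
     m: "m \<in> L2_loc (L2 torus) (L2_norm torus)" and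
     mf: "AE t in lebesgue. t \<ge> 0 \<longrightarrow> fourier (m t) = M_hat \<mu> (h t)" and
     ht: "ht \<in> L2_loc (Hs (1/2)) (Hs_norm (1/2))" and
     wh: "has_weak_time_derivative (L2 torus) (\<lambda>t. L2_inner torus (h t)) (\<lambda>t. L2_inner torus (ht t))" and
     uc: "continuous_L2 (slab ell) u" and hc: "continuous_L2 torus h" and
     eq: "\<forall>T>0. \<forall>v\<in>L2_time {0..T} (H1_sol ell) (H1_sol_norm ell).
        AE t in lebesgue. t \<in> {0..T} \<longrightarrow>
          (\<forall>q. has_trace ell ell (\<lambda>z. snd (v t z)) q \<longrightarrow>
             ut t (v t) + 1/2 * sym_grad_inner ell (u t) (v t) + L2_inner torus (m t) q = 0)" and
     tr: "AE t in lebesgue. t \<ge> 0 \<longrightarrow> has_trace ell ell (\<lambda>z. snd (u t z)) (ht t)" and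
     mean: "\<forall>t\<ge>0. (\<integral>x. h t x \<partial>torus) = 0"
    by (insert S) ((elim conjE, assumption)+)
  have const: "(\<lambda>_. v) \<in> L2_time {0..T} (H1_sol ell) (H1_sol_norm ell)" if v: "v \<in> H1_sol ell" for v :: "'n pt \<Rightarrow> 'n pt" and T
  proof -
    have "H1_sol_norm ell (\<lambda>x. v x - v x) = 0" using H1_sol_norm_scaleR[OF v, of 0] by simp
    then have "bochner_measurable {0..T} (H1_sol ell) (H1_sol_norm ell) (\<lambda>_. v)"
      unfolding bochner_measurable_def using v by (intro exI[of _ "\<lambda>_ _. v"]) (auto simp: vimage_def)
    moreover have "(\<integral>\<^sup>+t\<in>{0..T}. ennreal ((H1_sol_norm ell v)\<^sup>2) \<partial>lebesgue) < \<infinity>"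
      by (simp add: nn_integral_cmult_indicator ennreal_mult_less_top emeasure_lborel_Icc_eq)
    ultimately show ?thesis using v by (simp add: L2_time_def)
  qed
  have weak: "(\<integral>t. deriv \<phi> t * L2_inner (slab ell) (u t) v \<partial>lebesgue) =
         - (\<integral>t. \<phi> t * (- 1/2 * sym_grad_inner ell (u t) v - L2_inner torus (m t) q) \<partial>lebesgue)"
    if v: "v \<in> H1_sol ell" and q: "has_trace ell ell (\<lambda>z. snd (v z)) q" and \<phi>: "\<phi> \<in> time_test_functions" for v q \<phi>
  proof -
    have "AE t in lebesgue. 0 \<le> t \<longrightarrow> ut t v = - 1/2 * sym_grad_inner ell (u t) v - L2_inner torus (m t) q"
    proof (rule AE_ge0_of_intervals)
      fix T :: real assume "T > 0"
      from eq[rule_format, OF this const[OF v]]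
      show "AE t in lebesgue. t \<in> {0..T} \<longrightarrow> ut t v = - 1/2 * sym_grad_inner ell (u t) v - L2_inner torus (m t) q"
      proof eventually_elim
        case (elim t)
        show ?case
        proof
          assume "t \<in> {0..T}"
          from elim[rule_format, OF this q] show "ut t v = - 1/2 * sym_grad_inner ell (u t) v - L2_inner torus (m t) q" by simp
        qed
      qed
    qed
    then have ae: "AE t in lebesgue. \<phi> t * ut t v = \<phi> t * (- 1/2 * sym_grad_inner ell (u t) v - L2_inner torus (m t) q)"
    proof eventually_elim
      case (elim t)
      have "\<phi> t = 0" if "\<not> 0 \<le> t"
        using \<phi> that unfolding time_test_functions_def by (auto simp: not_le)
      then show ?case using elim by (cases "0 \<le> t") auto
    qed
    \<comment> \<open>Measurability is settled by cases. The integrands agree almost everywhere and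
      Lebesgue measure is complete, so if one fails to be measurable the other does too, and both
      integrals are 0 by convention.\<close>
    have "(\<integral>t. \<phi> t * ut t v \<partial>lebesgue) = (\<integral>t. \<phi> t * (- 1/2 * sym_grad_inner ell (u t) v - L2_inner torus (m t) q) \<partial>lebesgue)"
    proof (cases "(\<lambda>t. \<phi> t * ut t v) \<in> borel_measurable lebesgue")
      case True
      show ?thesis by (rule integral_cong_AE[OF True borel_measurable_AE[OF True ae] ae])
    next
      case False
      have "AE t in lebesgue. \<phi> t * (- 1/2 * sym_grad_inner ell (u t) v - L2_inner torus (m t) q) = \<phi> t * ut t v"
        using ae by eventually_elim (rule sym)
      from borel_measurable_AE[OF _ this] False
      have F2: "(\<lambda>t. \<phi> t * (- 1/2 * sym_grad_inner ell (u t) v - L2_inner torus (m t) q)) \<notin> borel_measurable lebesgue" by blast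
      from False have N1: "\<not> integrable lebesgue (\<lambda>t. \<phi> t * ut t v)" by (rule contrapos_nn) (rule borel_measurable_integrable)
      from F2 have N2: "\<not> integrable lebesgue (\<lambda>t. \<phi> t * (- 1/2 * sym_grad_inner ell (u t) v - L2_inner torus (m t) q))"
        by (rule contrapos_nn) (rule borel_measurable_integrable)
      show ?thesis unfolding not_integrable_integral_eq[OF N1] not_integrable_integral_eq[OF N2] ..
    qed
    then show ?thesis using wu[unfolded has_weak_time_derivative_def, rule_format, OF \<phi> v] by simp
  qed
  have "coercive_flow ell \<mu> u h m ht g \<sigma>"
  proof (unfold_locales)
    show "g \<le> \<mu> \<xi>" for \<xi> using \<sigma> by (simp add: \<mu>)
    fix \<xi> :: "int^'n" assume "\<xi> \<noteq> 0"
    then have n1: "1 \<le> norm (freq \<xi>)" by (rule norm_freq_ge_1)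
    \<comment> \<open>The base 2 pi |\<xi>| is at least 1, so raising the exponent from 1 to 2 r
      does not decrease the power.\<close>
    have "norm (freq \<xi>) \<le> 2 * pi * norm (freq \<xi>)" using pi_ge_two n1 by (intro mult_le_cancel_right1[THEN iffD2]) auto
    also have "\<dots> = (2 * pi * norm (freq \<xi>)) powr 1" using n1 by simp
    also have "\<dots> \<le> (2 * pi * norm (freq \<xi>)) powr (2 * r)" using r calculation n1 by (intro powr_mono) auto
    finally have "\<sigma> * norm (freq \<xi>) \<le> \<sigma> * (2 * pi * norm (freq \<xi>)) powr (2 * r)" using \<sigma> by (intro mult_left_mono) auto
    then show "\<sigma> * norm (freq \<xi>) \<le> \<mu> \<xi>" using g by (simp add: \<mu>)
  next
    show "ell > 0" "g > 0" "\<sigma> > 0" by (rule ell g \<sigma>)+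
    show "u \<in> L2_loc (H1_sol ell) (H1_sol_norm ell)" "m \<in> L2_loc (L2 torus) (L2_norm torus)"
      "ht \<in> L2_loc (Hs (1/2)) (Hs_norm (1/2))" "continuous_L2 (slab ell) u" "continuous_L2 torus h"
      by (rule u m ht uc hc)+
    show "AE t in lebesgue. t \<ge> 0 \<longrightarrow> fourier (m t) = M_hat \<mu> (h t)" by (rule mf)
    show "AE t in lebesgue. t \<ge> 0 \<longrightarrow> has_trace ell ell (\<lambda>z. snd (u t z)) (ht t)" by (rule tr)
    show "has_weak_time_derivative (L2 torus) (\<lambda>t. L2_inner torus (h t)) (\<lambda>t. L2_inner torus (ht t))" by (rule wh)
    show "(\<integral>x. h t x \<partial>torus) = 0" if "t \<ge> 0" for t using mean that by blast
  qed (rule weak)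
  then show ?thesis by blast
qed

theorem theorem4p1:
  fixes ell g \<sigma> r :: real and \<mu> :: "int^'n::finite \<Rightarrow> real"
  assumes "ell > 0" and "g > 0" and "\<sigma> > 0" and "r \<ge> 1/2"
    and "\<mu> = (\<lambda>\<xi>. g + \<sigma> * (2 * pi * norm (freq \<xi>)) powr (2 * r))"
    and "boundary_symbol \<mu>"
  shows "\<exists>c>0. \<exists>K>0. \<forall>u0 h0 u h.
           weak_solution ell \<mu> u0 h0 u h \<and> u0 \<in> L2 (slab ell) \<and> h0 \<in> Hs r \<longrightarrow>
           (\<forall>t\<ge>0. energy ell \<mu> u h t \<le> ennreal (K * exp (- c * t)) * energy ell \<mu> u h 0)"
proof -
  let ?C = "observability_const DIM('n pt) ell g \<sigma>"
  note pos = consts_pos[of "DIM('n pt)", OF _ assms(1)]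
  have C: "?C > 0" using pos assms(1-3) unfolding observability_const_def by (intro add_nonneg_pos add_pos_nonneg) auto
  \<comment> \<open>The rate and K = 2 are fixed before the solution is chosen; the halving time 4 C
    is determined by the dimension, \<open>ell\<close>, g and \<sigma>.\<close>
  have c: "0 < ln 2 / (4 * ?C)" using C by simp
  show ?thesis
  proof (rule exI[of _ "ln 2 / (4 * ?C)"], rule conjI[OF c], rule exI[of _ 2], intro conjI allI impI)
    fix u0 h0 u h and t :: real
    assume "weak_solution ell \<mu> u0 h0 u h \<and> u0 \<in> L2 (slab ell) \<and> h0 \<in> Hs r" and t: "0 \<le> t"
    then obtain m ht where "coercive_flow ell \<mu> u h m ht g \<sigma>"
      using weak_solution_coercive_flow[OF assms(1-5)] by blast
    then show "energy ell \<mu> u h t \<le> ennreal (2 * exp (- (ln 2 / (4 * ?C)) * t)) * energy ell \<mu> u h 0"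
      using t by (rule coercive_flow.energy_decay)
  qed simp
qed

end
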